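(* Fix $s>1/2$ and $E_{\max},h_0,\varepsilon_0>0$. Let $\{E(h)\}_{h\in(0,h_0]}\subseteq[-E_{\max},E_{\max}]$ be a family that may depend on $h$. Let $P(h)$ be the magnetic Schrödinger operator with domain $\mathcal D$ described in the context, with coefficients $\alpha,\beta,b=b_0+b_1,V=V_0+V_1$ satisfying the assumptions listed there. Assume moreover: (1) $\|V_1(\cdot,h)\|_{L^\infty}$, $\|dV_1(h)\|$, $\|b_1(\cdot,h)\|_{L^\infty}$, $\|db_1(h)\|$, $\|d\alpha(h)\|$, $\|d\beta(h)\|$, $\sup\alpha(\cdot,h)$ and $\sup\beta(\cdot,h)$ are bounded uniformly for $h\in(0,h_0]$. (2) There is $c>0$ independent of $h$ such that $\inf\alpha(\cdot,h)>c$ and $\inf\beta(\cdot,h)>c$ for all $h\in(0,h_0]$. (3) There is $R_1>0$ independent of $h$ such that $$\inf_{h\in(0,h_0],\,|x|\ge R_1}\Big(\beta^{-1}(x,h)\alpha(x,h)\big(E(h)-V_1(x,h)\big)+b_1^2(x,h)\Big)>0 .$$ (5) $\|V_0(h)\|$, $\|b_0(\cdot,h)\|_{L^1}$ and $\|b_0(\cdot,h)\|_{L^2}$ are bounded uniformly for $h\in(0,h_0]$. Then there is $C_1>0$ independent of $h$ such that for all $h\in(0,h_0]$ and all $\varepsilon(h)\in[-\varepsilon_0,\varepsilon_0]$ with $\varepsilon(h)\neq0$, $$\big\|\langle x\rangle^{-s}(P(h)-E(h)-i\varepsilon(h))^{-1}\langle x\rangle^{-s}\big\|_{L^2(\mathbb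 R)\to L^2(\mathbb R)}\le e^{C_1/h}.$$
   Context: Notation: $D_x=-i\partial_x$, $\langle x\rangle=(1+|x|^2)^{1/2}$. A function $f:\mathbb R\to\mathbb R$ has bounded variation (BV) if it is a difference of two bounded nondecreasing functions. A complex-valued function has locally bounded variation if its real and imaginary parts are each a difference of (not necessarily bounded) nondecreasing functions; an element of $L^1_{\rm loc}$ has this property if it has such a representative. For $f$ of locally bounded variation, $df$ denotes its distributional derivative, a complex Borel measure on bounded Borel sets (a finite signed Borel measure on $\mathbb R$ if $f$ is real and BV). For a finite signed Borel measure $\mu$, $|\mu|$ is its total variation measure and $\|\mu\|=|\mu|(\mathbb R)$. Coefficient assumptions, for each $h>0$ (all coefficients are real valued and may depend on $h$): $V=V_0+V_1$ and $b=b_0+b_1$, where $V_0=V_0(h)$ is a finite signed Borel measure on $\mathbb R$; $b_0(\cdot,h)\in L^1(\mathbb R)\cap L^2(\mathbb R)$; $V_1(\cdot,h)$ and $b_1(\cdot,h)$ have BV; $\alpha(\cdot,h),\beta(\cdot,h):\mathbb R\to(0,\infty)$ have BV; and $\inf\alpha(\cdot,h)>0$, $\inf\beta(\cdot,h)>0$. The operator is $$P(h)=\beta\big(-h^2\partial_x(\alpha\partial_x)+hbD_x+hD_xb\big)+V$$ on $L^2(\mathbb R;\beta^{-1}dx)$ (which equals $L^2(\mathbb R)$ with an equivalent norm). Its domain $\mathcal D=\mathcal D(h)$ is the set of all $u\in H^1(\mathbb R)$ such that $h\alpha u'+ibu$ belongs to $L^\infty(\mathbb R)$ and has locally bounded variation,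 and such that the measure $$\beta\,d(-h^2\alpha u'-ihbu)+h\beta bD_xu+u_cV$$ is (given by a density) in $L^2(\mathbb R)$, where $u_c$ is the continuous representative of $u$ and $V$ is viewed as the measure $V_0+V_1dx$. For $u\in\mathcal D$, $P(h)u$ is defined to be this $L^2$ function. With this domain $P(h)$ is self-adjoint on $L^2(\mathbb R;\beta^{-1}dx)$, so $(P(h)-E-i\varepsilon)^{-1}$ exists as a bounded operator for real $E$ and real $\varepsilon\neq0$. *)

theory Defs
  imports "HOL-Probability.Essential_Supremum" "HOL-Library.Disjoint_Sets"
begin

section \<open>Lebesgue spaces on the line\<close>

text \<open>Elements of the Lebesgue spaces are represented by Borel functions; equality in these spaces
  is equality almost everywhere.\<close>

definition L1 :: "(real \<Rightarrow> 'a::{banach, second_countable_topology}) set" where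
  "L1 = {f. integrable lborel f}"

definition L1_norm :: "(real \<Rightarrow> 'a::{banach, second_countable_topology}) \<Rightarrow> real" where
  "L1_norm f = (LINT x|lborel. norm (f x))"

definition L2 :: "(real \<Rightarrow> 'a::{banach, second_countable_topology}) set" where
  "L2 = {f \<in> borel_measurable lborel. integrable lborel (\<lambda>x. (norm (f x))\<^sup>2)}"

definition L2_norm :: "(real \<Rightarrow> 'a::{banach, second_countable_topology}) \<Rightarrow> real" where
  "L2_norm f = sqrt (LINT x|lborel. (norm (f x))\<^sup>2)"

definition Linf_norm :: "(real \<Rightarrow> 'a::{banach, second_countable_topology}) \<Rightarrow> ereal" where
  "Linf_norm f = esssup lborel (\<lambda>x. ereal (norm (f x)))"

definition Linf :: "(real \<Rightarrow> 'a::{banach, second_countable_topology}) set" where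
  "Linf = {f \<in> borel_measurable lborel. Linf_norm f < \<infinity>}"

definition L2_opnorm :: "((real \<Rightarrow> complex) \<Rightarrow> (real \<Rightarrow> complex)) \<Rightarrow> ereal" where
  "L2_opnorm T = (SUP f\<in>{f \<in> L2. L2_norm f \<le> 1}. ereal (L2_norm (T f)))"

section \<open>Functions of bounded variation\<close>

definition BV :: "(real \<Rightarrow> real) \<Rightarrow> bool" where
  "BV f \<longleftrightarrow> (\<exists>g k. mono g \<and> mono k \<and> bounded (range g) \<and> bounded (range k) \<and> f = (\<lambda>x. g x - k x))"

definition locally_BV :: "(real \<Rightarrow> complex) \<Rightarrow> bool" where
  "locally_BV f \<longleftrightarrow>
     (\<exists>g k. mono g \<and> mono k \<and> (\<lambda>x. Re (f x)) = (\<lambda>x. g x - k x)) \<and>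
     (\<exists>g k. mono g \<and> mono k \<and> (\<lambda>x. Im (f x)) = (\<lambda>x. g x - k x))"

definition locally_BV_class :: "(real \<Rightarrow> complex) \<Rightarrow> bool" where
  "locally_BV_class f \<longleftrightarrow> (\<exists>g. locally_BV g \<and> (AE x in lborel. f x = g x))"

section \<open>Signed and complex Borel measures\<close>

text \<open>Signed and complex measures are set functions whose values matter only on Borel sets
  (respectively on bounded Borel sets). Countable additivity applied to the constant sequence of
  empty sets forces the value 0 on the empty set.\<close>

definition finite_signed_measure :: "(real set \<Rightarrow> real) \<Rightarrow> bool" where
  "finite_signed_measure \<mu> \<longleftrightarrow>
     (\<forall>A::nat \<Rightarrow> real set. range A \<subseteq> sets borel \<and> disjoint_family A \<longrightarrow>
        (\<lambda>n. \<mu> (A n)) sums \<mu> (\<Union>n. A n))"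

definition local_complex_measure :: "(real set \<Rightarrow> complex) \<Rightarrow> bool" where
  "local_complex_measure \<mu> \<longleftrightarrow>
     (\<forall>A::nat \<Rightarrow> real set. range A \<subseteq> sets borel \<and> disjoint_family A \<and> bounded (\<Union>n. A n) \<longrightarrow>
        (\<lambda>n. \<mu> (A n)) sums \<mu> (\<Union>n. A n))"

definition total_variation :: "(real set \<Rightarrow> real) \<Rightarrow> real set \<Rightarrow> ennreal" where
  "total_variation \<mu> A =
     (SUP \<P>\<in>{\<P>. finite \<P> \<and> \<P> \<subseteq> sets borel \<and> disjoint \<P> \<and> \<Union>\<P> = A}. \<Sum>B\<in>\<P>. ennreal \<bar>\<mu> B\<bar>)"

definition measure_norm :: "(real set \<Rightarrow> real) \<Rightarrow> ennreal" where
  "measure_norm \<mu> = total_variation \<mu> UNIV"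

text \<open>The positive part in the Jordan decomposition of a real set function that is countably
  additive on bounded Borel sets; the negative part is the positive part of the negated set
  function. Negative values are truncated to 0 by the coercion to extended nonnegative reals, and
  the empty set always contributes 0. For a finite signed measure, restricting to bounded
  subsets does not change the supremum.\<close>

definition positive_part :: "(real set \<Rightarrow> real) \<Rightarrow> real measure" where
  "positive_part \<mu> = measure_of UNIV (sets borel)
     (\<lambda>A. SUP B\<in>{B \<in> sets borel. bounded B \<and> B \<subseteq> A}. ennreal (\<mu> B))"

definition signed_integral :: "(real set \<Rightarrow> real) \<Rightarrow> (real \<Rightarrow> complex) \<Rightarrow> complex" where
  "signed_integral \<mu> f =
     (LINT x|positive_part \<mu>. f x) - (LINT x|positive_part (\<lambda>A. - \<mu> A). f x)"

definition complex_integral :: "(real set \<Rightarrow> complex) \<Rightarrow> (real \<Rightarrow> complex) \<Rightarrow> complex" where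
  "complex_integral \<mu> f =
     signed_integral (\<lambda>A. Re (\<mu> A)) f + \<i> * signed_integral (\<lambda>A. Im (\<mu> A)) f"

section \<open>Distributional derivatives\<close>

definition test_function :: "(real \<Rightarrow> real) \<Rightarrow> bool" where
  "test_function \<phi> \<longleftrightarrow>
     (\<forall>k x. (deriv ^^ k) \<phi> field_differentiable at x) \<and> bounded {x. \<phi> x \<noteq> 0}"

definition has_derivative_measure :: "(real \<Rightarrow> complex) \<Rightarrow> (real set \<Rightarrow> complex) \<Rightarrow> bool" where
  "has_derivative_measure f \<mu> \<longleftrightarrow>
     (\<forall>\<phi>. test_function \<phi> \<longrightarrow>
        complex_integral \<mu> (\<lambda>x. complex_of_real (\<phi> x)) =
          - (LINT x|lborel. f x * complex_of_real (deriv \<phi> x)))"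

text \<open>The measure \<open>df\<close>, for a real function of bounded variation and for a complex function
  of locally bounded variation. It is determined uniquely on Borel sets, respectively on bounded
  Borel sets.\<close>

definition dBV :: "(real \<Rightarrow> real) \<Rightarrow> real set \<Rightarrow> real" where
  "dBV f = (SOME \<mu>. finite_signed_measure \<mu> \<and>
     has_derivative_measure (\<lambda>x. complex_of_real (f x)) (\<lambda>A. complex_of_real (\<mu> A)))"

definition dBV_loc :: "(real \<Rightarrow> complex) \<Rightarrow> real set \<Rightarrow> complex" where
  "dBV_loc f = (SOME \<mu>. local_complex_measure \<mu> \<and> has_derivative_measure f \<mu>)"

definition weak_derivative :: "(real \<Rightarrow> complex) \<Rightarrow> (real \<Rightarrow> complex) \<Rightarrow> bool" where
  "weak_derivative u v \<longleftrightarrow>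
     (\<forall>\<phi>. test_function \<phi> \<longrightarrow>
        (LINT x|lborel. v x * complex_of_real (\<phi> x)) =
          - (LINT x|lborel. u x * complex_of_real (deriv \<phi> x)))"

definition H1 :: "(real \<Rightarrow> complex) set" where
  "H1 = {u \<in> L2. \<exists>v\<in>L2. weak_derivative u v}"

definition wderiv :: "(real \<Rightarrow> complex) \<Rightarrow> real \<Rightarrow> complex" where
  "wderiv u = (SOME v. v \<in> L2 \<and> weak_derivative u v)"

definition Dx :: "(real \<Rightarrow> complex) \<Rightarrow> real \<Rightarrow> complex" where
  "Dx u = (\<lambda>x. - \<i> * wderiv u x)"

definition cont_rep :: "(real \<Rightarrow> complex) \<Rightarrow> real \<Rightarrow> complex" where
  "cont_rep u = (THE v. continuous_on UNIV v \<and> (AE x in lborel. v x = u x))"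

section \<open>The magnetic Schroedinger operator\<close>

text \<open>The coefficients are those at a fixed value of \<open>h\<close>: functions \<open>\<alpha>\<close>, \<open>\<beta>\<close>,
  \<open>b\<close> (the full magnetic coefficient), the singular part \<open>V0\<close> of the potential (a
  measure) and its bounded part \<open>V1\<close> (a function).\<close>

definition flux ::
  "real \<Rightarrow> (real \<Rightarrow> real) \<Rightarrow> (real \<Rightarrow> real) \<Rightarrow> (real \<Rightarrow> complex) \<Rightarrow> real \<Rightarrow> complex" where
  "flux h \<alpha> b u = (\<lambda>x. of_real (h * \<alpha> x) * wderiv u x + \<i> * of_real (b x) * u x)"

text \<open>The value on a bounded Borel set of the measure
  \<open>\<beta> d(- h\<^sup>2 \<alpha> u' - i h b u) + h \<beta> b D\<^sub>x u dx + u\<^sub>c V\<close>, where \<open>V = V0 + V1 dx\<close>.\<close>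

definition schroedinger_measure ::
  "real \<Rightarrow> (real \<Rightarrow> real) \<Rightarrow> (real \<Rightarrow> real) \<Rightarrow> (real \<Rightarrow> real) \<Rightarrow> (real set \<Rightarrow> real) \<Rightarrow> (real \<Rightarrow> real)
    \<Rightarrow> (real \<Rightarrow> complex) \<Rightarrow> real set \<Rightarrow> complex" where
  "schroedinger_measure h \<alpha> \<beta> b V0 V1 u A =
     complex_integral
       (dBV_loc (\<lambda>x. - of_real (h\<^sup>2 * \<alpha> x) * wderiv u x - \<i> * of_real (h * b x) * u x))
       (\<lambda>x. indicator A x * of_real (\<beta> x))
     + (LINT x|lborel. indicator A x * (of_real (h * \<beta> x * b x) * Dx u x))
     + signed_integral V0 (\<lambda>x. indicator A x * cont_rep u x)
     + (LINT x|lborel. indicator A x * (cont_rep u x * of_real (V1 x)))"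

definition has_density :: "(real set \<Rightarrow> complex) \<Rightarrow> (real \<Rightarrow> complex) \<Rightarrow> bool" where
  "has_density \<nu> g \<longleftrightarrow>
     (\<forall>A\<in>sets borel. bounded A \<longrightarrow> \<nu> A = (LINT x|lborel. indicator A x * g x))"

definition schroedinger_domain ::
  "real \<Rightarrow> (real \<Rightarrow> real) \<Rightarrow> (real \<Rightarrow> real) \<Rightarrow> (real \<Rightarrow> real) \<Rightarrow> (real set \<Rightarrow> real) \<Rightarrow> (real \<Rightarrow> real)
    \<Rightarrow> (real \<Rightarrow> complex) set" where
  "schroedinger_domain h \<alpha> \<beta> b V0 V1 =
     {u \<in> H1. flux h \<alpha> b u \<in> Linf \<and> locally_BV_class (flux h \<alpha> b u) \<and>
        (\<exists>g\<in>L2. has_density (schroedinger_measure h \<alpha> \<beta> b V0 V1 u) g)}"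

definition schroedinger_op ::
  "real \<Rightarrow> (real \<Rightarrow> real) \<Rightarrow> (real \<Rightarrow> real) \<Rightarrow> (real \<Rightarrow> real) \<Rightarrow> (real set \<Rightarrow> real) \<Rightarrow> (real \<Rightarrow> real)
    \<Rightarrow> (real \<Rightarrow> complex) \<Rightarrow> real \<Rightarrow> complex" where
  "schroedinger_op h \<alpha> \<beta> b V0 V1 u =
     (SOME g. g \<in> L2 \<and> has_density (schroedinger_measure h \<alpha> \<beta> b V0 V1 u) g)"

section \<open>Resolvents of unbounded operators on the Lebesgue space\<close>

definition solves ::
  "(real \<Rightarrow> complex) set \<Rightarrow> ((real \<Rightarrow> complex) \<Rightarrow> real \<Rightarrow> complex) \<Rightarrow> complex
    \<Rightarrow> (real \<Rightarrow> complex) \<Rightarrow> (real \<Rightarrow> complex) \<Rightarrow> bool" where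
  "solves D P z f u \<longleftrightarrow> u \<in> D \<and> (AE x in lborel. P u x - z * u x = f x)"

text \<open>\<open>P - z\<close> maps the domain \<open>D\<close> bijectively (modulo equality almost everywhere) onto the
  whole space, with bounded inverse.\<close>

definition in_resolvent_set ::
  "(real \<Rightarrow> complex) set \<Rightarrow> ((real \<Rightarrow> complex) \<Rightarrow> real \<Rightarrow> complex) \<Rightarrow> complex \<Rightarrow> bool" where
  "in_resolvent_set D P z \<longleftrightarrow>
     (\<forall>f\<in>L2. \<exists>u. solves D P z f u) \<and>
     (\<forall>f\<in>L2. \<forall>u v. solves D P z f u \<and> solves D P z f v \<longrightarrow> (AE x in lborel. u x = v x)) \<and>
     (\<exists>K. \<forall>f\<in>L2. \<forall>u. solves D P z f u \<longrightarrow> L2_norm u \<le> K * L2_norm f)"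

definition resolvent ::
  "(real \<Rightarrow> complex) set \<Rightarrow> ((real \<Rightarrow> complex) \<Rightarrow> real \<Rightarrow> complex) \<Rightarrow> complex
    \<Rightarrow> (real \<Rightarrow> complex) \<Rightarrow> real \<Rightarrow> complex" where
  "resolvent D P z f = (SOME u. solves D P z f u)"

definition bracket :: "real \<Rightarrow> real" where
  "bracket x = (1 + \<bar>x\<bar>\<^sup>2) powr (1/2)"

definition weight :: "real \<Rightarrow> (real \<Rightarrow> complex) \<Rightarrow> real \<Rightarrow> complex" where
  "weight s f = (\<lambda>x. of_real (bracket x powr (- s)) * f x)"

end

theory Submission
  imports Defs "HOL-Probability.Probability"
begin

text \<open>Let \<open>p = h \<alpha> u' + i b u\<close> be the flux and let \<open>n\<close> be \<open>1/h\<close> times the cumulative distribution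
  function of the measure \<open>\<beta>\<^sup>-\<^sup>1 V0 - \<alpha>\<^sup>-\<^sup>1 (b0\<^sup>2 + 2 b0 b1) dx\<close>. Then \<open>(P - E - i \<epsilon>) u = f\<close> means
  that \<open>u\<close> and \<open>r = p - n u\<close> are absolutely continuous and solve a linear first order system in which
  the singular coefficients occur only through the bounded function \<open>n\<close>. The derivative of the
  imaginary part of the product of \<open>r\<close> with the conjugate of \<open>u\<close> controls \<open>|\<epsilon>|\<close> times the square
  norm of \<open>u\<close>, which gives uniqueness, and existence as a limit of solutions of boundary value
  problems on \<open>[-N, N]\<close>.

  For the exponential bound one replaces \<open>n\<close> by its averages over intervals of length \<open>h\<^sup>2\<close>, which
  turns \<open>r\<close> into a function close to \<open>p\<close>, and forms the energy \<open>|p|\<^sup>2 + \<kappa> |u|\<^sup>2\<close>, where \<open>\<kappa>\<close> averages a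
  positive function that near infinity is \<open>\<alpha> (E - V1) / \<beta> + b1\<^sup>2\<close>. Bounded variation makes the
  logarithmic growth of the energy over the whole line \<open>O(1/h)\<close>, and the energy vanishes at
  infinity. Hence \<open>sup |u|\<close> is at most \<open>exp (C/h)\<close> times the \<open>L\<^sup>1\<close> norm of \<open>f\<close>, and square integrability
  of the weight for \<open>s > 1/2\<close> does the rest.\<close>

section \<open>Absolutely continuous functions\<close>

text \<open>The point masses of V0 make the flux jump, and b0 squared acts as one more singular
  potential. Both go into n, which has size and variation of order 1/h. An average of n over a
  length d has a derivative of L1 norm O(1/h) for every d, and it misses n by O(d/h) in L1. The
  energy multiplies this error by 1/h^2, one factor from the system and one from the size of n; d =
  h^2 makes the product O(1/h). The \<epsilon> term cannot join the growth rate, because a constant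
  is not integrable over the line. It is treated as a source: the imaginary part of the pairing,
  with a companion identity for its real part, bounds |\<epsilon>| times the integral of |p| |u| by
  the integral of |u| |f|, hence by sup |u| times the L1 norm of f. If X is the supremum of the
  square root of the energy, the result is X^2 \<le> C X times that norm, and dividing by X gives a
  bound uniform in \<epsilon>. The magnetic coefficient enters both equations as the same phase term
  -iB/h, so it cancels in every quadratic identity and only its local integrability matters.\<close>

text \<open>\<open>F\<close> is absolutely continuous on the interval \<open>I\<close> with derivative \<open>f\<close>. All
  calculus below is done with such pairs, because differentiability almost everywhere of
  absolutely continuous functions is not needed.\<close>

definition ac_on :: "real set \<Rightarrow> (real \<Rightarrow> 'a::{banach, second_countable_topology}) \<Rightarrow> (real \<Rightarrow> 'a) \<Rightarrow> bool"
  where "ac_on I F f \<longleftrightarrow> (\<forall>a\<in>I. \<forall>b\<in>I. a \<le> b \<longrightarrow>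
     set_integrable lborel {a..b} f \<and> (LBINT x:{a..b}. f x) = F b - F a)"

lemma ac_onD:
  assumes "ac_on I F f" "a \<in> I" "b \<in> I" "a \<le> b"
  shows "set_integrable lborel {a..b} f" "(LBINT x:{a..b}. f x) = F b - F a"
  using assms unfolding ac_on_def by auto

lemma ac_on_subset: "ac_on I F f \<Longrightarrow> J \<subseteq> I \<Longrightarrow> ac_on J F f"
  unfolding ac_on_def by blast

lemma ac_on_add: "ac_on I F f \<Longrightarrow> ac_on I G g \<Longrightarrow> ac_on I (\<lambda>x. F x + G x) (\<lambda>x. f x + g x)"
  unfolding ac_on_def by (auto intro: set_integral_add simp: set_integral_add(2))

lemma ac_on_bounded_linear:
  assumes "bounded_linear T" "ac_on I F f"
  shows "ac_on I (\<lambda>x. T (F x)) (\<lambda>x. T (f x))"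
proof -
  interpret T: bounded_linear T by fact
  have eq: "indicat_real A x *\<^sub>R T (f x) = T (indicat_real A x *\<^sub>R f x)" for A x
    by (simp add: T.scaleR)
  show ?thesis
    using assms(2)
    unfolding ac_on_def set_integrable_def set_lebesgue_integral_def eq
    by (auto intro: integrable_bounded_linear[OF assms(1)] simp: integral_bounded_linear[OF assms(1)] T.diff)
qed

lemma ac_on_const: "ac_on I (\<lambda>x. c) (\<lambda>x. 0)"
  unfolding ac_on_def by (simp add: set_integrable_def)

lemma ac_on_diff: "ac_on I F f \<Longrightarrow> ac_on I G g \<Longrightarrow> ac_on I (\<lambda>x. F x - G x) (\<lambda>x. f x - g x)"
  unfolding ac_on_def by (auto simp: set_integral_diff)

lemma ac_on_cmult:
  fixes F :: "real \<Rightarrow> 'a::{banach, second_countable_topology, real_normed_algebra}"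
  shows "ac_on I F f \<Longrightarrow> ac_on I (\<lambda>x. c * F x) (\<lambda>x. c * f x)"
  by (rule ac_on_bounded_linear[OF bounded_linear_mult_right])

text \<open>The second component of \<open>ac_on\<close> counts only up to null sets. This is how a
  weak derivative is exchanged for the right-hand side of the system.\<close>

lemma ac_on_cong_AE:
  assumes "ac_on I F f" "AE x in lborel. f x = g x" "g \<in> borel_measurable borel"
  shows "ac_on I F g"
proof -
  have *: "set_integrable lborel {a..b} g \<and> (LBINT x:{a..b}. g x) = (LBINT x:{a..b}. f x)"
    if "set_integrable lborel {a..b} f" for a b
  proof -
    have AE: "AE x in lborel. indicat_real {a..b} x *\<^sub>R f x = indicat_real {a..b} x *\<^sub>R g x"
      using assms(2) by eventually_elim simp
    have m: "(\<lambda>x. indicat_real {a..b} x *\<^sub>R f x) \<in> borel_measurable lborel"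
      using borel_measurable_integrable[OF that[unfolded set_integrable_def]] .
    have m': "(\<lambda>x. indicat_real {a..b} x *\<^sub>R g x) \<in> borel_measurable lborel"
      using assms(3) by measurable
    show ?thesis
      using that unfolding set_integrable_def set_lebesgue_integral_def
      using integrable_cong_AE[OF m m' AE] integral_cong_AE[OF m m' AE] by simp
  qed
  then show ?thesis using assms(1) unfolding ac_on_def by auto
qed

lemma ac_on_cong:
  assumes "ac_on I F f" "\<And>x. x \<in> I \<Longrightarrow> F x = G x" "\<And>x. x \<in> I \<Longrightarrow> f x = g x" "is_interval I"
  shows "ac_on I G g"
  unfolding ac_on_def
proof (intro ballI impI)
  fix a b :: real assume ab: "a \<in> I" "b \<in> I" "a \<le> b"
  then have sub: "x \<in> I" if "x \<in> {a..b}" for x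
    using mem_is_interval_1_I[OF assms(4) ab(1,2)] that by simp
  have "set_integrable lborel {a..b} g = set_integrable lborel {a..b} f"
    by (rule set_integrable_cong[OF refl refl]) (use assms(3) sub in metis)
  moreover have "(LBINT x:{a..b}. g x) = (LBINT x:{a..b}. f x)"
    by (rule set_lebesgue_integral_cong) (use assms(3) sub in \<open>simp, metis\<close>)
  ultimately show "set_integrable lborel {a..b} g \<and> (LBINT x:{a..b}. g x) = G b - G a"
    using ac_onD[OF assms(1) ab] assms(2) ab by simp
qed

lemma set_integral_split:
  fixes f :: "real \<Rightarrow> 'a::{banach, second_countable_topology}"
  assumes "set_integrable lborel {a..c} f" "a \<le> b" "b \<le> c"
  shows "(LBINT x:{a..c}. f x) = (LBINT x:{a..b}. f x) + (LBINT x:{b..c}. f x)"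
proof -
  have *: "{a..c} = {a..b} \<union> {b..c}" using assms by auto
  have "AE x in lborel. \<not> (x \<in> {a..b} \<and> x \<in> {b..c})"
    using AE_lborel_singleton[of b] by eventually_elim auto
  moreover have "set_integrable lborel {a..b} f" "set_integrable lborel {b..c} f"
    by (rule set_integrable_subset[OF assms(1)]; use assms in auto)+
  ultimately show ?thesis unfolding * by (intro set_integral_Un_AE) auto
qed

definition locint :: "(real \<Rightarrow> 'a::{banach, second_countable_topology}) \<Rightarrow> bool" where
  "locint f \<longleftrightarrow> (\<forall>a b. set_integrable lborel {a..b} f)"

lemma locintD: "locint f \<Longrightarrow> set_integrable lborel {a..b} f"
  by (simp add: locint_def)

lemma ac_on_imp_locint:
  assumes "ac_on UNIV F f" shows "locint f"
  unfolding locint_def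
proof safe
  fix a b :: real
  show "set_integrable lborel {a..b} f"
    using ac_onD(1)[OF assms, of a b] by (cases "a \<le> b") auto
qed

definition prim :: "(real \<Rightarrow> 'a::{banach, second_countable_topology}) \<Rightarrow> real \<Rightarrow> 'a" where
  "prim f x = (if 0 \<le> x then LBINT t:{0..x}. f t else - (LBINT t:{x..0}. f t))"

lemma ac_on_prim:
  assumes "locint f" shows "ac_on I (prim f) f"
  unfolding ac_on_def
proof (intro ballI impI conjI)
  fix a b :: real assume ab: "a \<le> b"
  show "set_integrable lborel {a..b} f" using assms by (rule locintD)
  consider "0 \<le> a" | "a < 0" "0 \<le> b" | "b < 0" by linarith
  then show "(LBINT x:{a..b}. f x) = prim f b - prim f a"
  proof cases
    case 1 then show ?thesis using ab set_integral_split[OF locintD[OF assms], of 0 a b] by (simp add: prim_def)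
  next
    case 2 then show ?thesis using ab set_integral_split[OF locintD[OF assms], of a 0 b] by (simp add: prim_def)
  next
    case 3 then show ?thesis using ab set_integral_split[OF locintD[OF assms], of a b 0] by (simp add: prim_def)
  qed
qed

lemma ac_on_from:
  assumes "\<And>x. a \<le> x \<Longrightarrow> x \<le> b \<Longrightarrow> F x = F a + (LBINT t:{a..x}. f t)" "set_integrable lborel {a..b} f"
  shows "ac_on {a..b} F f"
  unfolding ac_on_def
proof (intro ballI impI conjI)
  fix c d :: real assume cd: "c \<in> {a..b}" "d \<in> {a..b}" "c \<le> d"
  show "set_integrable lborel {c..d} f"
    using cd by (intro set_integrable_subset[OF assms(2)]) auto
  have "set_integrable lborel {a..d} f"
    using cd by (intro set_integrable_subset[OF assms(2)]) auto
  from set_integral_split[OF this, of c] cd assms(1)[of c] assms(1)[of d]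
  show "(LBINT x:{c..d}. f x) = F d - F c" by auto
qed

lemma ac_on_continuous:
  fixes F :: "real \<Rightarrow> 'a::euclidean_space"
  assumes "ac_on {a..b} F f"
  shows "continuous_on {a..b} F"
proof (cases "a \<le> b")
  case True
  have i: "set_integrable lborel {a..b} f" using ac_onD(1)[OF assms] True by auto
  have "continuous_on {a..b} (\<lambda>x. F a + integral {a..x} f)"
    using set_borel_integral_eq_integral(1)[OF i]
    by (intro continuous_intros indefinite_integral_continuous_1)
  moreover have "F a + integral {a..x} f = F x" if "x \<in> {a..b}" for x
  proof -
    have "set_integrable lborel {a..x} f"
      using that by (intro set_integrable_subset[OF i]) auto
    from set_borel_integral_eq_integral(2)[OF this] ac_onD(2)[OF assms, of a x] that True
    show ?thesis by simp
  qed
  ultimately show ?thesis using continuous_on_cong[OF refl, of "{a..b}" "\<lambda>x. F a + integral {a..x} f" F] by blast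
qed simp

lemma ac_on_UNIV_continuous:
  fixes F :: "real \<Rightarrow> 'a::euclidean_space"
  assumes "ac_on UNIV F f"
  shows "continuous_on UNIV F"
  unfolding continuous_on_eq_continuous_at[OF open_UNIV]
proof
  fix x :: real
  have "continuous_on {x-1..x+1} F"
    by (rule ac_on_continuous[OF ac_on_subset[OF assms]]) auto
  then show "isCont F x"
    by (rule continuous_on_interior) (auto simp: interior_atLeastAtMost_real)
qed

lemma set_integrable_bounded_mult:
  fixes f :: "real \<Rightarrow> 'a::{banach, second_countable_topology, real_normed_algebra}"
  assumes f: "set_integrable lborel S f" and g: "set_borel_measurable lborel S g"
    and bd: "\<And>x. x \<in> S \<Longrightarrow> norm (g x) \<le> C"
  shows "set_integrable lborel S (\<lambda>x. f x * g x)" "set_integrable lborel S (\<lambda>x. g x * f x)"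
proof -
  have fm: "set_borel_measurable lborel S f"
    using borel_measurable_integrable[OF f[unfolded set_integrable_def]] unfolding set_borel_measurable_def .
  have "(\<lambda>x. (indicator S x *\<^sub>R f x) * (indicator S x *\<^sub>R g x)) \<in> borel_measurable lborel"
    "(\<lambda>x. (indicator S x *\<^sub>R g x) * (indicator S x *\<^sub>R f x)) \<in> borel_measurable lborel"
    using fm g unfolding set_borel_measurable_def by measurable
  moreover have "(indicat_real S x *\<^sub>R f x) * (indicat_real S x *\<^sub>R g x) = indicat_real S x *\<^sub>R (f x * g x)" 
    "(indicat_real S x *\<^sub>R g x) * (indicat_real S x *\<^sub>R f x) = indicat_real S x *\<^sub>R (g x * f x)" for x
    by (auto simp: indicator_def)
  ultimately have m: "set_borel_measurable lborel S (\<lambda>x. f x * g x)" "set_borel_measurable lborel S (\<lambda>x. g x * f x)"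
    unfolding set_borel_measurable_def by (simp_all only:)
  have i: "set_integrable lborel S (\<lambda>x. max 0 C * norm (f x))"
    using set_integrable_norm[OF f] by (intro set_integrable_mult_right)
  have b: "norm (f x) * norm (g x) \<le> max 0 C * norm (f x)" if "x \<in> S" for x
    using mult_left_mono[of "norm (g x)" "max 0 C" "norm (f x)"] bd[OF that] by (simp add: mult.commute max.coboundedI2)
  have "norm (f x * g x) \<le> norm (max 0 C * norm (f x))" "norm (g x * f x) \<le> norm (max 0 C * norm (f x))" if "x \<in> S" for x
    using order_trans[OF norm_mult_ineq b[OF that]] order_trans[OF norm_mult_ineq, of "g x" "f x"] b[OF that]
    by (auto simp: abs_mult mult.commute)
  then show "set_integrable lborel S (\<lambda>x. f x * g x)" "set_integrable lborel S (\<lambda>x. g x * f x)"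
    using set_integrable_bound[OF i m(1)] set_integrable_bound[OF i m(2)] by auto
qed

lemma set_borel_measurable_continuous_Icc:
  fixes g :: "real \<Rightarrow> 'a::{real_normed_vector, second_countable_topology}"
  assumes "continuous_on {a..b} g"
  shows "set_borel_measurable lborel {a..b} g"
  using borel_measurable_continuous_on_indicator[OF _ assms] unfolding set_borel_measurable_def by simp

lemma set_integrable_continuous_mult:
  fixes f :: "real \<Rightarrow> 'a::{banach, second_countable_topology, real_normed_algebra}"
  assumes f: "set_integrable lborel {a..b} f" and g: "continuous_on {a..b} g"
  shows "set_integrable lborel {a..b} (\<lambda>x. f x * g x)" "set_integrable lborel {a..b} (\<lambda>x. g x * f x)"
proof -
  have "compact (g ` {a..b})" using g by (intro compact_continuous_image) auto
  then obtain C where "\<And>x. x \<in> {a..b} \<Longrightarrow> norm (g x) \<le> C"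
    by (meson bounded_iff compact_imp_bounded imageI)
  with set_integrable_bounded_mult[OF f set_borel_measurable_continuous_Icc[OF g]]
  show "set_integrable lborel {a..b} (\<lambda>x. f x * g x)" "set_integrable lborel {a..b} (\<lambda>x. g x * f x)" by blast+
qed

section \<open>Products and exponentials of absolutely continuous functions\<close>

lemma integrable_lborel_pair_mult:
  fixes f g :: "real \<Rightarrow> 'a::{real_normed_field, banach, second_countable_topology}"
  assumes "integrable lborel f" "integrable lborel g"
  shows "integrable (lborel \<Otimes>\<^sub>M lborel) (\<lambda>(x, y). f x * g y)"
proof -
  have [measurable]: "f \<in> borel_measurable borel" "g \<in> borel_measurable borel" using assms by auto
  show ?thesis
    by (rule lborel_pair.Fubini_integrable) (use assms in \<open>auto simp: norm_mult\<close>)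
qed

text \<open>The half planes y \<le> x and x \<le> y cover the plane once, except for the diagonal,
  which is null. Fubini turns the integral of f x * g y over each half plane into one of the two
  summands.\<close>

lemma triangle_Fubini:
  fixes f g :: "real \<Rightarrow> 'a::{real_normed_field, banach, second_countable_topology}"
  assumes f: "integrable lborel f" and g: "integrable lborel g"
  shows "(LBINT x. f x * (LBINT y. indicator {..x} y *\<^sub>R g y))
       + (LBINT x. (LBINT y. indicator {..x} y *\<^sub>R f y) * g x)
       = (LBINT x. f x) * (LBINT x. g x)"
    "integrable lborel (\<lambda>x. f x * (LBINT y. indicator {..x} y *\<^sub>R g y))"
    "integrable lborel (\<lambda>x. (LBINT y. indicator {..x} y *\<^sub>R f y) * g x)"
proof -
  let ?P = "\<lambda>x y. f x * g y"
  have [measurable]: "f \<in> borel_measurable borel" "g \<in> borel_measurable borel" using assms by auto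
  have P: "integrable (lborel \<Otimes>\<^sub>M lborel) (\<lambda>(x, y). ?P x y)"
    by (rule integrable_lborel_pair_mult[OF f g])
  let ?P1 = "\<lambda>x y. if y \<le> x then ?P x y else 0" and ?P2 = "\<lambda>x y. if x \<le> y then ?P x y else 0"
  have P1: "integrable (lborel \<Otimes>\<^sub>M lborel) (\<lambda>(x, y). ?P1 x y)"
    by (rule Bochner_Integration.integrable_bound[OF P]) (auto split: prod.split)
  have P2: "integrable (lborel \<Otimes>\<^sub>M lborel) (\<lambda>(x, y). ?P2 x y)"
    by (rule Bochner_Integration.integrable_bound[OF P]) (auto split: prod.split)
  have e1: "f x * (LBINT y. indicator {..x} y *\<^sub>R g y) = (LBINT y. ?P1 x y)" for x
    by (subst integral_mult_right_zero[symmetric]) (intro Bochner_Integration.integral_cong; simp add: indicator_def)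
  have e2: "(LBINT y. indicator {..x} y *\<^sub>R f y) * g x = (LBINT y. ?P2 y x)" for x
    by (subst integral_mult_left_zero[symmetric]) (intro Bochner_Integration.integral_cong; simp add: indicator_def)
  show "integrable lborel (\<lambda>x. f x * (LBINT y. indicator {..x} y *\<^sub>R g y))"
    unfolding e1 by (rule lborel_pair.integrable_fst[OF P1])
  show "integrable lborel (\<lambda>x. (LBINT y. indicator {..x} y *\<^sub>R f y) * g x)"
    unfolding e2 by (rule lborel_pair.integrable_snd[OF P2])
  have "(LBINT x. LBINT y. ?P1 x y) + (LBINT y. LBINT x. ?P2 x y)
      = (LBINT x. LBINT y. ?P1 x y) + (LBINT x. LBINT y. ?P2 x y)"
    using lborel_pair.Fubini_integral[OF P2] by simp
  also have "\<dots> = (LBINT x. (LBINT y. ?P1 x y) + (LBINT y. ?P2 x y))"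
    by (rule Bochner_Integration.integral_add[symmetric]; rule lborel_pair.integrable_fst) fact+
  also have "\<dots> = (LBINT x. LBINT y. ?P x y)"
  proof (rule integral_cong_AE)
    show "AE x in lborel. (LBINT y. ?P1 x y) + (LBINT y. ?P2 x y) = (LBINT y. ?P x y)"
      using lborel_pair.AE_integrable_fst[OF P1] lborel_pair.AE_integrable_fst[OF P2]
    proof eventually_elim
      case (elim x)
      then have "(LBINT y. ?P1 x y) + (LBINT y. ?P2 x y) = (LBINT y. ?P1 x y + ?P2 x y)"
        by simp
      also have "\<dots> = (LBINT y. ?P x y)"
      proof (rule integral_cong_AE)
        show "AE y in lborel. ?P1 x y + ?P2 x y = ?P x y"
          using AE_lborel_singleton[of x] by eventually_elim auto
      qed simp_all
      finally show ?case .
    qed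
  qed simp_all
  also have "\<dots> = (LBINT x. f x) * (LBINT x. g x)" by simp
  finally show "(LBINT x. f x * (LBINT y. indicator {..x} y *\<^sub>R g y))
       + (LBINT x. (LBINT y. indicator {..x} y *\<^sub>R f y) * g x)
       = (LBINT x. f x) * (LBINT x. g x)" unfolding e1 e2 .
qed

text \<open>Apply \<open>triangle_Fubini\<close> to the derivatives cut off to [a,b]: the inner
  integrals are G x - G a and F x - F a, so the identity is integration by parts up to boundary
  constants.\<close>

lemma ac_on_mult:
  fixes F G :: "real \<Rightarrow> 'a::{real_normed_field, euclidean_space}"
  assumes F: "ac_on I F f" and G: "ac_on I G g" and I: "is_interval I"
  shows "ac_on I (\<lambda>x. F x * G x) (\<lambda>x. f x * G x + F x * g x)"
  unfolding ac_on_def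
proof (intro ballI impI)
  fix a b :: real assume ab: "a \<in> I" "b \<in> I" "a \<le> b"
  have sub: "{a..b} \<subseteq> I" using mem_is_interval_1_I[OF I ab(1,2)] by (simp add: subset_iff)
  have Fc: "continuous_on {a..b} F" and Gc: "continuous_on {a..b} G"
    using ac_on_continuous[OF ac_on_subset[OF F sub]] ac_on_continuous[OF ac_on_subset[OF G sub]] by auto
  note fi = ac_onD[OF F ab] and gi = ac_onD[OF G ab]
  define f' where "f' = (\<lambda>x. indicat_real {a..b} x *\<^sub>R f x)"
  define g' where "g' = (\<lambda>x. indicat_real {a..b} x *\<^sub>R g x)"
  have f': "integrable lborel f'" "(LBINT x. f' x) = F b - F a"
    and g': "integrable lborel g'" "(LBINT x. g' x) = G b - G a"
    using fi gi unfolding f'_def g'_def set_integrable_def set_lebesgue_integral_def by auto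
  have Gx: "(LBINT y. indicat_real {..x} y *\<^sub>R g' y) = G x - G a" if "x \<in> {a..b}" for x
  proof -
    have "(LBINT y. indicat_real {..x} y *\<^sub>R g' y) = (LBINT y:{a..x}. g y)"
      unfolding g'_def set_lebesgue_integral_def using that
      by (intro Bochner_Integration.integral_cong) (auto simp: indicator_def)
    then show ?thesis using ac_onD(2)[OF G ab(1), of x] that sub by auto
  qed
  have Fx: "(LBINT y. indicat_real {..x} y *\<^sub>R f' y) = F x - F a" if "x \<in> {a..b}" for x
  proof -
    have "(LBINT y. indicat_real {..x} y *\<^sub>R f' y) = (LBINT y:{a..x}. f y)"
      unfolding f'_def set_lebesgue_integral_def using that
      by (intro Bochner_Integration.integral_cong) (auto simp: indicator_def)
    then show ?thesis using ac_onD(2)[OF F ab(1), of x] that sub by auto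
  qed
  have eq1: "f' x * (LBINT y. indicat_real {..x} y *\<^sub>R g' y) = indicat_real {a..b} x *\<^sub>R (f x * G x) - f' x * G a" for x
    using Gx[of x] by (auto simp: f'_def indicator_def right_diff_distrib)
  have eq2: "(LBINT y. indicat_real {..x} y *\<^sub>R f' y) * g' x = indicat_real {a..b} x *\<^sub>R (F x * g x) - F a * g' x" for x
    using Fx[of x] by (auto simp: g'_def indicator_def left_diff_distrib)
  have i1: "set_integrable lborel {a..b} (\<lambda>x. f x * G x)" and i2: "set_integrable lborel {a..b} (\<lambda>x. F x * g x)"
    using set_integrable_continuous_mult[OF fi(1) Gc] set_integrable_continuous_mult[OF gi(1) Fc] by auto
  note tri = triangle_Fubini(1)[OF f'(1) g'(1), unfolded eq1 eq2 f' g']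
  have "(LBINT x. indicat_real {a..b} x *\<^sub>R (f x * G x) - f' x * G a) = (LBINT x:{a..b}. f x * G x) - (F b - F a) * G a"
    using i1 f' unfolding set_integrable_def set_lebesgue_integral_def
    by (subst Bochner_Integration.integral_diff) auto
  moreover have "(LBINT x. indicat_real {a..b} x *\<^sub>R (F x * g x) - F a * g' x) = (LBINT x:{a..b}. F x * g x) - F a * (G b - G a)"
    using i2 g' unfolding set_integrable_def set_lebesgue_integral_def
    by (subst Bochner_Integration.integral_diff) auto
  ultimately have "((LBINT x:{a..b}. f x * G x) - (F b - F a) * G a) + ((LBINT x:{a..b}. F x * g x) - F a * (G b - G a)) = (F b - F a) * (G b - G a)"
    using tri by simp
  moreover have "X + Y = F b * G b - F a * G a"
    if "(X - (F b - F a) * G a) + (Y - F a * (G b - G a)) = (F b - F a) * (G b - G a)" for X Y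
  proof -
    have "X + Y = ((X - (F b - F a) * G a) + (Y - F a * (G b - G a))) + ((F b - F a) * G a + F a * (G b - G a))" by simp
    then show ?thesis unfolding that by (simp add: algebra_simps)
  qed
  ultimately have "(LBINT x:{a..b}. f x * G x) + (LBINT x:{a..b}. F x * g x) = F b * G b - F a * G a"
    by blast
  then show "set_integrable lborel {a..b} (\<lambda>x. f x * G x + F x * g x) \<and>
    (LBINT x:{a..b}. f x * G x + F x * g x) = F b * G b - F a * G a"
    using set_integral_add[OF i1 i2] by auto
qed

lemma ac_on_power:
  fixes F :: "real \<Rightarrow> 'a::{real_normed_field, euclidean_space}"
  assumes F: "ac_on I F f" and I: "is_interval I"
  shows "ac_on I (\<lambda>x. F x ^ Suc n) (\<lambda>x. of_nat (Suc n) * F x ^ n * f x)"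
proof (induction n)
  case (Suc n)
  show ?case
    by (rule ac_on_cong[OF ac_on_mult[OF Suc F I] _ _ I]) (auto simp: algebra_simps)
qed (use F in simp)

text \<open>The rule holds for the partial sums of the exponential series by
  \<open>ac_on_power\<close>. All of them are dominated by exp |F|, which is bounded on [a,b], so
  both sides of the integral identity pass to the limit.\<close>

lemma ac_on_exp:
  fixes F :: "real \<Rightarrow> real"
  assumes F: "ac_on I F f" and I: "is_interval I"
  shows "ac_on I (\<lambda>x. exp (F x)) (\<lambda>x. f x * exp (F x))"
  unfolding ac_on_def
proof (intro ballI impI conjI)
  fix a b :: real assume ab: "a \<in> I" "b \<in> I" "a \<le> b"
  have sub: "{a..b} \<subseteq> I" using mem_is_interval_1_I[OF I ab(1,2)] by (simp add: subset_iff)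
  have Fc: "continuous_on {a..b} F" using ac_on_continuous[OF ac_on_subset[OF F sub]] .
  note fi = ac_onD[OF F ab]
  show int: "set_integrable lborel {a..b} (\<lambda>x. f x * exp (F x))"
    by (intro set_integrable_continuous_mult(1)[OF fi(1)] continuous_intros Fc)
  define e where "e n x = (\<Sum>k<n. F x ^ k / fact k)" for n :: nat and x
  \<comment> \<open>Differentiation lowers the number of Taylor terms by one, hence the shift of the
    index.\<close>
  have ac: "ac_on I (\<lambda>x. e (Suc n) x) (\<lambda>x. f x * e n x)" for n
  proof (induction n)
    case 0 show ?case by (simp add: e_def ac_on_const)
  next
    case (Suc n)
    have "ac_on I (\<lambda>x. e (Suc n) x + (1 / fact (Suc n)) * F x ^ Suc n) (\<lambda>x. f x * e n x + (1 / fact (Suc n)) * (of_nat (Suc n) * F x ^ n * f x))"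
      by (intro ac_on_add Suc ac_on_cmult ac_on_power F I)
    then show ?case
      by (rule ac_on_cong[OF _ _ _ I]) (simp_all add: e_def field_simps del: of_nat_Suc)
  qed
  have lim: "(\<lambda>n. e n x) \<longlonglongrightarrow> exp (F x)" for x
    using exp_converges[of "F x"] unfolding sums_def e_def by (simp add: field_simps)
  have bnd: "\<bar>e n x\<bar> \<le> exp \<bar>F x\<bar>" for n x
  proof -
    have "\<bar>e n x\<bar> \<le> (\<Sum>k<n. \<bar>F x\<bar> ^ k / fact k)"
      unfolding e_def by (rule order_trans[OF sum_abs]) (simp add: power_abs)
    also have "\<dots> \<le> exp \<bar>F x\<bar>"
      using sum_le_suminf[OF summable_exp[of "\<bar>F x\<bar>"], of "{..<n}"]
      by (simp add: exp_def divide_inverse mult.commute)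
    finally show ?thesis .
  qed
  have "(\<lambda>n. LBINT x:{a..b}. f x * e n x) \<longlonglongrightarrow> (LBINT x:{a..b}. f x * exp (F x))"
    unfolding set_lebesgue_integral_def
  proof (rule integral_dominated_convergence)
    have i: "set_integrable lborel {a..b} (\<lambda>x. norm (f x) * exp \<bar>F x\<bar>)"
      using Fc by (intro set_integrable_continuous_mult(1) set_integrable_norm[OF fi(1)] continuous_intros)
    then show "integrable lborel (\<lambda>x. indicator {a..b} x *\<^sub>R (norm (f x) * exp \<bar>F x\<bar>))"
      unfolding set_integrable_def .
    show "AE x in lborel. (\<lambda>n. indicat_real {a..b} x *\<^sub>R (f x * e n x)) \<longlonglongrightarrow> indicat_real {a..b} x *\<^sub>R (f x * exp (F x))"
      by (intro AE_I2 tendsto_intros lim)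
    show "AE x in lborel. norm (indicat_real {a..b} x *\<^sub>R (f x * e n x)) \<le> indicat_real {a..b} x *\<^sub>R (norm (f x) * exp \<bar>F x\<bar>)" for n
      using bnd[of n] by (intro AE_I2) (auto simp: indicator_def abs_mult intro!: mult_left_mono)
    show "(\<lambda>x. indicat_real {a..b} x *\<^sub>R (f x * e n x)) \<in> borel_measurable lborel" for n
      using ac_onD(1)[OF ac ab] unfolding set_integrable_def by blast
    show "(\<lambda>x. indicat_real {a..b} x *\<^sub>R (f x * exp (F x))) \<in> borel_measurable lborel"
      using int unfolding set_integrable_def by blast
  qed
  moreover have "(\<lambda>n. LBINT x:{a..b}. f x * e n x) \<longlonglongrightarrow> exp (F b) - exp (F a)"
    unfolding ac_onD(2)[OF ac ab] by (intro tendsto_diff LIMSEQ_Suc lim)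
  ultimately show "(LBINT x:{a..b}. f x * exp (F x)) = exp (F b) - exp (F a)"
    by (rule LIMSEQ_unique)
qed

section \<open>Gronwall's inequality and linear systems\<close>

lemma set_integral_mono_AE_on:
  fixes f g :: "real \<Rightarrow> real"
  assumes "set_integrable lborel A f" "set_integrable lborel A g"
    "AE x in lborel. x \<in> A \<longrightarrow> f x \<le> g x"
  shows "(LBINT x:A. f x) \<le> (LBINT x:A. g x)"
  unfolding set_lebesgue_integral_def
proof (rule integral_mono_AE)
  show "AE x in lborel. indicat_real A x *\<^sub>R f x \<le> indicat_real A x *\<^sub>R g x"
    using assms(3) by eventually_elim (auto simp: indicator_def)
qed (use assms in \<open>auto simp: set_integrable_def\<close>)

lemma set_integral_nonneg_on:
  fixes f :: "real \<Rightarrow> real"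
  assumes "\<And>x. x \<in> A \<Longrightarrow> 0 \<le> f x"
  shows "0 \<le> (LBINT x:A. f x)"
  unfolding set_lebesgue_integral_def
  by (rule Bochner_Integration.integral_nonneg) (use assms in \<open>auto simp: indicator_def\<close>)

lemma ac_on_set_integral:
  assumes "set_integrable lborel {a..b} (f :: real \<Rightarrow> 'a::{banach, second_countable_topology})"
  shows "ac_on {a..b} (\<lambda>x. c + (LBINT t:{a..x}. f t)) f"
proof (rule ac_on_from)
  have "(LBINT t:{a..a}. f t) = 0"
    unfolding set_lebesgue_integral_def
    by (rule integral_eq_zero_AE) (use AE_lborel_singleton[of a] in \<open>eventually_elim, auto\<close>)
  then show "c + (LBINT t:{a..x}. f t) = c + (LBINT t:{a..a}. f t) + (LBINT t:{a..x}. f t)" for x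
    by simp
qed fact

text \<open>Let G be the primitive of g from y. The product rule gives Z exp (-G) a derivative of at
  most F exp (-G), which is at most F because F and G are nonnegative.\<close>

lemma gronwall_forward:
  fixes Z :: "real \<Rightarrow> real"
  assumes Z: "ac_on {y..x} Z z" and yx: "y \<le> x"
    and g: "set_integrable lborel {y..x} g" "\<And>t. t \<in> {y..x} \<Longrightarrow> 0 \<le> g t"
    and F: "set_integrable lborel {y..x} F" "\<And>t. t \<in> {y..x} \<Longrightarrow> 0 \<le> F t"
    and le: "AE t in lborel. t \<in> {y..x} \<longrightarrow> z t \<le> g t * Z t + F t"
  shows "Z x \<le> exp (LBINT t:{y..x}. g t) * (Z y + (LBINT t:{y..x}. F t))"
proof -
  define G where "G = (\<lambda>t. 0 + (LBINT s:{y..t}. g s))"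
  have G: "ac_on {y..x} G g" unfolding G_def by (rule ac_on_set_integral[OF g(1)])
  have Gy: "G y = 0"
    using ac_onD(2)[OF ac_on_set_integral[OF g(1), of 0], of y x] yx unfolding G_def by simp
  have G0: "0 \<le> G t" if "t \<in> {y..x}" for t
    unfolding G_def using that g(2) by (auto intro!: set_integral_nonneg_on)
  define E where "E = (\<lambda>t. exp (-1 * G t))"
  have E: "ac_on {y..x} E (\<lambda>t. (-1 * g t) * E t)"
    unfolding E_def by (intro ac_on_exp ac_on_cmult G) (simp add: is_interval_cc)
  have E1: "0 < E t" "t \<in> {y..x} \<Longrightarrow> E t \<le> 1" for t
    using G0[of t] by (auto simp: E_def)
  have "Z x * E x - Z y * E y = (LBINT t:{y..x}. z t * E t + Z t * ((-1 * g t) * E t))"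
    using ac_onD(2)[OF ac_on_mult[OF Z E is_interval_cc], of y x] yx by simp
  also have "\<dots> \<le> (LBINT t:{y..x}. F t)"
  proof (rule set_integral_mono_AE_on)
    show "set_integrable lborel {y..x} (\<lambda>t. z t * E t + Z t * ((-1 * g t) * E t))"
      using ac_onD(1)[OF ac_on_mult[OF Z E is_interval_cc], of y x] yx by simp
    show "AE t in lborel. t \<in> {y..x} \<longrightarrow> z t * E t + Z t * ((-1 * g t) * E t) \<le> F t"
      using le
    proof (eventually_elim, intro impI)
      fix t assume t: "t \<in> {y..x} \<longrightarrow> z t \<le> g t * Z t + F t" "t \<in> {y..x}"
      then have "(z t - g t * Z t) * E t \<le> F t * E t"
        using E1(1)[of t] by (intro mult_right_mono) auto
      also have "\<dots> \<le> F t" using E1[of t] F(2)[OF t(2)] t(2) by (simp add: mult_left_le)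
      finally show "z t * E t + Z t * ((-1 * g t) * E t) \<le> F t" by (simp add: algebra_simps)
    qed
  qed (rule F)
  finally have "Z x * E x \<le> Z y + (LBINT t:{y..x}. F t)" by (simp add: E_def Gy)
  then have "exp (G x) * (Z x * E x) \<le> exp (G x) * (Z y + (LBINT t:{y..x}. F t))" by simp
  then show ?thesis by (simp add: E_def exp_minus field_simps G_def)
qed

text \<open>With the integrating factor exp G the product Z exp G is nondecreasing, so bounds travel
  from the right end to the left end.\<close>

lemma gronwall_backward:
  fixes Z :: "real \<Rightarrow> real"
  assumes Z: "ac_on {y..x} Z z" and yx: "y \<le> x"
    and g: "set_integrable lborel {y..x} g"
    and le: "AE t in lborel. t \<in> {y..x} \<longrightarrow> - z t \<le> g t * Z t"
  shows "Z y \<le> exp (LBINT t:{y..x}. g t) * Z x"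
proof -
  define G where "G = (\<lambda>t. 0 + (LBINT s:{y..t}. g s))"
  have G: "ac_on {y..x} G g" unfolding G_def by (rule ac_on_set_integral[OF g(1)])
  have Gy: "G y = 0"
    using ac_onD(2)[OF ac_on_set_integral[OF g(1), of 0], of y x] yx unfolding G_def by simp
  define E where "E = (\<lambda>t. exp (G t))"
  have E: "ac_on {y..x} E (\<lambda>t. g t * E t)"
    unfolding E_def by (intro ac_on_exp G) (simp add: is_interval_cc)
  have "Z x * E x - Z y * E y = (LBINT t:{y..x}. z t * E t + Z t * (g t * E t))"
    using ac_onD(2)[OF ac_on_mult[OF Z E is_interval_cc], of y x] yx by simp
  also have "(LBINT t:{y..x}. 0) \<le> \<dots>"
  proof (rule set_integral_mono_AE_on)
    show "set_integrable lborel {y..x} (\<lambda>t. z t * E t + Z t * (g t * E t))"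
      using ac_onD(1)[OF ac_on_mult[OF Z E is_interval_cc], of y x] yx by simp
    show "AE t in lborel. t \<in> {y..x} \<longrightarrow> 0 \<le> z t * E t + Z t * (g t * E t)"
      using le
    proof (eventually_elim, intro impI)
      fix t assume "t \<in> {y..x} \<longrightarrow> - z t \<le> g t * Z t" "t \<in> {y..x}"
      then have "0 \<le> (z t + g t * Z t) * E t" by (simp add: E_def)
      then show "0 \<le> z t * E t + Z t * (g t * E t)" by (simp add: algebra_simps)
    qed
  qed (simp add: set_integrable_def)
  finally have "Z y * E y \<le> Z x * E x" by simp
  then have "Z y \<le> E x * Z x" by (simp add: E_def Gy mult.commute)
  then show ?thesis by (simp add: E_def G_def)
qed

lemma set_integral_norm_bound:
  fixes f :: "real \<Rightarrow> 'a::{banach, second_countable_topology}"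
  shows "norm (LBINT x:A. f x) \<le> (LBINT x:A. norm (f x))"
  unfolding set_lebesgue_integral_def
  by (rule order_trans[OF integral_norm_bound]) (auto intro!: eq_refl Bochner_Integration.integral_cong)

text \<open>Picard iteration, with increments measured against exp (2 G), where G is the primitive
  of the sum g of the norms of the coefficients. One iteration integrates g exp (2 G), which is half
  the derivative of exp (2 G). So the increments contract by 1/2 on the whole interval, although the
  coefficients are only integrable.\<close>

lemma linear_ode_exists:
  fixes c11 c12 c21 c22 f1 f2 :: "real \<Rightarrow> complex"
  assumes ab: "a \<le> b"
    and c: "set_integrable lborel {a..b} c11" "set_integrable lborel {a..b} c12"
       "set_integrable lborel {a..b} c21" "set_integrable lborel {a..b} c22"
    and f: "set_integrable lborel {a..b} f1" "set_integrable lborel {a..b} f2"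
  shows "\<exists>U V. U a = u0 \<and> V a = v0 \<and> ac_on {a..b} U (\<lambda>x. c11 x * U x + c12 x * V x + f1 x)
     \<and> ac_on {a..b} V (\<lambda>x. c21 x * U x + c22 x * V x + f2 x)"
proof -
  define W where "W = rec_nat ((\<lambda>x::real. u0), (\<lambda>x::real. v0)) (\<lambda>n (u, v).
     ((\<lambda>x. u0 + (LBINT t:{a..x}. c11 t * u t + c12 t * v t + f1 t)),
      (\<lambda>x. v0 + (LBINT t:{a..x}. c21 t * u t + c22 t * v t + f2 t))))"
  define U where "U n = fst (W n)" for n
  define V where "V n = snd (W n)" for n
  have U0: "U 0 = (\<lambda>x. u0)" "V 0 = (\<lambda>x. v0)" by (simp_all add: U_def V_def W_def)
  have US: "U (Suc n) = (\<lambda>x. u0 + (LBINT t:{a..x}. c11 t * U n t + c12 t * V n t + f1 t))"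
    and VS: "V (Suc n) = (\<lambda>x. v0 + (LBINT t:{a..x}. c21 t * U n t + c22 t * V n t + f2 t))" for n
    by (simp_all add: U_def V_def W_def case_prod_beta)
  have int: "set_integrable lborel {a..b} (\<lambda>t. c11 t * u t + c12 t * v t + f1 t)"
     "set_integrable lborel {a..b} (\<lambda>t. c21 t * u t + c22 t * v t + f2 t)"
    if "continuous_on {a..b} u" "continuous_on {a..b} v" for u v
    using that by (auto intro!: set_integral_add(1) set_integrable_continuous_mult(1) c f)
  have cont: "continuous_on {a..b} (U n) \<and> continuous_on {a..b} (V n)" for n
  proof (induction n)
    case (Suc n)
    then show ?case unfolding US VS
      using ac_on_continuous[OF ac_on_set_integral[OF int(1)]] ac_on_continuous[OF ac_on_set_integral[OF int(2)]]
      by blast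
  qed (simp add: U0)
  define g where "g x = norm (c11 x) + norm (c12 x) + norm (c21 x) + norm (c22 x)" for x
  have gi: "set_integrable lborel {a..b} g"
    unfolding g_def by (intro set_integral_add(1) set_integrable_norm c)
  define G where "G = (\<lambda>x. 0 + (LBINT t:{a..x}. g t))"
  have G: "ac_on {a..b} G g" unfolding G_def by (rule ac_on_set_integral[OF gi])
  have G0: "G a = 0" using ac_onD(2)[OF G, of a a] ab
    using ac_onD(2)[OF ac_on_set_integral[OF gi, of 0], of a b] unfolding G_def by simp
  have Gnn: "0 \<le> G x" for x unfolding G_def by (auto intro!: set_integral_nonneg_on simp: g_def)
  have E: "ac_on {a..b} (\<lambda>x. exp (2 * G x)) (\<lambda>x. 2 * g x * exp (2 * G x))"
    by (intro ac_on_exp ac_on_cmult G is_interval_cc)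
  define D where "D n x = norm (U (Suc n) x - U n x) + norm (V (Suc n) x - V n x)" for n x
  have Dc: "continuous_on {a..b} (D n)" for n
    unfolding D_def using cont by (intro continuous_intros) auto
  obtain K where K: "\<And>x. x \<in> {a..b} \<Longrightarrow> norm (D 0 x) \<le> K"
    using compact_imp_bounded[OF compact_continuous_image[OF Dc[of 0] compact_Icc]]
    unfolding bounded_iff by blast
  have K0: "0 \<le> K" using K[of a] ab norm_ge_zero[of "D 0 a"] by simp
  have D: "D n x \<le> K * (1/2)^n * exp (2 * G x)" if "x \<in> {a..b}" for n x
    using that
  proof (induction n arbitrary: x)
    case 0
    have "D 0 x \<le> K * 1" using K[OF 0] by simp
    also have "\<dots> \<le> K * exp (2 * G x)" using K0 Gnn[of x] by (intro mult_left_mono) auto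
    finally show ?case by simp
  next
    case (Suc n)
    have sub: "{a..x} \<subseteq> {a..b}" using Suc.prems by auto
    have i: "set_integrable lborel {a..x} h" if "set_integrable lborel {a..b} h" for h :: "real \<Rightarrow> 'b::{banach, second_countable_topology}"
      by (rule set_integrable_subset[OF that]) (use sub in auto)
    have cc: "continuous_on {a..b} (\<lambda>x. norm (U (Suc n) x - U n x))" "continuous_on {a..b} (\<lambda>x. norm (V (Suc n) x - V n x))"
      using cont by (intro continuous_intros; blast)+
    define p where "p k d1 d2 e m = k + (LBINT t:{a..x}. d1 t * U m t + d2 t * V m t + e t)" for k m and d1 d2 e :: "real \<Rightarrow> complex"
    have bd: "norm (p k d1 d2 e (Suc n) - p k d1 d2 e n) \<le> (LBINT t:{a..x}. norm (d1 t) * norm (U (Suc n) t - U n t) + norm (d2 t) * norm (V (Suc n) t - V n t))"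
      if di: "set_integrable lborel {a..b} d1" "set_integrable lborel {a..b} d2" "set_integrable lborel {a..b} e"
     for k d1 d2 e
    proof -
      have di': "set_integrable lborel {a..x} (\<lambda>t. d1 t * U m t + d2 t * V m t + e t)" for m
        using cont by (intro i set_integral_add(1) set_integrable_continuous_mult(1) di) auto
      have eq: "p k d1 d2 e (Suc n) - p k d1 d2 e n = (LBINT t:{a..x}. (d1 t * U (Suc n) t + d2 t * V (Suc n) t + e t) - (d1 t * U n t + d2 t * V n t + e t))"
        unfolding p_def using set_integral_diff(2)[OF di' di', of "Suc n" n] by simp
      have "norm (p k d1 d2 e (Suc n) - p k d1 d2 e n) \<le> (LBINT t:{a..x}. norm ((d1 t * U (Suc n) t + d2 t * V (Suc n) t + e t) - (d1 t * U n t + d2 t * V n t + e t)))"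
        unfolding eq by (rule set_integral_norm_bound)
      also have "\<dots> \<le> (LBINT t:{a..x}. norm (d1 t) * norm (U (Suc n) t - U n t) + norm (d2 t) * norm (V (Suc n) t - V n t))"
      proof (rule set_integral_mono)
        show "set_integrable lborel {a..x} (\<lambda>t. norm ((d1 t * U (Suc n) t + d2 t * V (Suc n) t + e t) - (d1 t * U n t + d2 t * V n t + e t)))"
          by (intro set_integrable_norm set_integral_diff(1) di')
        show "set_integrable lborel {a..x} (\<lambda>t. norm (d1 t) * norm (U (Suc n) t - U n t) + norm (d2 t) * norm (V (Suc n) t - V n t))"
          by (intro i set_integral_add(1) set_integrable_continuous_mult(1) set_integrable_norm di cc)
        fix t
        have "(d1 t * U (Suc n) t + d2 t * V (Suc n) t + e t) - (d1 t * U n t + d2 t * V n t + e t) = d1 t * (U (Suc n) t - U n t) + d2 t * (V (Suc n) t - V n t)"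
          by (simp add: algebra_simps)
        then show "norm ((d1 t * U (Suc n) t + d2 t * V (Suc n) t + e t) - (d1 t * U n t + d2 t * V n t + e t)) \<le> norm (d1 t) * norm (U (Suc n) t - U n t) + norm (d2 t) * norm (V (Suc n) t - V n t)"
          by (metis norm_mult norm_triangle_ineq)
      qed
      finally show ?thesis .
    qed
    have "D (Suc n) x \<le> (LBINT t:{a..x}. norm (c11 t) * norm (U (Suc n) t - U n t) + norm (c12 t) * norm (V (Suc n) t - V n t))
       + (LBINT t:{a..x}. norm (c21 t) * norm (U (Suc n) t - U n t) + norm (c22 t) * norm (V (Suc n) t - V n t))"
      unfolding D_def US[of "Suc n"] VS[of "Suc n"]
      using bd[OF c(1,2) f(1), of u0] bd[OF c(3,4) f(2), of v0]
      by (simp add: US[of n] VS[of n] p_def)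
    also have "\<dots> = (LBINT t:{a..x}. (norm (c11 t) * norm (U (Suc n) t - U n t) + norm (c12 t) * norm (V (Suc n) t - V n t))
       + (norm (c21 t) * norm (U (Suc n) t - U n t) + norm (c22 t) * norm (V (Suc n) t - V n t)))"
      by (rule set_integral_add(2)[symmetric]; intro i set_integral_add(1) set_integrable_continuous_mult(1) set_integrable_norm c cc)
    also have "\<dots> \<le> (LBINT t:{a..x}. (K * (1/2)^Suc n) * (2 * g t * exp (2 * G t)))"
    proof (rule set_integral_mono)
      show "set_integrable lborel {a..x} (\<lambda>t. (norm (c11 t) * norm (U (Suc n) t - U n t) + norm (c12 t) * norm (V (Suc n) t - V n t))
       + (norm (c21 t) * norm (U (Suc n) t - U n t) + norm (c22 t) * norm (V (Suc n) t - V n t)))"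
        by (intro i set_integral_add(1) set_integrable_continuous_mult(1) set_integrable_norm c cc)
      show "set_integrable lborel {a..x} (\<lambda>t. (K * (1/2)^Suc n) * (2 * g t * exp (2 * G t)))"
        using ac_onD(1)[OF E, of a x] Suc.prems by (intro set_integrable_mult_right) auto
      fix t assume t: "t \<in> {a..x}"
      have "(norm (c11 t) * norm (U (Suc n) t - U n t) + norm (c12 t) * norm (V (Suc n) t - V n t))
       + (norm (c21 t) * norm (U (Suc n) t - U n t) + norm (c22 t) * norm (V (Suc n) t - V n t)) \<le> g t * D n t"
        unfolding g_def D_def by (simp add: algebra_simps)
      also have "\<dots> \<le> g t * (K * (1/2)^n * exp (2 * G t))"
        using t Suc.prems by (intro mult_left_mono Suc.IH) (auto simp: g_def)
      finally show "(norm (c11 t) * norm (U (Suc n) t - U n t) + norm (c12 t) * norm (V (Suc n) t - V n t))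
       + (norm (c21 t) * norm (U (Suc n) t - U n t) + norm (c22 t) * norm (V (Suc n) t - V n t)) \<le> (K * (1/2)^Suc n) * (2 * g t * exp (2 * G t))"
        by (simp add: algebra_simps)
    qed
    also have "\<dots> = (K * (1/2)^Suc n) * (exp (2 * G x) - 1)"
      using ac_onD(2)[OF E, of a x] Suc.prems G0 by (subst set_integral_mult_right) simp
    also have "\<dots> \<le> (K * (1/2)^Suc n) * exp (2 * G x)" using K0 by (intro mult_left_mono) auto
    finally show ?case .
  qed
  have sm: "summable (\<lambda>n. K * (1/2)^n * C)" for C :: real
    by (intro summable_mult summable_mult2 summable_geometric) auto
  have conv: "\<exists>l. (\<lambda>n. X n) \<longlonglongrightarrow> l" and bnd: "norm (X n) \<le> norm (X 0) + 2 * K * C"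
    if X: "\<And>n. norm (X (Suc n) - X n) \<le> K * (1/2)^n * C" and "0 \<le> C" for X :: "nat \<Rightarrow> complex" and C n
  proof -
    have "summable (\<lambda>n. X (Suc n) - X n)" by (rule summable_comparison_test'[OF sm]) (rule X)
    then have "convergent (\<lambda>n. \<Sum>k<n. X (Suc k) - X k)" by (simp add: summable_iff_convergent)
    then obtain l where "(\<lambda>n. X n - X 0) \<longlonglongrightarrow> l"
      unfolding convergent_def by (auto simp: sum_lessThan_telescope)
    then have "(\<lambda>n. (X n - X 0) + X 0) \<longlonglongrightarrow> l + X 0" by (intro tendsto_intros)
    then show "\<exists>l. (\<lambda>n. X n) \<longlonglongrightarrow> l" by auto
    have "norm (X n - X 0) \<le> (\<Sum>k<n. norm (X (Suc k) - X k))"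
      by (subst sum_lessThan_telescope[symmetric]) (rule norm_sum)
    also have "\<dots> \<le> (\<Sum>k<n. K * (1/2)^k * C)" by (intro sum_mono X)
    also have "\<dots> = K * C * (\<Sum>k<n. (1/2)^k)" by (simp add: sum_distrib_left mult_ac)
    also have "\<dots> \<le> K * C * 2"
      using K0 \<open>0 \<le> C\<close> by (intro mult_left_mono) (subst geometric_sum, auto)
    finally show "norm (X n) \<le> norm (X 0) + 2 * K * C"
      using norm_triangle_sub[of "X n" "X 0"] by (simp add: mult_ac)
  qed
  have Gb: "exp (2 * G x) \<le> exp (2 * G b)" if "x \<in> {a..b}" for x
  proof -
    have "G b - G x = (LBINT t:{x..b}. g t)" using ac_onD(2)[OF G, of x b] that by auto
    moreover have "0 \<le> (LBINT t:{x..b}. g t)" by (auto intro!: set_integral_nonneg_on simp: g_def)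
    ultimately show ?thesis by simp
  qed
  have DU: "norm (U (Suc n) x - U n x) \<le> K * (1/2)^n * exp (2 * G b)" "norm (V (Suc n) x - V n x) \<le> K * (1/2)^n * exp (2 * G b)" if x: "x \<in> {a..b}" for n x
  proof -
    have "D n x \<le> K * (1/2)^n * exp (2 * G b)"
      using D[OF x, of n] mult_left_mono[OF Gb[OF x], of "K * (1/2)^n"] K0 by simp
    then show "norm (U (Suc n) x - U n x) \<le> K * (1/2)^n * exp (2 * G b)" "norm (V (Suc n) x - V n x) \<le> K * (1/2)^n * exp (2 * G b)"
      unfolding D_def using norm_ge_zero[of "U (Suc n) x - U n x"] norm_ge_zero[of "V (Suc n) x - V n x"] by linarith+
  qed
  have "\<exists>l. (\<lambda>n. U n x) \<longlonglongrightarrow> l" "\<exists>l. (\<lambda>n. V n x) \<longlonglongrightarrow> l" if "x \<in> {a..b}" for x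
    using conv[where X="\<lambda>n. U n x", OF DU(1)[OF that]] conv[where X="\<lambda>n. V n x", OF DU(2)[OF that]] by simp_all
  then obtain u v where u: "\<And>x. x \<in> {a..b} \<Longrightarrow> (\<lambda>n. U n x) \<longlonglongrightarrow> u x" and v: "\<And>x. x \<in> {a..b} \<Longrightarrow> (\<lambda>n. V n x) \<longlonglongrightarrow> v x"
    by metis
  have lim: "ac_on {a..b} w (\<lambda>x. d1 x * u x + d2 x * v x + e x) \<and> w a = k"
    if di: "set_integrable lborel {a..b} d1" "set_integrable lborel {a..b} d2" "set_integrable lborel {a..b} e"
      and w: "\<And>x. x \<in> {a..b} \<Longrightarrow> (\<lambda>n. X n x) \<longlonglongrightarrow> w x"
      and X: "\<And>n. X (Suc n) = (\<lambda>x. k + (LBINT t:{a..x}. d1 t * U n t + d2 t * V n t + e t))"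
    for w X k d1 d2 e
  proof -
    \<comment> \<open>The geometric series of the increments bounds the distance of every iterate
      from the initial constant by \<open>C\<close>; this dominates the integrands.\<close>
    define C where "C = 2 * K * exp (2 * G b)"
    have dom: "set_integrable lborel {a..b} (\<lambda>t. norm (d1 t) * (norm u0 + C) + norm (d2 t) * (norm v0 + C) + norm (e t))"
      by (intro set_integral_add(1) set_integrable_mult_left set_integrable_norm di)
    have le: "norm (d1 t * U n t + d2 t * V n t + e t) \<le> norm (d1 t) * (norm u0 + C) + norm (d2 t) * (norm v0 + C) + norm (e t)"
      if t: "t \<in> {a..b}" for n t
    proof -
      have "norm (U n t) \<le> norm u0 + C" "norm (V n t) \<le> norm v0 + C"
        using bnd[where X="\<lambda>n. U n t", OF DU(1)[OF t], of n] bnd[where X="\<lambda>n. V n t", OF DU(2)[OF t], of n]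
        by (auto simp: C_def U0)
      then have "norm (d1 t * U n t) \<le> norm (d1 t) * (norm u0 + C)" "norm (d2 t * V n t) \<le> norm (d2 t) * (norm v0 + C)"
        by (auto simp: norm_mult intro!: mult_left_mono)
      then show ?thesis
        using norm_triangle_ineq[of "d1 t * U n t + d2 t * V n t" "e t"] norm_triangle_ineq[of "d1 t * U n t" "d2 t * V n t"] by linarith
    qed
    have mn: "(\<lambda>t. indicat_real {a..x} t *\<^sub>R (d1 t * U n t + d2 t * V n t + e t)) \<in> borel_measurable lborel" if "x \<in> {a..b}" for n x
    proof -
      have "set_integrable lborel {a..x} (\<lambda>t. d1 t * U n t + d2 t * V n t + e t)"
        by (rule set_integrable_subset[of _ "{a..b}"]) (use cont that in \<open>auto intro!: set_integral_add(1) set_integrable_continuous_mult(1) di\<close>)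
      then show ?thesis unfolding set_integrable_def by (rule borel_measurable_integrable)
    qed
    have ptw: "(\<lambda>n. indicat_real {a..x} t *\<^sub>R (d1 t * U n t + d2 t * V n t + e t)) \<longlonglongrightarrow> indicat_real {a..x} t *\<^sub>R (d1 t * u t + d2 t * v t + e t)"
      if "x \<in> {a..b}" for x t
    proof (cases "t \<in> {a..x}")
      case True
      then show ?thesis using that by (intro tendsto_intros u v) auto
    qed simp
    have m: "(\<lambda>t. indicat_real {a..x} t *\<^sub>R (d1 t * u t + d2 t * v t + e t)) \<in> borel_measurable lborel" if "x \<in> {a..b}" for x
      by (rule borel_measurable_LIMSEQ_metric[OF mn[OF that] ptw[OF that]])
    have dom': "integrable lborel (\<lambda>t. indicator {a..x} t *\<^sub>R (norm (d1 t) * (norm u0 + C) + norm (d2 t) * (norm v0 + C) + norm (e t)))" if "x \<in> {a..b}" for x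
      using set_integrable_subset[OF dom, of "{a..x}"] that unfolding set_integrable_def by auto
    have le': "norm (indicat_real {a..x} t *\<^sub>R (d1 t * U n t + d2 t * V n t + e t)) \<le> indicator {a..x} t *\<^sub>R (norm (d1 t) * (norm u0 + C) + norm (d2 t) * (norm v0 + C) + norm (e t))"
      if "x \<in> {a..b}" for n t x
      using that le[of t n] by (auto simp: indicator_def)
    have L: "(\<lambda>n. LBINT t:{a..x}. d1 t * U n t + d2 t * V n t + e t) \<longlonglongrightarrow> (LBINT t:{a..x}. d1 t * u t + d2 t * v t + e t)"
      and LI: "set_integrable lborel {a..x} (\<lambda>t. d1 t * u t + d2 t * v t + e t)" if x: "x \<in> {a..b}" for x
      unfolding set_lebesgue_integral_def set_integrable_def
      by (rule integral_dominated_convergence[OF m[OF x] mn[OF x] dom'[OF x]]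
          integrable_dominated_convergence[OF m[OF x] mn[OF x] dom'[OF x]];
          use ptw[OF x] le'[OF x] in \<open>auto intro!: AE_I2\<close>)+
    have eq: "w x = k + (LBINT t:{a..x}. d1 t * u t + d2 t * v t + e t)" if x: "x \<in> {a..b}" for x
    proof (rule LIMSEQ_unique[OF LIMSEQ_Suc[OF w[OF x]]])
      show "(\<lambda>n. X (Suc n) x) \<longlonglongrightarrow> k + (LBINT t:{a..x}. d1 t * u t + d2 t * v t + e t)"
        unfolding X by (intro tendsto_intros L x)
    qed
    have "ac_on {a..b} (\<lambda>x. k + (LBINT t:{a..x}. d1 t * u t + d2 t * v t + e t)) (\<lambda>x. d1 x * u x + d2 x * v x + e x)"
      by (rule ac_on_set_integral) (use LI[of b] ab in auto)
    then have "ac_on {a..b} w (\<lambda>x. d1 x * u x + d2 x * v x + e x)"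
      by (rule ac_on_cong) (auto simp: eq is_interval_cc)
    moreover have "(LBINT t:{a..a}. h t) = (0::complex)" for h
      unfolding set_lebesgue_integral_def
      by (rule integral_eq_zero_AE) (use AE_lborel_singleton[of a] in \<open>eventually_elim, auto\<close>)
    ultimately show ?thesis using eq[of a] ab by auto
  qed
  show ?thesis
    using lim[OF c(1,2) f(1) u US] lim[OF c(3,4) f(2) v VS] by blast
qed

section \<open>Test functions\<close>

text \<open>Recursion on \<open>deriv\<close> instead of a condition on all iterated derivatives, so
  that closure under sums, products and affine substitutions follows by induction on
  \<open>n\<close>.\<close>

primrec ndiff :: "nat \<Rightarrow> (real \<Rightarrow> real) \<Rightarrow> bool" where
  "ndiff 0 f \<longleftrightarrow> True"
| "ndiff (Suc n) f \<longleftrightarrow> (\<forall>x. f field_differentiable at x) \<and> ndiff n (deriv f)"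

lemma ndiff_iff: "ndiff n f \<longleftrightarrow> (\<forall>k<n. \<forall>x. (deriv ^^ k) f field_differentiable at x)"
proof (induction n arbitrary: f)
  case (Suc n)
  have "(\<forall>k<Suc n. \<forall>x. (deriv ^^ k) f field_differentiable at x) \<longleftrightarrow>
    (\<forall>x. f field_differentiable at x) \<and> (\<forall>k<n. \<forall>x. (deriv ^^ k) (deriv f) field_differentiable at x)"
    by (simp add: All_less_Suc2 funpow_Suc_right del: funpow.simps)
  then show ?case using Suc by simp
qed simp

lemma test_function_iff: "test_function f \<longleftrightarrow> (\<forall>n. ndiff n f) \<and> bounded {x. f x \<noteq> 0}"
  unfolding test_function_def ndiff_iff by blast

lemma ndiff_Suc: "ndiff (Suc n) f \<Longrightarrow> ndiff n f"
  by (auto simp: ndiff_iff)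

lemma ndiff_add: "ndiff n f \<Longrightarrow> ndiff n g \<Longrightarrow> ndiff n (\<lambda>x. f x + g x)"
proof (induction n arbitrary: f g)
  case (Suc n)
  then have "deriv (\<lambda>x. f x + g x) = (\<lambda>x. deriv f x + deriv g x)" by (auto simp: fun_eq_iff)
  with Suc show ?case by (auto intro: field_differentiable_add)
qed simp

lemma ndiff_mult: "ndiff n f \<Longrightarrow> ndiff n g \<Longrightarrow> ndiff n (\<lambda>x. f x * g x)"
proof (induction n arbitrary: f g)
  case (Suc n)
  then have "deriv (\<lambda>x. f x * g x) = (\<lambda>x. f x * deriv g x + deriv f x * g x)" by (auto simp: fun_eq_iff)
  with Suc ndiff_Suc[OF Suc.prems(1)] ndiff_Suc[OF Suc.prems(2)]
  show ?case by (auto intro!: field_differentiable_mult ndiff_add Suc.IH)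
qed simp

lemma ndiff_const: "ndiff n (\<lambda>x. c)"
proof (induction n arbitrary: c)
  case (Suc n)
  have "deriv (\<lambda>x::real. c) = (\<lambda>x. 0)" by auto
  with Suc show ?case by auto
qed simp

lemma ndiff_affine: "ndiff n f \<Longrightarrow> ndiff n (\<lambda>x. f (a * x + b))"
proof (induction n arbitrary: f)
  case (Suc n)
  have D: "((\<lambda>x. f (a * x + b)) has_real_derivative deriv f (a * x + b) * a) (at x)" for x
  proof -
    have "(f has_real_derivative deriv f (a * x + b)) (at (a * x + b))"
      using Suc.prems by (simp add: DERIV_deriv_iff_field_differentiable)
    moreover have "((\<lambda>x. a * x + b) has_real_derivative a) (at x)"
      by (auto intro!: derivative_eq_intros)
    ultimately show ?thesis by (rule DERIV_chain2)
  qed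
  then have "deriv (\<lambda>x. f (a * x + b)) = (\<lambda>x. deriv f (a * x + b) * a)"
    by (auto simp: fun_eq_iff intro: DERIV_imp_deriv)
  moreover have "ndiff n (\<lambda>x. deriv f (a * x + b) * a)"
    using Suc by (auto intro!: ndiff_mult ndiff_const)
  ultimately show ?case using D by (auto simp: field_differentiable_def)
qed simp

lemma test_function_deriv_outside:
  fixes \<phi> :: "real \<Rightarrow> real"
  assumes "\<And>x. \<bar>x\<bar> > N \<Longrightarrow> \<phi> x = 0" "\<bar>x\<bar> > N"
  shows "deriv \<phi> x = 0"
proof -
  have "eventually (\<lambda>y. \<bar>y\<bar> > N) (nhds x)"
    using assms(2) by (intro order_tendstoD(1)[of _ "\<bar>x\<bar>"] tendsto_intros) (simp add: filterlim_ident)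
  then have "eventually (\<lambda>y. \<phi> y = 0) (nhds x)" by eventually_elim (rule assms(1))
  then have "deriv \<phi> x = deriv (\<lambda>y. 0) x" by (rule deriv_cong_ev) simp
  then show ?thesis by simp
qed

lemma test_function_support:
  assumes "test_function \<phi>"
  obtains N where "0 < N" "\<And>x. \<bar>x\<bar> > N \<Longrightarrow> \<phi> x = 0"
proof -
  obtain N where "\<And>x. \<phi> x \<noteq> 0 \<Longrightarrow> norm x \<le> N" "0 < N"
    using assms unfolding test_function_def bounded_pos by auto
  then show thesis using that[of N] by force
qed

lemma test_function_D:
  assumes "test_function \<phi>"
  shows "(\<phi> has_real_derivative deriv \<phi> x) (at x)" "continuous_on UNIV \<phi>" "continuous_on UNIV (deriv \<phi>)"
    "(deriv \<phi> has_real_derivative deriv (deriv \<phi>) x) (at x)"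
proof -
  have "ndiff (Suc (Suc 0)) \<phi>" using assms test_function_iff by blast
  then have d: "\<phi> field_differentiable at x" "deriv \<phi> field_differentiable at x" for x by auto
  then show "(\<phi> has_real_derivative deriv \<phi> x) (at x)" "(deriv \<phi> has_real_derivative deriv (deriv \<phi>) x) (at x)"
    by (auto simp: DERIV_deriv_iff_field_differentiable)
  show "continuous_on UNIV \<phi>" "continuous_on UNIV (deriv \<phi>)"
    using d by (auto intro!: continuous_at_imp_continuous_on field_differentiable_imp_continuous_at)
qed

lemma test_function_deriv:
  assumes "test_function \<phi>" shows "test_function (deriv \<phi>)"
proof -
  obtain N where N: "\<And>x. \<bar>x\<bar> > N \<Longrightarrow> \<phi> x = 0" using test_function_support[OF assms] by blast
  have "\<bar>x\<bar> \<le> N" if "deriv \<phi> x \<noteq> 0" for x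
    using test_function_deriv_outside[of N \<phi> x, OF N] that by force
  then have "bounded {x. deriv \<phi> x \<noteq> 0}" unfolding bounded_iff by (auto intro!: exI[of _ N])
  moreover have "ndiff n (deriv \<phi>)" for n
    using assms ndiff.simps(2)[of n \<phi>] by (auto simp: test_function_iff simp del: ndiff.simps)
  ultimately show ?thesis by (simp add: test_function_iff)
qed

lemma ac_on_C1:
  fixes F :: "real \<Rightarrow> 'a::euclidean_space"
  assumes "\<And>x. (F has_vector_derivative f x) (at x)" "continuous_on UNIV f"
  shows "ac_on I F f"
  unfolding ac_on_def
proof (intro ballI impI)
  fix a b :: real assume "a \<le> b"
  then have "(f has_integral (F b - F a)) {a..b}"
    by (intro fundamental_theorem_of_calculus) (auto intro: has_vector_derivative_at_within assms(1))
  moreover have i: "set_integrable lborel {a..b} f"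
    unfolding set_integrable_def
    by (rule borel_integrable_compact) (auto intro: continuous_on_subset[OF assms(2)])
  ultimately show "set_integrable lborel {a..b} f \<and> (LBINT x:{a..b}. f x) = F b - F a"
    using set_borel_integral_eq_integral(2)[OF i] by (simp add: integral_unique)
qed

lemma test_function_ac:
  assumes "test_function \<phi>"
  shows "ac_on I \<phi> (deriv \<phi>)" "ac_on I (\<lambda>x. complex_of_real (\<phi> x)) (\<lambda>x. complex_of_real (deriv \<phi> x))"
proof -
  note D = test_function_D[OF assms]
  show "ac_on I \<phi> (deriv \<phi>)"
    using D by (intro ac_on_C1) (auto simp: has_real_derivative_iff_has_vector_derivative)
  then show "ac_on I (\<lambda>x. complex_of_real (\<phi> x)) (\<lambda>x. complex_of_real (deriv \<phi> x))"
    by (rule ac_on_bounded_linear[OF bounded_linear_of_real])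
qed

text \<open>The functions \<open>p(1/x) exp(-1/x)\<close> on the positive half line, with \<open>p\<close> a polynomial,
  form a class closed under differentiation. This gives the smoothness of \<open>exp(-1/x)\<close>.\<close>

definition flat :: "real poly \<Rightarrow> real \<Rightarrow> real" where
  "flat p x = (if x > 0 then poly p (1/x) * exp (-(1/x)) else 0)"

lemma flat_tendsto_0: "(flat p \<longlongrightarrow> 0) (at_right 0)"
proof -
  have "((\<lambda>y. poly p y / exp y) \<longlongrightarrow> 0) at_top"
  proof (induction p)
    case (pCons c p)
    have *: "((\<lambda>y. y ^ n / exp y) \<longlongrightarrow> (0::real)) at_top" for n
      by (rule tendsto_power_div_exp_0)
    have "((\<lambda>y. (\<Sum>i\<le>degree (pCons c p). coeff (pCons c p) i * (y ^ i / exp y))) \<longlongrightarrow> (\<Sum>i\<le>degree (pCons c p). coeff (pCons c p) i * 0)) at_top"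
      by (intro tendsto_sum tendsto_mult tendsto_const *)
    then show ?case by (simp only: poly_altdef sum_divide_distrib times_divide_eq_right mult_zero_right sum.neutral_const)
  qed simp
  then have "((\<lambda>x. poly p (inverse x) / exp (inverse x)) \<longlongrightarrow> 0) (at_right 0)"
    by (rule filterlim_compose) (rule filterlim_inverse_at_top_right)
  then show ?thesis
  proof (rule Lim_transform_eventually)
    show "\<forall>\<^sub>F x in at_right 0. poly p (inverse x) / exp (inverse x) = flat p x"
      unfolding eventually_at_right_field by (intro exI[of _ 1]) (auto simp: flat_def exp_minus field_simps)
  qed
qed

lemma flat_has_derivative:
  "(flat p has_real_derivative flat (monom 1 2 * (p - pderiv p)) x) (at x)"
proof -
  consider "x > 0" | "x < 0" | "x = 0" by linarith
  then show ?thesis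
  proof cases
    case 1
    have "((\<lambda>x. poly p (1/x) * exp (-(1/x))) has_real_derivative
       poly (pderiv p) (1/x) * (- (1/x^2)) * exp (-(1/x)) + poly p (1/x) * (exp (-(1/x)) * (1/x^2))) (at x)"
      using 1 by (auto intro!: derivative_eq_intros simp: power2_eq_square field_simps)
    then have "(flat p has_real_derivative
       poly (pderiv p) (1/x) * (- (1/x^2)) * exp (-(1/x)) + poly p (1/x) * (exp (-(1/x)) * (1/x^2))) (at x)"
      by (rule has_field_derivative_transform_within_open[where S="{0<..}"]) (use 1 in \<open>auto simp: flat_def\<close>)
    then show ?thesis
      using 1 by (simp add: flat_def poly_monom algebra_simps power_one_over)
  next
    case 2
    have "((\<lambda>x. 0) has_real_derivative 0) (at x)" by simp
    then have "(flat p has_real_derivative 0) (at x)"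
      by (rule has_field_derivative_transform_within_open[where S="{..<0}"]) (use 2 in \<open>auto simp: flat_def\<close>)
    then show ?thesis using 2 by (simp add: flat_def)
  next
    case 3
    \<comment> \<open>From the right, the difference quotient of \<open>flat p\<close> at 0 is
      \<open>flat (monom 1 1 * p)\<close>, a function of the same class, so its limit is already
      known.\<close>
    have "((\<lambda>h. (flat p (0 + h) - flat p 0) / h) \<longlongrightarrow> 0) (at_right 0)"
    proof (rule Lim_transform_eventually[OF flat_tendsto_0[of "monom 1 1 * p"]])
      show "\<forall>\<^sub>F x in at_right 0. flat (monom 1 1 * p) x = (flat p (0 + x) - flat p 0) / x"
        unfolding eventually_at_right_field by (intro exI[of _ 1]) (auto simp: flat_def poly_monom)
    qed
    moreover have "((\<lambda>h. (flat p (0 + h) - flat p 0) / h) \<longlongrightarrow> 0) (at_left 0)"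
      by (rule Lim_transform_eventually[OF tendsto_const])
         (auto simp: flat_def eventually_at_left_field intro!: exI[of _ "-1"])
    ultimately have "((\<lambda>h. (flat p (0 + h) - flat p 0) / h) \<longlongrightarrow> 0) (at 0)"
      by (rule filterlim_split_at[rotated])
    then show ?thesis using 3 by (simp add: DERIV_def flat_def)
  qed
qed

lemma ndiff_flat: "ndiff n (flat p)"
proof (induction n arbitrary: p)
  case (Suc n)
  have "deriv (flat p) = flat (monom 1 2 * (p - pderiv p))"
    using flat_has_derivative by (auto simp: fun_eq_iff intro: DERIV_imp_deriv)
  with Suc show ?case using flat_has_derivative by (auto simp: field_differentiable_def)
qed simp

text \<open>A smooth function supported in [a,b]. As n grows, both exponents tend to 0 inside (a,b),
  so the functions tend boundedly to the indicator of (a,b). This is the bridge from test functions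
  to Borel sets.\<close>

definition bump :: "real \<Rightarrow> real \<Rightarrow> nat \<Rightarrow> real \<Rightarrow> real" where
  "bump a b n x = flat 1 (real (Suc n) * x + - (real (Suc n) * a)) * flat 1 (- real (Suc n) * x + real (Suc n) * b)"

lemma bump_test_function: "test_function (bump a b n)"
proof -
  have "ndiff k (bump a b n)" for k
    unfolding bump_def by (intro ndiff_mult ndiff_affine ndiff_flat)
  moreover have "{x. bump a b n x \<noteq> 0} \<subseteq> {a..b}"
  proof safe
    fix x assume "bump a b n x \<noteq> 0"
    then have "0 < real (Suc n) * (x - a)" "0 < real (Suc n) * (b - x)"
      by (auto simp: bump_def flat_def algebra_simps split: if_splits)
    then show "x \<in> {a..b}" by (auto simp: zero_less_mult_iff)
  qed
  ultimately show ?thesis unfolding test_function_iff using bounded_subset bounded_closed_interval by blast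
qed

lemma flat_bounds: "0 \<le> flat 1 x" "flat 1 x \<le> 1"
  by (auto simp: flat_def)

lemma bump_bounds: "0 \<le> bump a b n x" "bump a b n x \<le> 1" "bump a b n x \<le> indicator {a..b} x" "\<bar>bump a b n x\<bar> \<le> indicator {a<..<b} x"
proof -
  show nn: "0 \<le> bump a b n x" and le1: "bump a b n x \<le> 1" unfolding bump_def
    using flat_bounds by (auto intro!: mult_le_one)
  have z: "bump a b n x = 0" if "x \<notin> {a<..<b}"
  proof -
    have "real (Suc n) * (x - a) \<le> 0 \<or> real (Suc n) * (b - x) \<le> 0" using that by (auto simp: mult_le_0_iff)
    then show ?thesis by (auto simp: bump_def flat_def algebra_simps)
  qed
  show "bump a b n x \<le> indicator {a..b} x" "\<bar>bump a b n x\<bar> \<le> indicator {a<..<b} x"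
    using nn le1 z by (auto simp: indicator_def)
qed

lemma bump_LIMSEQ: "(\<lambda>n. bump a b n x) \<longlonglongrightarrow> indicator {a<..<b} x"
proof (cases "x \<in> {a<..<b}")
  case False
  then have "bump a b n x = 0" for n using bump_bounds(4)[of a b n x] by simp
  then show ?thesis using False by simp
next
  case True
  have *: "(\<lambda>n. flat 1 (real (Suc n) * c)) \<longlonglongrightarrow> 1" if "c > 0" for c
  proof -
    have "(\<lambda>n. exp (- (inverse (real (Suc n)) * inverse c))) \<longlonglongrightarrow> exp (- (0 * inverse c))"
      by (intro tendsto_intros LIMSEQ_inverse_real_of_nat)
    moreover have "flat 1 (real (Suc n) * c) = exp (- (inverse (real (Suc n)) * inverse c))" for n
      using that by (simp add: flat_def field_simps del: of_nat_Suc)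
    ultimately show ?thesis by simp
  qed
  have "bump a b n x = flat 1 (real (Suc n) * (x - a)) * flat 1 (real (Suc n) * (b - x))" for n
    by (simp add: bump_def algebra_simps)
  moreover have "(\<lambda>n. flat 1 (real (Suc n) * (x - a)) * flat 1 (real (Suc n) * (b - x))) \<longlonglongrightarrow> 1 * 1"
    using True by (intro tendsto_mult *) auto
  ultimately show ?thesis using True by simp
qed

lemma test_function_mult_const: "test_function \<phi> \<Longrightarrow> test_function (\<lambda>x. c * \<phi> x)"
  unfolding test_function_iff
  by (auto intro!: ndiff_mult ndiff_const elim: bounded_subset)

lemma test_function_add:
  assumes "test_function \<phi>" "test_function \<psi>" shows "test_function (\<lambda>x. \<phi> x + \<psi> x)"
proof -
  have "bounded ({x. \<phi> x \<noteq> 0} \<union> {x. \<psi> x \<noteq> 0})" using assms by (simp add: test_function_iff)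
  then have "bounded {x. \<phi> x + \<psi> x \<noteq> 0}" by (rule bounded_subset) auto
  then show ?thesis using assms by (simp add: test_function_iff ndiff_add)
qed

text \<open>The vanishing mean makes the primitive started at -N vanish again to the right of N, so
  it has bounded support.\<close>

lemma test_function_primitive:
  assumes "test_function \<phi>" "(LBINT x. \<phi> x) = 0"
  obtains \<psi> where "test_function \<psi>" "deriv \<psi> = \<phi>"
proof -
  obtain N where N: "0 < N" "\<And>x. \<bar>x\<bar> > N \<Longrightarrow> \<phi> x = 0" using test_function_support[OF assms(1)] by blast
  have c: "continuous_on A \<phi>" for A
    using test_function_D(2)[OF assms(1)] continuous_on_subset by blast
  have i: "set_integrable lborel {a..b} \<phi>" for a b
    unfolding set_integrable_def by (rule borel_integrable_compact) (auto intro: c)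
  define \<psi> where "\<psi> x = (LBINT t:{-N..x}. \<phi> t)" for x
  have L: "\<psi> x = 0" if "x < -N" for x using that unfolding \<psi>_def by (simp add: set_lebesgue_integral_def)
  have all: "\<psi> x = 0" if "x > N" for x
  proof -
    have "\<psi> x = (LBINT t. \<phi> t)"
      unfolding \<psi>_def set_lebesgue_integral_def
      by (rule Bochner_Integration.integral_cong) (use that N(2) in \<open>force simp: indicator_def\<close>)+
    then show ?thesis using assms(2) by simp
  qed
  \<comment> \<open>Starting the integral one unit further left leaves its values unchanged and
    makes -N an interior point, where the fundamental theorem applies from both sides.\<close>
  define \<Psi> where "\<Psi> x = integral {-N-1..x} \<phi>" for x
  have eq: "\<psi> x = \<Psi> x" if "x > -N-1" for x
  proof -
    have "(LBINT t:{-N..x}. \<phi> t) = (LBINT t:{-N-1..x}. \<phi> t)"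
      unfolding set_lebesgue_integral_def
      by (rule Bochner_Integration.integral_cong) (use that N(2) in \<open>force simp: indicator_def\<close>)+
    then show ?thesis unfolding \<psi>_def \<Psi>_def using set_borel_integral_eq_integral(2)[OF i] by simp
  qed
  have D: "(\<psi> has_real_derivative \<phi> x) (at x)" for x
  proof (cases "x < -N")
    case True
    have "((\<lambda>x. 0) has_real_derivative 0) (at x)" by simp
    then have "(\<psi> has_real_derivative 0) (at x)"
      by (rule has_field_derivative_transform_within_open[where S="{..<-N}"]) (use True L in auto)
    then show ?thesis using True N by simp
  next
    case False
    have "(\<Psi> has_real_derivative \<phi> x) (at x within {-N-1..x+1})"
      unfolding \<Psi>_def using False by (intro integral_has_real_derivative c) auto
    then have "(\<Psi> has_real_derivative \<phi> x) (at x within {-N-1<..<x+1})"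
      by (rule DERIV_subset) auto
    then have "(\<Psi> has_real_derivative \<phi> x) (at x)"
      using False by (subst (asm) at_within_open) auto
    then show ?thesis
      by (rule has_field_derivative_transform_within_open[where S="{-N-1<..}"]) (use False eq in auto)
  qed
  have dd: "deriv \<psi> = \<phi>" using D by (auto simp: fun_eq_iff intro: DERIV_imp_deriv)
  have "ndiff n \<psi>" for n
    using assms(1) D by (cases n) (auto simp: test_function_iff dd field_differentiable_def)
  moreover have "bounded {x. \<psi> x \<noteq> 0}"
    unfolding bounded_iff using L all by (intro exI[of _ N]) (force simp: abs_le_iff not_le[symmetric])
  ultimately show thesis using that[of \<psi>] dd by (simp add: test_function_iff)
qed

section \<open>Functionals with bounded convergence\<close>

text \<open>Bounded Borel functions of bounded support, which every locally finite measure can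
  integrate. Unlike test functions, they stay in their class when multiplied by the merely Borel
  coefficients.\<close>

definition bbs :: "(real \<Rightarrow> complex) \<Rightarrow> bool" where
  "bbs \<phi> \<longleftrightarrow> \<phi> \<in> borel_measurable borel \<and> (\<exists>C N. \<forall>x. norm (\<phi> x) \<le> C * indicator {-N..N} x)"

text \<open>Abstracts the integral against a complex measure that is finite on bounded sets.
  Derivative measures, singular measures and densities can then be added and multiplied by
  coefficients without constructing a common measure.\<close>

definition radon :: "((real \<Rightarrow> complex) \<Rightarrow> complex) \<Rightarrow> bool" where
  "radon L \<longleftrightarrow>
     (\<forall>\<phi> \<psi>. bbs \<phi> \<longrightarrow> bbs \<psi> \<longrightarrow> L (\<lambda>x. \<phi> x + \<psi> x) = L \<phi> + L \<psi>) \<and>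
     (\<forall>c \<phi>. bbs \<phi> \<longrightarrow> L (\<lambda>x. c * \<phi> x) = c * L \<phi>) \<and>
     (\<forall>\<Phi> \<phi> C N. (\<forall>n. \<Phi> n \<in> borel_measurable borel) \<longrightarrow>
        (\<forall>n x. norm (\<Phi> n x) \<le> C * indicator {-N..N} x) \<longrightarrow> (\<forall>x. (\<lambda>n. \<Phi> n x) \<longlonglongrightarrow> \<phi> x) \<longrightarrow>
        (\<lambda>n. L (\<Phi> n)) \<longlonglongrightarrow> L \<phi>)"

lemma bbsI: "\<phi> \<in> borel_measurable borel \<Longrightarrow> (\<And>x. norm (\<phi> x) \<le> C * indicator {-N..N} x) \<Longrightarrow> bbs \<phi>"
  unfolding bbs_def by blast

lemma bbs_support:
  assumes "bbs \<phi>"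
  obtains C N where "0 \<le> C" "0 < N" "\<phi> \<in> borel_measurable borel" "\<And>x. norm (\<phi> x) \<le> C * indicator {-N..N} x"
proof -
  obtain C N where CN: "\<phi> \<in> borel_measurable borel" "\<And>x. norm (\<phi> x) \<le> C * indicator {-N..N} x"
    using assms unfolding bbs_def by blast
  have "norm (\<phi> x) \<le> max C 0 * indicator {- max N 1..max N 1} x" for x
    using CN(2)[of x] by (cases "x \<in> {-N..N}") (auto split: split_indicator)
  then show thesis using that[of "max C 0" "max N 1"] CN(1) by auto
qed

lemma bbs_add: assumes "bbs \<phi>" "bbs \<psi>" shows "bbs (\<lambda>x. \<phi> x + \<psi> x)"
proof -
  obtain C N where 1: "0 \<le> C" "\<phi> \<in> borel_measurable borel" "\<And>x. norm (\<phi> x) \<le> C * indicator {-N..N} x"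
    using bbs_support[OF assms(1)] by metis
  obtain C' N' where 2: "0 \<le> C'" "\<psi> \<in> borel_measurable borel" "\<And>x. norm (\<psi> x) \<le> C' * indicator {-N'..N'} x"
    using bbs_support[OF assms(2)] by metis
  show ?thesis
  proof (rule bbsI)
    show "norm (\<phi> x + \<psi> x) \<le> (C + C') * indicator {- max N N'..max N N'} x" for x
    proof (cases "x \<in> {- max N N'..max N N'}")
      case True
      have "C * indicator {-N..N} x \<le> C" "C' * indicator {-N'..N'} x \<le> C'"
        using 1(1) 2(1) by (auto split: split_indicator)
      then show ?thesis using True 1(3)[of x] 2(3)[of x] norm_triangle_ineq[of "\<phi> x" "\<psi> x"] by simp
    next
      case False
      then have "x \<notin> {-N..N}" "x \<notin> {-N'..N'}" by auto
      then show ?thesis using False 1(3)[of x] 2(3)[of x] by simp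
    qed
  qed (use 1 2 in measurable)
qed

lemma bbs_mult:
  assumes "bbs \<phi>" "k \<in> borel_measurable borel" "\<And>N. \<exists>C. \<forall>x\<in>{-N..N}. norm (k x) \<le> C"
  shows "bbs (\<lambda>x. \<phi> x * k x)"
proof -
  obtain C N where 1: "0 \<le> C" "\<phi> \<in> borel_measurable borel" "\<And>x. norm (\<phi> x) \<le> C * indicator {-N..N} x"
    using bbs_support[OF assms(1)] by metis
  obtain C' where C': "\<And>x. x \<in> {-N..N} \<Longrightarrow> norm (k x) \<le> C'" using assms(3) by blast
  show ?thesis
  proof (rule bbsI)
    show "norm (\<phi> x * k x) \<le> (C * C') * indicator {-N..N} x" for x
      using 1(3)[of x] C'[of x] 1(1) by (cases "x \<in> {-N..N}") (auto simp: norm_mult intro!: mult_mono)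
  qed (use 1 assms(2) in measurable)
qed

lemma bbs_cmult: "bbs \<phi> \<Longrightarrow> bbs (\<lambda>x. c * \<phi> x)"
  using bbs_mult[of \<phi> "\<lambda>x. c"] by (auto simp: mult.commute)

lemma bbs_indicator: "A \<in> sets borel \<Longrightarrow> bounded A \<Longrightarrow> bbs (\<lambda>x. complex_of_real (indicator A x))"
proof -
  assume "A \<in> sets borel" "bounded A"
  moreover from \<open>bounded A\<close> obtain N where "\<And>x. x \<in> A \<Longrightarrow> \<bar>x\<bar> \<le> N" by (auto simp: bounded_iff)
  ultimately show ?thesis by (intro bbsI[of _ 1 N]) (auto simp: abs_le_iff minus_le_iff split: split_indicator)
qed

lemma test_function_bbs: assumes "test_function \<phi>" shows "bbs (\<lambda>x. complex_of_real (\<phi> x))"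
proof -
  obtain N where N: "\<And>x. \<bar>x\<bar> > N \<Longrightarrow> \<phi> x = 0" using test_function_support[OF assms] by blast
  note c = test_function_D(2)[OF assms]
  have "compact (\<phi> ` {-N..N})" by (intro compact_continuous_image continuous_on_subset[OF c]) auto
  then obtain C where C: "\<And>x. x \<in> {-N..N} \<Longrightarrow> norm (\<phi> x) \<le> C"
    by (meson bounded_iff compact_imp_bounded imageI)
  show ?thesis
  proof (rule bbsI)
    show "(\<lambda>x. complex_of_real (\<phi> x)) \<in> borel_measurable borel"
      using borel_measurable_continuous_onI[OF c] by measurable
    show "norm (complex_of_real (\<phi> x)) \<le> C * indicator {-N..N} x" for x
    proof (cases "x \<in> {-N..N}")
      case False
      then have "\<bar>x\<bar> > N" by auto
      then show ?thesis using False N by simp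
    qed (use C[of x] in simp)
  qed
qed

lemma radonD:
  assumes "radon L"
  shows "bbs \<phi> \<Longrightarrow> bbs \<psi> \<Longrightarrow> L (\<lambda>x. \<phi> x + \<psi> x) = L \<phi> + L \<psi>"
    "bbs \<phi> \<Longrightarrow> L (\<lambda>x. c * \<phi> x) = c * L \<phi>"
    "(\<And>n. \<Phi> n \<in> borel_measurable borel) \<Longrightarrow> (\<And>n x. norm (\<Phi> n x) \<le> C * indicator {-N..N} x) \<Longrightarrow>
      (\<And>x. (\<lambda>n. \<Phi> n x) \<longlonglongrightarrow> \<phi> x) \<Longrightarrow> (\<lambda>n. L (\<Phi> n)) \<longlonglongrightarrow> L \<phi>"
  using assms unfolding radon_def by blast+

lemma radonI:
  assumes "\<And>\<phi> \<psi>. bbs \<phi> \<Longrightarrow> bbs \<psi> \<Longrightarrow> L (\<lambda>x. \<phi> x + \<psi> x) = L \<phi> + L \<psi>"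
    "\<And>c \<phi>. bbs \<phi> \<Longrightarrow> L (\<lambda>x. c * \<phi> x) = c * L \<phi>"
    "\<And>\<Phi> \<phi> C N. (\<And>n. \<Phi> n \<in> borel_measurable borel) \<Longrightarrow> (\<And>n x. norm (\<Phi> n x) \<le> C * indicator {-N..N} x) \<Longrightarrow>
      (\<And>x. (\<lambda>n. \<Phi> n x) \<longlonglongrightarrow> \<phi> x) \<Longrightarrow> (\<lambda>n. L (\<Phi> n)) \<longlonglongrightarrow> L \<phi>"
  shows "radon L"
  unfolding radon_def using assms by blast

lemma radon_add:
  assumes "radon L" "radon K" shows "radon (\<lambda>\<phi>. L \<phi> + K \<phi>)"
proof (rule radonI, goal_cases)
  case (3 \<Phi> \<phi> C N)
  show ?case by (intro tendsto_add radonD(3)[OF assms(1) 3] radonD(3)[OF assms(2) 3])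
qed (simp_all add: radonD(1,2)[OF assms(1)] radonD(1,2)[OF assms(2)] distrib_left)

lemma radon_cmult:
  assumes "radon L" shows "radon (\<lambda>\<phi>. c * L \<phi>)"
proof (rule radonI, goal_cases)
  case (3 \<Phi> \<phi> C N)
  show ?case by (intro tendsto_mult_left radonD(3)[OF assms(1) 3])
qed (simp_all add: radonD(1,2)[OF assms(1)] distrib_left)

lemma radon_diff: "radon L \<Longrightarrow> radon K \<Longrightarrow> radon (\<lambda>\<phi>. L \<phi> - K \<phi>)"
  using radon_add[OF _ radon_cmult[of K "-1"]] by simp

text \<open>Multiplication of a measure by a locally bounded Borel function, as for \<beta> times
  the derivative of the flux.\<close>

lemma radon_mult:
  fixes k :: "real \<Rightarrow> complex"
  assumes L: "radon L" and k: "k \<in> borel_measurable borel" "\<And>N. \<exists>C. \<forall>x\<in>{-N..N}. norm (k x) \<le> C"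
  shows "radon (\<lambda>\<phi>. L (\<lambda>x. \<phi> x * k x))"
  unfolding radon_def
proof (intro conjI allI impI)
  fix \<phi> \<psi> assume "bbs \<phi>" "bbs \<psi>"
  then show "L (\<lambda>x. (\<phi> x + \<psi> x) * k x) = L (\<lambda>x. \<phi> x * k x) + L (\<lambda>x. \<psi> x * k x)"
    using radonD(1)[OF L bbs_mult[OF _ k] bbs_mult[OF _ k]] by (simp add: algebra_simps)
next
  fix c \<phi> assume "bbs \<phi>"
  then show "L (\<lambda>x. c * \<phi> x * k x) = c * L (\<lambda>x. \<phi> x * k x)"
    using radonD(2)[OF L bbs_mult[OF _ k]] by (simp add: mult.assoc)
next
  fix \<Phi> :: "nat \<Rightarrow> real \<Rightarrow> complex" and \<phi> C and N :: real assume 1: "\<forall>n. \<Phi> n \<in> borel_measurable borel" "\<forall>n x. cmod (\<Phi> n x) \<le> C * indicat_real {- N..N} x"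
      "\<forall>x. (\<lambda>n. \<Phi> n x) \<longlonglongrightarrow> \<phi> x"
  obtain C' where C': "\<And>x::real. x \<in> {-N..N} \<Longrightarrow> norm (k x) \<le> C'" using k(2) by blast
  show "(\<lambda>n. L (\<lambda>x. \<Phi> n x * k x)) \<longlonglongrightarrow> L (\<lambda>x. \<phi> x * k x)"
  proof (rule radonD(3)[OF L])
    show "cmod (\<Phi> n x * k x) \<le> (C * C') * indicator {-N..N} x" for n x
    proof (cases "x \<in> {-N..N}")
      case True
      then have "norm (\<Phi> n x) \<le> C" using 1(2)[rule_format, of n x] by simp
      then show ?thesis using True C'[of x] order_trans[OF norm_ge_zero[of "\<Phi> n x"]] by (auto simp: norm_mult intro!: mult_mono)
    next
      case False then show ?thesis using 1(2)[rule_format, of n x] by simp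
    qed
    show "(\<lambda>x. \<Phi> n x * k x) \<in> borel_measurable borel" for n using 1(1) k(1) by (intro borel_measurable_times) simp_all
    show "(\<lambda>n. \<Phi> n x * k x) \<longlonglongrightarrow> \<phi> x * k x" for x using 1(3) by (intro tendsto_intros) auto
  qed
qed

lemma bbs_integrable:
  assumes M: "sets M = sets borel" "\<And>N::real. emeasure M {-N..N} < \<infinity>" and "bbs \<phi>"
  shows "integrable M \<phi>"
proof -
  obtain C N where 1: "0 \<le> C" "\<phi> \<in> borel_measurable borel" "\<And>x. norm (\<phi> x) \<le> C * indicator {-N..N} x"
    using bbs_support[OF assms(3)] by metis
  have [measurable]: "\<phi> \<in> borel_measurable M" using 1(2) M(1) by (simp cong: measurable_cong_sets)
  have "integrable M (\<lambda>x. C * indicator {-N..N} x)"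
    by (intro integrable_mult_right integrable_real_indicator) (use M in auto)
  then show ?thesis
  proof (rule Bochner_Integration.integrable_bound)
    show "AE x in M. norm (\<phi> x) \<le> norm (C * indicator {-N..N} x)"
      using 1(3) by (intro AE_I2) (metis abs_ge_self order_trans real_norm_def)
  qed measurable
qed

lemma radon_integral:
  assumes M: "sets M = sets borel" "\<And>N::real. emeasure M {-N..N} < \<infinity>"
  shows "radon (\<lambda>\<phi>. LINT x|M. \<phi> x)"
  unfolding radon_def
proof (intro conjI allI impI)
  fix \<phi> \<psi> assume "bbs \<phi>" "bbs \<psi>"
  then show "(LINT x|M. \<phi> x + \<psi> x) = (LINT x|M. \<phi> x) + (LINT x|M. \<psi> x)"
    using bbs_integrable[OF M] by simp
next
  fix \<Phi> :: "nat \<Rightarrow> real \<Rightarrow> complex" and \<phi> C and N :: real assume 1: "\<forall>n. \<Phi> n \<in> borel_measurable borel" "\<forall>n x. cmod (\<Phi> n x) \<le> C * indicat_real {- N..N} x"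
      "\<forall>x. (\<lambda>n. \<Phi> n x) \<longlonglongrightarrow> \<phi> x"
  have m: "h \<in> borel_measurable M \<longleftrightarrow> h \<in> borel_measurable borel" for h :: "real \<Rightarrow> complex"
    using M(1) by (simp cong: measurable_cong_sets)
  show "(\<lambda>n. LINT x|M. \<Phi> n x) \<longlonglongrightarrow> (LINT x|M. \<phi> x)"
  proof (rule integral_dominated_convergence)
    show "integrable M (\<lambda>x. C * indicator {-N..N} x)"
      by (intro integrable_mult_right integrable_real_indicator) (use M in auto)
    show "\<phi> \<in> borel_measurable M" unfolding m
      by (rule borel_measurable_LIMSEQ_metric[of \<Phi>]) (use 1 in auto)
  qed (use 1 m in auto)
qed simp

lemma radon_locint:
  assumes f: "locint f" "f \<in> borel_measurable borel"
  shows "radon (\<lambda>\<phi>. LBINT x. \<phi> x * f x)"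
    and "bbs \<phi> \<Longrightarrow> integrable lborel (\<lambda>x. \<phi> x * f x)"
proof -
  have I: "integrable lborel (\<lambda>x. (C * indicator {-N..N} x) * norm (f x))" for C N :: real
    using set_integrable_norm[OF locintD[OF f(1), of "-N" N]]
    unfolding set_integrable_def by (simp add: mult.assoc)
  show *: "integrable lborel (\<lambda>x. \<phi> x * f x)" if b: "bbs \<phi>" for \<phi>
  proof -
    obtain C N where 1: "0 \<le> C" "\<phi> \<in> borel_measurable borel" "\<And>x. norm (\<phi> x) \<le> C * indicator {-N..N} x"
      using bbs_support[OF b] by metis
    show ?thesis
    proof (rule Bochner_Integration.integrable_bound[OF I])
      show "AE x in lborel. norm (\<phi> x * f x) \<le> norm ((C * indicator {-N..N} x) * norm (f x))"
        using 1 by (intro AE_I2) (auto simp: norm_mult abs_mult intro!: mult_right_mono)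
    qed (use f 1 in measurable)
  qed
  show "radon (\<lambda>\<phi>. LBINT x. \<phi> x * f x)"
    unfolding radon_def
  proof (intro conjI allI impI)
    fix \<phi> \<psi> assume "bbs \<phi>" "bbs \<psi>"
    then show "(LBINT x. (\<phi> x + \<psi> x) * f x) = (LBINT x. \<phi> x * f x) + (LBINT x. \<psi> x * f x)"
      using * by (simp add: distrib_right)
  next
    fix \<Phi> :: "nat \<Rightarrow> real \<Rightarrow> complex" and \<phi> C and N :: real assume 1: "\<forall>n. \<Phi> n \<in> borel_measurable borel" "\<forall>n x. cmod (\<Phi> n x) \<le> C * indicat_real {- N..N} x"
        "\<forall>x. (\<lambda>n. \<Phi> n x) \<longlonglongrightarrow> \<phi> x"
    have m: "\<phi> \<in> borel_measurable borel"
      by (rule borel_measurable_LIMSEQ_metric[of \<Phi>]) (use 1 in auto)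
    show "(\<lambda>n. LBINT x. \<Phi> n x * f x) \<longlonglongrightarrow> (LBINT x. \<phi> x * f x)"
    proof (rule integral_dominated_convergence[OF _ _ I])
      show "AE x in lborel. norm (\<Phi> n x * f x) \<le> C * indicator {-N..N} x * norm (f x)" for n
        using 1 by (intro AE_I2) (auto simp: norm_mult intro!: mult_right_mono)
      show "AE x in lborel. (\<lambda>n. \<Phi> n x * f x) \<longlonglongrightarrow> \<phi> x * f x"
        using 1 by (intro AE_I2 tendsto_intros) auto
      show "(\<lambda>x. \<Phi> n x * f x) \<in> borel_measurable lborel" for n using 1(1) f(2) by (intro borel_measurable_times) simp_all
    qed (use m f in measurable)
  qed (simp add: mult.assoc)
qed

section \<open>Functionals determined by their values on indicators or on test functions\<close>

lemma radon_zero: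
  assumes "radon L" shows "L (\<lambda>x. 0) = 0"
  using radonD(2)[OF assms bbs_indicator[of "{}"], of 0] by simp

text \<open>Simple functions approximate \<phi> pointwise with norm at most twice that of \<phi>,
  hence with the same support and a common bound. The claim follows by linearity and bounded
  convergence of the difference functional.\<close>

lemma radon_eqI_indicator:
  assumes L: "radon L" and K: "radon K"
    and eq: "\<And>A. A \<in> sets borel \<Longrightarrow> bounded A \<Longrightarrow> L (\<lambda>x. complex_of_real (indicator A x)) = K (\<lambda>x. complex_of_real (indicator A x))"
    and \<phi>: "bbs \<phi>"
  shows "L \<phi> = K \<phi>"
proof -
  define D where "D \<phi> = L \<phi> - K \<phi>" for \<phi>
  have D: "radon D" unfolding D_def using radon_diff[OF L K] .
  obtain C N where 1: "0 \<le> C" "\<phi> \<in> borel_measurable borel" "\<And>x. norm (\<phi> x) \<le> C * indicator {-N..N} x"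
    using bbs_support[OF \<phi>] by metis
  obtain F where F: "\<And>i. simple_function borel (F i)" "\<And>x. (\<lambda>i. F i x) \<longlonglongrightarrow> \<phi> x" "\<And>i x. dist (F i x) 0 \<le> 2 * dist (\<phi> x) 0"
    using borel_measurable_implies_sequence_metric[OF 1(2), of 0] by auto
  have Fb: "norm (F i x) \<le> (2 * C) * indicator {-N..N} x" for i x
    using F(3)[of i x] 1(3)[of x] by (simp add: dist_norm)
  \<comment> \<open>The value 0 is left out of the level sets because its preimage is unbounded; all
    the other level sets lie in the support of \<phi>.\<close>
  have sum0: "D (\<lambda>x. \<Sum>y\<in>S. y * complex_of_real (indicator (F i -` {y}) x)) = 0 \<and>
      bbs (\<lambda>x. \<Sum>y\<in>S. y * complex_of_real (indicator (F i -` {y}) x))" if "finite S" "0 \<notin> S" for S i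
    using that
  proof (induction S rule: finite_induct)
    case empty
    show ?case using radon_zero[OF D] bbs_indicator[of "{}"] by simp
  next
    case (insert y S)
    have "F i -` {y} \<subseteq> {-N..N}"
    proof
      fix x assume "x \<in> F i -` {y}"
      then have "F i x \<noteq> 0" using insert.prems by auto
      then show "x \<in> {-N..N}" using Fb[of i x] by (cases "x \<in> {-N..N}") auto
    qed
    then have "bounded (F i -` {y})" by (rule bounded_subset[OF bounded_closed_interval])
    moreover have "F i -` {y} \<in> sets borel" using simple_functionD(2)[OF F(1)[of i], of "{y}"] by simp
    ultimately have b: "bbs (\<lambda>x. complex_of_real (indicator (F i -` {y}) x))" and e: "D (\<lambda>x. complex_of_real (indicator (F i -` {y}) x)) = 0"
      using bbs_indicator eq by (auto simp: D_def)
    show ?case using insert radonD(1)[OF D bbs_cmult[OF b, of y]] radonD(2)[OF D b, of y] e bbs_add[OF bbs_cmult[OF b, of y]] by simp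
  qed
  have DF: "D (F i) = 0" for i
  proof -
    have fin: "finite (range (F i))" using F(1)[of i] by (simp add: simple_function_def)
    have "F i x = (\<Sum>y\<in>range (F i) - {0}. y * complex_of_real (indicator (F i -` {y}) x))" for x
    proof -
      have "(\<Sum>y\<in>range (F i) - {0}. y * complex_of_real (indicator (F i -` {y}) x)) = (\<Sum>y\<in>range (F i) - {0}. if y = F i x then F i x else 0)"
        by (rule sum.cong) (auto simp: indicator_def)
      also have "\<dots> = F i x" using fin by (simp add: sum.delta')
      finally show ?thesis by simp
    qed
    then have "F i = (\<lambda>x. \<Sum>y\<in>range (F i) - {0}. y * complex_of_real (indicator (F i -` {y}) x))" by (rule ext)
    then show ?thesis using sum0[of "range (F i) - {0}" i] fin by simp
  qed
  have "(\<lambda>i. D (F i)) \<longlonglongrightarrow> D \<phi>"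
    by (rule radonD(3)[OF D _ Fb F(2)]) (rule borel_measurable_simple_function[OF F(1)])
  then have "D \<phi> = 0" unfolding DF LIMSEQ_const_iff by simp
  then show ?thesis by (simp add: D_def)
qed

lemma borel_real_eq_Ioo: "sets borel = sigma_sets UNIV (range (\<lambda>(a, b). {a<..<b::real}))"
proof -
  have "(borel :: real measure) = sigma UNIV (range (\<lambda>(a, b). {a<..<b}))"
    using borel_eq_box[where 'a=real] by (simp add: box_real)
  then show ?thesis by (metis Pow_UNIV sets_measure_of top_greatest)
qed

text \<open>The bumps carry the equality to indicators of open intervals by bounded convergence.
  These intervals are stable under intersection and generate the Borel sets, so a Dynkin induction
  applies. It runs on intersections with a fixed bounded interval, since indicators of unbounded
  sets are outside \<open>bbs\<close>.\<close>

lemma radon_eqI_test: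
  assumes L: "radon L" and K: "radon K"
    and eq: "\<And>\<phi>. test_function \<phi> \<Longrightarrow> L (\<lambda>x. complex_of_real (\<phi> x)) = K (\<lambda>x. complex_of_real (\<phi> x))"
    and \<phi>: "bbs \<phi>"
  shows "L \<phi> = K \<phi>"
proof (rule radon_eqI_indicator[OF L K _ \<phi>])
  fix A :: "real set" assume A: "A \<in> sets borel" "bounded A"
  define D where "D \<phi> = L \<phi> - K \<phi>" for \<phi>
  have D: "radon D" unfolding D_def using radon_diff[OF L K] .
  let ?i = "\<lambda>A x. complex_of_real (indicator A x)"
  have int: "D (?i {a<..<b}) = 0" for a b
  proof -
    define N where "N = max \<bar>a\<bar> \<bar>b\<bar>"
    have "(\<lambda>n. D (\<lambda>x. complex_of_real (bump a b n x))) \<longlonglongrightarrow> D (?i {a<..<b})"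
    proof (rule radonD(3)[OF D])
      show "(\<lambda>x. complex_of_real (bump a b n x)) \<in> borel_measurable borel" for n
        using borel_measurable_continuous_onI[OF test_function_D(2)[OF bump_test_function]] by measurable
      show "norm (complex_of_real (bump a b n x)) \<le> 1 * indicator {-N..N} x" for n x
      proof (cases "x \<in> {a<..<b}")
        case True
        then have "x \<in> {-N..N}" by (auto simp: N_def)
        then show ?thesis using bump_bounds(1,2)[of a b n x] by simp
      next
        case False then show ?thesis using bump_bounds(4)[of a b n x] by simp
      qed
      show "(\<lambda>n. complex_of_real (bump a b n x)) \<longlonglongrightarrow> ?i {a<..<b} x" for x
        by (intro tendsto_of_real bump_LIMSEQ)
    qed
    moreover have "D (\<lambda>x. complex_of_real (bump a b n x)) = 0" for n
      using eq[OF bump_test_function] by (simp add: D_def)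
    ultimately show ?thesis by (simp add: LIMSEQ_const_iff)
  qed
  obtain N where N: "\<And>x. x \<in> A \<Longrightarrow> \<bar>x\<bar> < N" using A(2) unfolding bounded_pos
    by (metis gt_ex le_less_trans real_norm_def)
  let ?I = "{-N<..<N}"
  have bb: "bbs (?i (B \<inter> ?I))" if "B \<in> sets borel" for B
    using that by (intro bbs_indicator) (auto intro: bounded_subset[OF bounded_closed_interval[of "-N" N]])
  have "A \<in> sigma_sets UNIV (range (\<lambda>(a, b). {a<..<b::real}))"
    using A(1) unfolding borel_real_eq_Ioo by simp
  then have "D (?i (A \<inter> ?I)) = 0"
  proof (induction rule: sigma_sets_induct_disjoint[rotated 2, consumes 1, case_names basic empty compl union])
    case (basic B)
    then obtain a b where "B = {a<..<b}" by auto
    then have "B \<inter> ?I = {max a (-N)<..<min b N}" by auto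
    then show ?case using int by simp
  next
    case empty show ?case using radon_zero[OF D] by simp
  next
    case (compl B)
    then have B: "B \<in> sets borel" unfolding borel_real_eq_Ioo by simp
    have "?i ((UNIV - B) \<inter> ?I) = (\<lambda>x. ?i ?I x + (-1) * ?i (B \<inter> ?I) x)"
      by (auto simp: indicator_def)
    then show ?case
      using radonD(1)[OF D, of "?i ?I" "\<lambda>x. (-1) * ?i (B \<inter> ?I) x"] bb[of UNIV] bbs_cmult[OF bb[OF B], of "-1"]
        radonD(2)[OF D bb[OF B], of "-1"] compl.IH int[of "-N" N] by simp
  next
    case (union B)
    then have B: "B n \<in> sets borel" for n unfolding borel_real_eq_Ioo by auto
    have fin: "D (?i ((\<Union>i<n. B i) \<inter> ?I)) = 0" for n
    proof (induction n)
      case 0 show ?case using radon_zero[OF D] by simp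
    next
      case (Suc n)
      have "B i \<inter> B n = {}" if "i < n" for i using union(1) that by (intro disjoint_family_onD[of B UNIV]) auto
      then have "(\<Union>i<n. B i) \<inter> B n = {}" by auto
      then have "?i ((\<Union>i<Suc n. B i) \<inter> ?I) = (\<lambda>x. ?i ((\<Union>i<n. B i) \<inter> ?I) x + ?i (B n \<inter> ?I) x)"
        by (intro ext) (auto simp: lessThan_Suc split: split_indicator)
      moreover have "(\<Union>i<n. B i) \<in> sets borel" using B by auto
      ultimately show ?case using radonD(1)[OF D bb bb[OF B]] Suc union(3)[of n] by simp
    qed
    have "(\<lambda>n. D (?i ((\<Union>i<n. B i) \<inter> ?I))) \<longlonglongrightarrow> D (?i ((\<Union>i. B i) \<inter> ?I))"
    proof (rule radonD(3)[OF D])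
      show "?i ((\<Union>i<n. B i) \<inter> ?I) \<in> borel_measurable borel" for n using B by measurable
      show "norm (?i ((\<Union>i<n. B i) \<inter> ?I) x) \<le> 1 * indicator {-N..N} x" for n x by (auto simp: indicator_def)
      show "(\<lambda>n. ?i ((\<Union>i<n. B i) \<inter> ?I) x) \<longlonglongrightarrow> ?i ((\<Union>i. B i) \<inter> ?I) x" for x
        using tendsto_mult[OF LIMSEQ_indicator_UN[of B x] tendsto_const[of "indicat_real ?I x"]]
        by (intro tendsto_of_real) (simp add: indicator_inter_arith)
    qed
    then show ?case unfolding fin LIMSEQ_const_iff by simp
  next
    show "Int_stable (range (\<lambda>(a, b). {a<..<b::real}))"
    proof (rule Int_stableI)
      fix X Y :: "real set"
      assume "X \<in> range (\<lambda>(a, b). {a<..<b})" "Y \<in> range (\<lambda>(a, b). {a<..<b})"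
      then obtain a b c d where "X = {a<..<b}" "Y = {c<..<d}" by auto
      then have "X \<inter> Y = (\<lambda>(a, b). {a<..<b}) (max a c, min b d)" by auto
      then show "X \<inter> Y \<in> range (\<lambda>(a, b). {a<..<b})" by (rule range_eqI)
    qed
  qed auto
  moreover have "A \<inter> ?I = A" using N by (force simp: abs_less_iff)
  ultimately show "L (?i A) = K (?i A)" by (simp add: D_def)
qed

text \<open>The fundamental lemma of the calculus of variations. Equality spreads from test
  functions to indicators of bounded Borel sets, and densities on each interval [-n, n] are
  unique.\<close>

lemma locint_AE_eqI:
  fixes f g :: "real \<Rightarrow> complex"
  assumes f: "locint f" "f \<in> borel_measurable borel" and g: "locint g" "g \<in> borel_measurable borel"
    and eq: "\<And>\<phi>. test_function \<phi> \<Longrightarrow> (LBINT x. complex_of_real (\<phi> x) * f x) = (LBINT x. complex_of_real (\<phi> x) * g x)"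
  shows "AE x in lborel. f x = g x"
proof -
  have E: "(LBINT x. \<phi> x * f x) = (LBINT x. \<phi> x * g x)" if "bbs \<phi>" for \<phi>
    by (rule radon_eqI_test[OF radon_locint(1)[OF f] radon_locint(1)[OF g] _ that]) (rule eq)
  have "AE x in lborel. \<forall>n::nat. indicat_real {- real n..real n} x *\<^sub>R f x = indicat_real {- real n..real n} x *\<^sub>R g x"
    unfolding AE_all_countable
  proof
    fix n
    let ?I = "{- real n..real n}"
    show "AE x in lborel. indicat_real ?I x *\<^sub>R f x = indicat_real ?I x *\<^sub>R g x"
    proof (rule sigma_finite_measure.density_unique_banach[OF sigma_finite_lborel])
      show "integrable lborel (\<lambda>x. indicat_real ?I x *\<^sub>R f x)" "integrable lborel (\<lambda>x. indicat_real ?I x *\<^sub>R g x)"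
        using f(1) g(1) unfolding locint_def set_integrable_def by blast+
      fix A :: "real set" assume A: "A \<in> sets lborel"
      then have "bbs (\<lambda>x. complex_of_real (indicator (A \<inter> ?I) x))"
        by (intro bbs_indicator) (auto intro: bounded_subset[OF bounded_closed_interval[of "-real n" "real n"]])
      from E[OF this]
      show "(LBINT x:A. indicat_real ?I x *\<^sub>R f x) = (LBINT x:A. indicat_real ?I x *\<^sub>R g x)"
        by (simp add: set_lebesgue_integral_def indicator_inter_arith scaleR_conv_of_real mult.assoc)
    qed
  qed
  then show ?thesis
  proof eventually_elim
    fix x assume *: "\<forall>n::nat. indicat_real {- real n..real n} x *\<^sub>R f x = indicat_real {- real n..real n} x *\<^sub>R g x"
    obtain n :: nat where "\<bar>x\<bar> \<le> n" using real_arch_simple by blast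
    then show "f x = g x" using *[rule_format, of n] by (simp add: abs_le_iff minus_le_iff)
  qed
qed

section \<open>Weak derivatives and primitives\<close>

lemma borel_prim:
  fixes f :: "real \<Rightarrow> 'a::euclidean_space"
  assumes "locint f" shows "prim f \<in> borel_measurable borel"
  using ac_on_UNIV_continuous[OF ac_on_prim[OF assms]] by (rule borel_measurable_continuous_onI)

lemma locint_continuous: 
  fixes f :: "real \<Rightarrow> 'a::euclidean_space"
  shows "continuous_on UNIV f \<Longrightarrow> locint f"
  unfolding locint_def set_integrable_def
  by (intro allI borel_integrable_compact) (auto intro: continuous_on_subset)

lemma ac_test_by_parts:
  fixes F :: "real \<Rightarrow> complex"
  assumes F: "ac_on UNIV F f" and \<phi>: "test_function \<phi>"
  shows "(LBINT x. complex_of_real (\<phi> x) * f x) = - (LBINT x. complex_of_real (deriv \<phi> x) * F x)"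
proof -
  obtain N where N: "0 < N" "\<And>x. \<bar>x\<bar> > N \<Longrightarrow> \<phi> x = 0" using test_function_support[OF \<phi>] by blast
  have N': "deriv \<phi> x = 0" if "\<bar>x\<bar> > N" for x using test_function_deriv_outside[of N \<phi>, OF N(2) that] .
  let ?\<phi> = "\<lambda>x. complex_of_real (\<phi> x)" and ?\<phi>' = "\<lambda>x. complex_of_real (deriv \<phi> x)"
  let ?I = "{-N-1..N+1}"
  note c = test_function_D(2,3)[OF \<phi>] 
  have Fc: "continuous_on A F" for A using ac_on_UNIV_continuous[OF F] continuous_on_subset by blast
  have i1: "set_integrable lborel ?I (\<lambda>x. ?\<phi> x * f x)"
    using c(1) continuous_on_subset
    by (intro set_integrable_continuous_mult(2) locintD[OF ac_on_imp_locint[OF F]] continuous_intros) blast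
  have i2: "set_integrable lborel ?I (\<lambda>x. ?\<phi>' x * F x)"
    unfolding set_integrable_def using c(2) continuous_on_subset Fc
    by (intro borel_integrable_compact continuous_intros) auto
  have "(LBINT x:?I. ?\<phi>' x * F x + ?\<phi> x * f x) = ?\<phi> (N+1) * F (N+1) - ?\<phi> (-N-1) * F (-N-1)"
    using ac_onD(2)[OF ac_on_mult[OF test_function_ac(2)[OF \<phi>] F], of "-N-1" "N+1"] N(1) by simp
  also have "\<dots> = 0" using N by simp
  finally have "(LBINT x:?I. ?\<phi>' x * F x) + (LBINT x:?I. ?\<phi> x * f x) = 0"
    using set_integral_add(2)[OF i2 i1] by simp
  moreover have "(LBINT x:?I. h x) = (LBINT x. h x)" if "\<And>x. \<bar>x\<bar> > N \<Longrightarrow> h x = 0" for h :: "real \<Rightarrow> complex"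
    unfolding set_lebesgue_integral_def
  proof (rule Bochner_Integration.integral_cong[OF refl])
    fix x show "indicat_real ?I x *\<^sub>R h x = h x" using that[of x] by (cases "\<bar>x\<bar> > N") (auto simp: indicator_def)
  qed
  ultimately show ?thesis using N(2) N' by (simp add: eq_neg_iff_add_eq_0 add.commute)
qed

text \<open>The difference \<open>k\<close> of \<open>g\<close> and \<open>prim f\<close> has weak
  derivative 0. Subtracting a multiple of a normalised bump \<eta> from a test function removes its
  mean and turns it into a derivative. So \<open>k\<close> pairs with every test function like the
  constant \<open>c\<close>.\<close>

lemma du_Bois_Reymond:
  fixes g f :: "real \<Rightarrow> complex"
  assumes g: "locint g" "g \<in> borel_measurable borel" and f: "locint f"
    and eq: "\<And>\<phi>. test_function \<phi> \<Longrightarrow> (LBINT x. complex_of_real (\<phi> x) * f x) = - (LBINT x. complex_of_real (deriv \<phi> x) * g x)"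
  shows "\<exists>c. AE x in lborel. g x = c + prim f x"
proof -
  define k where "k x = g x - prim f x" for x
  have pc: "locint (prim f)" using ac_on_UNIV_continuous[OF ac_on_prim[OF f]] by (rule locint_continuous)
  have k: "locint k" "k \<in> borel_measurable borel"
    using g pc borel_prim[OF f] unfolding k_def locint_def by (auto intro: set_integral_diff(1))
  have k0: "(LBINT x. complex_of_real (deriv \<phi> x) * k x) = 0" if "test_function \<phi>" for \<phi>
  proof -
    note b = test_function_bbs[OF test_function_deriv[OF that]]
    have "(LBINT x. complex_of_real (deriv \<phi> x) * k x) = (LBINT x. complex_of_real (deriv \<phi> x) * g x) - (LBINT x. complex_of_real (deriv \<phi> x) * prim f x)"
      unfolding k_def right_diff_distrib
      by (rule Bochner_Integration.integral_diff) (rule radon_locint(2)[OF g b] radon_locint(2)[OF pc borel_prim[OF f] b])+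
    then show ?thesis using eq[OF that] ac_test_by_parts[OF ac_on_prim[OF f] that] by simp
  qed
  \<comment> \<open>The mass of a bump; it must be nonzero for \<eta> to be normalised. If it were
    zero, the positive function on (0,1) would vanish almost everywhere.\<close>
  define S where "S = (LBINT x. bump 0 1 0 x)"
  have bi: "integrable lborel (bump 0 1 0)"
    using radon_locint(2)[OF locint_continuous[of "\<lambda>x. 1::complex"] _ test_function_bbs[OF bump_test_function]]
    by (simp add: complex_of_real_integrable_eq)
  have "S \<noteq> 0"
  proof
    assume "S = 0"
    then have "AE x in lborel. bump 0 1 0 x = 0"
      unfolding S_def using integral_nonneg_eq_0_iff_AE[OF bi] bump_bounds(1) by auto
    then have "AE x in lborel. x \<notin> {0<..<1::real}"
      by eventually_elim (auto simp: bump_def flat_def)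
    then have "{0<..<1::real} \<in> null_sets lborel" by (subst AE_iff_null_sets) auto
    then show False by (simp add: null_sets_def)
  qed
  define \<eta> where "\<eta> x = inverse S * bump 0 1 0 x" for x
  have \<eta>: "test_function \<eta>" "(LBINT x. \<eta> x) = 1"
    using test_function_mult_const[OF bump_test_function] \<open>S \<noteq> 0\<close> unfolding \<eta>_def by (auto simp: S_def)
  define c where "c = (LBINT x. complex_of_real (\<eta> x) * k x)"
  have "AE x in lborel. k x = c"
  proof (rule locint_AE_eqI[OF k locint_continuous])
    fix \<psi> assume \<psi>: "test_function \<psi>"
    define m where "m = (LBINT x. \<psi> x)"
    have ti: "integrable lborel \<phi>" if "test_function \<phi>" for \<phi>
      using radon_locint(2)[OF locint_continuous[of "\<lambda>x. 1::complex"] _ test_function_bbs[OF that]]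
      by (simp add: complex_of_real_integrable_eq)
    have "test_function (\<lambda>x. \<psi> x + (- m) * \<eta> x)"
      by (intro test_function_add test_function_mult_const \<psi> \<eta>)
    moreover have "(LBINT x. \<psi> x + (- m) * \<eta> x) = 0"
      using ti[OF \<psi>] ti[OF \<eta>(1)] \<eta>(2) by (simp add: m_def)
    ultimately obtain \<Psi> where \<Psi>: "test_function \<Psi>" "deriv \<Psi> = (\<lambda>x. \<psi> x + (- m) * \<eta> x)"
      using test_function_primitive by blast
    have i1: "integrable lborel (\<lambda>x. complex_of_real (\<psi> x) * k x)" and i2: "integrable lborel (\<lambda>x. complex_of_real (\<eta> x) * k x)"
      using radon_locint(2)[OF k] test_function_bbs \<psi> \<eta>(1) by blast+
    have "0 = (LBINT x. complex_of_real (\<psi> x) * k x + (- of_real m) * (complex_of_real (\<eta> x) * k x))"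
      using k0[OF \<Psi>(1)] unfolding \<Psi>(2) by (simp add: algebra_simps)
    also have "\<dots> = (LBINT x. complex_of_real (\<psi> x) * k x) - of_real m * c"
      using i1 i2 by (subst Bochner_Integration.integral_add) (auto simp: c_def)
    finally show "(LBINT x. complex_of_real (\<psi> x) * k x) = (LBINT x. complex_of_real (\<psi> x) * c)"
      by (simp add: m_def integral_complex_of_real)
  qed auto
  then have "AE x in lborel. g x = c + prim f x" by eventually_elim (auto simp: k_def algebra_simps)
  then show ?thesis by blast
qed

section \<open>Signed measures on bounded Borel sets\<close>

text \<open>A common frame for finite signed measures and for the real and imaginary parts of local
  complex measures, whose total mass may be infinite.\<close>

definition charge :: "(real set \<Rightarrow> real) \<Rightarrow> bool" where
  "charge \<mu> \<longleftrightarrow>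
     (\<forall>A::nat \<Rightarrow> real set. range A \<subseteq> sets borel \<and> disjoint_family A \<and> bounded (\<Union>n. A n) \<longrightarrow>
        (\<lambda>n. \<mu> (A n)) sums \<mu> (\<Union>n. A n))"

lemma chargeD:
  assumes "charge \<mu>" "\<And>n::nat. A n \<in> sets borel" "disjoint_family A" "bounded (\<Union>n. A n)"
  shows "(\<lambda>n. \<mu> (A n)) sums \<mu> (\<Union>n. A n)"
  using assms unfolding charge_def by auto

lemma finite_signed_measure_charge: "finite_signed_measure \<mu> \<Longrightarrow> charge \<mu>"
  unfolding finite_signed_measure_def charge_def by blast

lemma charge_minus: "charge \<mu> \<Longrightarrow> charge (\<lambda>A. - \<mu> A)"
  unfolding charge_def by (auto intro!: sums_minus)

lemma local_complex_measure_charge: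
  assumes "local_complex_measure \<mu>"
  shows "charge (\<lambda>A. Re (\<mu> A))" "charge (\<lambda>A. Im (\<mu> A))"
  using assms unfolding local_complex_measure_def charge_def by (auto intro!: sums_Re sums_Im)

lemma charge_empty: assumes "charge \<mu>" shows "\<mu> {} = 0"
proof -
  have "(\<lambda>n::nat. \<mu> {}) sums \<mu> {}" using chargeD[OF assms, of "\<lambda>n. {}"] by (simp add: disjoint_family_on_def)
  then have "(\<lambda>n::nat. \<mu> {}) \<longlonglongrightarrow> 0" by (intro summable_LIMSEQ_zero) (rule sums_summable)
  then show ?thesis by (simp add: LIMSEQ_const_iff)
qed

lemma charge_Un:
  assumes \<mu>: "charge \<mu>" and AB: "A \<in> sets borel" "B \<in> sets borel" "A \<inter> B = {}" "bounded (A \<union> B)"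
  shows "\<mu> (A \<union> B) = \<mu> A + \<mu> B"
proof -
  define F where "F n = (if n = 0 then A else if n = 1 then B else {})" for n :: nat
  have U: "(\<Union>n. F n) = A \<union> B" by (auto simp: F_def split: if_splits)
  have "disjoint_family F" using AB(3) by (auto simp: disjoint_family_on_def F_def)
  then have "(\<lambda>n. \<mu> (F n)) sums \<mu> (A \<union> B)"
    using chargeD[OF \<mu>, of F] AB unfolding U by (auto simp: F_def)
  moreover have "(\<lambda>n. \<mu> (F n)) sums (\<Sum>n\<in>{0,1}. \<mu> (F n))"
    by (rule sums_finite) (auto simp: F_def charge_empty[OF \<mu>])
  ultimately show ?thesis using sums_unique2 by (fastforce simp: F_def)
qed

lemma charge_Diff:
  assumes "charge \<mu>" "A \<in> sets borel" "B \<in> sets borel" "B \<subseteq> A" "bounded A"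
  shows "\<mu> (A - B) = \<mu> A - \<mu> B"
  using charge_Un[OF assms(1,3), of "A - B"] assms by (simp add: Un_absorb1)

text \<open>If \<open>\<mu>\<close> were unbounded on the subsets of a bounded set, one could split off infinitely many
  disjoint pieces of measure at least 1 in absolute value, always keeping a part on which
  \<open>\<mu>\<close> is unbounded.\<close>

lemma charge_bounded:
  assumes \<mu>: "charge \<mu>" and A: "A \<in> sets borel" "bounded A"
  shows "\<exists>K. \<forall>B\<in>sets borel. B \<subseteq> A \<longrightarrow> \<bar>\<mu> B\<bar> \<le> K"
proof (rule ccontr)
  assume neg: "\<not> ?thesis"
  define bdd where "bdd A \<longleftrightarrow> (\<exists>K. \<forall>B\<in>sets borel. B \<subseteq> A \<longrightarrow> \<bar>\<mu> B\<bar> \<le> K)" for A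
  define bad where "bad A \<longleftrightarrow> A \<in> sets borel \<and> bounded A \<and> \<not> bdd A" for A
  have big: "\<exists>B\<in>sets borel. B \<subseteq> A \<and> \<bar>\<mu> B\<bar> > K" if "\<not> bdd A" for A K
  proof (rule ccontr)
    assume "\<not> (\<exists>B\<in>sets borel. B \<subseteq> A \<and> \<bar>\<mu> B\<bar> > K)"
    then have "\<forall>B\<in>sets borel. B \<subseteq> A \<longrightarrow> \<bar>\<mu> B\<bar> \<le> K" by (simp add: not_less)
    then have "bdd A" unfolding bdd_def by (rule exI)
    with that show False by simp
  qed
  have "bad A" using A neg unfolding bad_def bdd_def by simp
  have step: "\<exists>A'. bad A' \<and> A' \<subseteq> A \<and> \<bar>\<mu> (A - A')\<bar> \<ge> 1" if "bad A" for A
  proof -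
    have A: "A \<in> sets borel" "bounded A" "\<not> bdd A" using that by (simp_all add: bad_def)
    \<comment> \<open>The margin |\<mu> A| + 1 makes both B and A - B of measure more than 1 in
      absolute value, so either of them may be the piece split off.\<close>
    obtain B where B: "B \<in> sets borel" "B \<subseteq> A" "\<bar>\<mu> B\<bar> > \<bar>\<mu> A\<bar> + 1" using big[OF A(3)] by metis
    have d: "\<mu> (A - B) = \<mu> A - \<mu> B" using charge_Diff[OF \<mu> A(1) B(1,2) A(2)] .
    show ?thesis
    proof (cases "bad B")
      case True then show ?thesis using B d by (intro exI[of _ B]) auto
    next
      case False
      then have "bdd B" using B(1) bounded_subset[OF A(2) B(2)] by (simp add: bad_def)
      then obtain K1 where K1: "\<And>C. C \<in> sets borel \<Longrightarrow> C \<subseteq> B \<Longrightarrow> \<bar>\<mu> C\<bar> \<le> K1"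
        unfolding bdd_def by metis
      have "bad (A - B)"
      proof (rule ccontr)
        assume "\<not> bad (A - B)"
        then have "bdd (A - B)" using A B(1) bounded_subset[OF A(2), of "A - B"] by (auto simp: bad_def)
        then obtain K2 where K2: "\<And>C. C \<in> sets borel \<Longrightarrow> C \<subseteq> A - B \<Longrightarrow> \<bar>\<mu> C\<bar> \<le> K2"
          unfolding bdd_def by metis
        have "\<bar>\<mu> C\<bar> \<le> K1 + K2" if C: "C \<in> sets borel" "C \<subseteq> A" for C
        proof -
          have "C \<inter> B \<union> (C - B) = C" by auto
          then have "\<mu> C = \<mu> (C \<inter> B) + \<mu> (C - B)"
            using charge_Un[OF \<mu>, of "C \<inter> B" "C - B"] C B(1) bounded_subset[OF A(2) C(2)] by auto
          moreover have "\<bar>\<mu> (C \<inter> B)\<bar> \<le> K1" "\<bar>\<mu> (C - B)\<bar> \<le> K2"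
            using C B(1) by (intro K1 K2; auto)+
          ultimately show ?thesis by linarith
        qed
        then have "bdd A" unfolding bdd_def by blast
        then show False using A(3) by simp
      qed
      moreover have "A - (A - B) = B" using B by auto
      ultimately show ?thesis using B(3) by (intro exI[of _ "A - B"]) auto
    qed
  qed
  obtain F where F: "\<And>n::nat. bad (F n)" "F 0 = A" "\<And>n. F (Suc n) \<subseteq> F n \<and> \<bar>\<mu> (F n - F (Suc n))\<bar> \<ge> 1"
  proof -
    have "\<exists>F. \<forall>n::nat. (bad (F n) \<and> (n = 0 \<longrightarrow> F n = A)) \<and> (F (Suc n) \<subseteq> F n \<and> \<bar>\<mu> (F n - F (Suc n))\<bar> \<ge> 1)"
      by (rule dependent_nat_choice) (use \<open>bad A\<close> step in auto)
    then show thesis using that by metis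
  qed
  define E where "E n = F n - F (Suc n)" for n
  have mono: "F n \<subseteq> F m" if "m \<le> n" for m n using that F(3) by (induction rule: dec_induct) auto
  have "disjoint_family E"
    unfolding disjoint_family_on_def
  proof safe
    fix m n x assume "m \<noteq> n" "x \<in> E m" "x \<in> E n"
    moreover have "E i \<inter> E j = {}" if "i < j" for i j
      using mono[of "Suc i" j] that by (auto simp: E_def)
    ultimately show "x \<in> {}" by (metis IntI linorder_neqE_nat)
  qed
  moreover have "E n \<in> sets borel" for n using F(1) by (auto simp: E_def bad_def)
  moreover have "(\<Union>n. E n) \<subseteq> A" using mono[of 0] F(2) by (auto simp: E_def)
  ultimately have "(\<lambda>n. \<mu> (E n)) sums \<mu> (\<Union>n. E n)" by (intro chargeD[OF \<mu>] bounded_subset[OF A(2)])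
  then have "(\<lambda>n. \<mu> (E n)) \<longlonglongrightarrow> 0" by (intro summable_LIMSEQ_zero) (rule sums_summable)
  then obtain n where "\<bar>\<mu> (E n)\<bar> < 1" using LIMSEQ_D[of _ 0 1] by (metis diff_0_right le_refl real_norm_def zero_less_one)
  then show False using F(3)[of n] by (auto simp: E_def)
qed

text \<open>The supremum is itself countably additive. Unions of competitors in disjoint sets give
  superadditivity, hence one inequality for series. Cutting a competitor B of the union into the
  pieces B \<inter> A i gives the other.\<close>

lemma emeasure_positive_part:
  assumes \<mu>: "charge \<mu>" and A: "A \<in> sets borel"
  shows "emeasure (positive_part \<mu>) A = (SUP B\<in>{B \<in> sets borel. bounded B \<and> B \<subseteq> A}. ennreal (\<mu> B))"
proof -
  define p where "p A = (SUP B\<in>{B \<in> sets borel. bounded B \<and> B \<subseteq> A}. ennreal (\<mu> B))" for A :: "real set"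
  have p_up: "ennreal (\<mu> B) \<le> p A" if "B \<in> sets borel" "bounded B" "B \<subseteq> A" for B A
    unfolding p_def using that by (intro SUP_upper) auto
  have p0: "p {} = 0" unfolding p_def using charge_empty[OF \<mu>] by (auto intro!: antisym SUP_least)
  have disjoint_mono: "C \<inter> D = {}" if "C \<subseteq> A" "D \<subseteq> B" "A \<inter> B = {}" for A B C D :: "real set"
    using that by auto
  have super: "p A + p B \<le> p (A \<union> B)" if AB: "A \<inter> B = {}" for A B
  proof -
    have "ennreal (\<mu> C) + ennreal (\<mu> D) \<le> p (A \<union> B)"
      if "C \<in> sets borel" "bounded C" "C \<subseteq> A" "D \<in> sets borel" "bounded D" "D \<subseteq> B" for C D
    \<comment> \<open>\<open>ennreal\<close> truncates negative values, so additivity of \<mu>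
      carries over only if both values are positive. Otherwise one summand is 0.\<close>
    proof (cases "\<mu> C \<le> 0 \<or> \<mu> D \<le> 0")
      case True
      then have "ennreal (\<mu> C) + ennreal (\<mu> D) \<le> ennreal (\<mu> C) \<or> ennreal (\<mu> C) + ennreal (\<mu> D) \<le> ennreal (\<mu> D)"
        by (auto simp: ennreal_neg)
      then show ?thesis using p_up[of C "A \<union> B"] p_up[of D "A \<union> B"] that by (meson le_supI1 le_supI2 order_trans)
    next
      case False
      then have "ennreal (\<mu> C) + ennreal (\<mu> D) = ennreal (\<mu> (C \<union> D))"
        using charge_Un[OF \<mu>, of C D] that disjoint_mono[of C A D B] AB by (subst ennreal_plus[symmetric]) auto
      then show ?thesis using p_up[of "C \<union> D" "A \<union> B"] that by auto
    qed
    then have "ennreal (\<mu> C) + p B \<le> p (A \<union> B)" if "C \<in> sets borel" "bounded C" "C \<subseteq> A" for C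
      unfolding p_def[of B] using that
      by (subst ennreal_SUP_add_right) (auto intro!: SUP_least exI[of _ "{}"])
    then show ?thesis unfolding p_def[of A]
      by (subst ennreal_SUP_add_left[symmetric]) (auto intro!: SUP_least exI[of _ "{}"])
  qed
  have mono: "p A \<le> p B" if "A \<subseteq> B" for A B
    unfolding p_def using that by (intro SUP_subset_mono) auto
  have "countably_additive (sets borel) p"
    unfolding countably_additive_def
  proof (intro allI impI)
    fix A :: "nat \<Rightarrow> real set" assume A: "range A \<subseteq> sets borel" "disjoint_family A"
    show "(\<Sum>i. p (A i)) = p (\<Union>i. A i)"
    proof (rule antisym)
      have fin: "(\<Sum>i<n. p (A i)) \<le> p (\<Union>i<n. A i)" for n
      proof (induction n)
        case (Suc n)
        have "A i \<inter> A n = {}" if "i < n" for i using A(2) that by (intro disjoint_family_onD[of A UNIV]) auto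
        then have "(\<Union>i<n. A i) \<inter> A n = {}" by auto
        have "(\<Sum>i<Suc n. p (A i)) \<le> p (\<Union>i<n. A i) + p (A n)" using Suc by (simp add: add_right_mono)
        also have "\<dots> \<le> p ((\<Union>i<n. A i) \<union> A n)" by (rule super) fact
        finally show ?case by (simp add: lessThan_Suc Un_commute)
      qed (simp add: p0)
      show "(\<Sum>i. p (A i)) \<le> p (\<Union>i. A i)"
        by (rule suminf_le_const) (auto intro!: order_trans[OF fin mono])
      show "p (\<Union>i. A i) \<le> (\<Sum>i. p (A i))"
        unfolding p_def[of "\<Union>i. A i"]
      proof (rule SUP_least, clarify)
        fix B :: "real set" assume B: "B \<in> sets borel" "bounded B" "B \<subseteq> (\<Union>i. A i)"
        have U: "(\<Union>i. B \<inter> A i) = B" using B by auto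
        have s: "(\<lambda>i. \<mu> (B \<inter> A i)) sums \<mu> B"
          using chargeD[OF \<mu>, of "\<lambda>i. B \<inter> A i"] A B unfolding U by (auto simp: disjoint_family_on_def)
        then have "(\<lambda>n. ennreal (\<Sum>i<n. \<mu> (B \<inter> A i))) \<longlonglongrightarrow> ennreal (\<mu> B)"
          unfolding sums_def by (intro tendsto_ennrealI)
        moreover have "ennreal (\<Sum>i<n. \<mu> (B \<inter> A i)) \<le> (\<Sum>i. p (A i))" for n
        proof -
          have "ennreal (\<Sum>i<n. \<mu> (B \<inter> A i)) \<le> ennreal (\<Sum>i<n. max 0 (\<mu> (B \<inter> A i)))"
            by (intro ennreal_leI sum_mono) auto
          also have "\<dots> = (\<Sum>i<n. ennreal (max 0 (\<mu> (B \<inter> A i))))" by (rule sum_ennreal[symmetric]) auto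
          also have "\<dots> = (\<Sum>i<n. ennreal (\<mu> (B \<inter> A i)))" by (simp add: ennreal_max_0)
          also have "\<dots> \<le> (\<Sum>i<n. p (A i))" using A B by (intro sum_mono p_up) (auto intro: bounded_subset)
          also have "\<dots> \<le> (\<Sum>i. p (A i))" by (rule sum_le_suminf) auto
          finally show ?thesis .
        qed
        ultimately show "ennreal (\<mu> B) \<le> (\<Sum>i. p (A i))" by (intro LIMSEQ_le_const2) auto
      qed
    qed
  qed
  moreover have "positive (sets borel) p" by (simp add: positive_def p0)
  ultimately have "emeasure (positive_part \<mu>) A = p A"
    unfolding positive_part_def p_def[symmetric]
    using A sets.sigma_sets_eq[of borel]
    by (subst emeasure_measure_of_sigma) (auto simp: sets.sigma_algebra_axioms[of borel, simplified])
  then show ?thesis unfolding p_def .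
qed

lemma sets_positive_part: "sets (positive_part \<mu>) = sets borel"
  unfolding positive_part_def using sets.sigma_sets_eq[of "borel :: real measure"] by simp

lemma positive_part_finite:
  assumes \<mu>: "charge \<mu>" and A: "A \<in> sets borel" "bounded A"
  shows "emeasure (positive_part \<mu>) A < \<infinity>"
proof -
  obtain K where K: "\<And>B. B \<in> sets borel \<Longrightarrow> B \<subseteq> A \<Longrightarrow> \<bar>\<mu> B\<bar> \<le> K" using charge_bounded[OF \<mu> A] by blast
  have "emeasure (positive_part \<mu>) A \<le> ennreal K"
    unfolding emeasure_positive_part[OF \<mu> A(1)]
    by (rule SUP_least) (use K in \<open>fastforce intro!: ennreal_leI\<close>)
  then show ?thesis by (metis ennreal_less_top infinity_ennreal_def le_less_trans)
qed

lemma positive_part_upper: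
  assumes \<mu>: "charge \<mu>" and B: "B \<in> sets borel" "B \<subseteq> A" and A: "A \<in> sets borel" "bounded A"
  shows "\<mu> B \<le> measure (positive_part \<mu>) A"
proof (cases "\<mu> B \<le> 0")
  case False
  have "ennreal (\<mu> B) \<le> emeasure (positive_part \<mu>) A"
    unfolding emeasure_positive_part[OF \<mu> A(1)] using B A(2) by (intro SUP_upper) (auto intro: bounded_subset)
  also have "\<dots> = ennreal (measure (positive_part \<mu>) A)"
    using positive_part_finite[OF \<mu> A] by (intro emeasure_eq_ennreal_measure) auto
  finally show ?thesis using False by (simp add: ennreal_le_iff)
qed (use measure_nonneg order_trans in blast)

text \<open>For B within A, \<mu> B = \<mu> A - \<mu> (A - B) is at most \<mu> A plus the negative
  part of A. The supremum over B gives one inequality, and the same argument for -\<mu> gives the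
  other.\<close>

lemma Jordan_decomposition:
  assumes \<mu>: "charge \<mu>" and A: "A \<in> sets borel" "bounded A"
  shows "\<mu> A = measure (positive_part \<mu>) A - measure (positive_part (\<lambda>A. - \<mu> A)) A"
proof -
  have le: "measure (positive_part \<nu>) A \<le> \<nu> A + measure (positive_part (\<lambda>A. - \<nu> A)) A" if \<nu>: "charge \<nu>" for \<nu>
  proof -
    let ?n = "measure (positive_part (\<lambda>A. - \<nu> A)) A"
    have B: "\<nu> B \<le> \<nu> A + ?n" if "B \<in> sets borel" "B \<subseteq> A" for B
      using charge_Diff[OF \<nu> A(1) that A(2)] positive_part_upper[OF charge_minus[OF \<nu>] _ _ A, of "A - B"] that A(1) by auto
    have "emeasure (positive_part \<nu>) A \<le> ennreal (\<nu> A + ?n)"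
      unfolding emeasure_positive_part[OF \<nu> A(1)] using B by (intro SUP_least ennreal_leI) auto
    moreover have "0 \<le> \<nu> A + ?n" using B[of "{}"] charge_empty[OF \<nu>] by simp
    ultimately show ?thesis
      by (simp add: measure_def enn2real_leI)
  qed
  from le[OF \<mu>] le[OF charge_minus[OF \<mu>]] show ?thesis by simp
qed

lemma radon_signed_integral:
  assumes "charge \<mu>" shows "radon (signed_integral \<mu>)"
proof -
  have "radon (\<lambda>\<phi>. (LINT x|positive_part \<mu>. \<phi> x) - (LINT x|positive_part (\<lambda>A. - \<mu> A). \<phi> x))"
    by (intro radon_diff radon_integral sets_positive_part positive_part_finite assms charge_minus) auto
  then show ?thesis unfolding signed_integral_def[abs_def] .
qed

lemma radon_complex_integral:
  assumes "local_complex_measure \<mu>" shows "radon (complex_integral \<mu>)"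
  unfolding complex_integral_def[abs_def]
  by (intro radon_add radon_cmult radon_signed_integral local_complex_measure_charge assms)

text \<open>Frees the integral from the Jordan parts in its definition: any two locally finite
  measures whose difference is \<mu> may be used, for instance Stieltjes measures of monotone
  functions.\<close>

lemma signed_integral_eq:
  assumes \<mu>: "charge \<mu>"
    and G: "sets G = sets borel" "\<And>N::real. emeasure G {-N..N} < \<infinity>"
    and K: "sets K = sets borel" "\<And>N::real. emeasure K {-N..N} < \<infinity>"
    and eq: "\<And>A. A \<in> sets borel \<Longrightarrow> bounded A \<Longrightarrow> \<mu> A = measure G A - measure K A"
    and \<phi>: "bbs \<phi>"
  shows "signed_integral \<mu> \<phi> = (LINT x|G. \<phi> x) - (LINT x|K. \<phi> x)"
proof (rule radon_eqI_indicator[OF radon_signed_integral[OF \<mu>] _ _ \<phi>])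
  show "radon (\<lambda>\<phi>. (LINT x|G. \<phi> x) - (LINT x|K. \<phi> x))"
    by (intro radon_diff radon_integral G K)
  fix A :: "real set" assume A: "A \<in> sets borel" "bounded A"
  have *: "(LINT x|M. complex_of_real (indicator A x)) = complex_of_real (measure M A)" if "sets M = sets borel" for M
  proof -
    have "space M = UNIV" using sets_eq_imp_space_eq[OF that] by simp
    then show ?thesis using that A by (simp add: integral_complex_of_real)
  qed
  show "signed_integral \<mu> (\<lambda>x. complex_of_real (indicator A x)) = (LINT x|G. complex_of_real (indicator A x)) - (LINT x|K. complex_of_real (indicator A x))"
    unfolding signed_integral_def *[OF sets_positive_part] *[OF G(1)] *[OF K(1)]
    using eq[OF A] Jordan_decomposition[OF \<mu> A] by (simp flip: of_real_diff)
qed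

lemma positive_part_le_measure_norm:
  assumes \<mu>: "finite_signed_measure \<mu>"
  shows "emeasure (positive_part \<mu>) UNIV \<le> measure_norm \<mu>"
    "emeasure (positive_part (\<lambda>A. - \<mu> A)) UNIV \<le> measure_norm \<mu>"
proof -
  have le: "ennreal \<bar>\<mu> B\<bar> \<le> measure_norm \<mu>" if B: "B \<in> sets borel" for B
  proof -
    \<comment> \<open>The partition of the line into B and its complement already detects |\<mu>
      B|.\<close>
    have "ennreal \<bar>\<mu> B\<bar> \<le> (\<Sum>B\<in>{B, - B}. ennreal \<bar>\<mu> B\<bar>)"
      by (rule member_le_sum) auto
    also have "\<dots> \<le> measure_norm \<mu>"
      unfolding measure_norm_def total_variation_def using B
      by (intro SUP_upper) (auto simp: disjoint_def)
    finally show ?thesis .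
  qed
  have U: "(UNIV :: real set) \<in> sets borel" by simp
  have ch: "charge \<mu>" using finite_signed_measure_charge[OF \<mu>] .
  have le': "ennreal (\<mu> B) \<le> measure_norm \<mu>" "ennreal (- \<mu> B) \<le> measure_norm \<mu>" if "B \<in> sets borel" for B
    by (rule order_trans[OF ennreal_leI le[OF that]], simp)+
  show "emeasure (positive_part \<mu>) UNIV \<le> measure_norm \<mu>"
    unfolding emeasure_positive_part[OF ch U] by (rule SUP_least) (simp add: le')
  show "emeasure (positive_part (\<lambda>A. - \<mu> A)) UNIV \<le> measure_norm \<mu>"
    unfolding emeasure_positive_part[OF charge_minus[OF ch] U] by (rule SUP_least) (simp add: le')
qed

lemma sigma_finite_locally_finite:
  assumes M: "sets M = sets borel" "\<And>N::real. emeasure M {-N..N} < \<infinity>"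
  shows "sigma_finite_measure M"
proof
  have sp: "space M = UNIV" using sets_eq_imp_space_eq[OF M(1)] by simp
  show "\<exists>A. countable A \<and> A \<subseteq> sets M \<and> \<Union>A = space M \<and> (\<forall>a\<in>A. emeasure M a \<noteq> \<infinity>)"
  proof (intro exI[of _ "range (\<lambda>n::nat. {- real n..real n})"] conjI)
    have "x \<in> (\<Union>n::nat. {- real n..real n})" for x
    proof -
      obtain n :: nat where "\<bar>x\<bar> \<le> n" using real_arch_simple by blast
      then have "x \<in> {- real n..real n}" by (auto simp: abs_le_iff)
      then show ?thesis by blast
    qed
    then show "\<Union>(range (\<lambda>n::nat. {- real n..real n})) = space M" using sp by auto
    show "\<forall>a\<in>range (\<lambda>n::nat. {- real n..real n}). emeasure M a \<noteq> \<infinity>" using M(2) by (auto simp: less_top)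
  qed (auto simp: M)
qed

text \<open>\<Psi> y is minus the integral of \<psi> from y to L. Fubini on the triangle -L < y
  \<le> x \<le> L therefore moves the measure onto the intervals from -L to x, whose mass is G x - G
  (-L).\<close>

lemma measure_by_parts:
  fixes G :: "real \<Rightarrow> real" and \<Psi> :: "real \<Rightarrow> complex"
  assumes M: "sets M = sets borel" "\<And>N::real. emeasure M {-N..N} < \<infinity>"
    and G: "\<And>a b. a \<le> b \<Longrightarrow> measure M {a<..b} = G b - G a"
    and ac: "ac_on UNIV \<Psi> \<psi>" and \<psi>: "\<psi> \<in> borel_measurable borel"
    and supp: "\<And>x. \<bar>x\<bar> > N \<Longrightarrow> \<Psi> x = 0" "\<And>x. \<bar>x\<bar> > N \<Longrightarrow> \<psi> x = 0"
  shows "(LINT x|M. \<Psi> x) = - (LBINT x. \<psi> x * of_real (G x))"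
    "integrable lborel (\<lambda>x. \<psi> x * of_real (G x))"
proof -
  interpret M: sigma_finite_measure M by (rule sigma_finite_locally_finite[OF M])
  interpret P: pair_sigma_finite lborel M ..
  have mono: "mono G" by (rule monoI) (use G measure_nonneg[of M] in \<open>metis diff_ge_0_iff_ge\<close>)
  have [measurable]: "G \<in> borel_measurable borel" by (rule borel_measurable_mono[OF mono])
  note [measurable] = \<psi>
  have [measurable_cong]: "sets M = sets borel" by (rule M)
  \<comment> \<open>The extra 1 puts both endpoints strictly outside the support, so \<Psi> vanishes
    there.\<close>
  define L where "L = max N 0 + 1"
  have L: "L > 0" "L > N" by (auto simp: L_def)
  have fin: "emeasure M {-L<..x} < \<infinity>" if "x \<le> L" for x
  proof -
    have "emeasure M {-L<..x} \<le> emeasure M {-L..L}"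
      using that by (intro emeasure_mono) (auto simp: M(1))
    then show ?thesis using M(2)[of L] by (rule le_less_trans)
  qed
  have \<psi>i: "integrable lborel \<psi>"
  proof -
    have "integrable lborel (\<lambda>x. indicator {-L..L} x *\<^sub>R \<psi> x)"
      using locintD[OF ac_on_imp_locint[OF ac], of "-L" L] unfolding set_integrable_def .
    moreover have "indicator {-L..L} x *\<^sub>R \<psi> x = \<psi> x" for x
      using supp(2)[of x] L by (cases "\<bar>x\<bar> > N") (auto simp: indicator_def)
    ultimately show ?thesis by simp
  qed
  define H where "H x y = (if -L < y \<and> y \<le> x \<and> x \<le> L then \<psi> x else 0)" for x y
  have Hi: "integrable (lborel \<Otimes>\<^sub>M M) (case_prod H)"
  proof (rule P.Fubini_integrable)
    show "case_prod H \<in> borel_measurable (lborel \<Otimes>\<^sub>M M)" unfolding H_def by measurable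
    have Hn: "(\<lambda>y. norm (H x y)) = (\<lambda>y. norm (\<psi> x) * (if x \<le> L then indicator {-L<..x} y else 0))" for x
      by (auto simp: H_def indicator_def)
    have i: "integrable M (\<lambda>y. indicat_real {-L<..x} y)" if "x \<le> L" for x
      by (intro integrable_real_indicator) (use M(1) fin[OF that] in auto)
    have "AE x in lborel. integrable M (\<lambda>y. H x y)"
    proof (rule AE_I2)
      fix x
      have "H x = (\<lambda>y. (if x \<le> L then indicat_real {-L<..x} y else 0) *\<^sub>R \<psi> x)"
        by (auto simp: H_def indicator_def)
      then show "integrable M (\<lambda>y. H x y)" using i[of x] by (cases "x \<le> L") auto
    qed
    then show "AE x in lborel. integrable M (\<lambda>y. case (x, y) of (x, y) \<Rightarrow> H x y)" by simp
    have bd: "norm (LINT y|M. norm (H x y)) \<le> norm (norm (\<psi> x) * (G L - G (-L)))" for x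
    proof (cases "-L \<le> x \<and> x \<le> L")
      case True
      have "(LINT y|M. norm (H x y)) = norm (\<psi> x) * (G x - G (-L))"
        unfolding Hn using True G[of "-L" x] M(1) by (simp add: sets_eq_imp_space_eq[OF M(1)])
      moreover have "0 \<le> G x - G (-L)" "G x - G (-L) \<le> G L - G (-L)" using True mono by (auto simp: mono_def)
      ultimately show ?thesis by (auto simp: abs_mult intro!: mult_left_mono)
    next
      case False
      then have "H x y = 0" for y by (auto simp: H_def)
      then show ?thesis by simp
    qed
    have "integrable lborel (\<lambda>x. norm (\<psi> x) * (G L - G (-L)))" using \<psi>i by auto
    then show "integrable lborel (\<lambda>x. LINT y|M. norm (case (x, y) of (x, y) \<Rightarrow> H x y))"
      unfolding prod.case
    proof (rule Bochner_Integration.integrable_bound)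
      show "(\<lambda>x. LINT y|M. norm (H x y)) \<in> borel_measurable lborel"
        unfolding H_def by measurable
    qed (use bd in auto)
  qed
  have inner1: "(LBINT x. H x y) = - \<Psi> y" if y: "-L < y" "y \<le> L" for y
  proof -
    have "(LBINT x. H x y) = (LBINT x:{y..L}. \<psi> x)"
      unfolding set_lebesgue_integral_def by (rule Bochner_Integration.integral_cong) (use y in \<open>auto simp: H_def indicator_def\<close>)
    then show ?thesis using ac_onD(2)[OF ac, of y L] y supp(1)[of L] L by simp
  qed
  have inner1': "(LBINT x. H x y) = - \<Psi> y" for y
  proof (cases "-L < y \<and> y \<le> L")
    case False
    then have "\<bar>y\<bar> > N" using L by (auto simp: abs_if L_def split: if_splits)
    moreover have "H x y = 0" for x using False by (auto simp: H_def)
    ultimately show ?thesis using supp(1)[of y] by simp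
  qed (use inner1 in blast)
  have inner2: "(LINT y|M. H x y) = indicator {-L..L} x *\<^sub>R (\<psi> x * of_real (G x - G (-L)))" for x
  proof (cases "-L \<le> x \<and> x \<le> L")
    case True
    then have "H x = (\<lambda>y. indicat_real {-L<..x} y *\<^sub>R \<psi> x)"
      by (auto simp: H_def indicator_def)
    then show ?thesis using True G[of "-L" x] fin[of x] M(1) sets_eq_imp_space_eq[OF M(1)]
      by (simp add: scaleR_conv_of_real mult.commute)
  next
    case False
    then have "H x y = 0" for y by (auto simp: H_def)
    then show ?thesis using False by auto
  qed
  have z: "indicator {-L..L} x *\<^sub>R (\<psi> x * of_real (G x - G (-L))) = \<psi> x * of_real (G x) - of_real (G (-L)) * \<psi> x" for x
    using supp(2)[of x] L by (cases "\<bar>x\<bar> > N") (auto simp: indicator_def algebra_simps)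
  have i1: "integrable lborel (\<lambda>x. \<psi> x * of_real (G x) - of_real (G (-L)) * \<psi> x)"
    using P.integrable_fst[OF Hi] unfolding inner2 z .
  then have "integrable lborel (\<lambda>x. (\<psi> x * of_real (G x) - of_real (G (-L)) * \<psi> x) + of_real (G (-L)) * \<psi> x)"
    using \<psi>i by (intro Bochner_Integration.integrable_add) auto
  then show i2: "integrable lborel (\<lambda>x. \<psi> x * of_real (G x))" by simp
  \<comment> \<open>The constant G (-L) drops out because \<psi> has integral 0.\<close>
  have tot: "(LBINT x. \<psi> x) = 0"
  proof -
    have "(LBINT x. \<psi> x) = (LBINT x:{-L..L}. \<psi> x)"
      unfolding set_lebesgue_integral_def
    proof (rule Bochner_Integration.integral_cong[OF refl])
      fix x show "\<psi> x = indicator {-L..L} x *\<^sub>R \<psi> x"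
        using supp(2)[of x] L by (cases "\<bar>x\<bar> > N") (auto simp: indicator_def)
    qed
    also have "\<dots> = 0" using ac_onD(2)[OF ac, of "-L" L] L supp(1)[of L] supp(1)[of "-L"] by simp
    finally show ?thesis .
  qed
  have "- (LINT y|M. \<Psi> y) = (LBINT x. \<psi> x * of_real (G x) - of_real (G (-L)) * \<psi> x)"
    using P.Fubini_integral[OF Hi] unfolding inner1' inner2 z by simp
  also have "\<dots> = (LBINT x. \<psi> x * of_real (G x))"
    using i2 \<psi>i tot by simp
  finally show "(LINT x|M. \<Psi> x) = - (LBINT x. \<psi> x * of_real (G x))" by (metis minus_minus)
qed

section \<open>Derivatives of functions of bounded variation\<close>

text \<open>The right limit of a monotone function. \<open>interval_measure\<close> asks for right
  continuity; the function changes only at its countably many jumps, so its distributional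
  derivative stays the same.\<close>

definition right_version :: "(real \<Rightarrow> real) \<Rightarrow> real \<Rightarrow> real" where
  "right_version g x = (INF y\<in>{x<..}. g y)"

context
  fixes g :: "real \<Rightarrow> real"
  assumes g: "mono g"
begin

lemma right_version_le: "x < y \<Longrightarrow> right_version g x \<le> g y"
  unfolding right_version_def
  by (rule cINF_lower) (use g in \<open>auto intro!: bdd_belowI[of _ "g x"] simp: mono_def\<close>)

lemma right_version_ge: "(\<And>y. x < y \<Longrightarrow> c \<le> g y) \<Longrightarrow> c \<le> right_version g x"
  unfolding right_version_def by (rule cINF_greatest) auto

lemma right_version_mono: "x \<le> y \<Longrightarrow> right_version g x \<le> right_version g y"
  by (rule right_version_ge) (rule right_version_le, simp)

lemma right_version_continuous: "continuous (at_right a) (right_version g)"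
  unfolding continuous_within
proof (rule order_tendstoI)
  fix c assume "c < right_version g a"
  then have "c < right_version g x" if "a < x" for x
    using right_version_mono[of a x] that by simp
  then show "eventually (\<lambda>x. c < right_version g x) (at_right a)"
    unfolding eventually_at_right_field by (intro exI[of _ "a+1"]) auto
next
  fix c assume c: "right_version g a < c"
  have "\<exists>y>a. g y < c"
  proof (rule ccontr)
    assume "\<not> ?thesis"
    then have "c \<le> g y" if "a < y" for y using that by (meson not_less)
    then have "c \<le> right_version g a" by (rule right_version_ge)
    with c show False by simp
  qed
  then obtain y where y: "a < y" "g y < c" by blast
  have "right_version g x < c" if "x < y" for x
    using right_version_le[OF that] y by simp
  then show "eventually (\<lambda>x. right_version g x < c) (at_right a)"
    unfolding eventually_at_right_field using y by (intro exI[of _ y]) auto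
qed

lemma right_version_isCont:
  assumes "isCont g x" shows "right_version g x = g x"
proof (rule antisym)
  show "g x \<le> right_version g x" by (rule right_version_ge) (use g in \<open>auto simp: mono_def\<close>)
  have "(g \<longlongrightarrow> g x) (at_right x)" using assms by (simp add: isCont_def filterlim_at_split)
  moreover have "eventually (\<lambda>y. right_version g x \<le> g y) (at_right x)"
    unfolding eventually_at_right_field by (intro exI[of _ "x+1"]) (auto intro: right_version_le)
  ultimately show "right_version g x \<le> g x" by (rule tendsto_lowerbound) simp
qed

lemma right_version_AE: "AE x in lborel. right_version g x = g x"
proof -
  have "countable {x. \<not> isCont g x}" using mono_ctble_discont[OF g] .
  then have "{x. \<not> isCont g x} \<in> null_sets lborel" by (rule countable_imp_null_set_lborel)
  from AE_not_in[OF this] show ?thesis by eventually_elim (auto intro: right_version_isCont)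
qed

definition mono_measure :: "real measure" where
  "mono_measure = interval_measure (right_version g)"

lemma sets_mono_measure: "sets mono_measure = sets borel" by (simp add: mono_measure_def)

lemma emeasure_mono_measure: "a \<le> b \<Longrightarrow> emeasure mono_measure {a<..b} = right_version g b - right_version g a"
  unfolding mono_measure_def
  by (rule emeasure_interval_measure_Ioc) (auto intro: right_version_mono right_version_continuous)

lemma mono_measure_finite: "emeasure mono_measure {-N..N::real} < \<infinity>"
proof (cases "0 \<le> N")
  case True
  have "emeasure mono_measure {-N..N} \<le> emeasure mono_measure {-N-1<..N}"
    by (rule emeasure_mono) (auto simp: sets_mono_measure)
  also have "\<dots> < \<infinity>" using True by (subst emeasure_mono_measure) auto
  finally show ?thesis .
qed simp

lemma mono_measure_finite_UNIV:
  assumes "bounded (range g)"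
  shows "emeasure mono_measure UNIV < \<infinity>"
proof -
  obtain C where C: "\<And>x. \<bar>g x\<bar> \<le> C" using assms by (auto simp: bounded_iff)
  have "right_version g x \<le> C" for x using right_version_le[of x "x+1"] C[of "x+1"] by linarith
  moreover have "-C \<le> right_version g x" for x using C by (intro right_version_ge) (auto simp: abs_le_iff minus_le_iff)
  ultimately have le: "right_version g b - right_version g a \<le> 2 * C" for a b
    by (smt (verit, best))
  have "emeasure mono_measure (\<Union>n::nat. {- real n<..real n}) = (SUP n::nat. emeasure mono_measure {- real n<..real n})"
    by (rule SUP_emeasure_incseq[symmetric]) (auto simp: incseq_def sets_mono_measure)
  also have "\<dots> \<le> ennreal (2 * C)"
    by (rule SUP_least) (auto simp: emeasure_mono_measure intro!: ennreal_leI le)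
  also have "\<dots> < \<infinity>" by simp
  finally show ?thesis unfolding UN_Ioc_eq_UNIV .
qed

lemma mono_measure_derivative:
  assumes "test_function \<phi>"
  shows "(LINT x|mono_measure. complex_of_real (\<phi> x)) = - (LBINT x. complex_of_real (g x) * complex_of_real (deriv \<phi> x))"
    "integrable lborel (\<lambda>x. complex_of_real (g x) * complex_of_real (deriv \<phi> x))"
proof -
  obtain N where N: "\<And>x. \<bar>x\<bar> > N \<Longrightarrow> \<phi> x = 0" using test_function_support[OF assms] by blast
  have N': "deriv \<phi> x = 0" if "\<bar>x\<bar> > N" for x using test_function_deriv_outside[of N \<phi>, OF N that] .
  have m[measurable]: "deriv \<phi> \<in> borel_measurable borel" "g \<in> borel_measurable borel" "right_version g \<in> borel_measurable borel"
    using test_function_D(3)[OF assms] g right_version_mono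
    by (auto intro: borel_measurable_continuous_onI borel_measurable_mono simp: mono_def)
  have mm: "measure mono_measure {a<..b} = right_version g b - right_version g a" if "a \<le> b" for a b
    using emeasure_mono_measure[OF that] right_version_mono[OF that] by (simp add: measure_def)
  note p = measure_by_parts[OF sets_mono_measure mono_measure_finite mm test_function_ac(2)[OF assms], of N]
  have AE: "AE x in lborel. complex_of_real (deriv \<phi> x) * complex_of_real (right_version g x) = complex_of_real (g x) * complex_of_real (deriv \<phi> x)"
    using right_version_AE by eventually_elim simp
  have i: "integrable lborel (\<lambda>x. complex_of_real (deriv \<phi> x) * complex_of_real (right_version g x))"
    using p(2) N N' by simp
  have "(\<lambda>x. complex_of_real (g x) * complex_of_real (deriv \<phi> x)) \<in> borel_measurable lborel" by measurable
  from integrable_cong_AE[OF borel_measurable_integrable[OF i] this AE] i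
  show "integrable lborel (\<lambda>x. complex_of_real (g x) * complex_of_real (deriv \<phi> x))" by simp
  have "(LBINT x. complex_of_real (deriv \<phi> x) * complex_of_real (right_version g x)) = (LBINT x. complex_of_real (g x) * complex_of_real (deriv \<phi> x))"
    by (rule integral_cong_AE[OF _ _ AE]) simp_all
  then show "(LINT x|mono_measure. complex_of_real (\<phi> x)) = - (LBINT x. complex_of_real (g x) * complex_of_real (deriv \<phi> x))"
    using p(1) N N' by simp
qed

end

lemma mono_measure_sums:
  assumes "mono g" "range A \<subseteq> sets borel" "disjoint_family A" "bounded (\<Union>n::nat. A n) \<or> bounded (range g)"
  shows "(\<lambda>n. measure (mono_measure g) (A n)) sums measure (mono_measure g) (\<Union>n. A n)"
proof (rule measure_UNION)
  show "range A \<subseteq> sets (mono_measure g)" using assms(1,2) by (simp add: sets_mono_measure)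
  consider "bounded (\<Union>n. A n)" | "bounded (range g)" using assms(4) by blast
  then show "emeasure (mono_measure g) (\<Union>n. A n) \<noteq> \<infinity>"
  proof cases
    case 1
    then obtain N where "\<And>x. x \<in> (\<Union>n. A n) \<Longrightarrow> \<bar>x\<bar> \<le> N" by (auto simp: bounded_iff)
    then have "(\<Union>n. A n) \<subseteq> {-N..N}" by (force simp: abs_le_iff)
    then have "emeasure (mono_measure g) (\<Union>n. A n) \<le> emeasure (mono_measure g) {-N..N}"
      using assms(1) by (intro emeasure_mono) (auto simp: sets_mono_measure)
    then show ?thesis using mono_measure_finite[OF assms(1), of N] by (auto simp: top_unique)
  next
    case 2
    have "emeasure (mono_measure g) (\<Union>n. A n) \<le> emeasure (mono_measure g) UNIV"
      using assms(1) by (intro emeasure_mono) (auto simp: sets_mono_measure)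
    then show ?thesis using mono_measure_finite_UNIV[OF assms(1) 2] by (auto simp: top_unique)
  qed
qed fact

lemma signed_integral_zero: "bbs \<phi> \<Longrightarrow> signed_integral (\<lambda>A. 0) \<phi> = 0"
  using signed_integral_eq[of "\<lambda>A. 0" lborel lborel \<phi>] by (simp add: charge_def emeasure_lborel_Icc_eq)

lemma signed_integral_mono_measures:
  assumes g: "mono g" and k: "mono k" and \<phi>: "test_function \<phi>"
  shows "signed_integral (\<lambda>A. measure (mono_measure g) A - measure (mono_measure k) A) (\<lambda>x. complex_of_real (\<phi> x))
    = - (LBINT x. complex_of_real (g x - k x) * complex_of_real (deriv \<phi> x))"
    "integrable lborel (\<lambda>x. complex_of_real (g x - k x) * complex_of_real (deriv \<phi> x))"
proof -
  have "charge (\<lambda>A. measure (mono_measure g) A - measure (mono_measure k) A)"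
    unfolding charge_def using g k by (auto intro!: sums_diff mono_measure_sums)
  then have "signed_integral (\<lambda>A. measure (mono_measure g) A - measure (mono_measure k) A) (\<lambda>x. complex_of_real (\<phi> x))
    = (LINT x|mono_measure g. complex_of_real (\<phi> x)) - (LINT x|mono_measure k. complex_of_real (\<phi> x))"
    by (rule signed_integral_eq[OF _ sets_mono_measure[OF g] mono_measure_finite[OF g] sets_mono_measure[OF k]
          mono_measure_finite[OF k] _ test_function_bbs[OF \<phi>]]) simp_all
  also have "\<dots> = - (LBINT x. complex_of_real (g x) * complex_of_real (deriv \<phi> x) - complex_of_real (k x) * complex_of_real (deriv \<phi> x))"
    using mono_measure_derivative[OF g \<phi>] mono_measure_derivative[OF k \<phi>] by simp
  finally show "signed_integral (\<lambda>A. measure (mono_measure g) A - measure (mono_measure k) A) (\<lambda>x. complex_of_real (\<phi> x))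
    = - (LBINT x. complex_of_real (g x - k x) * complex_of_real (deriv \<phi> x))" by (simp add: left_diff_distrib)
  show "integrable lborel (\<lambda>x. complex_of_real (g x - k x) * complex_of_real (deriv \<phi> x))"
    using Bochner_Integration.integrable_diff[OF mono_measure_derivative(2)[OF g \<phi>] mono_measure_derivative(2)[OF k \<phi>]]
    by (simp add: left_diff_distrib)
qed

text \<open>The difference of the Stieltjes measures of the two monotone parts meets the
  specification, so the \<open>SOME\<close> in \<open>dBV\<close> selects a measure with the
  required properties.\<close>

lemma dBV_exists:
  assumes "BV f"
  shows "finite_signed_measure (dBV f)" "has_derivative_measure (\<lambda>x. complex_of_real (f x)) (\<lambda>A. complex_of_real (dBV f A))"
proof -
  obtain g k where gk: "mono g" "mono k" "bounded (range g)" "bounded (range k)" "f = (\<lambda>x. g x - k x)"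
    using assms unfolding BV_def by blast
  let ?\<mu> = "\<lambda>A. measure (mono_measure g) A - measure (mono_measure k) A"
  have "finite_signed_measure ?\<mu>"
    unfolding finite_signed_measure_def using gk by (auto intro!: sums_diff mono_measure_sums)
  moreover have "has_derivative_measure (\<lambda>x. complex_of_real (f x)) (\<lambda>A. complex_of_real (?\<mu> A))"
    unfolding has_derivative_measure_def complex_integral_def Re_complex_of_real Im_complex_of_real
    using signed_integral_mono_measures[OF gk(1,2)] by (auto simp: gk(5) signed_integral_zero test_function_bbs)
  ultimately have "\<exists>\<mu>. finite_signed_measure \<mu> \<and> has_derivative_measure (\<lambda>x. complex_of_real (f x)) (\<lambda>A. complex_of_real (\<mu> A))"
    by (intro exI[of _ ?\<mu>] conjI)
  from someI_ex[OF this] show "finite_signed_measure (dBV f)" "has_derivative_measure (\<lambda>x. complex_of_real (f x)) (\<lambda>A. complex_of_real (dBV f A))"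
    unfolding dBV_def by auto
qed

text \<open>As for \<open>dBV\<close>, separately for the real and imaginary parts. The monotone
  functions represent f only almost everywhere, which the pairing with test functions does not
  see.\<close>

lemma dBV_loc_exists:
  assumes "locally_BV_class f" "f \<in> borel_measurable borel"
  shows "local_complex_measure (dBV_loc f)" "has_derivative_measure f (dBV_loc f)"
proof -
  obtain F where F: "locally_BV F" "AE x in lborel. f x = F x" using assms(1) unfolding locally_BV_class_def by blast
  obtain g1 k1 g2 k2 where gk: "mono g1" "mono k1" "mono g2" "mono k2"
    "(\<lambda>x. Re (F x)) = (\<lambda>x. g1 x - k1 x)" "(\<lambda>x. Im (F x)) = (\<lambda>x. g2 x - k2 x)"
    using F(1) unfolding locally_BV_def by blast
  let ?\<mu>1 = "\<lambda>A. measure (mono_measure g1) A - measure (mono_measure k1) A"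
  let ?\<mu>2 = "\<lambda>A. measure (mono_measure g2) A - measure (mono_measure k2) A"
  let ?\<mu> = "\<lambda>A. Complex (?\<mu>1 A) (?\<mu>2 A)"
  have "local_complex_measure ?\<mu>"
    unfolding local_complex_measure_def sums_complex_iff using gk by (auto intro!: sums_diff mono_measure_sums)
  moreover have "has_derivative_measure f ?\<mu>"
    unfolding has_derivative_measure_def
  proof (intro allI impI)
    fix \<phi> assume \<phi>: "test_function \<phi>"
    note s1 = signed_integral_mono_measures[OF gk(1,2) \<phi>] and s2 = signed_integral_mono_measures[OF gk(3,4) \<phi>]
    have [measurable]: "deriv \<phi> \<in> borel_measurable borel"
      using test_function_D(3)[OF \<phi>] by (auto intro: borel_measurable_continuous_onI)
    have [measurable]: "g1 \<in> borel_measurable borel" "k1 \<in> borel_measurable borel" "g2 \<in> borel_measurable borel" "k2 \<in> borel_measurable borel"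
      using gk by (auto intro: borel_measurable_mono)
    have "complex_integral ?\<mu> (\<lambda>x. complex_of_real (\<phi> x)) =
       - (LBINT x. complex_of_real (g1 x - k1 x) * complex_of_real (deriv \<phi> x)) - \<i> * (LBINT x. complex_of_real (g2 x - k2 x) * complex_of_real (deriv \<phi> x))"
      unfolding complex_integral_def complex.sel s1(1) s2(1) by simp
    also have "\<dots> = - ((LBINT x. complex_of_real (g1 x - k1 x) * complex_of_real (deriv \<phi> x)) + (LBINT x. \<i> * (complex_of_real (g2 x - k2 x) * complex_of_real (deriv \<phi> x))))"
      by (simp del: of_real_diff)
    also have "\<dots> = - (LBINT x. complex_of_real (g1 x - k1 x) * complex_of_real (deriv \<phi> x) + \<i> * (complex_of_real (g2 x - k2 x) * complex_of_real (deriv \<phi> x)))"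
      using s1(2) s2(2) by (subst Bochner_Integration.integral_add) (auto simp del: of_real_diff)
    also have "\<dots> = - (LBINT x. f x * complex_of_real (deriv \<phi> x))"
    proof -
      have "F x = complex_of_real (g1 x - k1 x) + \<i> * complex_of_real (g2 x - k2 x)" for x
        using fun_cong[OF gk(5), of x] fun_cong[OF gk(6), of x] by (simp add: complex_eq_iff)
      then have Fe: "complex_of_real (g1 x - k1 x) * y + \<i> * (complex_of_real (g2 x - k2 x) * y) = F x * y" for x y
        by (simp add: distrib_right mult.assoc)
      have AE: "AE x in lborel. complex_of_real (g1 x - k1 x) * complex_of_real (deriv \<phi> x) + \<i> * (complex_of_real (g2 x - k2 x) * complex_of_real (deriv \<phi> x)) = f x * complex_of_real (deriv \<phi> x)"
        using F(2) unfolding Fe by eventually_elim simp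
      have m1: "(\<lambda>x. complex_of_real (g1 x - k1 x) * complex_of_real (deriv \<phi> x) + \<i> * (complex_of_real (g2 x - k2 x) * complex_of_real (deriv \<phi> x))) \<in> borel_measurable lborel" by measurable
      have m2: "(\<lambda>x. f x * complex_of_real (deriv \<phi> x)) \<in> borel_measurable lborel" using assms(2) by measurable
      show ?thesis unfolding integral_cong_AE[OF m1 m2 AE] ..
    qed
    finally show "complex_integral ?\<mu> (\<lambda>x. complex_of_real (\<phi> x)) = - (LBINT x. f x * complex_of_real (deriv \<phi> x))" .
  qed
  ultimately have "\<exists>\<mu>. local_complex_measure \<mu> \<and> has_derivative_measure f \<mu>" by blast
  from someI_ex[OF this] show "local_complex_measure (dBV_loc f)" "has_derivative_measure f (dBV_loc f)"
    unfolding dBV_loc_def by auto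
qed

section \<open>Integral modulus of continuity\<close>

text \<open>Bounded variation enters the estimates only through \<open>\<integral> |f(x+e) - f(x)| dx \<le> C e\<close>, which
  is insensitive to changes on null sets, unlike the pointwise variation.\<close>

definition tbv :: "real \<Rightarrow> (real \<Rightarrow> real) \<Rightarrow> bool" where
  "tbv C f \<longleftrightarrow> 0 \<le> C \<and> f \<in> borel_measurable borel \<and>
     (\<forall>e>0. (\<integral>\<^sup>+x. ennreal \<bar>f (x + e) - f x\<bar> \<partial>lborel) \<le> ennreal (C * e))"

lemma AE_lborel_shift:
  assumes "AE x in lborel. P (x :: real)" shows "AE x in lborel. P (x + e)"
proof -
  obtain N where N: "N \<in> null_sets lborel" "{x. \<not> P x} \<subseteq> N"
    using assms unfolding eventually_ae_filter by auto
  have [measurable]: "N \<in> sets borel" using N by auto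
  have S: "(\<lambda>x. x + e) -` N \<in> sets borel"
    using measurable_sets_borel[of "\<lambda>x. x + e" borel N] by simp
  then have "emeasure lborel ((\<lambda>x. x + e) -` N) = (\<integral>\<^sup>+x. indicator ((\<lambda>x. x + e) -` N) x \<partial>lborel)" by simp
  also have "\<dots> = (\<integral>\<^sup>+x. indicator N (e + 1 * x) \<partial>lborel)"
    by (rule nn_integral_cong) (simp add: indicator_def add.commute)
  also have "\<dots> = (\<integral>\<^sup>+x. indicator N x \<partial>lborel)"
    using nn_integral_real_affine[of "indicator N" 1 e] by simp
  also have "\<dots> = 0" using N by auto
  finally have "(\<lambda>x. x + e) -` N \<in> null_sets lborel"
    using S by (simp add: null_sets_def)
  from AE_not_in[OF this] show ?thesis by eventually_elim (use N in auto)
qed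

lemma tbv_mono: "tbv C f \<Longrightarrow> C \<le> D \<Longrightarrow> tbv D f"
  unfolding tbv_def by (auto intro: order_trans ennreal_leI mult_right_mono)

lemma tbv_cong_AE:
  assumes "tbv C f" "AE x in lborel. f x = g x" "g \<in> borel_measurable borel"
  shows "tbv C g"
proof -
  have "(\<integral>\<^sup>+x. ennreal \<bar>g (x + e) - g x\<bar> \<partial>lborel) = (\<integral>\<^sup>+x. ennreal \<bar>f (x + e) - f x\<bar> \<partial>lborel)" for e
    by (rule nn_integral_cong_AE) (use assms(2) AE_lborel_shift[OF assms(2), of e] in \<open>eventually_elim, simp\<close>)
  then show ?thesis using assms unfolding tbv_def by simp
qed

text \<open>The source of all closure rules for \<open>tbv\<close>: a bound for the increments of
  \<open>k\<close> by those of \<open>f\<close> and \<open>g\<close> is integrated. It may fail on a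
  null set, because coefficients are bounded only almost everywhere.\<close>

lemma tbv_dominated:
  assumes "tbv C f" "tbv D g" "k \<in> borel_measurable borel" "0 \<le> a" "0 \<le> b"
    and le: "\<And>e. 0 < e \<Longrightarrow> AE x in lborel. \<bar>k (x + e) - k x\<bar> \<le> a * \<bar>f (x + e) - f x\<bar> + b * \<bar>g (x + e) - g x\<bar>"
  shows "tbv (a * C + b * D) k"
  unfolding tbv_def
proof (intro conjI allI impI)
  fix e :: real assume e: "0 < e"
  have [measurable]: "f \<in> borel_measurable borel" "g \<in> borel_measurable borel" using assms by (auto simp: tbv_def)
  have "(\<integral>\<^sup>+x. ennreal \<bar>k (x + e) - k x\<bar> \<partial>lborel) \<le> (\<integral>\<^sup>+x. ennreal a * ennreal \<bar>f (x + e) - f x\<bar> + ennreal b * ennreal \<bar>g (x + e) - g x\<bar> \<partial>lborel)"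
    by (rule nn_integral_mono_AE)
      (rule eventually_mono[OF le[OF e]], use assms(4,5) in \<open>auto simp flip: ennreal_mult ennreal_plus intro: ennreal_leI\<close>)
  also have "\<dots> = ennreal a * (\<integral>\<^sup>+x. ennreal \<bar>f (x + e) - f x\<bar> \<partial>lborel) + ennreal b * (\<integral>\<^sup>+x. ennreal \<bar>g (x + e) - g x\<bar> \<partial>lborel)"
    by (simp add: nn_integral_add nn_integral_cmult)
  also have "\<dots> \<le> ennreal a * ennreal (C * e) + ennreal b * ennreal (D * e)"
    using assms(1,2) e by (intro add_mono mult_left_mono) (auto simp: tbv_def)
  also have "\<dots> = ennreal ((a * C + b * D) * e)"
    using assms e by (simp add: tbv_def distrib_right mult.assoc flip: ennreal_mult ennreal_plus)
  finally show "(\<integral>\<^sup>+x. ennreal \<bar>k (x + e) - k x\<bar> \<partial>lborel) \<le> ennreal ((a * C + b * D) * e)" .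
qed (use assms in \<open>auto simp: tbv_def\<close>)

lemma tbv_diff: "tbv C f \<Longrightarrow> tbv D g \<Longrightarrow> tbv (C + D) (\<lambda>x. f x - g x)"
  using tbv_dominated[of C f D g "\<lambda>x. f x - g x" 1 1] by (auto simp: tbv_def)

lemma tbv_const: "tbv 0 (\<lambda>x. c)"
  by (simp add: tbv_def)

lemma tbv_lipschitz:
  assumes "tbv C f" "L \<in> borel_measurable borel" "0 \<le> l" "\<And>x y. \<bar>L (f x) - L (f y)\<bar> \<le> l * \<bar>f x - f y\<bar>"
  shows "tbv (l * C) (\<lambda>x. L (f x))"
proof -
  have "f \<in> borel_measurable borel" using assms by (auto simp: tbv_def)
  then show ?thesis
    using tbv_dominated[OF assms(1) tbv_const, of "\<lambda>x. L (f x)" l 0] assms by auto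
qed

lemma tbv_mult:
  assumes f: "tbv C f" and g: "tbv D g" and bd: "AE x in lborel. \<bar>f x\<bar> \<le> a" "AE x in lborel. \<bar>g x\<bar> \<le> b"
    and "0 \<le> a" "0 \<le> b"
  shows "tbv (b * C + a * D) (\<lambda>x. f x * g x)"
proof (rule tbv_dominated[OF f g])
  show "(\<lambda>x. f x * g x) \<in> borel_measurable borel" using f g by (auto simp: tbv_def)
  fix e :: real assume "0 < e"
  show "AE x in lborel. \<bar>f (x + e) * g (x + e) - f x * g x\<bar> \<le> b * \<bar>f (x + e) - f x\<bar> + a * \<bar>g (x + e) - g x\<bar>"
    using bd(2) AE_lborel_shift[OF bd(1), of e]
  proof eventually_elim
    case (elim x)
    have "f (x + e) * g (x + e) - f x * g x = (f (x + e) - f x) * g x + f (x + e) * (g (x + e) - g x)"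
      by (simp add: algebra_simps)
    also have "\<bar>\<dots>\<bar> \<le> \<bar>f (x + e) - f x\<bar> * \<bar>g x\<bar> + \<bar>f (x + e)\<bar> * \<bar>g (x + e) - g x\<bar>"
      by (metis abs_mult abs_triangle_ineq)
    also have "\<dots> \<le> \<bar>f (x + e) - f x\<bar> * b + a * \<bar>g (x + e) - g x\<bar>"
      using elim by (intro add_mono mult_left_mono mult_right_mono) auto
    finally show ?case by (simp add: mult.commute)
  qed
qed fact+

text \<open>A point y lies between x (excluded) and x + e (included) for x in an interval of length
  e. By Fubini the integral is e times the mass of M.\<close>

lemma tbv_cdf:
  assumes M: "sets M = sets borel" "emeasure M UNIV \<le> ennreal C" "0 \<le> C"
  shows "tbv C (\<lambda>x. measure M {..x})"
proof -
  have sp: "space M = UNIV" using sets_eq_imp_space_eq[OF M(1)] by simp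
  have "emeasure M (space M) \<noteq> \<infinity>" using M(2) sp by (auto simp: top_unique)
  then interpret finite_measure M by (rule finite_measureI)
  interpret P: pair_sigma_finite lborel M ..
  have [measurable_cong]: "sets M = sets borel" by (rule M)
  have "mono (\<lambda>x. measure M {..x})" by (rule monoI) (auto intro!: finite_measure_mono simp: M)
  then have m[measurable]: "(\<lambda>x. measure M {..x}) \<in> borel_measurable borel" by (rule borel_measurable_mono)
  have "(\<integral>\<^sup>+x. ennreal \<bar>measure M {..x + e} - measure M {..x}\<bar> \<partial>lborel) \<le> ennreal (C * e)" if e: "0 < e" for e
  proof -
    have "ennreal \<bar>measure M {..x + e} - measure M {..x}\<bar> = (\<integral>\<^sup>+y. (if x < y \<and> y \<le> x + e then 1 else 0) \<partial>M)" for x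
    proof -
      have "{..x + e} = {..x} \<union> {x<..x + e}" using e by auto
      then have "measure M {..x + e} = measure M {..x} + measure M {x<..x + e}"
        by (simp add: finite_measure_Union[of "{..x}" "{x<..x + e}"] M(1) disjoint_iff)
      then have "ennreal \<bar>measure M {..x + e} - measure M {..x}\<bar> = emeasure M {x<..x+e}"
        by (simp add: emeasure_eq_measure)
      also have "\<dots> = (\<integral>\<^sup>+y. indicator {x<..x+e} y \<partial>M)" by (simp add: M(1))
      also have "\<dots> = (\<integral>\<^sup>+y. (if x < y \<and> y \<le> x + e then 1 else 0) \<partial>M)"
        by (rule nn_integral_cong) (auto simp: indicator_def)
      finally show ?thesis .
    qed
    then have "(\<integral>\<^sup>+x. ennreal \<bar>measure M {..x + e} - measure M {..x}\<bar> \<partial>lborel) = (\<integral>\<^sup>+x. \<integral>\<^sup>+y. (if x < y \<and> y \<le> x + e then 1 else 0) \<partial>M \<partial>lborel)"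
      by simp
    also have "\<dots> = (\<integral>\<^sup>+y. \<integral>\<^sup>+x. (if x < y \<and> y \<le> x + e then 1 else 0) \<partial>lborel \<partial>M)"
      by (rule P.Fubini'[symmetric]) measurable
    also have "\<dots> = (\<integral>\<^sup>+y. ennreal e \<partial>M)"
    proof (rule nn_integral_cong)
      fix y
      have "(\<integral>\<^sup>+x. (if x < y \<and> y \<le> x + e then 1 else 0) \<partial>lborel) = (\<integral>\<^sup>+x. indicator {y - e..<y} x \<partial>lborel)"
        by (rule nn_integral_cong) (auto simp: indicator_def)
      also have "\<dots> = ennreal e" using e by simp
      finally show "(\<integral>\<^sup>+x. (if x < y \<and> y \<le> x + e then 1 else 0) \<partial>lborel) = ennreal e" .
    qed
    also have "\<dots> = ennreal e * emeasure M UNIV" by (simp add: sp)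
    also have "\<dots> \<le> ennreal e * ennreal C" by (intro mult_left_mono M) simp
    also have "\<dots> = ennreal (C * e)" using e M(3) by (simp add: ennreal_mult mult.commute)
    finally show ?thesis .
  qed
  then show ?thesis unfolding tbv_def using M(3) m by simp
qed

lemma cdf_by_parts:
  fixes \<Psi> :: "real \<Rightarrow> complex"
  assumes M: "sets M = sets borel" "emeasure M UNIV < \<infinity>"
    and ac: "ac_on UNIV \<Psi> \<psi>" "\<psi> \<in> borel_measurable borel"
    and supp: "\<And>x. \<bar>x\<bar> > N \<Longrightarrow> \<Psi> x = 0" "\<And>x. \<bar>x\<bar> > N \<Longrightarrow> \<psi> x = 0"
  shows "(LINT x|M. \<Psi> x) = - (LBINT x. \<psi> x * of_real (measure M {..x}))"
    "integrable lborel (\<lambda>x. \<psi> x * of_real (measure M {..x}))"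
proof -
  have sp: "space M = UNIV" using sets_eq_imp_space_eq[OF M(1)] by simp
  interpret finite_measure M using M(2) sp by (intro finite_measureI) auto
  have "emeasure M {-N..N} < \<infinity>" for N :: real by (simp add: emeasure_eq_measure)
  moreover have "measure M {a<..b} = measure M {..b} - measure M {..a}" if "a \<le> b" for a b
  proof -
    have "{..b} = {..a} \<union> {a<..b}" using that by auto
    then show ?thesis by (simp add: finite_measure_Union[of "{..a}" "{a<..b}"] M(1) disjoint_iff)
  qed
  ultimately show "(LINT x|M. \<Psi> x) = - (LBINT x. \<psi> x * of_real (measure M {..x}))"
    "integrable lborel (\<lambda>x. \<psi> x * of_real (measure M {..x}))"
    using measure_by_parts[OF M(1) _ _ ac supp, where G = "\<lambda>x. measure M {..x}"] by simp_all
qed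

lemma BV_borel: assumes "BV f" shows "f \<in> borel_measurable borel"
proof -
  obtain g k where "mono g" "mono k" "f = (\<lambda>x. g x - k x)" using assms unfolding BV_def by blast
  then show ?thesis using borel_measurable_diff[OF borel_measurable_mono borel_measurable_mono, of g k] by simp
qed

lemma BV_bounded: assumes "BV f" shows "\<exists>C. \<forall>x. \<bar>f x\<bar> \<le> C"
proof -
  obtain g k where gk: "bounded (range g)" "bounded (range k)" "f = (\<lambda>x. g x - k x)"
    using assms unfolding BV_def by blast
  obtain C D where "\<And>x. \<bar>g x\<bar> \<le> C" "\<And>x. \<bar>k x\<bar> \<le> D" using gk by (auto simp: bounded_iff)
  then have "\<bar>f x\<bar> \<le> C + D" for x
    using abs_triangle_ineq4[of "g x" "k x"] gk(3) by (metis add_mono order_trans)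
  then show ?thesis by blast
qed

text \<open>Up to a constant, f agrees almost everywhere with the difference of the distribution
  functions of the Jordan parts of \<open>dBV f\<close>, by \<open>du_Bois_Reymond\<close> with weak
  derivative 0. The factor 2 arises because each Jordan part is bounded separately by the total
  variation norm.\<close>

lemma BV_tbv:
  assumes f: "BV f" and M: "measure_norm (dBV f) \<le> ennreal M" "0 \<le> M"
  shows "tbv (2 * M) f"
proof -
  let ?\<mu> = "dBV f"
  let ?P = "positive_part ?\<mu>" and ?N = "positive_part (\<lambda>A. - ?\<mu> A)"
  note \<mu> = dBV_exists[OF f]
  have P: "emeasure ?P UNIV \<le> ennreal M" "emeasure ?N UNIV \<le> ennreal M"
    using positive_part_le_measure_norm[OF \<mu>(1)] M(1) by (auto intro: order_trans)
  then have Pf: "emeasure ?P UNIV < \<infinity>" "emeasure ?N UNIV < \<infinity>" by (auto simp: less_top[symmetric] top_unique)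
  define G where "G x = measure ?P {..x} - measure ?N {..x}" for x
  have G: "tbv (2 * M) G"
    unfolding G_def using tbv_diff[OF tbv_cdf[OF sets_positive_part P(1) M(2)] tbv_cdf[OF sets_positive_part P(2) M(2)]] by simp
  have [measurable]: "f \<in> borel_measurable borel" "G \<in> borel_measurable borel" using BV_borel[OF f] G by (auto simp: tbv_def)
  define k where "k x = complex_of_real (f x - G x)" for x
  have Gb: "\<bar>G x\<bar> \<le> 2 * M" for x
  proof -
    have "measure ?P {..x} \<le> M" "measure ?N {..x} \<le> M"
      using P emeasure_mono[of "{..x}" UNIV ?P] emeasure_mono[of "{..x}" UNIV ?N] M(2)
      by (auto simp: sets_positive_part measure_def intro!: enn2real_leI intro: order_trans)
    then show ?thesis unfolding G_def using measure_nonneg[of ?P "{..x}"] measure_nonneg[of ?N "{..x}"] by linarith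
  qed
  obtain C where C: "\<And>x. \<bar>f x\<bar> \<le> C" using BV_bounded[OF f] by blast
  have locint_bdd: "locint h" if h: "h \<in> borel_measurable borel" "\<And>x. norm (h x) \<le> K" for h :: "real \<Rightarrow> complex" and K
    unfolding locint_def
  proof (intro allI)
    fix a b :: real
    have "set_integrable lborel {a..b} (\<lambda>x. (1::complex) * h x)"
      by (rule set_integrable_bounded_mult(1)[where C=K]) (use h locint_continuous[of "\<lambda>x. 1::complex"] in \<open>auto simp: locint_def set_borel_measurable_def\<close>)
    then show "set_integrable lborel {a..b} h" by simp
  qed
  have kl: "locint k" "k \<in> borel_measurable borel"
  proof -
    show m: "k \<in> borel_measurable borel" unfolding k_def by measurable
    show "locint k"
    proof (rule locint_bdd[OF m])
      show "norm (k x) \<le> C + 2 * M" for x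
        unfolding k_def norm_of_real using C[of x] Gb[of x] by linarith
    qed
  qed
  have "\<exists>c. AE x in lborel. k x = c + prim (\<lambda>x. 0) x"
  proof (rule du_Bois_Reymond[OF kl])
    show "locint (\<lambda>x. 0::complex)" by (rule locint_continuous) auto
    fix \<phi> assume \<phi>: "test_function \<phi>"
    obtain N where N: "\<And>x. \<bar>x\<bar> > N \<Longrightarrow> \<phi> x = 0" using test_function_support[OF \<phi>] by blast
    have N': "deriv \<phi> x = 0" if "\<bar>x\<bar> > N" for x using test_function_deriv_outside[of N \<phi>, OF N that] .
    let ?\<phi> = "\<lambda>x. complex_of_real (\<phi> x)" and ?\<phi>' = "\<lambda>x. complex_of_real (deriv \<phi> x)"
    have m: "?\<phi>' \<in> borel_measurable borel" by (intro borel_measurable_continuous_onI continuous_on_of_real test_function_D(3)[OF \<phi>])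
    note pP = cdf_by_parts[OF sets_positive_part Pf(1) test_function_ac(2)[OF \<phi>] m, of N]
    note pN = cdf_by_parts[OF sets_positive_part Pf(2) test_function_ac(2)[OF \<phi>] m, of N]
    have "complex_integral (\<lambda>A. complex_of_real (?\<mu> A)) ?\<phi> = signed_integral ?\<mu> ?\<phi>"
      unfolding complex_integral_def by (simp add: signed_integral_zero test_function_bbs[OF \<phi>])
    also have "\<dots> = - (LBINT x. ?\<phi>' x * of_real (measure ?P {..x})) + (LBINT x. ?\<phi>' x * of_real (measure ?N {..x}))"
      unfolding signed_integral_def using pP(1) pN(1) N N' by simp
    also have "\<dots> = - (LBINT x. ?\<phi>' x * of_real (G x))"
      unfolding G_def using pP(2) pN(2) N N' by (simp add: right_diff_distrib)
    finally have e: "- (LBINT x. of_real (f x) * ?\<phi>' x) = - (LBINT x. ?\<phi>' x * of_real (G x))"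
      using \<mu>(2) \<phi> unfolding has_derivative_measure_def by simp
    have i1: "integrable lborel (\<lambda>x. ?\<phi>' x * of_real (f x))"
    proof (rule radon_locint(2)[OF locint_bdd[of _ C]])
      show "bbs ?\<phi>'" by (rule test_function_bbs[OF test_function_deriv[OF \<phi>]])
    qed (use C in auto)
    have i2: "integrable lborel (\<lambda>x. ?\<phi>' x * of_real (G x))"
    proof (rule radon_locint(2)[OF locint_bdd[of _ "2 * M"]])
      show "bbs ?\<phi>'" by (rule test_function_bbs[OF test_function_deriv[OF \<phi>]])
    qed (use Gb in auto)
    have "(LBINT x. ?\<phi>' x * k x) = (LBINT x. ?\<phi>' x * of_real (f x)) - (LBINT x. ?\<phi>' x * of_real (G x))"
      unfolding k_def of_real_diff right_diff_distrib by (rule Bochner_Integration.integral_diff[OF i1 i2])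
    also have "\<dots> = 0" using e unfolding mult.commute[of "complex_of_real (f _)"] by simp
    finally show "(LBINT x. ?\<phi> x * 0) = - (LBINT x. ?\<phi>' x * k x)" by simp
  qed
  moreover have "prim (\<lambda>x. 0::complex) x = 0" for x by (simp add: prim_def set_lebesgue_integral_def)
  ultimately obtain c where c: "AE x in lborel. k x = c" by auto
  have "tbv (2 * M) (\<lambda>x. G x - (- Re c))" using tbv_diff[OF G tbv_const, of "- Re c"] by simp
  moreover have "AE x in lborel. G x - (- Re c) = f x"
    using c by eventually_elim (auto simp: k_def complex_eq_iff)
  ultimately show ?thesis by (rule tbv_cong_AE) simp
qed

section \<open>The reduced first order system\<close>

named_theorems locbdd_intros
named_theorems locintb_intros

text \<open>Multipliers of locally integrable functions. The closure rules in
  \<open>locbdd_intros\<close> and \<open>locintb_intros\<close> settle the integrability of the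
  polynomial expressions in coefficients and solutions that occur below.\<close>

definition locbdd :: "(real \<Rightarrow> 'a::{banach, second_countable_topology}) \<Rightarrow> bool" where
  "locbdd g \<longleftrightarrow> g \<in> borel_measurable borel \<and> (\<forall>N. \<exists>C. \<forall>x\<in>{-N..N}. norm (g x) \<le> C)"

lemma locbddD: "locbdd g \<Longrightarrow> g \<in> borel_measurable borel" "locbdd g \<Longrightarrow> \<exists>C. \<forall>x\<in>{-N..N}. norm (g x) \<le> C"
  by (auto simp: locbdd_def)

lemma locbdd_bounded: "g \<in> borel_measurable borel \<Longrightarrow> (\<And>x. norm (g x) \<le> C) \<Longrightarrow> locbdd g"
  by (auto simp: locbdd_def)

lemma locbdd_const [locbdd_intros]: "locbdd (\<lambda>x. c)" by (auto simp: locbdd_def)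

lemma locbdd_continuous:
  assumes "continuous_on UNIV g" shows "locbdd g"
  unfolding locbdd_def
proof (intro conjI allI)
  show "g \<in> borel_measurable borel" using assms by (rule borel_measurable_continuous_onI)
  fix N :: real
  have "compact (g ` {-N..N})" by (intro compact_continuous_image continuous_on_subset[OF assms]) auto
  then show "\<exists>C. \<forall>x\<in>{-N..N}. norm (g x) \<le> C" using compact_imp_bounded bounded_iff by (metis imageI)
qed

lemma locbdd_add [locbdd_intros]: assumes "locbdd f" "locbdd g" shows "locbdd (\<lambda>x. f x + g x)"
  unfolding locbdd_def
proof (intro conjI allI)
  show "(\<lambda>x. f x + g x) \<in> borel_measurable borel" using assms by (auto simp: locbdd_def)
  fix N
  obtain C D where "\<forall>x\<in>{-N..N}. norm (f x) \<le> C" "\<forall>x\<in>{-N..N}. norm (g x) \<le> D"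
    using locbddD(2)[OF assms(1), of N] locbddD(2)[OF assms(2), of N] by blast
  then show "\<exists>C. \<forall>x\<in>{-N..N}. norm (f x + g x) \<le> C"
    by (intro exI[of _ "C + D"]) (auto intro: norm_triangle_le add_mono)
qed

lemma locbdd_mult [locbdd_intros]:
  fixes f g :: "real \<Rightarrow> 'a::{real_normed_algebra, banach, second_countable_topology}"
  assumes "locbdd f" "locbdd g" shows "locbdd (\<lambda>x. f x * g x)"
  unfolding locbdd_def
proof (intro conjI allI)
  show "(\<lambda>x. f x * g x) \<in> borel_measurable borel" using assms by (auto simp: locbdd_def)
  fix N
  obtain C D where "\<forall>x\<in>{-N..N}. norm (f x) \<le> C" "\<forall>x\<in>{-N..N}. norm (g x) \<le> D"
    using locbddD(2)[OF assms(1), of N] locbddD(2)[OF assms(2), of N] by blast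
  then have "\<forall>x\<in>{-N..N}. norm (f x * g x) \<le> C * D"
    by (meson mult_mono' norm_ge_zero norm_mult_ineq order_trans)
  then show "\<exists>C. \<forall>x\<in>{-N..N}. norm (f x * g x) \<le> C" by blast
qed

lemma locbdd_norm [locbdd_intros]: "locbdd g \<Longrightarrow> locbdd (\<lambda>x. norm (g x))"
  by (auto simp: locbdd_def)

lemma locbdd_of_real [locbdd_intros]: "locbdd g \<Longrightarrow> locbdd (\<lambda>x. complex_of_real (g x))"
  by (auto simp: locbdd_def)

lemma locbdd_cnj [locbdd_intros]: "locbdd g \<Longrightarrow> locbdd (\<lambda>x. cnj (g x))"
  by (auto simp: locbdd_def intro: borel_measurable_continuous_on[of cnj] continuous_intros)

lemma locbdd_norm_le:
  assumes "locbdd f" "g \<in> borel_measurable borel" "\<And>x. norm (g x) \<le> norm (f x)"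
  shows "locbdd g"
  unfolding locbdd_def
proof (intro conjI allI)
  fix N
  obtain C where "\<forall>x\<in>{-N..N}. norm (f x) \<le> C" using locbddD(2)[OF assms(1)] by blast
  then have "\<forall>x\<in>{-N..N}. norm (g x) \<le> C" using order_trans[OF assms(3)] by blast
  then show "\<exists>C. \<forall>x\<in>{-N..N}. norm (g x) \<le> C" by blast
qed fact

lemma locbdd_Re_Im [locbdd_intros]:
  assumes "locbdd g" shows "locbdd (\<lambda>x. Re (g x))" "locbdd (\<lambda>x. Im (g x))"
  using locbddD(1)[OF assms] by (auto intro!: locbdd_norm_le[OF assms] abs_Re_le_cmod abs_Im_le_cmod)

lemma locbdd_minus [locbdd_intros]: "locbdd g \<Longrightarrow> locbdd (\<lambda>x. - g x)"
  by (auto simp: locbdd_def)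

lemma locbdd_diff [locbdd_intros]: "locbdd f \<Longrightarrow> locbdd g \<Longrightarrow> locbdd (\<lambda>x. f x - g x)"
  using locbdd_add[of f "\<lambda>x. - g x"] locbdd_minus[of g] by simp

lemma locbdd_power2 [locbdd_intros]:
  fixes f :: "real \<Rightarrow> 'a::{real_normed_algebra_1, banach, second_countable_topology}"
  shows "locbdd f \<Longrightarrow> locbdd (\<lambda>x. (f x)\<^sup>2)"
  unfolding power2_eq_square by (rule locbdd_mult)

definition locintb :: "(real \<Rightarrow> 'a::{banach, second_countable_topology}) \<Rightarrow> bool" where
  "locintb f \<longleftrightarrow> f \<in> borel_measurable borel \<and> locint f"

lemma locintbD: "locintb f \<Longrightarrow> f \<in> borel_measurable borel" "locintb f \<Longrightarrow> set_integrable lborel {a..b} f" "locintb f \<Longrightarrow> locint f"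
  by (auto simp: locintb_def locint_def)

lemma set_integrable_dominated:
  assumes "set_integrable lborel {a..b} (f :: real \<Rightarrow> 'b::{banach, second_countable_topology})"
    "g \<in> borel_measurable borel" "\<And>x. x \<in> {a..b} \<Longrightarrow> norm (g x) \<le> norm (f x)"
  shows "set_integrable lborel {a..b} (g :: real \<Rightarrow> 'c::{banach, second_countable_topology})"
  by (rule set_integrable_bound[OF assms(1)]) (use assms(2,3) in \<open>auto simp: set_borel_measurable_def\<close>)

lemma locintb_mult [locintb_intros]:
  fixes f g :: "real \<Rightarrow> 'a::{real_normed_algebra, banach, second_countable_topology}"
  assumes "locbdd f" "locintb g" shows "locintb (\<lambda>x. f x * g x)"
  unfolding locintb_def locint_def
proof (intro conjI allI)
  show m: "(\<lambda>x. f x * g x) \<in> borel_measurable borel" using assms by (auto simp: locbdd_def locintb_def)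
  fix a b :: real
  obtain C where C: "\<forall>x\<in>{- max \<bar>a\<bar> \<bar>b\<bar>..max \<bar>a\<bar> \<bar>b\<bar>}. norm (f x) \<le> C" using locbddD(2)[OF assms(1)] by blast
  have "norm (f x) \<le> C" if "x \<in> {a..b}" for x
  proof -
    have "a \<le> x" "x \<le> b" using that by auto
    then have "- max \<bar>a\<bar> \<bar>b\<bar> \<le> x" "x \<le> max \<bar>a\<bar> \<bar>b\<bar>" by linarith+
    then show ?thesis using C by simp
  qed
  then show "set_integrable lborel {a..b} (\<lambda>x. f x * g x)"
    using set_integrable_bounded_mult(2)[OF locintbD(2)[OF assms(2)], of a b f C] locbddD(1)[OF assms(1)]
    by (simp add: set_borel_measurable_def)
qed

lemma locintb_const: "locintb (\<lambda>x. c :: 'a::euclidean_space)"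
  by (auto simp: locintb_def intro: locint_continuous)

lemma locintb_locbdd:
  fixes f :: "real \<Rightarrow> 'a::{real_normed_algebra_1, euclidean_space}"
  shows "locbdd f \<Longrightarrow> locintb f"
  using locintb_mult[OF _ locintb_const[of "1::'a"], of f] by simp

lemma locintb_add [locintb_intros]: "locintb f \<Longrightarrow> locintb g \<Longrightarrow> locintb (\<lambda>x. f x + g x)"
  by (auto simp: locintb_def locint_def intro!: set_integral_add(1))

lemma locintb_diff [locintb_intros]: "locintb f \<Longrightarrow> locintb g \<Longrightarrow> locintb (\<lambda>x. f x - g x)"
  by (auto simp: locintb_def locint_def intro!: set_integral_diff(1))

lemma locintb_norm [locintb_intros]: "locintb f \<Longrightarrow> locintb (\<lambda>x. norm (f x))"
  by (auto simp: locintb_def locint_def intro: set_integrable_norm)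

lemma locintb_bounded_linear:
  assumes "bounded_linear T" "locintb f" shows "locintb (\<lambda>x. T (f x))"
proof -
  interpret T: bounded_linear T by fact
  have "(\<lambda>x. T (f x)) \<in> borel_measurable borel"
    using assms(2) by (intro borel_measurable_continuous_on[of T] T.continuous_on) (auto simp: locintb_def)
  moreover have "indicat_real A x *\<^sub>R T (f x) = T (indicat_real A x *\<^sub>R f x)" for A x
    by (simp add: T.scaleR)
  ultimately show ?thesis
    using assms unfolding locintb_def locint_def set_integrable_def by (auto intro: integrable_bounded_linear)
qed

lemmas locintb_of_real_Re_Im [locintb_intros] =
  locintb_bounded_linear[of complex_of_real, OF bounded_linear_of_real]
  locintb_bounded_linear[OF bounded_linear_Re] locintb_bounded_linear[OF bounded_linear_Im]

lemma L2_locintb: assumes "f \<in> L2" shows "locintb f"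
  unfolding locintb_def locint_def
proof (intro conjI allI)
  show m: "f \<in> borel_measurable borel" using assms by (simp add: L2_def)
  fix a b :: real
  have i: "integrable lborel (\<lambda>x. (norm (f x))\<^sup>2)" using assms by (simp add: L2_def)
  have "set_integrable lborel {a..b} (\<lambda>x. 1 + (norm (f x))\<^sup>2)"
    using locintbD(2)[OF locintb_const[of "1::real"], of a b] integrable_mult_indicator[OF _ i, of "{a..b}"]
    by (intro set_integral_add(1)) (auto simp: set_integrable_def)
  then show "set_integrable lborel {a..b} f"
  proof (rule set_integrable_dominated[OF _ m])
    fix x show "norm (f x) \<le> norm (1 + (norm (f x))\<^sup>2)"
      using sum_squares_bound[of "norm (f x)" 1] by (simp add: power2_eq_square abs_of_nonneg)
        (smt (verit) mult_nonneg_nonneg norm_ge_zero)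
  qed
qed

lemma L2_mult_integrable:
  fixes f g :: "real \<Rightarrow> complex"
  assumes "f \<in> L2" "g \<in> L2" shows "integrable lborel (\<lambda>x. norm (f x) * norm (g x))"
proof (rule Bochner_Integration.integrable_bound)
  show "integrable lborel (\<lambda>x. (norm (f x))\<^sup>2 + (norm (g x))\<^sup>2)" using assms by (auto simp: L2_def)
  show "AE x in lborel. norm (norm (f x) * norm (g x)) \<le> norm ((norm (f x))\<^sup>2 + (norm (g x))\<^sup>2)"
  proof (rule AE_I2)
    fix x
    have "0 \<le> norm (f x) * norm (g x)" "0 \<le> (norm (f x))\<^sup>2 + (norm (g x))\<^sup>2" by auto
    moreover have "norm (f x) * norm (g x) \<le> (norm (f x))\<^sup>2 + (norm (g x))\<^sup>2"
      using sum_squares_bound[of "norm (f x)" "norm (g x)"] \<open>0 \<le> norm (f x) * norm (g x)\<close> by linarith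
    ultimately show "norm (norm (f x) * norm (g x)) \<le> norm ((norm (f x))\<^sup>2 + (norm (g x))\<^sup>2)" by simp
  qed
qed (use assms in \<open>auto simp: L2_def\<close>)

text \<open>An integrable function need not tend to 0, but it cannot stay above \<delta> on a half
  line. That suffices to make boundary terms small for suitable large N.\<close>

lemma small_boundary:
  fixes q :: "real \<Rightarrow> real"
  assumes q: "integrable lborel q" "\<And>x. 0 \<le> q x" and \<delta>: "0 < \<delta>"
  shows "\<exists>N\<ge>N0. q N + q (-N) < \<delta>"
proof (rule ccontr)
  assume "\<not> ?thesis"
  then have le: "\<delta> \<le> q x + q (-x)" if "x \<ge> N0" for x using that by (meson not_less)
  let ?g = "\<lambda>x. q x + q (-x)"
  have g: "integrable lborel ?g"
    using q(1) lborel_integrable_real_affine[OF q(1), of "-1" 0] by simp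
  \<comment> \<open>An interval of this length on which the sum is at least \<delta> would carry
    integral at least that of \<open>?g\<close> plus 1.\<close>
  define T where "T = ((LBINT x. ?g x) + 1) / \<delta>"
  have nn: "0 \<le> (LBINT x. ?g x)" using q(2) by (intro Bochner_Integration.integral_nonneg) auto
  then have T: "T > 0" using \<delta> by (auto simp: T_def)
  have "integrable lborel (\<lambda>x. \<delta> * indicator {N0..N0+T} x)"
    by (intro integrable_mult_right integrable_real_indicator) (auto simp: emeasure_lborel_Icc_eq)
  then have "(LBINT x. \<delta> * indicator {N0..N0+T} x) \<le> (LBINT x. ?g x)"
    by (rule integral_mono[OF _ g]) (use le q(2) in \<open>auto simp: indicator_def intro: add_nonneg_nonneg\<close>)
  then have "\<delta> * T \<le> (LBINT x. ?g x)" using T by simp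
  then show False using \<delta> by (simp add: T_def)
qed

lemma LIMSEQ_set_integral_Icc:
  fixes g :: "real \<Rightarrow> real"
  assumes g: "integrable lborel g"
  shows "(\<lambda>n. LBINT x:{- real n..real n}. g x) \<longlonglongrightarrow> (LBINT x. g x)"
  unfolding set_lebesgue_integral_def
proof (rule integral_dominated_convergence[where w = "\<lambda>x. norm (g x)"])
  show "AE x in lborel. (\<lambda>n. indicat_real {- real n..real n} x *\<^sub>R g x) \<longlonglongrightarrow> g x"
  proof (rule AE_I2)
    fix x :: real
    obtain m :: nat where m: "\<bar>x\<bar> \<le> m" using real_arch_simple by blast
    have "\<forall>n\<ge>m. indicat_real {- real n..real n} x *\<^sub>R g x = g x"
    proof (intro allI impI)
      fix n assume "m \<le> n"
      then have "\<bar>x\<bar> \<le> real n" using m by linarith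
      then have "x \<in> {- real n..real n}" by auto
      then show "indicat_real {- real n..real n} x *\<^sub>R g x = g x" by simp
    qed
    then have "\<forall>\<^sub>F n in sequentially. indicat_real {- real n..real n} x *\<^sub>R g x = g x"
      unfolding eventually_sequentially by blast
    then show "(\<lambda>n. indicat_real {- real n..real n} x *\<^sub>R g x) \<longlonglongrightarrow> g x" by (rule tendsto_eventually)
  qed
qed (use g in \<open>auto simp: indicator_def\<close>)

text \<open>Tailored to \<open>small_boundary\<close>: the bound is available only for some
  arbitrarily large N, and monotonicity in N of integrals of a nonnegative function transfers it to
  all intervals.\<close>

lemma integral_le_exhaustion:
  fixes g :: "real \<Rightarrow> real"
  assumes g: "integrable lborel g" "\<And>x. 0 \<le> g x"
    and le: "\<And>N0 \<delta>. 0 < \<delta> \<Longrightarrow> \<exists>N\<ge>N0. (LBINT x:{-N..N}. g x) \<le> C + \<delta>"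
  shows "(LBINT x. g x) \<le> C"
proof (rule LIMSEQ_le_const2[OF LIMSEQ_set_integral_Icc[OF g(1)]], intro exI allI impI)
  fix n :: nat
  have "(LBINT x:{- real n..real n}. g x) \<le> C + \<delta>" if pos: "0 < \<delta>" for \<delta>
  proof -
    obtain N where N: "N \<ge> real n" "(LBINT x:{-N..N}. g x) \<le> C + \<delta>" using le[OF pos] by blast
    have "(LBINT x:{- real n..real n}. g x) \<le> (LBINT x:{-N..N}. g x)"
      unfolding set_lebesgue_integral_def
      by (rule integral_mono[OF integrable_mult_indicator[OF _ g(1)] integrable_mult_indicator[OF _ g(1)]])
        (use g N in \<open>auto simp: indicator_def\<close>)
    then show ?thesis using N by simp
  qed
  then show "(LBINT x:{- real n..real n}. g x) \<le> C" by (rule field_le_epsilon)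
qed

lemma integrable_exhaustion:
  fixes g :: "real \<Rightarrow> real"
  assumes g: "locintb g" "\<And>x. 0 \<le> g x" and le: "\<And>n::nat. (LBINT x:{- real n..real n}. g x) \<le> C"
  shows "integrable lborel g"
proof -
  have m: "g \<in> borel_measurable lborel" using locintbD(1)[OF g(1)] by simp
  have "(\<integral>\<^sup>+x. ennreal (g x) \<partial>lborel) = (SUP n. \<integral>\<^sup>+x. ennreal (indicator {- real n..real n} x * g x) \<partial>lborel)"
  proof (subst nn_integral_monotone_convergence_SUP[symmetric])
    show "incseq (\<lambda>n x. ennreal (indicat_real {- real n..real n} x * g x))"
      using g(2) by (auto simp: incseq_def le_fun_def indicator_def intro!: ennreal_leI)
    show "(\<integral>\<^sup>+x. ennreal (g x) \<partial>lborel) = (\<integral>\<^sup>+x. (SUP n. ennreal (indicat_real {- real n..real n} x * g x)) \<partial>lborel)"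
    proof (rule nn_integral_cong)
      fix x :: real
      obtain m :: nat where "\<bar>x\<bar> \<le> m" using real_arch_simple by blast
      then have "x \<in> {- real m..real m}" by auto
      then show "ennreal (g x) = (SUP n. ennreal (indicat_real {- real n..real n} x * g x))"
        by (intro antisym SUP_upper2[of m] SUP_least) (use g(2) in \<open>auto simp: indicator_def\<close>)
    qed
  qed (use m in auto)
  also have "\<dots> \<le> ennreal C"
  proof (rule SUP_least)
    fix n :: nat
    have "integrable lborel (\<lambda>x. indicat_real {- real n..real n} x * g x)"
      using locintbD(2)[OF g(1), of "- real n" "real n"] by (simp add: set_integrable_def)
    then have "(\<integral>\<^sup>+x. ennreal (indicator {- real n..real n} x * g x) \<partial>lborel) = ennreal (LBINT x:{- real n..real n}. g x)"
      unfolding set_lebesgue_integral_def using g(2)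
      by (subst nn_integral_eq_integral) (auto simp: indicator_def)
    then show "(\<integral>\<^sup>+x. ennreal (indicator {- real n..real n} x * g x) \<partial>lborel) \<le> ennreal C"
      using le[of n] by (auto intro: ennreal_leI)
  qed
  finally have "(\<integral>\<^sup>+x. ennreal (norm (g x)) \<partial>lborel) < \<infinity>"
    using g(2) by (auto simp: less_top[symmetric] top_unique)
  then show ?thesis using m by (intro integrableI_bounded) auto
qed

text \<open>This is h times the derivative of \<open>cnj U * r\<close> along the system. The terms
  with B cancel. The imaginary part keeps only the \<epsilon> term and the source, since Q, n and a
  enter through real multiples of quadratic forms.\<close>

lemma pairing_identity:
  fixes U r f :: complex and a B Q w n e :: real
  assumes "p = r + of_real n * U"
  shows "cnj (of_real a * p - \<i> * of_real B * U) * r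
     + cnj U * ((of_real Q - \<i> * of_real (e * w)) * U - of_real w * f - \<i> * of_real B * p
         - of_real n * (of_real a * p - \<i> * of_real B * U))
     = of_real (a * (cmod p)\<^sup>2 + Q * (cmod U)\<^sup>2 - 2 * n * a * Re (cnj U * p) - w * Re (cnj U * f))
       - \<i> * of_real (e * w * (cmod U)\<^sup>2 + w * Im (cnj U * f))"
proof -
  obtain U1 U2 r1 r2 f1 f2 where c: "U = Complex U1 U2" "r = Complex r1 r2" "f = Complex f1 f2"
    by (cases U; cases r; cases f) auto
  show ?thesis
    unfolding assms cmod_power2 complex_eq_iff c
    by (simp add: power2_eq_square) (intro conjI; algebra)
qed

text \<open>In the application a = 1/\<alpha>, w = 1/\<beta>, B = a (b0 + b1), and Q = w (V1 - E) -
  a b1^2 almost everywhere. The bound K of n is kept separate from M because it is of order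
  1/h.\<close>

locale reduced_system =
  fixes h \<epsilon> K M :: real and a w Q n B :: "real \<Rightarrow> real"
  assumes h_pos: "0 < h" and eps: "\<epsilon> \<noteq> 0" and M_ge: "1 \<le> M"
    and borel: "a \<in> borel_measurable borel" "w \<in> borel_measurable borel" "Q \<in> borel_measurable borel" "n \<in> borel_measurable borel"
    and a_bd: "\<And>x. 1 / M \<le> a x" "\<And>x. a x \<le> M"
    and w_bd: "\<And>x. 1 / M \<le> w x" "\<And>x. w x \<le> M"
    and Q_bd: "\<And>x. \<bar>Q x\<bar> \<le> M" and n_bd: "\<And>x. \<bar>n x\<bar> \<le> K"
    and B: "locintb B"
begin

lemma a_pos: "0 < a x" and w_pos: "0 < w x"
  using a_bd(1)[of x] w_bd(1)[of x] M_ge by (auto intro: less_le_trans[rotated])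

lemma K_nonneg: "0 \<le> K"
  using n_bd[of 0] by simp

lemma locbdd_coeffs [locbdd_intros]: "locbdd a" "locbdd w" "locbdd Q" "locbdd n"
  using a_pos w_pos a_bd(2) w_bd(2) Q_bd n_bd
  by (auto intro!: locbdd_bounded[OF borel(1), of M] locbdd_bounded[OF borel(2), of M] locbdd_bounded[OF borel(3), of M]
      locbdd_bounded[OF borel(4), of K] simp: abs_of_pos)

lemmas [locintb_intros] = B

definition P :: "(real \<Rightarrow> complex) \<Rightarrow> (real \<Rightarrow> complex) \<Rightarrow> real \<Rightarrow> complex" where
  "P U r x = r x + of_real (n x) * U x"

definition dU :: "(real \<Rightarrow> complex) \<Rightarrow> (real \<Rightarrow> complex) \<Rightarrow> real \<Rightarrow> complex" where
  "dU U r x = (of_real (a x) * P U r x - \<i> * of_real (B x) * U x) / of_real h"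

text \<open>Formally h p' = (Q + h n' - i \<epsilon> w) U - w f - i B p. Subtracting h (n U)'
  cancels the singular term h n' U and leaves -n h U', the last term here.\<close>

definition dr :: "(real \<Rightarrow> complex) \<Rightarrow> (real \<Rightarrow> complex) \<Rightarrow> (real \<Rightarrow> complex) \<Rightarrow> real \<Rightarrow> complex" where
  "dr f U r x = ((of_real (Q x) - \<i> * of_real (\<epsilon> * w x)) * U x - of_real (w x) * f x - \<i> * of_real (B x) * P U r x
       - of_real (n x) * (of_real (a x) * P U r x - \<i> * of_real (B x) * U x)) / of_real h"

text \<open>Continuity on the whole line, even if the equations hold only on \<open>I\<close>, keeps
  \<open>U\<close> and \<open>r\<close> Borel and locally bounded without reference to
  \<open>I\<close>.\<close>

definition sol :: "real set \<Rightarrow> (real \<Rightarrow> complex) \<Rightarrow> (real \<Rightarrow> complex) \<Rightarrow> (real \<Rightarrow> complex) \<Rightarrow> bool" where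
  "sol I f U r \<longleftrightarrow> continuous_on UNIV U \<and> continuous_on UNIV r \<and> ac_on I U (dU U r) \<and> ac_on I r (dr f U r)"

lemma sol_locbdd [locbdd_intros]:
  assumes "sol I f U r" shows "locbdd U" "locbdd r" "locbdd (P U r)"
proof -
  show 1: "locbdd U" "locbdd r" using assms by (auto simp: sol_def intro: locbdd_continuous)
  show "locbdd (P U r)" unfolding P_def[abs_def] by (intro locbdd_intros 1)
qed

lemma pairing_ac:
  assumes s: "sol I f U r" and I: "is_interval I"
  shows "ac_on I (\<lambda>x. Re (cnj (U x) * r x)) (\<lambda>x. (a x * (cmod (P U r x))\<^sup>2 + Q x * (cmod (U x))\<^sup>2
       - 2 * n x * a x * Re (cnj (U x) * P U r x) - w x * Re (cnj (U x) * f x)) / h)"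
    "ac_on I (\<lambda>x. Im (cnj (U x) * r x)) (\<lambda>x. - (\<epsilon> * w x * (cmod (U x))\<^sup>2 + w x * Im (cnj (U x) * f x)) / h)"
proof -
  have ac: "ac_on I (\<lambda>x. cnj (U x) * r x) (\<lambda>x. cnj (dU U r x) * r x + cnj (U x) * dr f U r x)"
    using s unfolding sol_def by (intro ac_on_mult ac_on_bounded_linear[OF bounded_linear_cnj] I) auto
  have eq: "cnj (dU U r x) * r x + cnj (U x) * dr f U r x
     = (of_real (a x * (cmod (P U r x))\<^sup>2 + Q x * (cmod (U x))\<^sup>2 - 2 * n x * a x * Re (cnj (U x) * P U r x) - w x * Re (cnj (U x) * f x))
       - \<i> * of_real (\<epsilon> * w x * (cmod (U x))\<^sup>2 + w x * Im (cnj (U x) * f x))) / of_real h" for x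
    unfolding pairing_identity[OF P_def, where B = "B x" and f = "f x" and Q = "Q x" and a = "a x" and w = "w x" and e = \<epsilon>, symmetric] dU_def dr_def
    by (simp add: add_divide_distrib distrib_right)
  have Re: "Re ((of_real y - \<i> * of_real z) / of_real h) = y / h" and Im: "Im ((of_real y - \<i> * of_real z) / of_real h) = - z / h" for y z
    by (simp_all add: Re_divide_of_real Im_divide_of_real)
  show "ac_on I (\<lambda>x. Re (cnj (U x) * r x)) (\<lambda>x. (a x * (cmod (P U r x))\<^sup>2 + Q x * (cmod (U x))\<^sup>2
       - 2 * n x * a x * Re (cnj (U x) * P U r x) - w x * Re (cnj (U x) * f x)) / h)"
    using ac_on_bounded_linear[OF bounded_linear_Re ac] unfolding eq Re .
  show "ac_on I (\<lambda>x. Im (cnj (U x) * r x)) (\<lambda>x. - (\<epsilon> * w x * (cmod (U x))\<^sup>2 + w x * Im (cnj (U x) * f x)) / h)"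
    using ac_on_bounded_linear[OF bounded_linear_Im ac] unfolding eq Im .
qed

text \<open>Integrate the derivative of the imaginary part of the pairing. Apart from the source it
  has the fixed sign of -\<epsilon>, so for \<epsilon> \<noteq> 0 it controls the square integral of
  U.\<close>

lemma Im_estimate:
  assumes s: "sol {c..d} f U r" and cd: "c \<le> d" and f: "locintb f"
  shows "\<bar>\<epsilon>\<bar> / M * (LBINT x:{c..d}. (cmod (U x))\<^sup>2)
    \<le> h * (cmod (U c) * cmod (r c) + cmod (U d) * cmod (r d)) + M * (LBINT x:{c..d}. cmod (U x) * cmod (f x))"
proof -
  note [locbdd_intros] = sol_locbdd[OF s] and [locintb_intros] = f
  have i1: "set_integrable lborel {c..d} (\<lambda>x. w x * (cmod (U x))\<^sup>2)"
    by (intro locintbD(2) locintb_locbdd locbdd_intros)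
  have i2: "set_integrable lborel {c..d} (\<lambda>x. w x * Im (cnj (U x) * f x))"
    by (intro locintbD(2) locintb_intros locbdd_intros)
  have i3: "set_integrable lborel {c..d} (\<lambda>x. cmod (U x) * cmod (f x))"
    by (intro locintbD(2) locintb_mult locintb_norm f locbdd_intros)
  have i4: "set_integrable lborel {c..d} (\<lambda>x. (cmod (U x))\<^sup>2)"
    by (intro locintbD(2) locintb_locbdd locbdd_intros)
  define J where "J x = Im (cnj (U x) * r x)" for x
  have J: "\<bar>J x\<bar> \<le> cmod (U x) * cmod (r x)" for x
    unfolding J_def using abs_Im_le_cmod[of "cnj (U x) * r x"] by (simp add: norm_mult)
  have "J d - J c = (LBINT x:{c..d}. (- 1 / h) * (\<epsilon> * (w x * (cmod (U x))\<^sup>2) + w x * Im (cnj (U x) * f x)))"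
  proof -
    have "J d - J c = (LBINT x:{c..d}. - (\<epsilon> * w x * (cmod (U x))\<^sup>2 + w x * Im (cnj (U x) * f x)) / h)"
      unfolding J_def by (rule ac_onD(2)[OF pairing_ac(2)[OF s is_interval_cc], symmetric]) (use cd in auto)
    also have "\<dots> = (LBINT x:{c..d}. (- 1 / h) * (\<epsilon> * (w x * (cmod (U x))\<^sup>2) + w x * Im (cnj (U x) * f x)))"
      by (rule arg_cong[where f = "set_lebesgue_integral lborel {c..d}"]) (use h_pos in \<open>auto simp: fun_eq_iff field_simps\<close>)
    finally show ?thesis .
  qed
  also have "\<dots> = (- 1 / h) * (\<epsilon> * (LBINT x:{c..d}. w x * (cmod (U x))\<^sup>2) + (LBINT x:{c..d}. w x * Im (cnj (U x) * f x)))"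
    using i1 i2 by (simp only: set_integral_mult_right set_integral_add set_integrable_mult_right)
  finally have eq: "\<epsilon> * (LBINT x:{c..d}. w x * (cmod (U x))\<^sup>2) = h * (J c - J d) - (LBINT x:{c..d}. w x * Im (cnj (U x) * f x))"
    using h_pos by (simp add: field_simps)
  have "\<bar>LBINT x:{c..d}. w x * Im (cnj (U x) * f x)\<bar> \<le> (LBINT x:{c..d}. norm (w x * Im (cnj (U x) * f x)))"
    using set_integral_norm_bound[of "{c..d}" "\<lambda>x. w x * Im (cnj (U x) * f x)"] by simp
  also have "\<dots> \<le> (LBINT x:{c..d}. M * (cmod (U x) * cmod (f x)))"
  proof (rule set_integral_mono[OF set_integrable_norm[OF i2] set_integrable_mult_right[OF i3]])
    fix x show "norm (w x * Im (cnj (U x) * f x)) \<le> M * (cmod (U x) * cmod (f x))"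
      unfolding real_norm_def abs_mult using abs_Im_le_cmod[of "cnj (U x) * f x"] w_bd(2)[of x] w_pos[of x] M_ge
      by (intro mult_mono) (auto simp: norm_mult)
  qed
  finally have b: "\<bar>LBINT x:{c..d}. w x * Im (cnj (U x) * f x)\<bar> \<le> M * (LBINT x:{c..d}. cmod (U x) * cmod (f x))" by simp
  have "(LBINT x:{c..d}. (1/M) * (cmod (U x))\<^sup>2) \<le> (LBINT x:{c..d}. w x * (cmod (U x))\<^sup>2)"
    by (rule set_integral_mono[OF set_integrable_mult_right[OF i4] i1]) (rule mult_right_mono[OF w_bd(1)], simp)
  then have "\<bar>\<epsilon>\<bar> * ((1/M) * (LBINT x:{c..d}. (cmod (U x))\<^sup>2)) \<le> \<bar>\<epsilon>\<bar> * (LBINT x:{c..d}. w x * (cmod (U x))\<^sup>2)"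
    by (intro mult_left_mono) auto
  also have "\<dots> = \<bar>\<epsilon> * (LBINT x:{c..d}. w x * (cmod (U x))\<^sup>2)\<bar>"
    using w_pos by (simp add: abs_mult abs_of_nonneg set_integral_nonneg_on less_imp_le)
  also have "\<dots> \<le> \<bar>h * (J c - J d)\<bar> + \<bar>LBINT x:{c..d}. w x * Im (cnj (U x) * f x)\<bar>"
    unfolding eq by (rule abs_triangle_ineq4)
  also have "\<bar>h * (J c - J d)\<bar> \<le> h * (cmod (U c) * cmod (r c) + cmod (U d) * cmod (r d))"
    unfolding abs_mult using h_pos J[of c] J[of d] by (intro mult_mono) auto
  finally show ?thesis using b by simp
qed

text \<open>In the derivative of the real part of the pairing, the term a |p|^2 is at least |p|^2 /
  M. Young's inequality gives up half of a |p|^2 to the cross term 2 n a Re (cnj U * p), at the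
  price of 2 K^2 M |U|^2.\<close>

lemma Re_estimate:
  assumes s: "sol {c..d} f U r" and cd: "c \<le> d" and f: "locintb f"
  shows "(LBINT x:{c..d}. (cmod (P U r x))\<^sup>2)
    \<le> 2 * M * (h * (cmod (U c) * cmod (r c) + cmod (U d) * cmod (r d))
      + (M + 2 * K\<^sup>2 * M) * (LBINT x:{c..d}. (cmod (U x))\<^sup>2)
      + M * (LBINT x:{c..d}. cmod (U x) * cmod (f x)))"
proof -
  note [locbdd_intros] = sol_locbdd[OF s] and [locintb_intros] = f
  define X where "X x = a x * (cmod (P U r x))\<^sup>2 + Q x * (cmod (U x))\<^sup>2
       - 2 * n x * a x * Re (cnj (U x) * P U r x) - w x * Re (cnj (U x) * f x)" for x
  have X: "set_integrable lborel {c..d} X" unfolding X_def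
    by (intro locintbD(2) locintb_diff[OF locintb_locbdd] locintb_mult locintb_of_real_Re_Im f locbdd_intros)
  have i3: "set_integrable lborel {c..d} (\<lambda>x. cmod (U x) * cmod (f x))"
    by (intro locintbD(2) locintb_mult locintb_norm f locbdd_intros)
  have i4: "set_integrable lborel {c..d} (\<lambda>x. (cmod (U x))\<^sup>2)" and i5: "set_integrable lborel {c..d} (\<lambda>x. (cmod (P U r x))\<^sup>2)"
    by (intro locintbD(2) locintb_locbdd locbdd_intros)+
  define J where "J x = Re (cnj (U x) * r x)" for x
  have J: "\<bar>J x\<bar> \<le> cmod (U x) * cmod (r x)" for x
    unfolding J_def using abs_Re_le_cmod[of "cnj (U x) * r x"] by (simp add: norm_mult)
  have "J d - J c = (LBINT x:{c..d}. (1 / h) * X x)"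
  proof -
    have "J d - J c = (LBINT x:{c..d}. X x / h)"
      unfolding J_def X_def by (rule ac_onD(2)[OF pairing_ac(1)[OF s is_interval_cc], symmetric]) (use cd in auto)
    then show ?thesis by simp
  qed
  then have eq: "(LBINT x:{c..d}. X x) = h * (J d - J c)"
    using h_pos by (simp add: field_simps)
  let ?C = "M + 2 * K\<^sup>2 * M"
  have "(LBINT x:{c..d}. (1 / (2 * M)) * (cmod (P U r x))\<^sup>2) \<le> (LBINT x:{c..d}. X x + (?C * (cmod (U x))\<^sup>2 + M * (cmod (U x) * cmod (f x))))"
  proof (rule set_integral_mono)
    show "set_integrable lborel {c..d} (\<lambda>x. X x + (?C * (cmod (U x))\<^sup>2 + M * (cmod (U x) * cmod (f x))))"
      by (intro set_integral_add(1) X set_integrable_mult_right i3 i4)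
    fix x
    let ?u = "cmod (U x)" and ?p = "cmod (P U r x)"
    have 1: "\<bar>Q x\<bar> * ?u\<^sup>2 \<le> M * ?u\<^sup>2" using Q_bd[of x] by (intro mult_right_mono) auto
    have 2: "w x * Re (cnj (U x) * f x) \<le> M * (?u * cmod (f x))"
      by (rule order_trans[OF mult_left_mono[of _ "?u * cmod (f x)"] mult_right_mono[OF w_bd(2)]])
        (use complex_Re_le_cmod[of "cnj (U x) * f x"] w_pos[of x] in \<open>auto simp: norm_mult\<close>)
    have "\<bar>2 * n x * a x * Re (cnj (U x) * P U r x)\<bar> = 2 * a x * (\<bar>n x\<bar> * \<bar>Re (cnj (U x) * P U r x)\<bar>)"
      using a_pos[of x] by (simp add: abs_mult)
    also have "\<dots> \<le> 2 * a x * (\<bar>n x\<bar> * (?u * ?p))"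
      using a_pos[of x] abs_Re_le_cmod[of "cnj (U x) * P U r x"] by (intro mult_left_mono) (auto simp: norm_mult)
    also have "\<dots> = a x * (2 * (2 * \<bar>n x\<bar> * ?u) * (?p / 2) * 1) * 1" by simp
    also have "\<dots> \<le> a x * (2 * (n x)\<^sup>2 * ?u\<^sup>2 + ?p\<^sup>2 / 2)"
    proof -
      have "0 \<le> (2 * \<bar>n x\<bar> * ?u - ?p)\<^sup>2" by simp
      then have "2 * (2 * \<bar>n x\<bar> * ?u) * (?p / 2) \<le> 2 * (n x)\<^sup>2 * ?u\<^sup>2 + ?p\<^sup>2 / 2"
        by (simp add: power2_diff power_mult_distrib field_simps)
      then show ?thesis using a_pos[of x] by (simp add: mult_left_mono)
    qed
    also have "\<dots> = a x * (2 * (n x)\<^sup>2 * ?u\<^sup>2) + a x * ?p\<^sup>2 / 2" by (simp add: algebra_simps)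
    also have "a x * (2 * (n x)\<^sup>2 * ?u\<^sup>2) \<le> M * (2 * K\<^sup>2 * ?u\<^sup>2)"
      using a_bd(2)[of x] a_pos[of x] power_mono[OF n_bd[of x], of 2] M_ge
      by (intro mult_mono mult_right_mono) auto
    finally have 3: "2 * n x * a x * Re (cnj (U x) * P U r x) \<le> M * (2 * K\<^sup>2 * ?u\<^sup>2) + a x * ?p\<^sup>2 / 2" by simp
    have "1 / M * ?p\<^sup>2 \<le> a x * ?p\<^sup>2" using a_bd(1)[of x] by (intro mult_right_mono) auto
    then have 4: "1 / (2 * M) * ?p\<^sup>2 \<le> a x * ?p\<^sup>2 / 2" by (simp add: field_simps)
    show "1 / (2 * M) * ?p\<^sup>2 \<le> X x + (?C * ?u\<^sup>2 + M * (?u * cmod (f x)))"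
    proof -
      have "- (Q x * ?u\<^sup>2) \<le> M * ?u\<^sup>2"
        using 1 mult_right_mono[OF abs_ge_minus_self[of "Q x"], of "?u\<^sup>2"] by simp
      then show ?thesis using 2 3 4 unfolding X_def by (simp add: algebra_simps)
    qed
  qed (intro set_integrable_mult_right i5)
  also have "\<dots> = h * (J d - J c) + (?C * (LBINT x:{c..d}. (cmod (U x))\<^sup>2) + M * (LBINT x:{c..d}. cmod (U x) * cmod (f x)))"
    using X i3 i4 by (simp only: set_integral_add set_integral_mult_right set_integrable_mult_right eq)
  also have "h * (J d - J c) \<le> h * (cmod (U c) * cmod (r c) + cmod (U d) * cmod (r d))"
    using h_pos J[of c] J[of d] by (intro mult_left_mono) auto
  finally show ?thesis using M_ge by (simp add: field_simps)
qed

lemma r_le: "cmod (r x) \<le> cmod (P U r x) + K * cmod (U x)"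
proof -
  have "cmod (r x) = cmod (P U r x - of_real (n x) * U x)" by (simp add: P_def)
  also have "\<dots> \<le> cmod (P U r x) + \<bar>n x\<bar> * cmod (U x)" by (rule order_trans[OF norm_triangle_ineq4]) (simp add: norm_mult)
  also have "\<bar>n x\<bar> * cmod (U x) \<le> K * cmod (U x)" using n_bd[of x] by (intro mult_right_mono) auto
  finally show ?thesis by simp
qed

lemma pairing_le: "cmod (U x) * cmod (r x) \<le> (1 + K) * ((cmod (U x))\<^sup>2 + (cmod (P U r x))\<^sup>2)"
proof -
  let ?u = "cmod (U x)" and ?p = "cmod (P U r x)"
  have "?u * cmod (r x) \<le> ?u * (?p + K * ?u)" by (intro mult_left_mono r_le) auto
  also have "\<dots> = ?u * ?p + K * ?u\<^sup>2" by (simp add: algebra_simps power2_eq_square)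
  also have "?u * ?p \<le> ?u\<^sup>2 + ?p\<^sup>2"
  proof -
    have "0 \<le> ?u * ?p" by simp
    then show ?thesis using sum_squares_bound[of ?u ?p] unfolding mult.assoc by linarith
  qed
  also have "K * ?u\<^sup>2 \<le> K * (?u\<^sup>2 + ?p\<^sup>2)" using K_nonneg by (intro mult_left_mono) auto
  finally show ?thesis by (simp add: algebra_simps)
qed

text \<open>The interval estimates along a sequence of N whose boundary terms tend to 0; by
  \<open>pairing_le\<close> these terms are dominated by the integrable function |U|^2 +
  |p|^2.\<close>

lemma line_estimate:
  assumes s: "sol UNIV f U r" and UP: "U \<in> L2" "P U r \<in> L2" and f: "f \<in> L2"
  shows "\<bar>\<epsilon>\<bar> * (LBINT x. (cmod (U x))\<^sup>2) \<le> M\<^sup>2 * (LBINT x. cmod (U x) * cmod (f x))"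
    "(LBINT x. (cmod (P U r x))\<^sup>2) \<le> 2 * M * ((M + 2 * K\<^sup>2 * M) * (LBINT x. (cmod (U x))\<^sup>2)
       + M * (LBINT x. cmod (U x) * cmod (f x)))"
proof -
  let ?q = "\<lambda>x. (cmod (U x))\<^sup>2 + (cmod (P U r x))\<^sup>2"
  have q: "integrable lborel ?q" using UP by (auto simp: L2_def)
  have iU: "integrable lborel (\<lambda>x. (cmod (U x))\<^sup>2)" and iP: "integrable lborel (\<lambda>x. (cmod (P U r x))\<^sup>2)"
    using UP by (auto simp: L2_def)
  have iD: "integrable lborel (\<lambda>x. cmod (U x) * cmod (f x))" by (rule L2_mult_integrable[OF UP(1) f])
  have sub: "(LBINT x:{-N..N}. g x) \<le> (LBINT x. g x)" if "integrable lborel g" "\<And>x. 0 \<le> g x" for g :: "real \<Rightarrow> real" and N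
    unfolding set_lebesgue_integral_def
    by (rule integral_mono[OF integrable_mult_indicator[OF _ that(1)] that(1)]) (use that in \<open>auto simp: indicator_def\<close>)
  have sN: "sol {-N..N} f U r" for N using s by (auto simp: sol_def intro: ac_on_subset)
  define D where "D = (LBINT x. cmod (U x) * cmod (f x))"
  have bd: "\<exists>N\<ge>N0. N \<ge> 0 \<and> h * (cmod (U (-N)) * cmod (r (-N)) + cmod (U N) * cmod (r N)) \<le> \<delta>" if \<delta>: "0 < \<delta>" for N0 \<delta>
  proof -
    have K1: "0 < h * (1 + K)" using h_pos K_nonneg by simp
    obtain N where N: "N \<ge> max N0 0" "?q N + ?q (-N) < \<delta> / (h * (1 + K))"
      using small_boundary[OF q, of "\<delta> / (h * (1 + K))" "max N0 0"] \<delta> K1 by auto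
    have "cmod (U (-N)) * cmod (r (-N)) + cmod (U N) * cmod (r N) \<le> (1 + K) * (?q N + ?q (-N))"
      using pairing_le[of U N r] pairing_le[of U "-N" r] by (simp add: algebra_simps)
    then have "h * (cmod (U (-N)) * cmod (r (-N)) + cmod (U N) * cmod (r N)) \<le> h * ((1 + K) * (?q N + ?q (-N)))"
      using h_pos by (intro mult_left_mono) auto
    also have "\<dots> \<le> \<delta>" using N(2) K1 by (simp add: field_simps)
    finally show ?thesis using N(1) by auto
  qed
  have M0: "0 < M" using M_ge by simp
  have e0: "0 < \<bar>\<epsilon>\<bar>" using eps by simp
  have fl: "locintb f" by (rule L2_locintb[OF f])
  show 1: "\<bar>\<epsilon>\<bar> * (LBINT x. (cmod (U x))\<^sup>2) \<le> M\<^sup>2 * (LBINT x. cmod (U x) * cmod (f x))"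
  proof -
    have "(LBINT x. (cmod (U x))\<^sup>2) \<le> M\<^sup>2 * D / \<bar>\<epsilon>\<bar>"
    proof (rule integral_le_exhaustion[OF iU])
      fix N0 \<delta> :: real assume \<delta>: "0 < \<delta>"
      obtain N where N: "N \<ge> N0" "N \<ge> 0" "h * (cmod (U (-N)) * cmod (r (-N)) + cmod (U N) * cmod (r N)) \<le> \<delta> * \<bar>\<epsilon>\<bar> / M"
        using bd[of "\<delta> * \<bar>\<epsilon>\<bar> / M" N0] \<delta> e0 M0 by auto
      have "\<bar>\<epsilon>\<bar> / M * (LBINT x:{-N..N}. (cmod (U x))\<^sup>2) \<le> \<delta> * \<bar>\<epsilon>\<bar> / M + M * D"
        using Im_estimate[OF sN[of N] _ fl] N sub[OF iD, of N] M0 unfolding D_def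
        by (smt (verit) mult_left_mono mult_nonneg_nonneg norm_ge_zero)
      then have "(LBINT x:{-N..N}. (cmod (U x))\<^sup>2) \<le> M\<^sup>2 * D / \<bar>\<epsilon>\<bar> + \<delta>"
        using e0 M0 by (simp add: field_simps power2_eq_square)
      then show "\<exists>N\<ge>N0. (LBINT x:{-N..N}. (cmod (U x))\<^sup>2) \<le> M\<^sup>2 * D / \<bar>\<epsilon>\<bar> + \<delta>" using N by blast
    qed simp
    then show ?thesis using e0 by (simp add: field_simps D_def)
  qed
  show "(LBINT x. (cmod (P U r x))\<^sup>2) \<le> 2 * M * ((M + 2 * K\<^sup>2 * M) * (LBINT x. (cmod (U x))\<^sup>2)
       + M * (LBINT x. cmod (U x) * cmod (f x)))"
  proof (rule integral_le_exhaustion[OF iP])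
    fix N0 \<delta> :: real assume \<delta>: "0 < \<delta>"
    obtain N where N: "N \<ge> N0" "N \<ge> 0" "h * (cmod (U (-N)) * cmod (r (-N)) + cmod (U N) * cmod (r N)) \<le> \<delta> / (2 * M)"
      using bd[of "\<delta> / (2 * M)" N0] \<delta> M0 by auto
    have "(LBINT x:{-N..N}. (cmod (P U r x))\<^sup>2) \<le> 2 * M * (h * (cmod (U (-N)) * cmod (r (-N)) + cmod (U N) * cmod (r N))
      + (M + 2 * K\<^sup>2 * M) * (LBINT x:{-N..N}. (cmod (U x))\<^sup>2) + M * (LBINT x:{-N..N}. cmod (U x) * cmod (f x)))"
      using Re_estimate[OF sN[of N] _ fl] N by simp
    also have "\<dots> \<le> 2 * M * (\<delta> / (2 * M) + (M + 2 * K\<^sup>2 * M) * (LBINT x. (cmod (U x))\<^sup>2) + M * D)"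
      using N(3) M0 sub[OF iU, of N] sub[OF iD, of N] unfolding D_def
      by (intro mult_left_mono add_mono) auto
    also have "\<dots> = 2 * M * ((M + 2 * K\<^sup>2 * M) * (LBINT x. (cmod (U x))\<^sup>2) + M * D) + \<delta>"
      using M0 by (simp add: field_simps)
    finally show "\<exists>N\<ge>N0. (LBINT x:{-N..N}. (cmod (P U r x))\<^sup>2) \<le> 2 * M * ((M + 2 * K\<^sup>2 * M) * (LBINT x. (cmod (U x))\<^sup>2)
       + M * (LBINT x. cmod (U x) * cmod (f x))) + \<delta>" using N(1) unfolding D_def by blast
  qed simp
qed

end

section \<open>Existence of square integrable solutions\<close>

text \<open>Dominated convergence in the integral form of a linear equation. Bounds and equations
  are asked only from some index on, since the approximations live on growing intervals.\<close>

lemma ac_on_limit: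
  fixes U V X :: "nat \<Rightarrow> real \<Rightarrow> complex"
  assumes d: "locintb d1" "locintb d2" "locintb e"
    and m: "\<And>k. U k \<in> borel_measurable borel" "\<And>k. V k \<in> borel_measurable borel"
    and lim: "\<And>x. (\<lambda>k. U k x) \<longlonglongrightarrow> u x" "\<And>x. (\<lambda>k. V k x) \<longlonglongrightarrow> v x" "\<And>x. (\<lambda>k. X k x) \<longlonglongrightarrow> w x"
    and bd: "\<And>N. \<exists>C. \<forall>\<^sub>F k in sequentially. \<forall>x\<in>{-N..N}. norm (U k x) \<le> C \<and> norm (V k x) \<le> C"
    and eq: "\<And>N. \<forall>\<^sub>F k in sequentially. ac_on {-N..N} (X k) (\<lambda>x. d1 x * U k x + d2 x * V k x + e x)"
  shows "ac_on UNIV w (\<lambda>x. d1 x * u x + d2 x * v x + e x)"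
  unfolding ac_on_def
proof (intro ballI impI)
  fix a b :: real assume ab: "a \<le> b"
  define N where "N = max \<bar>a\<bar> \<bar>b\<bar>"
  have sub: "x \<in> {-N..N}" if "x \<in> {a..b}" for x
  proof -
    have "a \<le> x" "x \<le> b" using that by auto
    then have "- max \<bar>a\<bar> \<bar>b\<bar> \<le> x" "x \<le> max \<bar>a\<bar> \<bar>b\<bar>" by linarith+
    then show ?thesis by (simp add: N_def)
  qed
  obtain C where C: "\<forall>\<^sub>F k in sequentially. \<forall>x\<in>{-N..N}. norm (U k x) \<le> C \<and> norm (V k x) \<le> C" using bd by blast
  obtain k0 where k0: "\<And>k x. k \<ge> k0 \<Longrightarrow> x \<in> {a..b} \<Longrightarrow> norm (U k x) \<le> C \<and> norm (V k x) \<le> C"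
    "\<And>k. k \<ge> k0 \<Longrightarrow> ac_on {-N..N} (X k) (\<lambda>x. d1 x * U k x + d2 x * V k x + e x)"
    using eventually_conj[OF C eq[of N]] sub unfolding eventually_sequentially by blast
  let ?g = "\<lambda>k x. d1 x * U k x + d2 x * V k x + e x"
  let ?h = "\<lambda>x. d1 x * u x + d2 x * v x + e x"
  have dm: "d1 \<in> borel_measurable borel" "d2 \<in> borel_measurable borel" "e \<in> borel_measurable borel"
    using d locintbD(1) by auto
  have gm: "?g k \<in> borel_measurable borel" for k using dm m by measurable
  have um: "u \<in> borel_measurable borel" "v \<in> borel_measurable borel"
    using borel_measurable_LIMSEQ_metric[OF m(1) lim(1)] borel_measurable_LIMSEQ_metric[OF m(2) lim(2)] by auto
  have hm: "?h \<in> borel_measurable borel" using dm um by measurable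
  have dom: "integrable lborel (\<lambda>x. indicator {a..b} x *\<^sub>R (norm (d1 x) * C + norm (d2 x) * C + norm (e x)))"
    using locintbD(2)[of "\<lambda>x. norm (d1 x) * C + norm (d2 x) * C + norm (e x)" a b]
      d locintb_mult[OF locbdd_const[of C] locintb_norm, of d1] locintb_mult[OF locbdd_const[of C] locintb_norm, of d2]
    unfolding set_integrable_def by (simp add: locintb_add locintb_norm mult.commute)
  have le: "norm (indicat_real {a..b} x *\<^sub>R ?g (k + k0) x) \<le> indicator {a..b} x *\<^sub>R (norm (d1 x) * C + norm (d2 x) * C + norm (e x))" for k x
  proof (cases "x \<in> {a..b}")
    case True
    have "norm (?g (k + k0) x) \<le> norm (d1 x * U (k + k0) x) + norm (d2 x * V (k + k0) x) + norm (e x)"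
      by (intro norm_triangle_mono order_refl)
    also have "\<dots> \<le> norm (d1 x) * C + norm (d2 x) * C + norm (e x)"
      unfolding norm_mult using k0(1)[OF _ True, of "k + k0"] by (intro add_mono mult_left_mono) auto
    finally show ?thesis using True by simp
  qed simp
  have ptw: "(\<lambda>k. indicat_real {a..b} x *\<^sub>R ?g (k + k0) x) \<longlonglongrightarrow> indicat_real {a..b} x *\<^sub>R ?h x" for x
    using LIMSEQ_ignore_initial_segment[OF lim(1)] LIMSEQ_ignore_initial_segment[OF lim(2)] by (intro tendsto_intros) auto
  have m1: "(\<lambda>x. indicat_real {a..b} x *\<^sub>R ?h x) \<in> borel_measurable lborel" using hm by measurable
  have m2: "(\<lambda>x. indicat_real {a..b} x *\<^sub>R ?g (k + k0) x) \<in> borel_measurable lborel" for k using gm by measurable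
  have I: "set_integrable lborel {a..b} ?h"
    unfolding set_integrable_def
    by (rule integrable_dominated_convergence[OF m1 _ dom, where s = "\<lambda>k x. indicat_real {a..b} x *\<^sub>R ?g (k + k0) x"]) (intro m2 AE_I2 ptw le)+
  have L: "(\<lambda>k. LBINT x:{a..b}. ?g (k + k0) x) \<longlonglongrightarrow> (LBINT x:{a..b}. ?h x)"
    unfolding set_lebesgue_integral_def
    by (rule integral_dominated_convergence[OF m1 _ dom, where s = "\<lambda>k x. indicat_real {a..b} x *\<^sub>R ?g (k + k0) x"]) (intro m2 AE_I2 ptw le)+
  have E: "(LBINT x:{a..b}. ?g (k + k0) x) = X (k + k0) b - X (k + k0) a" for k
    using ac_onD(2)[OF k0(2)[of "k + k0"], of a b] sub[of a] sub[of b] ab by simp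
  have "(\<lambda>k. LBINT x:{a..b}. ?g (k + k0) x) \<longlonglongrightarrow> w b - w a"
    unfolding E by (intro tendsto_intros LIMSEQ_ignore_initial_segment lim)
  with L have "(LBINT x:{a..b}. ?h x) = w b - w a" by (rule LIMSEQ_unique)
  with I show "set_integrable lborel {a..b} ?h \<and> (LBINT x:{a..b}. ?h x) = w b - w a" by simp
qed

lemma Re_mult_bound: "\<bar>Re (z * w)\<bar> \<le> cmod z * cmod w"
  using abs_Re_le_cmod[of "z * w"] by (simp add: norm_mult)

lemma self_le_power2_add_1: "(x::real) \<le> x\<^sup>2 + 1"
  using zero_le_power2[of "x - 1"] zero_le_power2[of x] unfolding power2_diff one_power2 by linarith

context reduced_system
begin

definition c11 :: "real \<Rightarrow> complex" where "c11 x = (of_real (a x * n x) - \<i> * of_real (B x)) / of_real h"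
definition c12 :: "real \<Rightarrow> complex" where "c12 x = of_real (a x / h)"
definition c21 :: "real \<Rightarrow> complex" where "c21 x = (of_real (Q x - (n x)\<^sup>2 * a x) - \<i> * of_real (\<epsilon> * w x)) / of_real h"
definition c22 :: "real \<Rightarrow> complex" where "c22 x = (- of_real (a x * n x) - \<i> * of_real (B x)) / of_real h"

lemma dU_eq: "dU U r x = c11 x * U x + c12 x * r x"
  unfolding dU_def P_def c11_def c12_def using h_pos by (simp add: field_simps)

lemma dr_eq: "dr f U r x = c21 x * U x + c22 x * r x + (- of_real (w x / h) * f x)"
  unfolding dr_def P_def c21_def c22_def using h_pos by (simp add: field_simps power2_eq_square)

lemma locintb_coeffs: "locintb c11" "locintb c12" "locintb c21" "locintb c22"
proof -
  have c: "locintb (\<lambda>x. (1 / of_real h) * g x)" if "locintb g" for g :: "real \<Rightarrow> complex"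
    by (rule locintb_mult[OF locbdd_const that])
  have B': "locintb (\<lambda>x. \<i> * complex_of_real (B x))"
    by (intro locintb_mult locbdd_const locintb_of_real_Re_Im B)
  have "locintb (\<lambda>x. of_real (a x * n x) - \<i> * complex_of_real (B x))"
    "locintb (\<lambda>x. - of_real (a x * n x) - \<i> * complex_of_real (B x))"
    by (intro locintb_diff[OF locintb_locbdd B'] locbdd_intros)+
  from this[THEN c] show "locintb c11" "locintb c22" by (auto simp: c11_def[abs_def] c22_def[abs_def])
  have "locintb (\<lambda>x. of_real (Q x - (n x)\<^sup>2 * a x) - \<i> * of_real (\<epsilon> * w x))" "locintb (\<lambda>x. complex_of_real (a x))"
    by (intro locintb_locbdd locbdd_intros)+
  from this[THEN c] show "locintb c21" "locintb c12" by (auto simp: c21_def[abs_def] c12_def[abs_def])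
qed

lemma sol_lincomb:
  assumes "sol I f U r" "sol I g V s"
  shows "sol I (\<lambda>x. f x + c * g x) (\<lambda>x. U x + c * V x) (\<lambda>x. r x + c * s x)"
proof -
  have "dU (\<lambda>x. U x + c * V x) (\<lambda>x. r x + c * s x) = (\<lambda>x. dU U r x + c * dU V s x)"
    "dr (\<lambda>x. f x + c * g x) (\<lambda>x. U x + c * V x) (\<lambda>x. r x + c * s x) = (\<lambda>x. dr f U r x + c * dr g V s x)"
    unfolding dU_eq dr_eq by (auto simp: algebra_simps)
  then show ?thesis using assms unfolding sol_def by (auto intro!: continuous_intros ac_on_add ac_on_cmult)
qed

lemma P_lincomb: "P (\<lambda>x. U x + c * V x) (\<lambda>x. r x + c * s x) x = P U r x + c * P V s x"
  by (simp add: P_def algebra_simps)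

text \<open>Growth rate of |U|^2 + |r|^2. It serves only existence at fixed h, where its size as h
  tends to 0 does no harm.\<close>

definition G0 :: real where "G0 = 2 / h * (M * (2 + \<bar>\<epsilon>\<bar> + K\<^sup>2 + K))"

lemma G0_nonneg: "0 \<le> G0"
  unfolding G0_def using h_pos M_ge K_nonneg by (intro mult_nonneg_nonneg divide_nonneg_pos) auto

lemma energy_ac:
  assumes s: "sol I f U r" and I: "is_interval I"
  shows "ac_on I (\<lambda>x. (cmod (U x))\<^sup>2 + (cmod (r x))\<^sup>2) (\<lambda>x. 2 * Re (cnj (U x) * dU U r x) + 2 * Re (cnj (r x) * dr f U r x))"
proof -
  have sq: "ac_on I (\<lambda>x. (cmod (V x))\<^sup>2) (\<lambda>x. 2 * Re (cnj (V x) * v x))" if "ac_on I V v" for V v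
  proof -
    have "ac_on I (\<lambda>x. Re (cnj (V x) * V x)) (\<lambda>x. Re (cnj (v x) * V x + cnj (V x) * v x))"
      by (intro ac_on_bounded_linear[OF bounded_linear_Re] ac_on_mult ac_on_bounded_linear[OF bounded_linear_cnj] that I)
    then show ?thesis
      by (rule ac_on_cong[OF _ _ _ I]) (simp_all add: cmod_power2 power2_eq_square[of "Re _"] power2_eq_square[of "Im _"])
  qed
  show ?thesis using s unfolding sol_def by (intro ac_on_add sq) auto
qed

lemma energy_derivative_bound:
  "\<bar>2 * Re (cnj (U x) * dU U r x) + 2 * Re (cnj (r x) * dr f U r x)\<bar>
    \<le> G0 * ((cmod (U x))\<^sup>2 + (cmod (r x))\<^sup>2) + 2 * M / h * (cmod (f x) * cmod (r x))"
proof -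
  let ?u = "cmod (U x)" and ?r = "cmod (r x)" and ?z = "(cmod (U x))\<^sup>2 + (cmod (r x))\<^sup>2"
  let ?q = "of_real (Q x - (n x)\<^sup>2 * a x) - \<i> * complex_of_real (\<epsilon> * w x)"
  have e1: "Re (cnj (U x) * dU U r x) = (a x * n x * ?u\<^sup>2 + a x * Re (cnj (U x) * r x)) / h"
    unfolding dU_eq c11_def c12_def cmod_power2 using h_pos
    by (simp add: field_simps power2_eq_square)
  have e2: "Re (cnj (r x) * dr f U r x) = (Re (cnj (r x) * (?q * U x)) - a x * n x * ?r\<^sup>2 - w x * Re (cnj (r x) * f x)) / h"
    unfolding dr_eq c21_def c22_def cmod_power2 using h_pos
    by (simp add: field_simps power2_eq_square)
  have na: "\<bar>a x * n x\<bar> \<le> M * K"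
    unfolding abs_mult using a_bd(2)[of x] a_pos[of x] n_bd[of x] by (intro mult_mono) auto
  have q: "cmod ?q \<le> M + K\<^sup>2 * M + \<bar>\<epsilon>\<bar> * M"
  proof -
    have "cmod ?q \<le> \<bar>Q x - (n x)\<^sup>2 * a x\<bar> + \<bar>\<epsilon> * w x\<bar>"
      using norm_triangle_ineq4[of "complex_of_real (Q x - (n x)\<^sup>2 * a x)" "\<i> * complex_of_real (\<epsilon> * w x)"]
      unfolding norm_mult norm_of_real norm_ii by simp
    also have "\<bar>Q x - (n x)\<^sup>2 * a x\<bar> \<le> \<bar>Q x\<bar> + \<bar>(n x)\<^sup>2 * a x\<bar>" by (rule abs_triangle_ineq4)
    also have "\<bar>(n x)\<^sup>2 * a x\<bar> \<le> K\<^sup>2 * M"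
      unfolding abs_mult using a_bd(2)[of x] a_pos[of x] power_mono[OF n_bd[of x], of 2] by (intro mult_mono) auto
    also have "\<bar>\<epsilon> * w x\<bar> \<le> \<bar>\<epsilon>\<bar> * M"
      unfolding abs_mult using w_bd(2)[of x] w_pos[of x] by (intro mult_left_mono) auto
    finally show ?thesis using Q_bd[of x] by simp
  qed
  have ur: "?u * ?r \<le> ?z"
  proof -
    have "0 \<le> ?u * ?r" by simp
    then show ?thesis using sum_squares_bound[of ?u ?r] unfolding mult.assoc by linarith
  qed
  have z0: "0 \<le> ?z" by simp
  have M0: "0 < M" using M_ge by simp
  have t1: "\<bar>a x * n x * ?u\<^sup>2\<bar> + \<bar>a x * n x * ?r\<^sup>2\<bar> \<le> M * K * ?z"
  proof -
    have "\<bar>a x * n x * ?u\<^sup>2\<bar> + \<bar>a x * n x * ?r\<^sup>2\<bar> = \<bar>a x * n x\<bar> * ?z" by (simp add: abs_mult distrib_left)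
    also have "\<dots> \<le> M * K * ?z" by (rule mult_right_mono[OF na z0])
    finally show ?thesis .
  qed
  have t2: "\<bar>a x * Re (cnj (U x) * r x)\<bar> \<le> M * ?z"
  proof -
    have "\<bar>a x * Re (cnj (U x) * r x)\<bar> \<le> a x * (?u * ?r)"
      unfolding abs_mult using a_pos[of x] Re_mult_bound[of "cnj (U x)" "r x"] by (simp add: mult_left_mono)
    also have "\<dots> \<le> M * ?z" using a_bd(2)[of x] a_pos[of x] M0 ur by (intro mult_mono) auto
    finally show ?thesis .
  qed
  have t3: "\<bar>Re (cnj (r x) * (?q * U x))\<bar> \<le> (M + K\<^sup>2 * M + \<bar>\<epsilon>\<bar> * M) * ?z"
  proof -
    have "\<bar>Re (cnj (r x) * (?q * U x))\<bar> \<le> cmod (cnj (r x)) * cmod (?q * U x)" by (rule Re_mult_bound)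
    also have "\<dots> = cmod ?q * (?u * ?r)" by (simp add: norm_mult mult_ac del: of_real_mult of_real_diff)
    also have "\<dots> \<le> (M + K\<^sup>2 * M + \<bar>\<epsilon>\<bar> * M) * ?z"
      using M0 by (intro mult_mono q ur) auto
    finally show ?thesis .
  qed
  have t4: "\<bar>w x * Re (cnj (r x) * f x)\<bar> \<le> M * (cmod (f x) * ?r)"
  proof -
    have "\<bar>w x * Re (cnj (r x) * f x)\<bar> \<le> w x * (?r * cmod (f x))"
      unfolding abs_mult using w_pos[of x] Re_mult_bound[of "cnj (r x)" "f x"] by (simp add: mult_left_mono)
    also have "\<dots> \<le> M * (?r * cmod (f x))" using w_bd(2)[of x] by (intro mult_right_mono) auto
    finally show ?thesis by (simp add: mult.commute)
  qed
  have gen: "\<bar>A + C + (D - B - E)\<bar> \<le> k1 + k2 + k3 + k4" if "\<bar>A\<bar> + \<bar>B\<bar> \<le> k1" "\<bar>C\<bar> \<le> k2" "\<bar>D\<bar> \<le> k3" "\<bar>E\<bar> \<le> k4"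
    for A B C D E k1 k2 k3 k4 :: real
    using that by linarith
  have dd: "2 * (X / h) + 2 * (Y / h) = 2 / h * (X + Y)" for X Y by (simp add: add_divide_distrib distrib_left)
  have "\<bar>2 * Re (cnj (U x) * dU U r x) + 2 * Re (cnj (r x) * dr f U r x)\<bar>
     = \<bar>2 / h * ((a x * n x * ?u\<^sup>2 + a x * Re (cnj (U x) * r x)) + (Re (cnj (r x) * (?q * U x)) - a x * n x * ?r\<^sup>2 - w x * Re (cnj (r x) * f x)))\<bar>"
    unfolding e1 e2 dd ..
  also have "\<dots> = 2 / h * \<bar>(a x * n x * ?u\<^sup>2 + a x * Re (cnj (U x) * r x)) + (Re (cnj (r x) * (?q * U x)) - a x * n x * ?r\<^sup>2 - w x * Re (cnj (r x) * f x))\<bar>"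
    by (subst abs_mult) (use h_pos in \<open>simp only: abs_divide abs_of_pos abs_numeral\<close>)
  also have "\<dots> \<le> 2 / h * (M * K * ?z + M * ?z + (M + K\<^sup>2 * M + \<bar>\<epsilon>\<bar> * M) * ?z + M * (cmod (f x) * ?r))"
    by (rule mult_left_mono[OF gen[OF t1 t2 t3 t4]]) (use h_pos in simp)
  also have "\<dots> = G0 * ?z + 2 * M / h * (cmod (f x) * ?r)"
    unfolding G0_def by (simp add: algebra_simps)
  finally show ?thesis .
qed

text \<open>The 1 added to the energy makes |r| \<le> z, so the source enters as a multiple of z and
  a single exponential factor bounds the growth in both directions.\<close>

lemma growth_inhomogeneous:
  assumes s: "sol {c..d} f U r" and f: "locintb f" and cd: "c \<le> d"
  defines "z \<equiv> \<lambda>x. (cmod (U x))\<^sup>2 + (cmod (r x))\<^sup>2 + 1"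
  defines "E \<equiv> exp (LBINT t:{c..d}. G0 + 2 * M / h * cmod (f t))"
  shows "z d \<le> E * z c" "z c \<le> E * z d"
proof -
  let ?z' = "\<lambda>x. 2 * Re (cnj (U x) * dU U r x) + 2 * Re (cnj (r x) * dr f U r x) + 0"
  have ac: "ac_on {c..d} z ?z'"
    unfolding z_def by (intro ac_on_add[OF energy_ac[OF s] ac_on_const]) (rule is_interval_cc)
  have g: "set_integrable lborel {c..d} (\<lambda>t. G0 + 2 * M / h * cmod (f t))"
    by (intro locintbD(2) locintb_add locintb_const locintb_mult locbdd_const locintb_norm f)
  have g0: "0 \<le> G0 + 2 * M / h * cmod (f t)" for t
    using G0_nonneg M_ge h_pos by (intro add_nonneg_nonneg mult_nonneg_nonneg divide_nonneg_pos) auto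
  have le: "\<bar>?z' t\<bar> \<le> (G0 + 2 * M / h * cmod (f t)) * z t" for t
  proof -
    have rz: "cmod (r t) \<le> z t"
      unfolding z_def using self_le_power2_add_1[of "cmod (r t)"] zero_le_power2[of "cmod (U t)"] by linarith
    have "\<bar>?z' t\<bar> \<le> G0 * ((cmod (U t))\<^sup>2 + (cmod (r t))\<^sup>2) + 2 * M / h * (cmod (f t) * cmod (r t))"
      using energy_derivative_bound[of U t r f] by simp
    also have "\<dots> \<le> G0 * z t + 2 * M / h * (cmod (f t) * z t)"
      using G0_nonneg M_ge h_pos rz by (intro add_mono mult_left_mono) (auto simp: z_def)
    finally show ?thesis by (simp add: distrib_right mult.assoc)
  qed
  show "z d \<le> E * z c"
    using gronwall_forward[OF ac cd g g0, of "\<lambda>t. 0"] le by (auto simp: E_def set_integrable_def abs_le_iff)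
  show "z c \<le> E * z d"
    using gronwall_backward[OF ac cd g] le by (auto simp: E_def abs_le_iff)
qed

text \<open>Without a source the bound is proportional to the energy itself. It applies to
  differences of solutions, and it keeps a solution with nonzero data away from 0.\<close>

lemma growth_homogeneous:
  assumes s: "sol {c..d} (\<lambda>x. 0) U r" and cd: "c \<le> d"
  defines "z \<equiv> \<lambda>x. (cmod (U x))\<^sup>2 + (cmod (r x))\<^sup>2"
  shows "z d \<le> exp (G0 * (d - c)) * z c" "z c \<le> exp (G0 * (d - c)) * z d"
proof -
  let ?z' = "\<lambda>x. 2 * Re (cnj (U x) * dU U r x) + 2 * Re (cnj (r x) * dr (\<lambda>x. 0) U r x)"
  have ac: "ac_on {c..d} z ?z'"
    unfolding z_def by (rule energy_ac[OF s]) (rule is_interval_cc)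
  have g: "set_integrable lborel {c..d} (\<lambda>t. G0)" by (intro locintbD(2) locintb_const)
  have le: "\<bar>?z' t\<bar> \<le> G0 * z t" for t
    using energy_derivative_bound[of U t r "\<lambda>x. 0"] by (simp add: z_def)
  have i: "(LBINT t:{c..d}. G0) = G0 * (d - c)" using cd by (simp add: set_lebesgue_integral_def)
  show "z d \<le> exp (G0 * (d - c)) * z c"
    using gronwall_forward[OF ac cd g G0_nonneg, of "\<lambda>t. 0"] le by (auto simp: set_integrable_def abs_le_iff i)
  show "z c \<le> exp (G0 * (d - c)) * z d"
    using gronwall_backward[OF ac cd g] le by (auto simp: abs_le_iff i)
qed

lemma sol_initial_value:
  assumes f: "locintb f" and cd: "c \<le> d"
  shows "\<exists>U r. sol {c..d} f U r \<and> U c = u0 \<and> r c = r0"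
proof -
  have f2: "locintb (\<lambda>x. - of_real (w x / h) * f x)"
    using locintb_mult[OF locbdd_mult[OF locbdd_of_real[OF locbdd_coeffs(2)] locbdd_const[of "- 1 / of_real h"]] f] by simp
  obtain U V where UV: "U c = u0" "V c = r0" "ac_on {c..d} U (\<lambda>x. c11 x * U x + c12 x * V x + 0)"
      "ac_on {c..d} V (\<lambda>x. c21 x * U x + c22 x * V x + (- of_real (w x / h) * f x))"
    using linear_ode_exists[OF cd locintb_coeffs(1)[THEN locintbD(2)] locintb_coeffs(2)[THEN locintbD(2)]
        locintb_coeffs(3)[THEN locintbD(2)] locintb_coeffs(4)[THEN locintbD(2)] locintb_const[of 0, THEN locintbD(2)] f2[THEN locintbD(2)], of u0 r0]
    by (elim exE conjE) (rule that)
  \<comment> \<open>Freezing the solution at the endpoints extends it continuously to the line, as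
    \<open>sol\<close> demands.\<close>
  define k where "k x = max c (min d x)" for x
  have k: "k x \<in> {c..d}" "x \<in> {c..d} \<Longrightarrow> k x = x" for x using cd by (auto simp: k_def)
  have kc: "continuous_on UNIV k" unfolding k_def by (intro continuous_intros)
  have "range k \<subseteq> {c..d}" using k(1) by blast
  then have c: "continuous_on UNIV (\<lambda>x. U (k x))" "continuous_on UNIV (\<lambda>x. V (k x))"
    by (rule continuous_on_compose2[OF ac_on_continuous[OF UV(3)] kc] continuous_on_compose2[OF ac_on_continuous[OF UV(4)] kc])+
  have "ac_on {c..d} (\<lambda>x. U (k x)) (\<lambda>x. c11 x * U (k x) + c12 x * V (k x))"
    by (rule ac_on_cong[OF UV(3) _ _ is_interval_cc]) (simp_all add: k(2))
  moreover have "ac_on {c..d} (\<lambda>x. V (k x)) (\<lambda>x. c21 x * U (k x) + c22 x * V (k x) + (- of_real (w x / h) * f x))"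
    by (rule ac_on_cong[OF UV(4) _ _ is_interval_cc]) (simp_all add: k(2))
  ultimately have "sol {c..d} f (\<lambda>x. U (k x)) (\<lambda>x. V (k x))"
    unfolding sol_def dU_eq[abs_def] dr_eq[abs_def] using c by blast
  moreover have "k c = c" using k(2) cd by auto
  ultimately show ?thesis using UV(1,2) by (intro exI[of _ "\<lambda>x. U (k x)"] exI[of _ "\<lambda>x. V (k x)"]) auto
qed

section \<open>Dirichlet problems on bounded intervals\<close>

lemma energy_le: "(cmod (U x))\<^sup>2 + (cmod (r x))\<^sup>2 \<le> (1 + 2 * K\<^sup>2) * (cmod (U x))\<^sup>2 + 2 * (cmod (P U r x))\<^sup>2"
proof -
  have "(cmod (r x))\<^sup>2 \<le> (cmod (P U r x) + K * cmod (U x))\<^sup>2" by (intro power_mono r_le) auto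
  also have "\<dots> \<le> 2 * (cmod (P U r x))\<^sup>2 + 2 * (K * cmod (U x))\<^sup>2"
    using sum_squares_bound[of "cmod (P U r x)" "K * cmod (U x)"] by (simp add: power2_sum)
  finally show ?thesis by (simp add: algebra_simps power_mult_distrib)
qed

lemma energy_integral_le:
  assumes s: "sol {c..d} f U r"
  shows "(LBINT x:{c..d}. (cmod (U x))\<^sup>2 + (cmod (r x))\<^sup>2)
    \<le> (1 + 2 * K\<^sup>2) * (LBINT x:{c..d}. (cmod (U x))\<^sup>2) + 2 * (LBINT x:{c..d}. (cmod (P U r x))\<^sup>2)"
proof -
  note [locbdd_intros] = sol_locbdd[OF s]
  have i: "set_integrable lborel {c..d} (\<lambda>x. (cmod (U x))\<^sup>2)" "set_integrable lborel {c..d} (\<lambda>x. (cmod (P U r x))\<^sup>2)"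
    "set_integrable lborel {c..d} (\<lambda>x. (cmod (r x))\<^sup>2)"
    by (intro locintbD(2) locintb_locbdd locbdd_intros)+
  have "(LBINT x:{c..d}. (cmod (U x))\<^sup>2 + (cmod (r x))\<^sup>2)
     \<le> (LBINT x:{c..d}. (1 + 2 * K\<^sup>2) * (cmod (U x))\<^sup>2 + 2 * (cmod (P U r x))\<^sup>2)"
    by (intro set_integral_mono set_integral_add(1) set_integrable_mult_right i energy_le)
  also have "\<dots> = (1 + 2 * K\<^sup>2) * (LBINT x:{c..d}. (cmod (U x))\<^sup>2) + 2 * (LBINT x:{c..d}. (cmod (P U r x))\<^sup>2)"
    using i by (simp only: set_integral_add set_integral_mult_right set_integrable_mult_right)
  finally show ?thesis .
qed

text \<open>Shooting: correct a particular solution by a multiple of the homogeneous solution V that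
  vanishes at -N. This works unless V N = 0. In that case \<open>Im_estimate\<close>, with
  \<epsilon> \<noteq> 0, would make V vanish in L2, and \<open>Re_estimate\<close> would do the same
  for its flux.\<close>

lemma Dirichlet_exists:
  assumes f: "locintb f" and N: "0 < N"
  shows "\<exists>U r. sol {-N..N} f U r \<and> U (-N) = 0 \<and> U N = 0"
proof -
  have z: "locintb (\<lambda>x. 0 :: complex)" by (rule locintb_const)
  obtain U r where U: "sol {-N..N} f U r" "U (-N) = 0" using sol_initial_value[OF f, of "-N" N 0 0] N by auto
  obtain V s where V: "sol {-N..N} (\<lambda>x. 0) V s" "V (-N) = 0" "s (-N) = 1" using sol_initial_value[OF z, of "-N" N 0 1] N by auto
  have "V N \<noteq> 0"
  proof
    assume VN: "V N = 0"
    let ?A = "LBINT x:{-N..N}. (cmod (V x))\<^sup>2"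
    have A0: "0 \<le> ?A" by (rule set_integral_nonneg_on) simp
    have "\<bar>\<epsilon>\<bar> / M * ?A \<le> 0" using Im_estimate[OF V(1) _ z] V(2) VN N by simp
    then have A: "?A = 0" using A0 eps M_ge by (simp add: mult_le_0_iff divide_le_0_iff)
    have "(LBINT x:{-N..N}. (cmod (P V s x))\<^sup>2) \<le> 0" using Re_estimate[OF V(1) _ z] V(2) VN N A by simp
    then have "(LBINT x:{-N..N}. (cmod (V x))\<^sup>2 + (cmod (s x))\<^sup>2) \<le> 0"
      using energy_integral_le[OF V(1)] A by simp
    \<comment> \<open>The energy of V is 1 at -N, so the growth bound keeps it above a positive
      constant on all of [-N, N], against the vanishing of its integral.\<close>
    moreover have "(LBINT x:{-N..N}. exp (- (G0 * (2 * N)))) \<le> (LBINT x:{-N..N}. (cmod (V x))\<^sup>2 + (cmod (s x))\<^sup>2)"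
    proof (rule set_integral_mono)
      note [locbdd_intros] = sol_locbdd[OF V(1)]
      show "set_integrable lborel {-N..N} (\<lambda>x. exp (- (G0 * (2 * N))))"
        "set_integrable lborel {-N..N} (\<lambda>x. (cmod (V x))\<^sup>2 + (cmod (s x))\<^sup>2)"
        by (intro locintbD(2) locintb_locbdd locbdd_intros)+
      fix x assume x: "x \<in> {-N..N}"
      have sx: "sol {-N..x} (\<lambda>x. 0) V s" using V(1) x unfolding sol_def by (auto elim: ac_on_subset)
      have "1 \<le> exp (G0 * (x - - N)) * ((cmod (V x))\<^sup>2 + (cmod (s x))\<^sup>2)"
        using growth_homogeneous(2)[OF sx] x V(2,3) by simp
      also have "\<dots> \<le> exp (G0 * (2 * N)) * ((cmod (V x))\<^sup>2 + (cmod (s x))\<^sup>2)"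
        using x G0_nonneg by (intro mult_right_mono) (auto intro!: mult_left_mono)
      finally show "exp (- (G0 * (2 * N))) \<le> (cmod (V x))\<^sup>2 + (cmod (s x))\<^sup>2" by (simp add: exp_minus field_simps)
    qed
    moreover have "(LBINT x:{-N..N}. exp (- (G0 * (2 * N)))) = 2 * N * exp (- (G0 * (2 * N)))"
      using N by (simp add: set_lebesgue_integral_def)
    ultimately have "2 * N * exp (- (G0 * (2 * N))) \<le> 0" by linarith
    then show False using N by (simp add: mult_le_0_iff)
  qed
  define c where "c = - U N / V N"
  have "sol {-N..N} f (\<lambda>x. U x + c * V x) (\<lambda>x. r x + c * s x)" using sol_lincomb[OF U(1) V(1), of c] by simp
  moreover have "U N + c * V N = 0" using \<open>V N \<noteq> 0\<close> by (simp add: c_def)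
  ultimately show ?thesis using U(2) V(2) by (intro exI[of _ "\<lambda>x. U x + c * V x"] exI[of _ "\<lambda>x. r x + c * s x"]) auto
qed

text \<open>The bound may depend on \<epsilon>, h and f but not on N. The Dirichlet conditions
  remove the boundary terms of the pairing, so no information at infinity is needed.\<close>

lemma Dirichlet_bound:
  assumes f: "f \<in> L2"
  shows "\<exists>C\<ge>0. \<forall>N U r. 0 < N \<longrightarrow> sol {-N..N} f U r \<longrightarrow> U (-N) = 0 \<longrightarrow> U N = 0 \<longrightarrow>
     (LBINT x:{-N..N}. (cmod (U x))\<^sup>2) \<le> C \<and> (LBINT x:{-N..N}. (cmod (P U r x))\<^sup>2) \<le> C"
proof -
  define F where "F = (LBINT x. (cmod (f x))\<^sup>2)"
  have fi: "integrable lborel (\<lambda>x. (cmod (f x))\<^sup>2)" using f by (simp add: L2_def)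
  have F0: "0 \<le> F" unfolding F_def by (rule Bochner_Integration.integral_nonneg) simp
  have fl: "locintb f" by (rule L2_locintb[OF f])
  have M0: "0 < M" using M_ge by simp
  have e0: "0 < \<bar>\<epsilon>\<bar>" using eps by simp
  define C1 where "C1 = M^4 / \<epsilon>\<^sup>2 * F"
  define C2 where "C2 = 2 * M * ((M + 2 * K\<^sup>2 * M) * C1 + M * (C1 + F))"
  have C1: "0 \<le> C1" unfolding C1_def using F0 by (intro mult_nonneg_nonneg divide_nonneg_nonneg) auto
  have main: "(LBINT x:{-N..N}. (cmod (U x))\<^sup>2) \<le> C1" "(LBINT x:{-N..N}. (cmod (P U r x))\<^sup>2) \<le> C2"
    if N: "0 < N" and s: "sol {-N..N} f U r" and bc: "U (-N) = 0" "U N = 0" for N U r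
  proof -
    note [locbdd_intros] = sol_locbdd[OF s]
    let ?A = "LBINT x:{-N..N}. (cmod (U x))\<^sup>2" and ?D = "LBINT x:{-N..N}. cmod (U x) * cmod (f x)"
    let ?F = "LBINT x:{-N..N}. (cmod (f x))\<^sup>2"
    have iU: "set_integrable lborel {-N..N} (\<lambda>x. (cmod (U x))\<^sup>2)"
      by (intro locintbD(2) locintb_locbdd locbdd_intros)
    have iD: "set_integrable lborel {-N..N} (\<lambda>x. cmod (U x) * cmod (f x))"
      by (intro locintbD(2) locintb_mult locintb_norm fl locbdd_intros)
    have iF: "set_integrable lborel {-N..N} (\<lambda>x. (cmod (f x))\<^sup>2)"
      unfolding set_integrable_def by (rule integrable_mult_indicator[OF _ fi]) simp
    have FF: "?F \<le> F" unfolding F_def set_lebesgue_integral_def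
      by (rule integral_mono[OF integrable_mult_indicator[OF _ fi] fi]) (auto simp: indicator_def)
    have young: "?D \<le> \<eta> / 2 * ?A + 1 / (2 * \<eta>) * ?F" if \<eta>: "0 < \<eta>" for \<eta>
    proof -
      have "?D \<le> (LBINT x:{-N..N}. \<eta> / 2 * (cmod (U x))\<^sup>2 + 1 / (2 * \<eta>) * (cmod (f x))\<^sup>2)"
      proof (intro set_integral_mono set_integral_add(1) set_integrable_mult_right iU iF iD)
        fix x
        have "0 \<le> (\<eta> * cmod (U x) - cmod (f x))\<^sup>2" by simp
        then have "2 * \<eta> * (cmod (U x) * cmod (f x)) \<le> \<eta>\<^sup>2 * (cmod (U x))\<^sup>2 + (cmod (f x))\<^sup>2"
          by (simp add: power2_diff power_mult_distrib algebra_simps)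
        then show "cmod (U x) * cmod (f x) \<le> \<eta> / 2 * (cmod (U x))\<^sup>2 + 1 / (2 * \<eta>) * (cmod (f x))\<^sup>2"
          using \<eta> by (simp add: field_simps power2_eq_square)
      qed
      also have "\<dots> = \<eta> / 2 * ?A + 1 / (2 * \<eta>) * ?F"
        using iU iF by (simp only: set_integral_add set_integral_mult_right set_integrable_mult_right)
      finally show ?thesis .
    qed
    have "\<bar>\<epsilon>\<bar> / M * ?A \<le> M * ?D" using Im_estimate[OF s _ fl] bc N by simp
    \<comment> \<open>Young's inequality with weight |\<epsilon>| / M^2, chosen so that the part
      with U is half of the left-hand side.\<close>
    also have "M * ?D \<le> M * (\<bar>\<epsilon>\<bar> / M\<^sup>2 / 2 * ?A + 1 / (2 * (\<bar>\<epsilon>\<bar> / M\<^sup>2)) * ?F)"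
      using young[of "\<bar>\<epsilon>\<bar> / M\<^sup>2"] e0 M0 by (intro mult_left_mono) auto
    also have "\<dots> = \<bar>\<epsilon>\<bar> / (2 * M) * ?A + M^3 / (2 * \<bar>\<epsilon>\<bar>) * ?F"
      using e0 M0 by (simp add: field_simps power2_eq_square power3_eq_cube)
    finally have "\<bar>\<epsilon>\<bar> / (2 * M) * ?A \<le> M^3 / (2 * \<bar>\<epsilon>\<bar>) * ?F" by (simp add: field_simps)
    also have "\<dots> \<le> M^3 / (2 * \<bar>\<epsilon>\<bar>) * F" using FF M0 by (intro mult_left_mono) auto
    finally have "(2 * M / \<bar>\<epsilon>\<bar>) * (\<bar>\<epsilon>\<bar> / (2 * M) * ?A) \<le> (2 * M / \<bar>\<epsilon>\<bar>) * (M^3 / (2 * \<bar>\<epsilon>\<bar>) * F)"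
      using M0 e0 by (intro mult_left_mono) auto
    moreover have "(2 * M / e) * (e / (2 * M) * y) = y" "(2 * M / e) * (M^3 / (2 * e) * F) = M^4 / e\<^sup>2 * F" if "0 < e" for e y :: real
      using that M0 by (simp_all add: power2_eq_square power3_eq_cube power4_eq_xxxx)
    ultimately show 1: "?A \<le> C1" using e0 by (simp only: C1_def power2_abs)
    have "?D \<le> 1 / 2 * ?A + 1 / 2 * ?F" using young[of 1] by simp
    moreover have "0 \<le> ?A" by (rule set_integral_nonneg_on) simp
    ultimately have D: "?D \<le> C1 + F" using 1 FF F0 by simp
    have "(LBINT x:{-N..N}. (cmod (P U r x))\<^sup>2) \<le> 2 * M * ((M + 2 * K\<^sup>2 * M) * ?A + M * ?D)"
      using Re_estimate[OF s _ fl] bc N by simp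
    also have "\<dots> \<le> C2" unfolding C2_def using 1 D M0 by (intro mult_left_mono add_mono) auto
    finally show "(LBINT x:{-N..N}. (cmod (P U r x))\<^sup>2) \<le> C2" .
  qed
  show ?thesis by (rule exI[of _ "max C1 C2"]) (use main C1 in \<open>fastforce intro: order_trans\<close>)
qed

text \<open>The Dirichlet solutions on growing intervals have L2 bounds independent of the interval.
  A subsequence converges locally to a solution on the line, which inherits these bounds.\<close>

lemma sol_L2_exists:
  assumes f: "f \<in> L2"
  shows "\<exists>U r. sol UNIV f U r \<and> U \<in> L2 \<and> P U r \<in> L2"
proof -
  have fl: "locintb f" by (rule L2_locintb[OF f])
  obtain C where C: "0 \<le> C" "\<And>N U r. 0 < N \<Longrightarrow> sol {-N..N} f U r \<Longrightarrow> U (-N) = 0 \<Longrightarrow> U N = 0 \<Longrightarrow>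
     (LBINT x:{-N..N}. (cmod (U x))\<^sup>2) \<le> C \<and> (LBINT x:{-N..N}. (cmod (P U r x))\<^sup>2) \<le> C"
    using Dirichlet_bound[OF f] by blast
  have "\<forall>k::nat. \<exists>U r. sol {-real (Suc k)..real (Suc k)} f U r \<and> U (-real (Suc k)) = 0 \<and> U (real (Suc k)) = 0"
    by (intro allI Dirichlet_exists[OF fl]) simp
  then obtain Us rs where D: "\<And>k::nat. sol {-real (Suc k)..real (Suc k)} f (Us k) (rs k)" "\<And>k::nat. Us k (-real (Suc k)) = 0" "\<And>k::nat. Us k (real (Suc k)) = 0"
    by metis
  have bd: "(LBINT x:{-real (Suc k)..real (Suc k)}. (cmod (Us k x))\<^sup>2) \<le> C \<and> (LBINT x:{-real (Suc k)..real (Suc k)}. (cmod (P (Us k) (rs k) x))\<^sup>2) \<le> C" for k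
    using C(2)[OF _ D(1,2,3), of k] by simp
  have lb: "locbdd (Us k)" "locbdd (rs k)" "locbdd (P (Us k) (rs k))" for k using sol_locbdd[OF D(1)] by auto
  have sub: "sol {c..d} f (Us k) (rs k)" if "{c..d} \<subseteq> {-real (Suc k)..real (Suc k)}" for c d k
    using D(1)[of k] that unfolding sol_def by (auto elim: ac_on_subset)
  have mono_int: "(LBINT x:{c..d}. (cmod (g x))\<^sup>2) \<le> (LBINT x:{-real (Suc k)..real (Suc k)}. (cmod (g x))\<^sup>2)"
    if "{c..d} \<subseteq> {-real (Suc k)..real (Suc k)}" "locbdd g" for c d k and g :: "real \<Rightarrow> complex"
  proof -
    have i: "set_integrable lborel {c..d} (\<lambda>x. (cmod (g x))\<^sup>2)" for c d by (intro locintbD(2) locintb_locbdd locbdd_intros that)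
    show ?thesis unfolding set_lebesgue_integral_def
      by (rule integral_mono) (use i that(1) in \<open>auto simp: set_integrable_def indicator_def\<close>)
  qed
  let ?z = "\<lambda>k x. (cmod (Us k x))\<^sup>2 + (cmod (rs k x))\<^sup>2"
  define E where "E N = exp (LBINT t:{-N..N}. G0 + 2 * M / h * cmod (f t))" for N
  have gi: "set_integrable lborel {c..d} (\<lambda>t. G0 + 2 * M / h * cmod (f t))" for c d
    by (intro locintbD(2) locintb_add locintb_const locintb_mult locbdd_const locintb_norm fl)
  have g0: "0 \<le> G0 + 2 * M / h * cmod (f t)" for t
    using G0_nonneg M_ge h_pos by (intro add_nonneg_nonneg mult_nonneg_nonneg divide_nonneg_pos) auto
  have Emono: "exp (LBINT t:{c..d}. G0 + 2 * M / h * cmod (f t)) \<le> E N" if "{c..d} \<subseteq> {-N..N}" for c d N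
    unfolding E_def exp_le_cancel_iff set_lebesgue_integral_def
    by (rule integral_mono) (use gi g0 that in \<open>auto simp: set_integrable_def indicator_def\<close>)
  \<comment> \<open>Averaging the growth estimate between 0 and x over x in [0,1] trades the L2
    bounds for a bound of the energy at the point 0, uniform in k.\<close>
  define Z0 where "Z0 = E 1 * ((1 + 2 * K\<^sup>2) * C + 2 * C + 1)"
  have z0: "?z k 0 + 1 \<le> Z0" for k
  proof -
    have le: "?z k 0 + 1 \<le> E 1 * (?z k x + 1)" if x: "x \<in> {0..1}" for x
    proof -
      have "{0..x} \<subseteq> {-real (Suc k)..real (Suc k)}" using x by auto
      from growth_inhomogeneous(2)[OF sub[OF this] fl] x
      have "?z k 0 + 1 \<le> exp (LBINT t:{0..x}. G0 + 2 * M / h * cmod (f t)) * (?z k x + 1)" by simp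
      also have "\<dots> \<le> E 1 * (?z k x + 1)" using x by (intro mult_right_mono Emono) auto
      finally show ?thesis .
    qed
    have "(LBINT x:{0..1::real}. ?z k 0 + 1) \<le> (LBINT x:{0..1}. E 1 * (?z k x + 1))"
      by (intro set_integral_mono le locintbD(2) locintb_locbdd locbdd_intros lb)
    also have "\<dots> = E 1 * ((LBINT x:{0..1}. ?z k x) + (LBINT x:{0..1::real}. 1))"
      by (subst set_integral_mult_right, subst set_integral_add(2)) (intro locintbD(2) locintb_locbdd locbdd_intros lb refl)+
    also have "\<dots> \<le> Z0"
    proof -
      have s01: "{0..1} \<subseteq> {-real (Suc k)..real (Suc k)}" by auto
      have "(LBINT x:{0..1}. ?z k x) \<le> (1 + 2 * K\<^sup>2) * (LBINT x:{0..1}. (cmod (Us k x))\<^sup>2) + 2 * (LBINT x:{0..1}. (cmod (P (Us k) (rs k) x))\<^sup>2)"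
        by (rule energy_integral_le[OF sub[OF s01]])
      also have "\<dots> \<le> (1 + 2 * K\<^sup>2) * C + 2 * C"
        using mono_int[OF s01 lb(1)[of k]] mono_int[OF s01 lb(3)[of k]] bd[of k] by (intro add_mono mult_left_mono) auto
      finally show ?thesis unfolding Z0_def by (intro mult_left_mono) (auto simp: E_def set_lebesgue_integral_def)
    qed
    finally show ?thesis by (simp add: set_lebesgue_integral_def)
  qed
  have zb: "?z k x + 1 \<le> E N * Z0" if x: "x \<in> {-N..N}" and k: "N \<le> real (Suc k)" for k x N
  proof -
    have "?z k x + 1 \<le> E N * (?z k 0 + 1)"
    proof (cases "0 \<le> x")
      case True
      have "{0..x} \<subseteq> {-real (Suc k)..real (Suc k)}" using x k by auto
      from growth_inhomogeneous(1)[OF sub[OF this] fl] True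
      have "?z k x + 1 \<le> exp (LBINT t:{0..x}. G0 + 2 * M / h * cmod (f t)) * (?z k 0 + 1)" by simp
      also have "\<dots> \<le> E N * (?z k 0 + 1)" using x by (intro mult_right_mono Emono) auto
      finally show ?thesis .
    next
      case False
      have "{x..0} \<subseteq> {-real (Suc k)..real (Suc k)}" using x k by auto
      from growth_inhomogeneous(2)[OF sub[OF this] fl] False
      have "?z k x + 1 \<le> exp (LBINT t:{x..0}. G0 + 2 * M / h * cmod (f t)) * (?z k 0 + 1)" by simp
      also have "\<dots> \<le> E N * (?z k 0 + 1)" using x by (intro mult_right_mono Emono) auto
      finally show ?thesis .
    qed
    also have "\<dots> \<le> E N * Z0" by (intro mult_left_mono z0) (simp add: E_def)
    finally show ?thesis .
  qed
  have UrB: "cmod (Us k x) \<le> E N * Z0" "cmod (rs k x) \<le> E N * Z0" if "x \<in> {-N..N}" "N \<le> real (Suc k)" for k x N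
    using zb[OF that] self_le_power2_add_1[of "cmod (Us k x)"] self_le_power2_add_1[of "cmod (rs k x)"]
      zero_le_power2[of "cmod (Us k x)"] zero_le_power2[of "cmod (rs k x)"] by linarith+
  \<comment> \<open>Compactness is used only at the point 0. The difference of two approximations
    solves the homogeneous system where both are defined, so \<open>growth_homogeneous\<close>
    carries the Cauchy property from 0 to every x.\<close>
  have "bounded (range (\<lambda>k. (Us k 0, rs k 0)))"
  proof -
    have "norm (Us k 0, rs k 0) \<le> E 0 * Z0 + E 0 * Z0" for k
      by (rule order_trans[OF norm_Pair_le]) (intro add_mono UrB, auto)
    then show ?thesis unfolding bounded_iff by blast
  qed
  then obtain l \<sigma> where \<sigma>: "strict_mono \<sigma>" "((\<lambda>k. (Us k 0, rs k 0)) \<circ> \<sigma>) \<longlonglongrightarrow> l"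
    using bounded_imp_convergent_subsequence by blast
  have c0: "Cauchy (\<lambda>k. Us (\<sigma> k) 0)" "Cauchy (\<lambda>k. rs (\<sigma> k) 0)"
    using tendsto_fst[OF \<sigma>(2)] tendsto_snd[OF \<sigma>(2)] by (auto simp: o_def intro: LIMSEQ_imp_Cauchy)
  have diff: "(cmod (Us j x - Us k x))\<^sup>2 + (cmod (rs j x - rs k x))\<^sup>2 \<le> exp (G0 * \<bar>x\<bar>) * ((cmod (Us j 0 - Us k 0))\<^sup>2 + (cmod (rs j 0 - rs k 0))\<^sup>2)"
    if jk: "\<bar>x\<bar> \<le> real j" "\<bar>x\<bar> \<le> real k" for j k x
  proof (cases "0 \<le> x")
    case True
    have "sol {0..x} (\<lambda>x. f x + (-1) * f x) (\<lambda>x. Us j x + (-1) * Us k x) (\<lambda>x. rs j x + (-1) * rs k x)"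
      by (intro sol_lincomb sub) (use True jk in auto)
    then have "sol {0..x} (\<lambda>x. 0) (\<lambda>x. Us j x - Us k x) (\<lambda>x. rs j x - rs k x)" by simp
    from growth_homogeneous(1)[OF this] True show ?thesis by simp
  next
    case False
    have "sol {x..0} (\<lambda>x. f x + (-1) * f x) (\<lambda>x. Us j x + (-1) * Us k x) (\<lambda>x. rs j x + (-1) * rs k x)"
      by (intro sol_lincomb sub) (use False jk in auto)
    then have "sol {x..0} (\<lambda>x. 0) (\<lambda>x. Us j x - Us k x) (\<lambda>x. rs j x - rs k x)" by simp
    from growth_homogeneous(2)[OF this] False show ?thesis by simp
  qed
  have cx: "Cauchy (\<lambda>k. Us (\<sigma> k) x) \<and> Cauchy (\<lambda>k. rs (\<sigma> k) x)" for x
  proof -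
    have small: "\<exists>K0. \<forall>j\<ge>K0. \<forall>k\<ge>K0. (cmod (Us (\<sigma> j) x - Us (\<sigma> k) x))\<^sup>2 + (cmod (rs (\<sigma> j) x - rs (\<sigma> k) x))\<^sup>2 < e\<^sup>2" if e: "0 < e" for e
    proof -
      let ?E = "exp (G0 * \<bar>x\<bar>)"
      define \<delta> where "\<delta> = e / sqrt (2 * ?E)"
      have d: "0 < \<delta>" "\<delta>\<^sup>2 = e\<^sup>2 / (2 * ?E)" using e by (auto simp: \<delta>_def power_divide)
      obtain K1 where K1: "\<And>j k. j \<ge> K1 \<Longrightarrow> k \<ge> K1 \<Longrightarrow> cmod (Us (\<sigma> j) 0 - Us (\<sigma> k) 0) < \<delta>" using CauchyD[OF c0(1) d(1)] by blast
      obtain K2 where K2: "\<And>j k. j \<ge> K2 \<Longrightarrow> k \<ge> K2 \<Longrightarrow> cmod (rs (\<sigma> j) 0 - rs (\<sigma> k) 0) < \<delta>" using CauchyD[OF c0(2) d(1)] by blast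
      obtain K3 :: nat where K3: "\<bar>x\<bar> \<le> real K3" using real_arch_simple by blast
      show ?thesis
      proof (intro exI allI impI)
        fix j k assume jk: "max (max K1 K2) K3 \<le> j" "max (max K1 K2) K3 \<le> k"
        have "\<bar>x\<bar> \<le> real (\<sigma> j)" "\<bar>x\<bar> \<le> real (\<sigma> k)"
          using K3 jk seq_suble[OF \<sigma>(1), of j] seq_suble[OF \<sigma>(1), of k] by auto
        from diff[OF this]
        have "(cmod (Us (\<sigma> j) x - Us (\<sigma> k) x))\<^sup>2 + (cmod (rs (\<sigma> j) x - rs (\<sigma> k) x))\<^sup>2 \<le> ?E * ((cmod (Us (\<sigma> j) 0 - Us (\<sigma> k) 0))\<^sup>2 + (cmod (rs (\<sigma> j) 0 - rs (\<sigma> k) 0))\<^sup>2)" .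
        also have "\<dots> < ?E * (\<delta>\<^sup>2 + \<delta>\<^sup>2)"
          using K1[of j k] K2[of j k] jk by (intro mult_strict_left_mono add_strict_mono power_strict_mono) auto
        also have "\<dots> = e\<^sup>2" unfolding d(2) by (simp add: field_simps)
        finally show "(cmod (Us (\<sigma> j) x - Us (\<sigma> k) x))\<^sup>2 + (cmod (rs (\<sigma> j) x - rs (\<sigma> k) x))\<^sup>2 < e\<^sup>2" .
      qed
    qed
    have sm: "cmod v < e" if "(cmod v)\<^sup>2 + y\<^sup>2 < e\<^sup>2" "0 < e" for v and e y :: real
      using that zero_le_power2[of y] by (intro power2_less_imp_less[of "cmod v" e]; linarith)
    have sm': "cmod v < e" if "y\<^sup>2 + (cmod v)\<^sup>2 < e\<^sup>2" "0 < e" for v and e y :: real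
      using that zero_le_power2[of y] by (intro power2_less_imp_less[of "cmod v" e]; linarith)
    show ?thesis
      by (intro conjI CauchyI) (use small sm sm' in meson)+
  qed
  then have "\<exists>u v. \<forall>x. (\<lambda>k. Us (\<sigma> k) x) \<longlonglongrightarrow> u x \<and> (\<lambda>k. rs (\<sigma> k) x) \<longlonglongrightarrow> v x"
    unfolding Cauchy_convergent_iff convergent_def by metis
  then obtain u v where uv: "\<And>x. (\<lambda>k. Us (\<sigma> k) x) \<longlonglongrightarrow> u x" "\<And>x. (\<lambda>k. rs (\<sigma> k) x) \<longlonglongrightarrow> v x" by blast
  have ev: "\<forall>\<^sub>F k in sequentially. N \<le> real (Suc (\<sigma> k))" for N
  proof -
    obtain K3 :: nat where K3: "N \<le> real K3" using real_arch_simple by blast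
    then have "N \<le> real (Suc (\<sigma> k))" if "K3 \<le> k" for k using that seq_suble[OF \<sigma>(1), of k] by simp
    then show ?thesis unfolding eventually_sequentially by blast
  qed
  have evb: "\<forall>\<^sub>F k in sequentially. \<forall>x\<in>{-N..N}. norm (Us (\<sigma> k) x) \<le> E N * Z0 \<and> norm (rs (\<sigma> k) x) \<le> E N * Z0" for N
    using ev[of N] by eventually_elim (use UrB in blast)
  have evs: "\<forall>\<^sub>F k in sequentially. sol {-N..N} f (Us (\<sigma> k)) (rs (\<sigma> k))" for N
    using ev[of N] by eventually_elim (rule sub, auto)
  have f2: "locintb (\<lambda>x. - of_real (w x / h) * f x)"
    using locintb_mult[OF locbdd_mult[OF locbdd_of_real[OF locbdd_coeffs(2)] locbdd_const[of "- 1 / of_real h"]] fl] by simp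
  have lm: "Us (\<sigma> k) \<in> borel_measurable borel" "rs (\<sigma> k) \<in> borel_measurable borel" for k using lb locbddD(1) by auto
  have acu: "ac_on UNIV u (\<lambda>x. c11 x * u x + c12 x * v x + 0)"
  proof (rule ac_on_limit[OF locintb_coeffs(1,2) locintb_const lm uv uv(1)])
    show "\<exists>C. \<forall>\<^sub>F k in sequentially. \<forall>x\<in>{-N..N}. norm (Us (\<sigma> k) x) \<le> C \<and> norm (rs (\<sigma> k) x) \<le> C" for N using evb by blast
    show "\<forall>\<^sub>F k in sequentially. ac_on {-N..N} (Us (\<sigma> k)) (\<lambda>x. c11 x * Us (\<sigma> k) x + c12 x * rs (\<sigma> k) x + 0)" for N
      using evs[of N] by eventually_elim (simp add: sol_def dU_eq[abs_def])
  qed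
  have acv: "ac_on UNIV v (\<lambda>x. c21 x * u x + c22 x * v x + (- of_real (w x / h) * f x))"
  proof (rule ac_on_limit[OF locintb_coeffs(3,4) f2 lm uv uv(2)])
    show "\<exists>C. \<forall>\<^sub>F k in sequentially. \<forall>x\<in>{-N..N}. norm (Us (\<sigma> k) x) \<le> C \<and> norm (rs (\<sigma> k) x) \<le> C" for N using evb by blast
    show "\<forall>\<^sub>F k in sequentially. ac_on {-N..N} (rs (\<sigma> k)) (\<lambda>x. c21 x * Us (\<sigma> k) x + c22 x * rs (\<sigma> k) x + (- of_real (w x / h) * f x))" for N
      using evs[of N] by eventually_elim (simp add: sol_def dr_eq[abs_def])
  qed
  have S: "sol UNIV f u v"
    unfolding sol_def dU_eq[abs_def] dr_eq[abs_def]
    using acu acv ac_on_UNIV_continuous[OF acu] ac_on_UNIV_continuous[OF acv] by simp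
  \<comment> \<open>On each fixed interval the L2 bound passes to the limit by dominated
    convergence; \<open>integrable_exhaustion\<close> then gives square integrability on the
    line.\<close>
  have L2I: "g \<in> L2" if g: "locbdd g" and G: "\<And>k. locbdd (Gs k)" and lim: "\<And>x. (\<lambda>k. Gs k x) \<longlonglongrightarrow> g x"
     and bdd: "\<And>N. \<exists>C'. \<forall>\<^sub>F k in sequentially. \<forall>x\<in>{-N..N}. cmod (Gs k x) \<le> C'"
     and int: "\<And>N. \<forall>\<^sub>F k in sequentially. (LBINT x:{-N..N}. (cmod (Gs k x))\<^sup>2) \<le> C" for g Gs
  proof -
    have "(LBINT x:{-N..N}. (cmod (g x))\<^sup>2) \<le> C" for N
    proof -
      obtain C' where C': "\<forall>\<^sub>F k in sequentially. \<forall>x\<in>{-N..N}. cmod (Gs k x) \<le> C'" using bdd by blast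
      then obtain k0 where k0: "\<And>k x. k \<ge> k0 \<Longrightarrow> x \<in> {-N..N} \<Longrightarrow> cmod (Gs k x) \<le> C'" unfolding eventually_sequentially by blast
      have "(\<lambda>k. LBINT x:{-N..N}. (cmod (Gs (k + k0) x))\<^sup>2) \<longlonglongrightarrow> (LBINT x:{-N..N}. (cmod (g x))\<^sup>2)"
        unfolding set_lebesgue_integral_def
      proof (rule integral_dominated_convergence[where w = "\<lambda>x. indicator {-N..N} x *\<^sub>R C'\<^sup>2"])
        show "integrable lborel (\<lambda>x. indicat_real {-N..N} x *\<^sub>R C'\<^sup>2)"
          using locintbD(2)[OF locintb_const[of "C'\<^sup>2"], of "-N" N] by (simp add: set_integrable_def)
        show "AE x in lborel. norm (indicat_real {-N..N} x *\<^sub>R (cmod (Gs (k + k0) x))\<^sup>2) \<le> indicat_real {-N..N} x *\<^sub>R C'\<^sup>2" for k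
          using k0[of "k + k0"] by (intro AE_I2) (auto simp: indicator_def intro: power_mono)
        show "AE x in lborel. (\<lambda>k. indicat_real {-N..N} x *\<^sub>R (cmod (Gs (k + k0) x))\<^sup>2) \<longlonglongrightarrow> indicat_real {-N..N} x *\<^sub>R (cmod (g x))\<^sup>2"
          by (intro AE_I2 tendsto_intros LIMSEQ_ignore_initial_segment lim)
        show "(\<lambda>x. indicat_real {-N..N} x *\<^sub>R (cmod (g x))\<^sup>2) \<in> borel_measurable lborel"
          "(\<lambda>x. indicat_real {-N..N} x *\<^sub>R (cmod (Gs (k + k0) x))\<^sup>2) \<in> borel_measurable lborel" for k
          using locbddD(1)[OF g] locbddD(1)[OF G] by measurable
      qed
      moreover obtain k1 where "\<And>k. k \<ge> k1 \<Longrightarrow> (LBINT x:{-N..N}. (cmod (Gs k x))\<^sup>2) \<le> C" using int[of N] unfolding eventually_sequentially by blast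
      ultimately show ?thesis by (intro LIMSEQ_le_const2) (auto intro!: exI[of _ k1])
    qed
    then have "integrable lborel (\<lambda>x. (cmod (g x))\<^sup>2)"
      by (intro integrable_exhaustion[where C = C] locintb_locbdd locbdd_intros g) auto
    then show ?thesis using locbddD(1)[OF g] by (simp add: L2_def)
  qed
  have "u \<in> L2"
  proof (rule L2I[OF sol_locbdd(1)[OF S] lb(1)[of "\<sigma> _"] uv(1)])
    show "\<exists>C'. \<forall>\<^sub>F k in sequentially. \<forall>x\<in>{-N..N}. cmod (Us (\<sigma> k) x) \<le> C'" for N
      by (rule exI, rule eventually_mono[OF evb[of N]]) blast
    show "\<forall>\<^sub>F k in sequentially. (LBINT x:{-N..N}. (cmod (Us (\<sigma> k) x))\<^sup>2) \<le> C" for N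
      using ev[of N]
    proof eventually_elim
      case (elim k)
      then have "{-N..N} \<subseteq> {-real (Suc (\<sigma> k))..real (Suc (\<sigma> k))}" by auto
      from mono_int[OF this lb(1)] bd[of "\<sigma> k"] show ?case by (meson order_trans)
    qed
  qed
  moreover have "P u v \<in> L2"
  proof (rule L2I[OF sol_locbdd(3)[OF S] lb(3)[of "\<sigma> _"]])
    show "(\<lambda>k. P (Us (\<sigma> k)) (rs (\<sigma> k)) x) \<longlonglongrightarrow> P u v x" for x
      unfolding P_def by (intro tendsto_intros uv)
    show "\<exists>C'. \<forall>\<^sub>F k in sequentially. \<forall>x\<in>{-N..N}. cmod (P (Us (\<sigma> k)) (rs (\<sigma> k)) x) \<le> C'" for N
    proof (rule exI, rule eventually_mono[OF evb[of N]], intro ballI)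
      fix k x assume *: "\<forall>x\<in>{-N..N}. norm (Us (\<sigma> k) x) \<le> E N * Z0 \<and> norm (rs (\<sigma> k) x) \<le> E N * Z0" "x \<in> {-N..N}"
      have "cmod (P (Us (\<sigma> k)) (rs (\<sigma> k)) x) \<le> cmod (rs (\<sigma> k) x) + \<bar>n x\<bar> * cmod (Us (\<sigma> k) x)"
        unfolding P_def by (rule order_trans[OF norm_triangle_ineq]) (simp add: norm_mult)
      also have "\<dots> \<le> E N * Z0 + K * (E N * Z0)"
        using * n_bd[of x] by (intro add_mono mult_mono) auto
      finally show "cmod (P (Us (\<sigma> k)) (rs (\<sigma> k)) x) \<le> E N * Z0 + K * (E N * Z0)" .
    qed
    show "\<forall>\<^sub>F k in sequentially. (LBINT x:{-N..N}. (cmod (P (Us (\<sigma> k)) (rs (\<sigma> k)) x))\<^sup>2) \<le> C" for N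
      using ev[of N]
    proof eventually_elim
      case (elim k)
      then have "{-N..N} \<subseteq> {-real (Suc (\<sigma> k))..real (Suc (\<sigma> k))}" by auto
      from mono_int[OF this lb(3)] bd[of "\<sigma> k"] show ?case by (meson order_trans)
    qed
  qed
  ultimately show ?thesis using S by blast
qed

end

section \<open>Averages\<close>

lemma tbv_integrable:
  assumes "tbv C g" "0 < e"
  shows "integrable lborel (\<lambda>x. \<bar>g (x + e) - g x\<bar>)" "(LBINT x. \<bar>g (x + e) - g x\<bar>) \<le> C * e"
proof -
  have m: "g \<in> borel_measurable borel" and C: "0 \<le> C"
    and le: "(\<integral>\<^sup>+x. ennreal \<bar>g (x + e) - g x\<bar> \<partial>lborel) \<le> ennreal (C * e)"
    using assms by (auto simp: tbv_def)
  show i: "integrable lborel (\<lambda>x. \<bar>g (x + e) - g x\<bar>)"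
    by (rule integrableI_bounded) (use m le in \<open>auto simp: less_top[symmetric] top_unique\<close>)
  show "(LBINT x. \<bar>g (x + e) - g x\<bar>) \<le> C * e"
    using le C assms(2) by (subst (asm) nn_integral_eq_integral[OF i]) (auto simp: ennreal_le_iff)
qed

lemma ac_on_shift:
  assumes "ac_on UNIV F f" shows "ac_on UNIV (\<lambda>x. F (x + e)) (\<lambda>x. f (x + e))"
  unfolding ac_on_def
proof (intro ballI impI)
  fix a b :: real assume ab: "a \<le> b"
  let ?g = "\<lambda>x. indicat_real {a + e..b + e} x *\<^sub>R f x"
  have eq: "(\<lambda>x. indicat_real {a..b} x *\<^sub>R f (x + e)) = (\<lambda>x. ?g (e + 1 * x))"
    by (auto simp: indicator_def add.commute)
  have "set_integrable lborel {a + e..b + e} f" "(LBINT x:{a + e..b + e}. f x) = F (b + e) - F (a + e)"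
    using ac_onD[OF assms, of "a + e" "b + e"] ab by auto
  then show "set_integrable lborel {a..b} (\<lambda>x. f (x + e)) \<and> (LBINT x:{a..b}. f (x + e)) = F (b + e) - F (a + e)"
    unfolding set_integrable_def set_lebesgue_integral_def eq
    using lborel_integral_real_affine[of 1 ?g e] lborel_integrable_real_affine[of ?g 1 e] by simp
qed

definition avg :: "real \<Rightarrow> (real \<Rightarrow> real) \<Rightarrow> real \<Rightarrow> real" where
  "avg e g x = (1 / e) * (prim g (x + e) - prim g x)"

lemma avg_ac:
  assumes "locint g" shows "ac_on UNIV (avg e g) (\<lambda>x. (1 / e) * (g (x + e) - g x))"
  unfolding avg_def[abs_def]
  by (intro ac_on_cmult ac_on_diff ac_on_shift[OF ac_on_prim] ac_on_prim assms)

lemma avg_eq: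
  assumes "locint g" "0 < e" shows "avg e g x = (1 / e) * (LBINT t:{x..x+e}. g t)"
  using ac_onD(2)[OF ac_on_prim[OF assms(1)], of x UNIV "x + e"] assms(2) by (simp add: avg_def)

lemma avg_bounds:
  assumes g: "locint g" "0 < e" and bd: "\<And>x. c \<le> g x" "\<And>x. g x \<le> d"
  shows "c \<le> avg e g x" "avg e g x \<le> d"
proof -
  have i: "set_integrable lborel {x..x+e} g" using g by (simp add: locint_def)
  have k: "set_integrable lborel {x..x+e} (\<lambda>t. c)" for c :: real by (rule locintbD(2)[OF locintb_const])
  have "(LBINT t:{x..x+e}. c) \<le> (LBINT t:{x..x+e}. g t)" "(LBINT t:{x..x+e}. g t) \<le> (LBINT t:{x..x+e}. d)"
    by (rule set_integral_mono[OF k i bd(1)] set_integral_mono[OF i k bd(2)])+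
  then show "c \<le> avg e g x" "avg e g x \<le> d"
    using g(2) unfolding avg_eq[OF g] by (simp_all add: set_lebesgue_integral_def field_simps)
qed

lemma avg_borel: "locint g \<Longrightarrow> avg e g \<in> borel_measurable borel"
  using borel_measurable_continuous_onI[OF ac_on_UNIV_continuous[OF avg_ac]] .

text \<open>The difference is at most the average over t in [0, e] of |g (x + t) - g x|. After
  exchanging the integrals each t contributes C t / e \<le> C, and t runs over an interval of length
  e.\<close>

lemma avg_diff_integrable:
  assumes tb: "tbv C g" and g: "locint g" and e: "0 < e"
  shows "integrable lborel (\<lambda>x. \<bar>avg e g x - g x\<bar>)" "(LBINT x. \<bar>avg e g x - g x\<bar>) \<le> C * e"
proof -
  have m[measurable]: "g \<in> borel_measurable borel" and C: "0 \<le> C" using tb by (auto simp: tbv_def)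
  have [measurable]: "avg e g \<in> borel_measurable borel" by (rule avg_borel[OF g])
  have pt: "ennreal \<bar>avg e g x - g x\<bar> \<le> (\<integral>\<^sup>+t. indicator {0..e} t * ennreal (\<bar>g (x + t) - g x\<bar> / e) \<partial>lborel)" for x
  proof -
    let ?h = "\<lambda>t. indicat_real {0..e} t * ((g (x + t) - g x) / e)"
    have i0: "integrable lborel (\<lambda>t. indicat_real {x..x+e} t * g t)" using locintD[OF g, of x "x+e"] by (simp add: set_integrable_def)
    have sh: "indicat_real {x..x+e} (x + 1 * t) * g (x + 1 * t) = indicat_real {0..e} t * g (x + t)" for t
      by (auto simp: indicator_def)
    have i1: "integrable lborel (\<lambda>t. indicat_real {0..e} t * g (x + t))"
      using lborel_integrable_real_affine[OF i0, of 1 x] unfolding sh by simp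
    have v1: "(LBINT t:{x..x+e}. g t) = (LBINT t. indicat_real {0..e} t * g (x + t))"
      using lborel_integral_real_affine[of 1 "\<lambda>t. indicat_real {x..x+e} t * g t" x] unfolding sh
      by (simp add: set_lebesgue_integral_def)
    have i2: "integrable lborel (\<lambda>t. indicat_real {0..e} t * g x)"
      by (intro integrable_mult_left integrable_real_indicator) (auto simp: emeasure_lborel_Icc_eq)
    have h: "?h = (\<lambda>t. (indicat_real {0..e} t * g (x + t) - indicat_real {0..e} t * g x) / e)"
      by (auto simp: field_simps)
    have ih: "integrable lborel ?h" unfolding h by (intro integrable_divide_zero Bochner_Integration.integrable_diff i1 i2)
    have "avg e g x - g x = (LBINT t. ?h t)"
      unfolding avg_eq[OF g e] v1 h using i1 i2 e by (simp add: field_simps)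
    then have "ennreal \<bar>avg e g x - g x\<bar> \<le> (\<integral>\<^sup>+t. ennreal (norm (?h t)) \<partial>lborel)"
      using integral_norm_bound_ennreal[OF ih] by simp
    also have "\<dots> = (\<integral>\<^sup>+t. indicator {0..e} t * ennreal (\<bar>g (x + t) - g x\<bar> / e) \<partial>lborel)"
      by (rule nn_integral_cong) (use e in \<open>auto simp: indicator_def\<close>)
    finally show ?thesis .
  qed
  have "(\<integral>\<^sup>+x. ennreal \<bar>avg e g x - g x\<bar> \<partial>lborel) \<le> (\<integral>\<^sup>+x. \<integral>\<^sup>+t. indicator {0..e} t * ennreal (\<bar>g (x + t) - g x\<bar> / e) \<partial>lborel \<partial>lborel)"
    by (intro nn_integral_mono pt)
  also have "\<dots> = (\<integral>\<^sup>+t. \<integral>\<^sup>+x. indicator {0..e} t * ennreal (\<bar>g (x + t) - g x\<bar> / e) \<partial>lborel \<partial>lborel)"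
    by (rule lborel_pair.Fubini'[symmetric]) measurable
  also have "\<dots> \<le> (\<integral>\<^sup>+t. indicator {0..e} t * ennreal C \<partial>lborel)"
  proof (rule nn_integral_mono)
    fix t
    show "(\<integral>\<^sup>+x. indicator {0..e} t * ennreal (\<bar>g (x + t) - g x\<bar> / e) \<partial>lborel) \<le> indicator {0..e} t * ennreal C"
    proof (cases "0 < t \<and> t \<le> e")
      case True
      have "(\<integral>\<^sup>+x. ennreal (\<bar>g (x + t) - g x\<bar> / e) \<partial>lborel) = (\<integral>\<^sup>+x. ennreal (1 / e) * ennreal \<bar>g (x + t) - g x\<bar> \<partial>lborel)"
        using e by (intro nn_integral_cong) (simp flip: ennreal_mult)
      also have "\<dots> = ennreal (1 / e) * (\<integral>\<^sup>+x. ennreal \<bar>g (x + t) - g x\<bar> \<partial>lborel)" by (rule nn_integral_cmult) simp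
      also have "\<dots> \<le> ennreal (1 / e) * ennreal (C * t)" using tb True by (intro mult_left_mono) (auto simp: tbv_def)
      also have "\<dots> = ennreal (C * t / e)" using e C True by (simp flip: ennreal_mult)
      also have "\<dots> \<le> ennreal C" using e C True by (intro ennreal_leI) (simp add: field_simps mult_left_mono)
      finally show ?thesis using True by simp
    next
      case False
      then have "t = 0 \<or> t \<notin> {0..e}" by auto
      then show ?thesis by auto
    qed
  qed
  also have "\<dots> = ennreal (C * e)"
    unfolding mult.commute[of "indicator _ _"] using e C by (simp add: nn_integral_cmult_indicator ennreal_mult)
  finally have le: "(\<integral>\<^sup>+x. ennreal \<bar>avg e g x - g x\<bar> \<partial>lborel) \<le> ennreal (C * e)" .
  show i: "integrable lborel (\<lambda>x. \<bar>avg e g x - g x\<bar>)"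
    by (rule integrableI_bounded) (use le in \<open>auto simp: less_top[symmetric] top_unique\<close>)
  show "(LBINT x. \<bar>avg e g x - g x\<bar>) \<le> C * e"
    using le C e by (subst (asm) nn_integral_eq_integral[OF i]) (auto simp: ennreal_le_iff)
qed

section \<open>The exponential estimate\<close>

text \<open>The function \<open>k\<close> is a positive substitute for \<open>-Q/a\<close>, with which it agrees near infinity.
  Neither \<open>k\<close> nor \<open>n\<close> is continuous, so the energy is formed with their averages over intervals of
  length \<open>h\<^sup>2\<close>. The averages \<open>\<kappa>\<close>, \<open>\<nu>\<close> satisfy \<open>\<integral> |\<kappa>'| + |k - \<kappa>| \<le> C\<close> and
  \<open>\<integral> h |\<nu>'| + (n - \<nu>)\<^sup>2 \<le> C\<close>, and these are the rates of growth of the energy, up to \<open>1/h\<close>.\<close>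

locale uniform_system = reduced_system h \<epsilon> "M / h" M a w Q n B
  for h \<epsilon> M and a w Q n B :: "real \<Rightarrow> real" +
  fixes k :: "real \<Rightarrow> real" and R :: real
  assumes h_le: "h \<le> M" and eps_le: "\<bar>\<epsilon>\<bar> \<le> M" and R: "0 \<le> R" "R \<le> M"
    and n_tbv: "tbv (M / h) n" and k_tbv: "tbv M k"
    and k_bd: "\<And>x. 1 / M \<le> k x" "\<And>x. k x \<le> M"
    and k_infinity: "AE x in lborel. R \<le> \<bar>x\<bar> \<longrightarrow> Q x + a x * k x = 0"
begin

lemma M_pos: "0 < M" using M_ge by simp

lemma k_borel: "k \<in> borel_measurable borel" using k_tbv by (simp add: tbv_def)

lemma k_pos: "0 < k x" using k_bd(1)[of x] M_pos by (smt (verit) divide_pos_pos)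

lemma locbdd_k: "locbdd k"
  using k_pos k_bd(2) by (intro locbdd_bounded[OF k_borel, of M]) (auto simp: abs_of_pos)

lemma locints: "locint n" "locint k"
  using locintb_locbdd[OF locbdd_coeffs(4)] locintb_locbdd[OF locbdd_k] by (auto intro: locintbD(3))

definition \<nu> :: "real \<Rightarrow> real" where "\<nu> = avg (h\<^sup>2) n"
definition \<nu>' :: "real \<Rightarrow> real" where "\<nu>' x = (1 / h\<^sup>2) * (n (x + h\<^sup>2) - n x)"
definition \<kappa> :: "real \<Rightarrow> real" where "\<kappa> = avg (h\<^sup>2) k"
definition \<kappa>' :: "real \<Rightarrow> real" where "\<kappa>' x = (1 / h\<^sup>2) * (k (x + h\<^sup>2) - k x)"

lemma h2_pos: "0 < h\<^sup>2" using h_pos by simp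

lemma \<nu>_ac: "ac_on UNIV \<nu> \<nu>'" and \<kappa>_ac: "ac_on UNIV \<kappa> \<kappa>'"
  unfolding \<nu>_def \<nu>'_def[abs_def] \<kappa>_def \<kappa>'_def[abs_def] by (intro avg_ac locints)+

lemma \<nu>_bd: "\<bar>\<nu> x\<bar> \<le> M / h"
  using avg_bounds[OF locints(1) h2_pos, of "- (M / h)" "M / h" x] n_bd unfolding \<nu>_def
  by (simp add: abs_le_iff minus_le_iff)

lemma \<kappa>_bd: "1 / M \<le> \<kappa> x" "\<kappa> x \<le> M"
  using avg_bounds[OF locints(2) h2_pos k_bd] unfolding \<kappa>_def .

lemma \<kappa>_pos: "0 < \<kappa> x" using \<kappa>_bd(1)[of x] M_pos by (smt (verit) divide_pos_pos)

lemma averages_integrable: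
  "integrable lborel (\<lambda>x. \<bar>\<kappa> x - k x\<bar>)" "integrable lborel (\<lambda>x. \<bar>\<nu> x - n x\<bar>)"
  "integrable lborel (\<lambda>x. \<bar>\<kappa>' x\<bar>)" "integrable lborel (\<lambda>x. \<bar>\<nu>' x\<bar>)"
  "(LBINT x. \<bar>\<kappa> x - k x\<bar>) \<le> M^3" "(LBINT x. \<bar>\<nu> x - n x\<bar>) \<le> M\<^sup>2"
  "(LBINT x. \<bar>\<kappa>' x\<bar>) \<le> M" "h * (LBINT x. \<bar>\<nu>' x\<bar>) \<le> M"
proof -
  note 1 = avg_diff_integrable[OF k_tbv locints(2) h2_pos] and 2 = avg_diff_integrable[OF n_tbv locints(1) h2_pos]
  note 3 = tbv_integrable[OF k_tbv h2_pos] and 4 = tbv_integrable[OF n_tbv h2_pos]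
  have e: "\<bar>\<kappa>' x\<bar> = (1 / h\<^sup>2) * \<bar>k (x + h\<^sup>2) - k x\<bar>" "\<bar>\<nu>' x\<bar> = (1 / h\<^sup>2) * \<bar>n (x + h\<^sup>2) - n x\<bar>" for x
    by (simp_all add: \<kappa>'_def \<nu>'_def abs_mult)
  show "integrable lborel (\<lambda>x. \<bar>\<kappa> x - k x\<bar>)" "integrable lborel (\<lambda>x. \<bar>\<nu> x - n x\<bar>)"
    using 1 2 by (simp_all add: \<kappa>_def \<nu>_def)
  show "integrable lborel (\<lambda>x. \<bar>\<kappa>' x\<bar>)" "integrable lborel (\<lambda>x. \<bar>\<nu>' x\<bar>)"
    unfolding e by (intro integrable_mult_right 3 4)+
  have "M * h\<^sup>2 \<le> M * M\<^sup>2" using h_le h_pos M_pos by (intro mult_left_mono power_mono) auto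
  then show "(LBINT x. \<bar>\<kappa> x - k x\<bar>) \<le> M^3" using 1(2) by (simp add: \<kappa>_def power3_eq_cube power2_eq_square)
  have "M / h * h\<^sup>2 \<le> M * M" using h_le h_pos M_pos by (simp add: power2_eq_square)
  then show "(LBINT x. \<bar>\<nu> x - n x\<bar>) \<le> M\<^sup>2" using 2(2) by (simp add: \<nu>_def power2_eq_square)
  show "(LBINT x. \<bar>\<kappa>' x\<bar>) \<le> M" unfolding e using 3(2) h2_pos by (simp add: field_simps)
  have "h * ((1 / h\<^sup>2) * (LBINT x. \<bar>n (x + h\<^sup>2) - n x\<bar>)) \<le> h * ((1 / h\<^sup>2) * (M / h * h\<^sup>2))"
    using h_pos 4(2) by (intro mult_left_mono) auto
  also have "\<dots> = M" using h_pos by simp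
  finally show "h * (LBINT x. \<bar>\<nu>' x\<bar>) \<le> M" unfolding e by simp
qed

text \<open>The growth rate of the energy \<open>S\<close>. The summands measure, in order, how far
  k is from -Q/a, the averaging error of k, the derivative of \<nu>, the quadratic and the linear
  effect of n - \<nu>, and the derivative of \<kappa>.\<close>

definition g :: "real \<Rightarrow> real" where
  "g x = 1 / h * ((1 + M) * (\<bar>Q x + a x * k x\<bar> + M * \<bar>\<kappa> x - k x\<bar> + h * \<bar>\<nu>' x\<bar> + M * (2 * M / h * \<bar>\<nu> x - n x\<bar>)) + 2 * M * \<bar>\<nu> x - n x\<bar> + h * (M * \<bar>\<kappa>' x\<bar>))"

text \<open>Bounds h times the integral of \<open>g\<close>, summand by summand and free of h. The
  first product comes from |Q + a k|, which is at most M + M^2 and lives on [-R, R] with R \<le>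
  M.\<close>

definition Cg :: real where
  "Cg = (1 + M) * ((M + M\<^sup>2) * (2 * M) + M * M^3 + M + M * (2 * M * M)) + 2 * M * M\<^sup>2 + M * (M * M)"

lemma Qk_integrable:
  "integrable lborel (\<lambda>x. \<bar>Q x + a x * k x\<bar>)" "(LBINT x. \<bar>Q x + a x * k x\<bar>) \<le> (M + M\<^sup>2) * (2 * M)"
proof -
  have m: "(\<lambda>x. \<bar>Q x + a x * k x\<bar>) \<in> borel_measurable lborel" using borel k_borel by measurable
  have i: "integrable lborel (\<lambda>x. (M + M\<^sup>2) * indicator {-R..R} x)"
    by (intro integrable_mult_right integrable_real_indicator) (auto simp: emeasure_lborel_Icc_eq)
  have le: "AE x in lborel. \<bar>Q x + a x * k x\<bar> \<le> (M + M\<^sup>2) * indicator {-R..R} x"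
    using k_infinity
  proof eventually_elim
    case (elim x)
    show ?case
    proof (cases "x \<in> {-R..R}")
      case True
      have "\<bar>a x * k x\<bar> \<le> M * M" unfolding abs_mult using a_bd(2)[of x] a_pos[of x] k_bd(2)[of x] k_pos[of x] M_pos
        by (intro mult_mono) auto
      then show ?thesis using True Q_bd[of x] abs_triangle_ineq[of "Q x" "a x * k x"] by (simp add: power2_eq_square)
    next
      case False
      then have "R \<le> \<bar>x\<bar>" by auto
      then show ?thesis using elim False by simp
    qed
  qed
  show 1: "integrable lborel (\<lambda>x. \<bar>Q x + a x * k x\<bar>)"
    by (rule Bochner_Integration.integrable_bound[OF i m]) (use le in eventually_elim, simp)
  have "(LBINT x. \<bar>Q x + a x * k x\<bar>) \<le> (LBINT x. (M + M\<^sup>2) * indicator {-R..R} x)"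
    by (rule integral_mono_AE[OF 1 i le])
  also have "\<dots> = (M + M\<^sup>2) * (2 * R)" using R by simp
  also have "\<dots> \<le> (M + M\<^sup>2) * (2 * M)" using R M_pos by (intro mult_left_mono) auto
  finally show "(LBINT x. \<bar>Q x + a x * k x\<bar>) \<le> (M + M\<^sup>2) * (2 * M)" .
qed

lemma g_nonneg: "0 \<le> g x"
  unfolding g_def using h_pos M_pos by (intro mult_nonneg_nonneg add_nonneg_nonneg) auto

lemma g_integrable: "integrable lborel g" "(LBINT x. g x) \<le> Cg / h"
proof -
  note A = averages_integrable and q = Qk_integrable
  show "integrable lborel g" unfolding g_def[abs_def]
    by (intro integrable_mult_right Bochner_Integration.integrable_add A q)
  have "(LBINT x. g x) = 1 / h * ((1 + M) * ((LBINT x. \<bar>Q x + a x * k x\<bar>) + M * (LBINT x. \<bar>\<kappa> x - k x\<bar>)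
     + h * (LBINT x. \<bar>\<nu>' x\<bar>) + M * (2 * M / h * (LBINT x. \<bar>\<nu> x - n x\<bar>)))
     + 2 * M * (LBINT x. \<bar>\<nu> x - n x\<bar>) + h * (M * (LBINT x. \<bar>\<kappa>' x\<bar>)))"
    unfolding g_def using A q by (simp del: times_divide_eq_left)
  also have "\<dots> \<le> 1 / h * Cg"
    unfolding Cg_def
  proof (intro mult_left_mono add_mono)
    \<comment> \<open>The bound M^2 of \<open>averages_integrable\<close> is too weak for this
      summand. The sharper value M h is what cancels the factor 1/h, and it fixes the averaging
      length h^2.\<close>
    have "(LBINT x. \<bar>\<nu> x - n x\<bar>) \<le> M / h * h\<^sup>2"
      using avg_diff_integrable(2)[OF n_tbv locints(1) h2_pos] by (simp add: \<nu>_def)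
    then have "2 * M / h * (LBINT x. \<bar>\<nu> x - n x\<bar>) \<le> 2 * M / h * (M / h * h\<^sup>2)"
      using M_pos h_pos by (intro mult_left_mono) auto
    also have "\<dots> = 2 * M * M" using h_pos by (simp add: power2_eq_square)
    finally show "2 * M / h * (LBINT x. \<bar>\<nu> x - n x\<bar>) \<le> 2 * M * M" .
    have "h * (M * (LBINT x. \<bar>\<kappa>' x\<bar>)) \<le> M * (M * M)"
      using h_le h_pos M_pos A(7) by (intro mult_mono mult_nonneg_nonneg Bochner_Integration.integral_nonneg) auto
    then show "h * (M * (LBINT x. \<bar>\<kappa>' x\<bar>)) \<le> M * (M * M)" .
  qed (use A q M_pos h_pos in auto)
  finally show "(LBINT x. g x) \<le> Cg / h" by simp
qed

text \<open>The flux with n replaced by its average \<nu>. It is absolutely continuous, while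
  \<open>P U r\<close> jumps with n, and it differs from the flux by (\<nu> - n) U.\<close>

definition pt :: "(real \<Rightarrow> complex) \<Rightarrow> (real \<Rightarrow> complex) \<Rightarrow> real \<Rightarrow> complex" where
  "pt U r x = r x + of_real (\<nu> x) * U x"

definition S :: "(real \<Rightarrow> complex) \<Rightarrow> (real \<Rightarrow> complex) \<Rightarrow> real \<Rightarrow> real" where
  "S U r x = (cmod (pt U r x))\<^sup>2 + \<kappa> x * (cmod (U x))\<^sup>2"

definition dpt :: "(real \<Rightarrow> complex) \<Rightarrow> (real \<Rightarrow> complex) \<Rightarrow> (real \<Rightarrow> complex) \<Rightarrow> real \<Rightarrow> complex" where
  "dpt f U r x = dr f U r x + (of_real (\<nu>' x) * U x + of_real (\<nu> x) * dU U r x)"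

definition dS :: "(real \<Rightarrow> complex) \<Rightarrow> (real \<Rightarrow> complex) \<Rightarrow> (real \<Rightarrow> complex) \<Rightarrow> real \<Rightarrow> real" where
  "dS f U r x = 2 * Re (cnj (pt U r x) * dpt f U r x) + (\<kappa>' x * (cmod (U x))\<^sup>2 + \<kappa> x * (2 * Re (cnj (U x) * dU U r x)))"

lemma S_ac:
  assumes s: "sol UNIV f U r" shows "ac_on UNIV (S U r) (dS f U r)"
proof -
  have sq: "ac_on UNIV (\<lambda>x. (cmod (V x))\<^sup>2) (\<lambda>x. 2 * Re (cnj (V x) * v x))" if "ac_on UNIV V v" for V v
  proof -
    have "ac_on UNIV (\<lambda>x. Re (cnj (V x) * V x)) (\<lambda>x. Re (cnj (v x) * V x + cnj (V x) * v x))"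
      by (intro ac_on_bounded_linear[OF bounded_linear_Re] ac_on_mult ac_on_bounded_linear[OF bounded_linear_cnj] that is_interval_univ)
    then show ?thesis
      by (rule ac_on_cong[OF _ _ _ is_interval_univ]) (simp_all add: cmod_power2 power2_eq_square[of "Re _"] power2_eq_square[of "Im _"])
  qed
  have U: "ac_on UNIV U (dU U r)" "ac_on UNIV r (dr f U r)" using s by (auto simp: sol_def)
  have "ac_on UNIV (pt U r) (dpt f U r)"
    unfolding pt_def[abs_def] dpt_def[abs_def]
    by (intro ac_on_add U ac_on_mult ac_on_bounded_linear[OF bounded_linear_of_real] \<nu>_ac is_interval_univ)
  then show ?thesis unfolding S_def[abs_def] dS_def[abs_def]
    by (intro ac_on_add ac_on_mult sq U \<kappa>_ac is_interval_univ)
qed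

text \<open>The terms with B cancel. The leading coefficient Q + a \<kappa> would vanish for
  \<kappa> = -Q/a; what remains are averaging errors, derivatives of the averages, the \<epsilon>
  term and the source.\<close>

lemma dS_identity:
  "h * dS f U r x = 2 * (Q x + a x * \<kappa> x + h * \<nu>' x - a x * (n x - \<nu> x)\<^sup>2) * Re (cnj (pt U r x) * U x)
     + 2 * (\<epsilon> * w x) * Im (cnj (pt U r x) * U x) - 2 * a x * (n x - \<nu> x) * (cmod (pt U r x))\<^sup>2
     - 2 * w x * Re (cnj (pt U r x) * f x) + 2 * \<kappa> x * a x * (n x - \<nu> x) * (cmod (U x))\<^sup>2 + h * \<kappa>' x * (cmod (U x))\<^sup>2"
proof -
  obtain u1 u2 where u: "U x = Complex u1 u2" by (cases "U x")
  obtain p1 p2 where p: "pt U r x = Complex p1 p2" by (cases "pt U r x")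
  obtain f1 f2 where f: "f x = Complex f1 f2" by (cases "f x")
  have P: "P U r x = pt U r x + of_real (n x - \<nu> x) * U x" by (simp add: P_def pt_def algebra_simps)
  have 1: "of_real h * dU U r x = of_real (a x) * P U r x - \<i> * of_real (B x) * U x"
    unfolding dU_def using h_pos by simp
  have 2: "of_real h * dpt f U r x = (of_real (Q x + h * \<nu>' x) - \<i> * of_real (\<epsilon> * w x)) * U x - of_real (w x) * f x - \<i> * of_real (B x) * P U r x
       - of_real (n x - \<nu> x) * (of_real (a x) * P U r x - \<i> * of_real (B x) * U x)"
    unfolding dpt_def dr_def dU_def using h_pos by (simp add: field_simps)
  have h: "h * Re z = Re (of_real h * z)" for z by simp
  have "h * dS f U r x = 2 * Re (cnj (pt U r x) * (of_real h * dpt f U r x)) + (h * \<kappa>' x * (cmod (U x))\<^sup>2 + \<kappa> x * (2 * Re (cnj (U x) * (of_real h * dU U r x))))"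
    unfolding dS_def by (simp add: algebra_simps)
  also have "\<dots> = 2 * (Q x + a x * \<kappa> x + h * \<nu>' x - a x * (n x - \<nu> x)\<^sup>2) * Re (cnj (pt U r x) * U x)
     + 2 * (\<epsilon> * w x) * Im (cnj (pt U r x) * U x) - 2 * a x * (n x - \<nu> x) * (cmod (pt U r x))\<^sup>2
     - 2 * w x * Re (cnj (pt U r x) * f x) + 2 * \<kappa> x * a x * (n x - \<nu> x) * (cmod (U x))\<^sup>2 + h * \<kappa>' x * (cmod (U x))\<^sup>2"
    unfolding 1 2 P cmod_power2 u p f by (simp add: power2_eq_square algebra_simps)
  finally show ?thesis .
qed

lemma S_lower: "(cmod (pt U r x))\<^sup>2 \<le> S U r x" "(cmod (U x))\<^sup>2 \<le> M * S U r x" "0 \<le> S U r x"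
  "cmod (pt U r x) * cmod (U x) \<le> (1 + M) / 2 * S U r x"
proof -
  have k: "0 \<le> \<kappa> x * (cmod (U x))\<^sup>2" using \<kappa>_pos[of x] by simp
  then show 1: "(cmod (pt U r x))\<^sup>2 \<le> S U r x" and "0 \<le> S U r x" by (simp_all add: S_def)
  have "1 \<le> M * \<kappa> x" using \<kappa>_bd(1)[of x] M_pos by (simp add: field_simps)
  then have "1 * (cmod (U x))\<^sup>2 \<le> (M * \<kappa> x) * (cmod (U x))\<^sup>2" by (rule mult_right_mono) simp
  also have "\<dots> \<le> M * S U r x" using M_pos by (simp add: S_def mult.assoc mult_left_mono)
  finally show 2: "(cmod (U x))\<^sup>2 \<le> M * S U r x" by simp
  show "cmod (pt U r x) * cmod (U x) \<le> (1 + M) / 2 * S U r x"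
    using sum_squares_bound[of "cmod (pt U r x)" "cmod (U x)"] 1 2 by (simp add: field_simps)
qed

text \<open>The \<epsilon> term is counted among the sources. In the rate \<open>g\<close> it would
  contribute a constant, which has infinite integral over the line.\<close>

definition FF :: "(real \<Rightarrow> complex) \<Rightarrow> (real \<Rightarrow> complex) \<Rightarrow> (real \<Rightarrow> complex) \<Rightarrow> real \<Rightarrow> real" where
  "FF f U r x = 2 * M / h * (\<bar>\<epsilon>\<bar> * (cmod (pt U r x) * cmod (U x)) + cmod (pt U r x) * cmod (f x))"

lemma dS_bound: "dS f U r x \<le> g x * S U r x + FF f U r x"
proof -
  let ?p = "cmod (pt U r x)" and ?u = "cmod (U x)" and ?S = "S U r x"
  let ?d = "\<nu> x - n x"
  have S0: "0 \<le> ?S" by (rule S_lower)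
  have pu: "0 \<le> ?p * ?u" by simp
  have d: "\<bar>n x - \<nu> x\<bar> = \<bar>?d\<bar>" by (rule abs_minus_commute)
  \<comment> \<open>One factor is bounded by 2 M / h, so that only the first power of the averaging
    error, which is small in L1, remains.\<close>
  have d2: "(n x - \<nu> x)\<^sup>2 \<le> 2 * M / h * \<bar>?d\<bar>"
  proof -
    have "\<bar>?d\<bar> \<le> 2 * M / h" using \<nu>_bd[of x] n_bd[of x] by (simp add: abs_le_iff)
    then have "\<bar>?d\<bar> * \<bar>?d\<bar> \<le> 2 * M / h * \<bar>?d\<bar>" by (rule mult_right_mono) simp
    then show ?thesis by (simp add: power2_eq_square algebra_simps abs_mult_self_eq flip: abs_mult)
  qed
  have mulM: "y * a x \<le> y * M" "y * w x \<le> y * M" if "0 \<le> y" for y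
    using that a_bd(2)[of x] w_bd(2)[of x] by (auto intro: mult_left_mono)
  let ?G = "\<bar>Q x + a x * k x\<bar> + M * \<bar>\<kappa> x - k x\<bar> + h * \<bar>\<nu>' x\<bar> + M * (2 * M / h * \<bar>?d\<bar>)"
  have c1: "\<bar>Q x + a x * \<kappa> x + h * \<nu>' x - a x * (n x - \<nu> x)\<^sup>2\<bar> \<le> ?G"
  proof -
    have "Q x + a x * \<kappa> x = (Q x + a x * k x) + a x * (\<kappa> x - k x)" by (simp add: algebra_simps)
    then have "\<bar>Q x + a x * \<kappa> x + h * \<nu>' x - a x * (n x - \<nu> x)\<^sup>2\<bar> \<le> \<bar>Q x + a x * k x\<bar> + \<bar>a x * (\<kappa> x - k x)\<bar> + \<bar>h * \<nu>' x\<bar> + \<bar>a x * (n x - \<nu> x)\<^sup>2\<bar>"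
      by linarith
    moreover have "\<bar>a x * (\<kappa> x - k x)\<bar> \<le> M * \<bar>\<kappa> x - k x\<bar>"
      using mulM(1)[of "\<bar>\<kappa> x - k x\<bar>"] a_pos[of x] by (simp add: abs_mult mult.commute)
    moreover have "\<bar>h * \<nu>' x\<bar> = h * \<bar>\<nu>' x\<bar>" using h_pos by (simp add: abs_mult)
    moreover have "\<bar>a x * (n x - \<nu> x)\<^sup>2\<bar> \<le> M * (2 * M / h * \<bar>?d\<bar>)"
      unfolding abs_mult using a_bd(2)[of x] a_pos[of x] d2 M_pos by (intro mult_mono) auto
    ultimately show ?thesis by linarith
  qed
  have t1: "2 * (Q x + a x * \<kappa> x + h * \<nu>' x - a x * (n x - \<nu> x)\<^sup>2) * Re (cnj (pt U r x) * U x) \<le> (1 + M) * ?G * ?S"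
  proof -
    let ?c = "Q x + a x * \<kappa> x + h * \<nu>' x - a x * (n x - \<nu> x)\<^sup>2"
    have rb: "\<bar>Re (cnj (pt U r x) * U x)\<bar> \<le> (1 + M) / 2 * ?S"
      by (rule order_trans[OF Re_mult_bound]) (use S_lower(4)[of U r x] in simp)
    have "?c * Re (cnj (pt U r x) * U x) \<le> \<bar>?c\<bar> * \<bar>Re (cnj (pt U r x) * U x)\<bar>"
      by (metis abs_ge_self abs_mult)
    also have "\<dots> \<le> ?G * ((1 + M) / 2 * ?S)"
      by (rule mult_mono[OF c1 rb order_trans[OF abs_ge_zero c1] abs_ge_zero])
    finally show ?thesis by (simp add: field_simps)
  qed
  have t2: "2 * (\<epsilon> * w x) * Im (cnj (pt U r x) * U x) \<le> 2 * M * (\<bar>\<epsilon>\<bar> * (?p * ?u))"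
  proof -
    have "(\<epsilon> * w x) * Im (cnj (pt U r x) * U x) \<le> \<bar>\<epsilon> * w x\<bar> * \<bar>Im (cnj (pt U r x) * U x)\<bar>"
      by (metis abs_ge_self abs_mult)
    also have "\<dots> \<le> (\<bar>\<epsilon>\<bar> * M) * (?p * ?u)"
      using abs_Im_le_cmod[of "cnj (pt U r x) * U x"] w_bd(2)[of x] w_pos[of x] M_pos
      by (intro mult_mono) (auto simp: norm_mult abs_mult intro: mult_left_mono)
    finally show ?thesis by (simp add: algebra_simps)
  qed
  have t3: "- 2 * a x * (n x - \<nu> x) * ?p\<^sup>2 + 2 * \<kappa> x * a x * (n x - \<nu> x) * ?u\<^sup>2 \<le> 2 * M * \<bar>?d\<bar> * ?S"
  proof -
    have k0: "0 \<le> \<kappa> x * ?u\<^sup>2" using \<kappa>_pos[of x] by simp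
    have "- 2 * a x * (n x - \<nu> x) * ?p\<^sup>2 + 2 * \<kappa> x * a x * (n x - \<nu> x) * ?u\<^sup>2 = (2 * a x) * ((n x - \<nu> x) * (\<kappa> x * ?u\<^sup>2 - ?p\<^sup>2))"
      by (simp add: algebra_simps)
    also have "\<dots> \<le> (2 * a x) * (\<bar>?d\<bar> * ?S)"
    proof (rule mult_left_mono)
      have "(n x - \<nu> x) * (\<kappa> x * ?u\<^sup>2 - ?p\<^sup>2) \<le> \<bar>n x - \<nu> x\<bar> * \<bar>\<kappa> x * ?u\<^sup>2 - ?p\<^sup>2\<bar>" by (metis abs_ge_self abs_mult)
      also have "\<dots> \<le> \<bar>?d\<bar> * ?S" unfolding d
        using k0 by (intro mult_left_mono) (auto simp: S_def abs_le_iff)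
      finally show "(n x - \<nu> x) * (\<kappa> x * ?u\<^sup>2 - ?p\<^sup>2) \<le> \<bar>?d\<bar> * ?S" .
    qed (use a_pos[of x] in simp)
    also have "\<dots> \<le> 2 * M * \<bar>?d\<bar> * ?S"
      using mulM(1)[of "2 * (\<bar>?d\<bar> * ?S)"] S0 by (simp add: algebra_simps)
    finally show ?thesis .
  qed
  have t4: "- 2 * w x * Re (cnj (pt U r x) * f x) \<le> 2 * M * (?p * cmod (f x))"
  proof -
    have "- Re (cnj (pt U r x) * f x) \<le> ?p * cmod (f x)"
      using Re_mult_bound[of "cnj (pt U r x)" "f x"] by simp
    then have "w x * (- Re (cnj (pt U r x) * f x)) \<le> w x * (?p * cmod (f x))"
      using w_pos[of x] by (intro mult_left_mono) auto
    also have "\<dots> \<le> M * (?p * cmod (f x))" using w_bd(2)[of x] by (intro mult_right_mono) auto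
    finally show ?thesis by (simp add: algebra_simps)
  qed
  have t5: "h * \<kappa>' x * ?u\<^sup>2 \<le> h * (M * \<bar>\<kappa>' x\<bar>) * ?S"
  proof -
    have "\<kappa>' x * ?u\<^sup>2 \<le> \<bar>\<kappa>' x\<bar> * (M * ?S)"
      using S_lower(2)[of U x r] by (intro mult_mono) auto
    then have "h * (\<kappa>' x * ?u\<^sup>2) \<le> h * (\<bar>\<kappa>' x\<bar> * (M * ?S))" using h_pos by (intro mult_left_mono) auto
    then show ?thesis by (simp add: algebra_simps)
  qed
  have sc: "1 / h * (A * s + 2 * M * y) = 1 / h * A * s + 2 * M / h * y" for A s y
    using h_pos by (simp add: field_simps)
  have dist: "(A + C + E) * s + m * (y + z) = A * s + C * s + E * s + (m * y + m * z)" for A C E s m y z :: real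
    by (simp add: algebra_simps)
  have "h * dS f U r x \<le> ((1 + M) * ?G + 2 * M * \<bar>?d\<bar> + h * (M * \<bar>\<kappa>' x\<bar>)) * ?S + 2 * M * (\<bar>\<epsilon>\<bar> * (?p * ?u) + ?p * cmod (f x))"
    unfolding dS_identity dist using t1 t2 t3 t4 t5 by linarith
  then have "1 / h * (h * dS f U r x) \<le> 1 / h * (((1 + M) * ?G + 2 * M * \<bar>?d\<bar> + h * (M * \<bar>\<kappa>' x\<bar>)) * ?S + 2 * M * (\<bar>\<epsilon>\<bar> * (?p * ?u) + ?p * cmod (f x)))"
    using h_pos by (intro mult_left_mono) auto
  also have "\<dots> = g x * S U r x + FF f U r x"
    unfolding g_def FF_def sc ..
  finally show ?thesis using h_pos by simp
qed

lemma pt_L2: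
  assumes s: "sol UNIV f U r" and UP: "U \<in> L2" "P U r \<in> L2"
  shows "pt U r \<in> L2" "integrable lborel (S U r)"
    "(cmod (pt U r x)) * cmod (U x) \<le> (cmod (P U r x))\<^sup>2 + (1 + 2 * M / h) * (cmod (U x))\<^sup>2"
proof -
  have nd: "\<bar>\<nu> x - n x\<bar> \<le> 2 * M / h" for x using \<nu>_bd[of x] n_bd[of x] by (simp add: abs_le_iff)
  have C: "0 \<le> 2 * M / h" using M_pos h_pos by simp
  have ple: "cmod (pt U r x) \<le> cmod (P U r x) + 2 * M / h * cmod (U x)" for x
  proof -
    have "pt U r x = P U r x + of_real (\<nu> x - n x) * U x" by (simp add: P_def pt_def algebra_simps)
    also have "cmod \<dots> \<le> cmod (P U r x) + \<bar>\<nu> x - n x\<bar> * cmod (U x)"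
      by (rule order_trans[OF norm_triangle_ineq]) (simp only: norm_mult norm_of_real order_refl)
    also have "\<bar>\<nu> x - n x\<bar> * cmod (U x) \<le> 2 * M / h * cmod (U x)" using nd[of x] by (intro mult_right_mono) auto
    finally show ?thesis by simp
  qed
  have iU: "integrable lborel (\<lambda>x. (cmod (U x))\<^sup>2)" and iP: "integrable lborel (\<lambda>x. (cmod (P U r x))\<^sup>2)"
    using UP by (auto simp: L2_def)
  have ptm: "pt U r \<in> borel_measurable borel"
    using locbddD(1)[OF sol_locbdd(1)[OF s]] locbddD(1)[OF sol_locbdd(2)[OF s]] avg_borel[OF locints(1), of "h\<^sup>2"]
    unfolding pt_def[abs_def] \<nu>_def by measurable
  have "integrable lborel (\<lambda>x. (cmod (pt U r x))\<^sup>2)"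
  proof (rule Bochner_Integration.integrable_bound)
    show "integrable lborel (\<lambda>x. 2 * (cmod (P U r x))\<^sup>2 + 2 * (2 * M / h)\<^sup>2 * (cmod (U x))\<^sup>2)" using iU iP by auto
    have "(cmod (pt U r x))\<^sup>2 \<le> 2 * (cmod (P U r x))\<^sup>2 + 2 * (2 * M / h)\<^sup>2 * (cmod (U x))\<^sup>2" for x
    proof -
      have "(cmod (pt U r x))\<^sup>2 \<le> (cmod (P U r x) + 2 * M / h * cmod (U x))\<^sup>2" by (intro power_mono ple) auto
      also have "\<dots> \<le> 2 * (cmod (P U r x))\<^sup>2 + 2 * (2 * M / h * cmod (U x))\<^sup>2"
        using sum_squares_bound[of "cmod (P U r x)" "2 * M / h * cmod (U x)"] unfolding power2_sum by linarith
      finally show ?thesis by (simp add: power_mult_distrib power_divide)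
    qed
    then show "AE x in lborel. norm ((cmod (pt U r x))\<^sup>2) \<le> norm (2 * (cmod (P U r x))\<^sup>2 + 2 * (2 * M / h)\<^sup>2 * (cmod (U x))\<^sup>2)"
      by (intro AE_I2) (simp add: abs_of_nonneg)
  qed (use ptm in measurable)
  then show p: "pt U r \<in> L2" using ptm by (simp add: L2_def)
  show "integrable lborel (S U r)"
  proof (rule Bochner_Integration.integrable_bound)
    show "integrable lborel (\<lambda>x. (cmod (pt U r x))\<^sup>2 + M * (cmod (U x))\<^sup>2)" using iU p by (auto simp: L2_def)
    show "S U r \<in> borel_measurable lborel"
      using borel_measurable_continuous_onI[OF ac_on_UNIV_continuous[OF S_ac[OF s]]] by simp
    show "AE x in lborel. norm (S U r x) \<le> norm ((cmod (pt U r x))\<^sup>2 + M * (cmod (U x))\<^sup>2)"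
    proof (rule AE_I2)
      fix x
      have "\<kappa> x * (cmod (U x))\<^sup>2 \<le> M * (cmod (U x))\<^sup>2" using \<kappa>_bd(2)[of x] by (intro mult_right_mono) auto
      then show "norm (S U r x) \<le> norm ((cmod (pt U r x))\<^sup>2 + M * (cmod (U x))\<^sup>2)"
        using S_lower(3)[of U r x] M_pos unfolding S_def by simp
    qed
  qed
  let ?u = "cmod (U x)" and ?p = "cmod (P U r x)"
  have "cmod (pt U r x) * ?u \<le> (?p + 2 * M / h * ?u) * ?u" by (intro mult_right_mono ple) auto
  also have "\<dots> = ?p * ?u + 2 * M / h * ?u\<^sup>2" by (simp add: algebra_simps power2_eq_square)
  also have "?p * ?u \<le> ?p\<^sup>2 + ?u\<^sup>2"
  proof -
    have "0 \<le> ?p * ?u" by simp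
    then show ?thesis using sum_squares_bound[of ?p ?u] unfolding mult.assoc by linarith
  qed
  finally show "(cmod (pt U r x)) * cmod (U x) \<le> (cmod (P U r x))\<^sup>2 + (1 + 2 * M / h) * (cmod (U x))\<^sup>2"
    by (simp add: algebra_simps)
qed

text \<open>Gronwall's inequality from -N to x, along N for which S at -N is small; integrability of
  S provides such N.\<close>

lemma S_le:
  assumes s: "sol UNIV f U r" and UP: "U \<in> L2" "P U r \<in> L2" and f: "f \<in> L2"
  shows "S U r x \<le> exp (Cg / h) * (LBINT x. FF f U r x)" "integrable lborel (FF f U r)"
proof -
  note pL = pt_L2[OF s UP]
  show Fi: "integrable lborel (FF f U r)"
    unfolding FF_def[abs_def]
    using L2_mult_integrable[OF pL(1) UP(1)] L2_mult_integrable[OF pL(1) f]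
    by (intro integrable_mult_right Bochner_Integration.integrable_add) auto
  have F0: "0 \<le> FF f U r x" for x unfolding FF_def using M_pos h_pos by simp
  define I where "I = (LBINT x. FF f U r x)"
  have sub: "set_integrable lborel A G" "(LBINT x:A. G x) \<le> (LBINT x. G x)"
    if "integrable lborel G" "\<And>x. 0 \<le> G x" "A \<in> sets borel" for G :: "real \<Rightarrow> real" and A
  proof -
    have i: "integrable lborel (\<lambda>x. indicat_real A x *\<^sub>R G x)" using that by (intro integrable_mult_indicator) auto
    then show "set_integrable lborel A G" by (simp add: set_integrable_def)
    show "(LBINT x:A. G x) \<le> (LBINT x. G x)"
      unfolding set_lebesgue_integral_def
      by (rule integral_mono[OF i that(1)]) (use that(2) in \<open>auto simp: indicator_def\<close>)
  qed
  have "S U r x \<le> exp (Cg / h) * I + \<delta>" if \<delta>: "0 < \<delta>" for \<delta>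
  proof -
    obtain N where N: "N \<ge> \<bar>x\<bar>" "S U r N + S U r (-N) < \<delta> / exp (Cg / h)"
      using small_boundary[OF pL(2) S_lower(3), of "\<delta> / exp (Cg / h)" "\<bar>x\<bar>"] \<delta> by auto
    have ac: "ac_on {-N..x} (S U r) (dS f U r)" using S_ac[OF s] by (rule ac_on_subset) simp
    have "S U r x \<le> exp (LBINT t:{-N..x}. g t) * (S U r (-N) + (LBINT t:{-N..x}. FF f U r t))"
      by (rule gronwall_forward[OF ac]) (use N(1) sub g_integrable(1) g_nonneg Fi F0 dS_bound in \<open>auto intro!: AE_I2\<close>)
    also have "\<dots> \<le> exp (Cg / h) * (\<delta> / exp (Cg / h) + I)"
      using sub(2)[OF g_integrable(1) g_nonneg, of "{-N..x}"] g_integrable(2) sub(2)[OF Fi F0, of "{-N..x}"] N(2) S_lower(3)[of U r N] S_lower(3)[of U r "-N"]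
      unfolding I_def by (intro mult_mono add_mono add_nonneg_nonneg set_integral_nonneg_on F0) auto
    also have "\<dots> = exp (Cg / h) * I + \<delta>" by (simp add: field_simps)
    finally show ?thesis .
  qed
  then show "S U r x \<le> exp (Cg / h) * I" by (rule field_le_epsilon)
qed

text \<open>Prepares membership in the operator domain, where the flux must be essentially bounded.
  The energy controls |U| and \<open>pt\<close>, and from these the flux at fixed h.\<close>

lemma sol_bounded:
  assumes s: "sol UNIV f U r" and UP: "U \<in> L2" "P U r \<in> L2" and f: "f \<in> L2"
  shows "\<exists>C. \<forall>x. cmod (U x) \<le> C \<and> cmod (P U r x) \<le> C"
proof -
  define I where "I = exp (Cg / h) * (LBINT x. FF f U r x)"
  have SI: "S U r x \<le> I" for x using S_le(1)[OF s UP f] by (simp add: I_def)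
  have U: "cmod (U x) \<le> M * I + 1" for x
    using self_le_power2_add_1[of "cmod (U x)"] S_lower(2)[of U x r] mult_left_mono[OF SI[of x], of M] M_pos by linarith
  have p: "cmod (pt U r x) \<le> I + 1" for x
    using self_le_power2_add_1[of "cmod (pt U r x)"] S_lower(1)[of U r x] SI[of x] by linarith
  have nd: "\<bar>n x - \<nu> x\<bar> \<le> 2 * M / h" for x using \<nu>_bd[of x] n_bd[of x] by (simp add: abs_le_iff)
  have "cmod (P U r x) \<le> (I + 1) + 2 * M / h * (M * I + 1)" for x
  proof -
    have "P U r x = pt U r x + of_real (n x - \<nu> x) * U x" by (simp add: P_def pt_def algebra_simps)
    also have "cmod \<dots> \<le> cmod (pt U r x) + \<bar>n x - \<nu> x\<bar> * cmod (U x)"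
      by (rule order_trans[OF norm_triangle_ineq]) (simp only: norm_mult norm_of_real order_refl)
    also have "\<dots> \<le> (I + 1) + 2 * M / h * (M * I + 1)"
      using nd[of x] U[of x] p[of x] M_pos h_pos by (intro add_mono mult_mono) auto
    finally show ?thesis .
  qed
  then show ?thesis using U by (intro exI[of _ "max (M * I + 1) ((I + 1) + 2 * M / h * (M * I + 1))"]) (simp add: max.coboundedI1 max.coboundedI2)
qed

text \<open>The factor in the bound of |\<epsilon>| times the integral of |pt| |U| by the integral
  of |U| |f|. It arises from the two parts of \<open>line_estimate\<close> and is of order
  1/h^2.\<close>

definition T :: real where
  "T = 2 * M * ((M + 2 * (M / h)\<^sup>2 * M) * M\<^sup>2 + M * M) + (1 + 2 * M / h) * M\<^sup>2"

definition Csup :: real where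
  "Csup = exp (Cg / h) * (2 * M / h * (T * M + 1))"

text \<open>Let X be the supremum of the square root of S and L the L1 norm of f. The source
  integrals in \<open>S_le\<close> are at most a constant times L X: the \<epsilon> term through
  \<open>T\<close>, the other because |pt| \<le> X. Hence X^2 \<le> \<open>Csup\<close> L X, and X
  cancels whatever \<epsilon> is.\<close>

lemma sup_estimate:
  assumes s: "sol UNIV f U r" and UP: "U \<in> L2" "P U r \<in> L2" and f: "f \<in> L2" "integrable lborel f"
  shows "cmod (U x) \<le> M * (Csup * (LBINT x. cmod (f x)))"
proof -
  define L where "L = (LBINT x. cmod (f x))"
  have L0: "0 \<le> L" unfolding L_def by (rule Bochner_Integration.integral_nonneg) simp
  define X where "X = (SUP x. sqrt (S U r x))"
  have bdd: "bdd_above (range (\<lambda>x. sqrt (S U r x)))"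
    using S_le(1)[OF s UP f(1)] by (intro bdd_aboveI2[of _ _ "sqrt (exp (Cg / h) * (LBINT x. FF f U r x))"]) simp
  have SX: "sqrt (S U r x) \<le> X" for x unfolding X_def by (rule cSUP_upper[OF _ bdd]) simp
  have X0: "0 \<le> X" using SX[of 0] S_lower(3)[of U r 0] by (meson order_trans real_sqrt_ge_zero)
  have pX: "cmod (pt U r x) \<le> X" for x
    using SX[of x] S_lower(1)[of U r x] real_le_rsqrt order_trans by blast
  have uX: "cmod (U x) \<le> M * X" for x
  proof -
    have "(cmod (U x))\<^sup>2 \<le> M * S U r x" by (rule S_lower)
    also have "\<dots> \<le> M\<^sup>2 * S U r x"
      using M_ge S_lower(3)[of U r x] by (intro mult_right_mono) (auto simp: power2_eq_square)
    finally have "cmod (U x) \<le> sqrt (M\<^sup>2 * S U r x)" by (rule real_le_rsqrt)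
    also have "\<dots> = M * sqrt (S U r x)" using M_pos by (simp add: real_sqrt_mult)
    also have "\<dots> \<le> M * X" using SX M_pos by (intro mult_left_mono) auto
    finally show ?thesis .
  qed
  define D where "D = (LBINT x. cmod (U x) * cmod (f x))"
  define AU where "AU = (LBINT x. (cmod (U x))\<^sup>2)"
  define AP where "AP = (LBINT x. (cmod (P U r x))\<^sup>2)"
  have fn: "integrable lborel (\<lambda>x. cmod (f x))" using f(2) by (rule integrable_norm)
  have D0: "0 \<le> D" unfolding D_def by (rule Bochner_Integration.integral_nonneg) simp
  have "D \<le> (LBINT x. (M * X) * cmod (f x))" unfolding D_def
    by (rule integral_mono[OF L2_mult_integrable[OF UP(1) f(1)] integrable_mult_right[OF fn]]) (use uX in \<open>auto intro: mult_right_mono\<close>)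
  then have DL: "D \<le> M * X * L" by (simp add: L_def)
  note line = line_estimate[OF s UP f(1), folded D_def AU_def AP_def]
  let ?c = "M + 2 * (M / h)\<^sup>2 * M"
  have c0: "0 \<le> ?c" using M_pos by simp
  \<comment> \<open>Only |\<epsilon>| times the square norm of U is under uniform control, so the
    estimate of the flux is used after multiplication by |\<epsilon>|.\<close>
  have "\<bar>\<epsilon>\<bar> * AP \<le> \<bar>\<epsilon>\<bar> * (2 * M * (?c * AU + M * D))" by (rule mult_left_mono[OF line(2)]) simp
  also have "\<dots> = 2 * M * (?c * (\<bar>\<epsilon>\<bar> * AU) + \<bar>\<epsilon>\<bar> * (M * D))" by (simp add: algebra_simps)
  also have "\<dots> \<le> 2 * M * (?c * (M\<^sup>2 * D) + M * (M * D))"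
    using line(1) c0 eps_le M_pos D0 by (intro mult_left_mono add_mono mult_right_mono) auto
  finally have AP: "\<bar>\<epsilon>\<bar> * AP \<le> 2 * M * (?c * (M\<^sup>2 * D) + M * (M * D))" .
  have iU: "integrable lborel (\<lambda>x. (cmod (U x))\<^sup>2)" and iP: "integrable lborel (\<lambda>x. (cmod (P U r x))\<^sup>2)"
    using UP by (auto simp: L2_def)
  note pL = pt_L2[OF s UP]
  note i1 = L2_mult_integrable[OF pL(1) UP(1)] and i2 = L2_mult_integrable[OF pL(1) f(1)]
  have "(LBINT x. cmod (pt U r x) * cmod (U x)) \<le> (LBINT x. (cmod (P U r x))\<^sup>2 + (1 + 2 * M / h) * (cmod (U x))\<^sup>2)"
    by (rule integral_mono[OF i1]) (use iU iP pL(3) in auto)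
  also have "\<dots> = AP + (1 + 2 * M / h) * AU" using iU iP by (simp add: AU_def AP_def)
  finally have "\<bar>\<epsilon>\<bar> * (LBINT x. cmod (pt U r x) * cmod (U x)) \<le> \<bar>\<epsilon>\<bar> * (AP + (1 + 2 * M / h) * AU)"
    by (rule mult_left_mono) simp
  also have "\<dots> = \<bar>\<epsilon>\<bar> * AP + (1 + 2 * M / h) * (\<bar>\<epsilon>\<bar> * AU)" by (simp add: algebra_simps)
  also have "\<dots> \<le> 2 * M * (?c * (M\<^sup>2 * D) + M * (M * D)) + (1 + 2 * M / h) * (M\<^sup>2 * D)"
    using AP line(1) M_pos h_pos by (intro add_mono mult_left_mono) auto
  also have "\<dots> = T * D" unfolding T_def by (simp add: algebra_simps)
  finally have E1: "\<bar>\<epsilon>\<bar> * (LBINT x. cmod (pt U r x) * cmod (U x)) \<le> T * D" .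
  have T0: "0 \<le> T" unfolding T_def using M_pos h_pos by (intro add_nonneg_nonneg mult_nonneg_nonneg) auto
  have "(LBINT x. cmod (pt U r x) * cmod (f x)) \<le> (LBINT x. X * cmod (f x))"
    by (rule integral_mono[OF i2 integrable_mult_right[OF fn]]) (use pX in \<open>auto intro: mult_right_mono\<close>)
  then have E2: "(LBINT x. cmod (pt U r x) * cmod (f x)) \<le> X * L" by (simp add: L_def)
  have "(LBINT x. FF f U r x) = 2 * M / h * (\<bar>\<epsilon>\<bar> * (LBINT x. cmod (pt U r x) * cmod (U x)) + (LBINT x. cmod (pt U r x) * cmod (f x)))"
    unfolding FF_def using i1 i2 by simp
  also have "\<dots> \<le> 2 * M / h * (T * (M * X * L) + X * L)"
    using E1 E2 mult_left_mono[OF DL T0] M_pos h_pos by (intro mult_left_mono add_mono) auto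
  finally have FL: "exp (Cg / h) * (LBINT x. FF f U r x) \<le> exp (Cg / h) * (2 * M / h * (T * (M * X * L) + X * L))"
    by (rule mult_left_mono) simp
  have "S U r y \<le> Csup * L * X" for y
  proof -
    have "exp (Cg / h) * (2 * M / h * (T * (M * X * L) + X * L)) = Csup * L * X"
      unfolding Csup_def by (simp add: distrib_left distrib_right add_divide_distrib mult_ac)
    then show ?thesis using order_trans[OF S_le(1)[OF s UP f(1)] FL] by simp
  qed
  then have "sqrt (S U r y) \<le> sqrt (Csup * L * X)" for y by simp
  then have "X \<le> sqrt (Csup * L * X)" unfolding X_def by (intro cSUP_least) auto
  then have "X\<^sup>2 \<le> Csup * L * X" using X0 by (metis power_mono real_sqrt_ge_zero real_sqrt_pow2_iff order_trans abs_of_nonneg real_sqrt_abs real_sqrt_le_iff)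
  then have "X \<le> Csup * L \<or> X = 0" using X0 by (auto simp: power2_eq_square)
  moreover have "0 \<le> Csup * L" unfolding Csup_def using L0 T0 M_pos h_pos by (intro mult_nonneg_nonneg add_nonneg_nonneg) auto
  ultimately have "X \<le> Csup * L" by auto
  then have "M * X \<le> M * (Csup * L)" using M_pos by (intro mult_left_mono) auto
  with uX[of x] show ?thesis unfolding L_def by (rule order_trans)
qed

end

section \<open>The cumulative distribution of the singular coefficients\<close>

text \<open>The distribution function of w V0 - c dx as a combination of four monotone ones. Since
  \<open>ennreal\<close> truncates, the last two densities are the positive and the negative part of
  c.\<close>

definition cumulative :: "(real set \<Rightarrow> real) \<Rightarrow> (real \<Rightarrow> real) \<Rightarrow> (real \<Rightarrow> real) \<Rightarrow> real \<Rightarrow> real" where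
  "cumulative V w c x =
     (measure (density (positive_part V) (\<lambda>x. ennreal (w x))) {..x} - measure (density (positive_part (\<lambda>A. - V A)) (\<lambda>x. ennreal (w x))) {..x})
     - (measure (density lborel (\<lambda>x. ennreal (c x))) {..x} - measure (density lborel (\<lambda>x. ennreal (- c x))) {..x})"

lemma emeasure_density_le:
  assumes "sets P = sets borel" "w \<in> borel_measurable borel" "\<And>x. w x \<le> M" "0 \<le> M" "emeasure P UNIV \<le> ennreal X" "0 \<le> X"
  shows "emeasure (density P (\<lambda>x. ennreal (w x))) UNIV \<le> ennreal (M * X)"
proof -
  have sp: "space P = UNIV" using sets_eq_imp_space_eq[OF assms(1)] by simp
  have [measurable]: "w \<in> borel_measurable P" using assms(1,2) by (simp cong: measurable_cong_sets)
  have "emeasure (density P (\<lambda>x. ennreal (w x))) UNIV = (\<integral>\<^sup>+x. ennreal (w x) \<partial>P)"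
    using emeasure_density[of "\<lambda>x. ennreal (w x)" P UNIV] sp by (simp add: assms(1))
  also have "\<dots> \<le> (\<integral>\<^sup>+x. ennreal M \<partial>P)" by (intro nn_integral_mono ennreal_leI assms)
  also have "\<dots> = ennreal M * emeasure P UNIV" by (simp add: sp)
  also have "\<dots> \<le> ennreal M * ennreal X" by (intro mult_left_mono assms) simp
  finally show ?thesis using assms by (simp add: ennreal_mult)
qed

lemma emeasure_density_lborel_le:
  assumes "integrable lborel c" "(LBINT x. \<bar>c x\<bar>) \<le> Y"
  shows "emeasure (density lborel (\<lambda>x. ennreal (c x))) UNIV \<le> ennreal Y"
proof -
  have [measurable]: "c \<in> borel_measurable borel" using assms(1) by auto
  have "emeasure (density lborel (\<lambda>x. ennreal (c x))) UNIV = (\<integral>\<^sup>+x. ennreal (c x) \<partial>lborel)"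
    using emeasure_density[of "\<lambda>x. ennreal (c x)" lborel UNIV] by simp
  also have "\<dots> \<le> (\<integral>\<^sup>+x. ennreal \<bar>c x\<bar> \<partial>lborel)" by (intro nn_integral_mono ennreal_leI) simp
  also have "\<dots> = ennreal (LBINT x. \<bar>c x\<bar>)" using assms(1) by (intro nn_integral_eq_integral) auto
  finally show ?thesis using assms(2) ennreal_leI order_trans by blast
qed

definition bmono :: "(real \<Rightarrow> real) \<Rightarrow> bool" where
  "bmono f \<longleftrightarrow> mono f \<and> (\<exists>C. \<forall>x. 0 \<le> f x \<and> f x \<le> C)"

lemma cdf_bounds:
  assumes M: "sets M = sets borel" "emeasure M UNIV \<le> ennreal C" "0 \<le> C"
  shows "bmono (\<lambda>x. measure M {..x})" "measure M {..x} \<le> C"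
proof -
  have sp: "space M = UNIV" using sets_eq_imp_space_eq[OF M(1)] by simp
  have "emeasure M (space M) \<noteq> \<infinity>" using M(2) sp by (auto simp: top_unique)
  then interpret finite_measure M by (rule finite_measureI)
  have le: "measure M {..x} \<le> C" for x
  proof -
    have "measure M {..x} \<le> measure M UNIV" by (rule finite_measure_mono) (auto simp: M(1))
    also have "\<dots> \<le> C" using M(2,3) by (simp add: measure_def enn2real_leI)
    finally show ?thesis .
  qed
  then show "measure M {..x} \<le> C" .
  have "mono (\<lambda>x. measure M {..x})" by (rule monoI) (auto intro!: finite_measure_mono simp: M)
  then show "bmono (\<lambda>x. measure M {..x})" using le unfolding bmono_def by (auto intro: exI[of _ C])
qed

locale cumulative_data =
  fixes V :: "real set \<Rightarrow> real" and w c :: "real \<Rightarrow> real" and M X Y :: real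
  assumes V: "finite_signed_measure V" "measure_norm V \<le> ennreal X" "0 \<le> X"
    and w: "w \<in> borel_measurable borel" "\<And>x. 0 \<le> w x" "\<And>x. w x \<le> M"
    and c: "integrable lborel c" "(LBINT x. \<bar>c x\<bar>) \<le> Y"
begin

abbreviation "M1 \<equiv> density (positive_part V) (\<lambda>x. ennreal (w x))"
abbreviation "M2 \<equiv> density (positive_part (\<lambda>A. - V A)) (\<lambda>x. ennreal (w x))"
abbreviation "M3 \<equiv> density lborel (\<lambda>x. ennreal (c x))"
abbreviation "M4 \<equiv> density lborel (\<lambda>x. ennreal (- c x))"

lemma M_nonneg: "0 \<le> M" using w(2,3)[of 0] by simp

lemma Y_nonneg: "0 \<le> Y"
  by (rule order_trans[OF Bochner_Integration.integral_nonneg c(2)]) simp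

lemma sets_Ms: "sets M1 = sets borel" "sets M2 = sets borel" "sets M3 = sets borel" "sets M4 = sets borel"
  by (simp_all add: sets_positive_part)

lemma P_le: "emeasure (positive_part V) UNIV \<le> ennreal X" "emeasure (positive_part (\<lambda>A. - V A)) UNIV \<le> ennreal X"
  using positive_part_le_measure_norm[OF V(1)] V(2) by (auto intro: order_trans)

lemma Ms_le: "emeasure M1 UNIV \<le> ennreal (M * X)" "emeasure M2 UNIV \<le> ennreal (M * X)"
  "emeasure M3 UNIV \<le> ennreal Y" "emeasure M4 UNIV \<le> ennreal Y"
  using emeasure_density_le[OF sets_positive_part w(1,3) M_nonneg P_le(1) V(3)]
    emeasure_density_le[OF sets_positive_part w(1,3) M_nonneg P_le(2) V(3)]
    emeasure_density_lborel_le[OF c] emeasure_density_lborel_le[of "\<lambda>x. - c x" Y] c by auto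

lemma MX: "0 \<le> M * X" using M_nonneg V(3) by simp

lemma cumulative_bound: "\<bar>cumulative V w c x\<bar> \<le> 2 * (M * X + Y)"
proof -
  have gen: "\<bar>(p - q) - (r - s)\<bar> \<le> 2 * (u + v)"
    if "p \<le> u" "q \<le> u" "r \<le> v" "s \<le> v" "0 \<le> p" "0 \<le> q" "0 \<le> r" "0 \<le> s" for p q r s u v :: real
    using that by (smt (verit))
  show ?thesis
    unfolding cumulative_def
    by (rule gen) (intro measure_nonneg cdf_bounds(2)[OF sets_Ms(1) Ms_le(1) MX] cdf_bounds(2)[OF sets_Ms(2) Ms_le(2) MX]
      cdf_bounds(2)[OF sets_Ms(3) Ms_le(3) Y_nonneg] cdf_bounds(2)[OF sets_Ms(4) Ms_le(4) Y_nonneg])+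
qed

lemma cumulative_tbv: "tbv (2 * (M * X + Y)) (cumulative V w c)"
proof -
  have "tbv ((M * X + M * X) + (Y + Y)) (cumulative V w c)"
    unfolding cumulative_def[abs_def]
    by (intro tbv_diff tbv_cdf sets_Ms Ms_le MX Y_nonneg)
  then show ?thesis by (simp add: algebra_simps)
qed

lemma cumulative_bmono: "\<exists>f1 f2 f3 f4. bmono f1 \<and> bmono f2 \<and> bmono f3 \<and> bmono f4 \<and> cumulative V w c = (\<lambda>x. (f1 x - f2 x) - (f3 x - f4 x))"
  using cdf_bounds(1)[OF sets_Ms(1) Ms_le(1) MX] cdf_bounds(1)[OF sets_Ms(2) Ms_le(2) MX]
    cdf_bounds(1)[OF sets_Ms(3) Ms_le(3) Y_nonneg] cdf_bounds(1)[OF sets_Ms(4) Ms_le(4) Y_nonneg]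
  unfolding cumulative_def[abs_def] by blast

text \<open>States that w V0 - c dx is the derivative of \<open>cumulative\<close>. The test
  function is merely absolutely continuous, because it will be a smooth function times the
  solution.\<close>

lemma cumulative_by_parts:
  assumes ac: "ac_on UNIV \<Psi> \<psi>" "\<psi> \<in> borel_measurable borel"
    and supp: "\<And>x. \<bar>x\<bar> > N \<Longrightarrow> \<Psi> x = 0" "\<And>x. \<bar>x\<bar> > N \<Longrightarrow> \<psi> x = 0"
  shows "signed_integral V (\<lambda>x. \<Psi> x * complex_of_real (w x)) - (LBINT x. \<Psi> x * of_real (c x))
      = - (LBINT x. \<psi> x * of_real (cumulative V w c x))"
    "integrable lborel (\<lambda>x. \<psi> x * of_real (cumulative V w c x))"
proof -
  have fin: "emeasure M1 UNIV < \<infinity>" "emeasure M2 UNIV < \<infinity>" "emeasure M3 UNIV < \<infinity>" "emeasure M4 UNIV < \<infinity>"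
    using Ms_le by (auto simp: less_top[symmetric] top_unique)
  note p = cdf_by_parts[OF _ _ ac supp]
  note p1 = p[OF sets_Ms(1) fin(1)] and p2 = p[OF sets_Ms(2) fin(2)] and p3 = p[OF sets_Ms(3) fin(3)] and p4 = p[OF sets_Ms(4) fin(4)]
  have eq: "\<psi> x * of_real (cumulative V w c x) = (\<psi> x * of_real (measure M1 {..x}) - \<psi> x * of_real (measure M2 {..x}))
     - (\<psi> x * of_real (measure M3 {..x}) - \<psi> x * of_real (measure M4 {..x}))" for x
    unfolding cumulative_def by (simp add: algebra_simps)
  show "integrable lborel (\<lambda>x. \<psi> x * of_real (cumulative V w c x))"
    unfolding eq by (intro Bochner_Integration.integrable_diff p1(2) p2(2) p3(2) p4(2))
  have \<Psi>c: "continuous_on UNIV \<Psi>" by (rule ac_on_UNIV_continuous[OF ac(1)])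
  have [measurable]: "\<Psi> \<in> borel_measurable borel" by (rule borel_measurable_continuous_onI[OF \<Psi>c])
  have d: "(LINT x|density P (\<lambda>x. ennreal (w x)). \<Psi> x) = (LINT x|P. \<Psi> x * of_real (w x))" if "sets P = sets borel" for P
  proof -
    have "\<Psi> \<in> borel_measurable P" "w \<in> borel_measurable P" using that w(1) by (simp_all cong: measurable_cong_sets)
    then show ?thesis using w(2) by (subst integral_density) (auto simp: scaleR_conv_of_real mult.commute)
  qed
  have [measurable]: "c \<in> borel_measurable borel" using c(1) by auto
  obtain C where C: "\<And>x. cmod (\<Psi> x) \<le> C"
  proof -
    have "compact (\<Psi> ` {-N..N})" by (intro compact_continuous_image continuous_on_subset[OF \<Psi>c]) auto
    then obtain C where C: "\<And>x. x \<in> {-N..N} \<Longrightarrow> norm (\<Psi> x) \<le> C" by (meson bounded_iff compact_imp_bounded imageI)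
    have "cmod (\<Psi> x) \<le> max C 0" for x
    proof (cases "x \<in> {-N..N}")
      case False
      then have "\<bar>x\<bar> > N" by auto
      then show ?thesis using supp by simp
    qed (use C in \<open>simp add: max.coboundedI1\<close>)
    then show thesis by (rule that)
  qed
  have d': "(LINT x|density lborel (\<lambda>x. ennreal (e x)). \<Psi> x) = (LBINT x. \<Psi> x * of_real (max 0 (e x)))"
    if e: "integrable lborel e" for e
  proof -
    have m: "e \<in> borel_measurable borel" using e by auto
    have "density lborel (\<lambda>x. ennreal (e x)) = density lborel (\<lambda>x. ennreal (max 0 (e x)))" by (simp add: ennreal_max_0)
    then have "(LINT x|density lborel (\<lambda>x. ennreal (e x)). \<Psi> x) = (LINT x|density lborel (\<lambda>x. ennreal (max 0 (e x))). \<Psi> x)" by simp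
    also have "\<dots> = (LBINT x. \<Psi> x * of_real (max 0 (e x)))"
      using m by (subst integral_density) (auto simp: scaleR_conv_of_real mult.commute)
    finally show ?thesis .
  qed
  have i': "integrable lborel (\<lambda>x. \<Psi> x * of_real (max 0 (e x)))" if e: "integrable lborel e" for e
  proof (rule Bochner_Integration.integrable_bound)
    show "integrable lborel (\<lambda>x. C * norm (e x))" using e by auto
    show "AE x in lborel. norm (\<Psi> x * complex_of_real (max 0 (e x))) \<le> norm (C * norm (e x))"
    proof (rule AE_I2)
      fix x
      have "0 \<le> C" using C[of x] norm_ge_zero order_trans by blast
      then show "norm (\<Psi> x * complex_of_real (max 0 (e x))) \<le> norm (C * norm (e x))"
        using C[of x] unfolding norm_mult norm_of_real by (auto intro!: mult_mono simp: abs_mult)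
    qed
    have "e \<in> borel_measurable borel" using e by auto
    then show "(\<lambda>x. \<Psi> x * complex_of_real (max 0 (e x))) \<in> borel_measurable lborel" by measurable
  qed
  have c': "integrable lborel (\<lambda>x. - c x)" using c(1) by auto
  have cc: "\<Psi> x * of_real (c x) = \<Psi> x * of_real (max 0 (c x)) - \<Psi> x * of_real (max 0 (- c x))" for x
    by (auto simp: max_def)
  have "(LBINT x. \<Psi> x * of_real (c x)) = (LINT x|M3. \<Psi> x) - (LINT x|M4. \<Psi> x)"
    unfolding cc d'[OF c(1)] d'[OF c'] by (rule Bochner_Integration.integral_diff[OF i'[OF c(1)] i'[OF c']])
  then have l: "(LBINT x. \<Psi> x * of_real (c x)) = - (LBINT x. \<psi> x * of_real (measure M3 {..x})) - - (LBINT x. \<psi> x * of_real (measure M4 {..x}))"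
    using p3(1) p4(1) by simp
  have "signed_integral V (\<lambda>x. \<Psi> x * complex_of_real (w x)) = (LINT x|M1. \<Psi> x) - (LINT x|M2. \<Psi> x)"
    unfolding signed_integral_def d[OF sets_positive_part] ..
  then have s: "signed_integral V (\<lambda>x. \<Psi> x * complex_of_real (w x)) = - (LBINT x. \<psi> x * of_real (measure M1 {..x})) - - (LBINT x. \<psi> x * of_real (measure M2 {..x}))"
    using p1(1) p2(1) by simp
  have t: "(LBINT x. \<psi> x * of_real (cumulative V w c x)) =
      ((LBINT x. \<psi> x * of_real (measure M1 {..x})) - (LBINT x. \<psi> x * of_real (measure M2 {..x})))
       - ((LBINT x. \<psi> x * of_real (measure M3 {..x})) - (LBINT x. \<psi> x * of_real (measure M4 {..x})))"
    unfolding eq using p1(2) p2(2) p3(2) p4(2)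
    by (simp only: Bochner_Integration.integral_diff Bochner_Integration.integrable_diff)
  show "signed_integral V (\<lambda>x. \<Psi> x * complex_of_real (w x)) - (LBINT x. \<Psi> x * of_real (c x))
      = - (LBINT x. \<psi> x * of_real (cumulative V w c x))"
    unfolding l s t by simp
qed

end

section \<open>Local bounded variation of products\<close>

definition lbv :: "(real \<Rightarrow> real) \<Rightarrow> bool" where
  "lbv f \<longleftrightarrow> (\<exists>g k. mono g \<and> mono k \<and> f = (\<lambda>x. g x - k x))"

lemma lbvI: "mono g \<Longrightarrow> mono k \<Longrightarrow> (\<And>x. f x = g x - k x) \<Longrightarrow> lbv f"
  unfolding lbv_def by blast

lemma lbv_add: assumes "lbv f" "lbv g" shows "lbv (\<lambda>x. f x + g x)"
proof -
  obtain a b c d where *: "mono a" "mono b" "mono c" "mono d" "f = (\<lambda>x. a x - b x)" "g = (\<lambda>x. c x - d x)"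
    using assms unfolding lbv_def by blast
  have "mono (\<lambda>x. a x + c x)" "mono (\<lambda>x. b x + d x)" using *(1-4) by (auto simp: mono_def intro: add_mono)
  then show ?thesis by (rule lbvI) (simp add: *)
qed

lemma lbv_minus: "lbv f \<Longrightarrow> lbv (\<lambda>x. - f x)"
  unfolding lbv_def by (metis minus_diff_eq)

lemma lbv_diff: "lbv f \<Longrightarrow> lbv g \<Longrightarrow> lbv (\<lambda>x. f x - g x)"
  using lbv_add[OF _ lbv_minus, of f g] by simp

lemma lbv_cmult: assumes "lbv f" "0 \<le> c" shows "lbv (\<lambda>x. c * f x)"
proof -
  obtain a b where *: "mono a" "mono b" "f = (\<lambda>x. a x - b x)" using assms unfolding lbv_def by blast
  have "mono (\<lambda>x. c * a x)" "mono (\<lambda>x. c * b x)" using * assms by (auto simp: mono_def intro: mult_left_mono)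
  then show ?thesis by (rule lbvI) (simp add: * right_diff_distrib)
qed

text \<open>The product of nonnegative monotone functions of the same direction is monotone. The mixed case is
  reduced to this one by subtracting the bounded factor from an upper bound.\<close>

lemma lbv_bmono_mult:
  assumes f: "bmono f" and g: "lbv g" shows "lbv (\<lambda>x. f x * g x)"
proof -
  obtain C where C: "mono f" "\<And>x. 0 \<le> f x" "\<And>x. f x \<le> C" using f unfolding bmono_def by blast
  have m: "lbv (\<lambda>x. f x * a x)" if a: "mono a" for a
  proof -
    have fa: "mono (\<lambda>x. f x * max 0 (a x))"
    proof (rule monoI)
      fix x y :: real assume xy: "x \<le> y"
      have "f x \<le> f y" "max 0 (a x) \<le> max 0 (a y)" using monoD[OF C(1) xy] monoD[OF a xy] by auto
      then show "f x * max 0 (a x) \<le> f y * max 0 (a y)" using C(2)[of y] by (intro mult_mono) auto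
    qed
    have fb: "mono (\<lambda>x. - ((C - f x) * max 0 (- a x)))"
    proof (rule monoI)
      fix x y :: real assume xy: "x \<le> y"
      have "C - f y \<le> C - f x" "max 0 (- a y) \<le> max 0 (- a x)" using monoD[OF C(1) xy] monoD[OF a xy] by auto
      then have "(C - f y) * max 0 (- a y) \<le> (C - f x) * max 0 (- a x)" using C(3)[of x] by (intro mult_mono) auto
      then show "- ((C - f x) * max 0 (- a x)) \<le> - ((C - f y) * max 0 (- a y))" by simp
    qed
    have C0: "0 \<le> C" using C(2)[of 0] C(3)[of 0] by simp
    have fc: "mono (\<lambda>x. - (C * max 0 (- a x)))"
    proof (rule monoI)
      fix x y :: real assume xy: "x \<le> y"
      have "max 0 (- a y) \<le> max 0 (- a x)" using monoD[OF a xy] by auto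
      then show "- (C * max 0 (- a x)) \<le> - (C * max 0 (- a y))" using C0 by (simp add: mult_left_mono)
    qed
    \<comment> \<open>Writing a = a+ - a-, one has f a = (f a+ - C a-) + (C - f) a-, where the
      bracket is nondecreasing and the last term is nonincreasing.\<close>
    have "mono (\<lambda>x. f x * max 0 (a x) + - (C * max 0 (- a x)))"
      by (rule monoI) (rule add_mono[OF monoD[OF fa] monoD[OF fc]])
    from lbvI[OF this fb] show ?thesis by (auto simp: max_def algebra_simps)
  qed
  obtain a b where *: "mono a" "mono b" "g = (\<lambda>x. a x - b x)" using g unfolding lbv_def by blast
  show ?thesis using lbv_diff[OF m[OF *(1)] m[OF *(2)]] by (simp add: * right_diff_distrib)
qed

text \<open>The primitives of the positive and the negative part of f are monotone, and F minus
  their difference has derivative 0, hence is constant.\<close>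

lemma lbv_ac:
  assumes F: "ac_on UNIV F (f :: real \<Rightarrow> real)" shows "lbv F"
proof -
  have l: "locint f" by (rule ac_on_imp_locint[OF F])
  have l1: "locint (\<lambda>x. (\<bar>f x\<bar> + f x) / 2)" "locint (\<lambda>x. (\<bar>f x\<bar> - f x) / 2)"
    using l unfolding locint_def by (auto intro!: set_integrable_divide set_integral_add(1) set_integral_diff(1) set_integrable_abs)
  have mono: "mono (\<lambda>x. c + prim p x)" if "locint p" "\<And>x. 0 \<le> p x" for c and p :: "real \<Rightarrow> real"
  proof (rule monoI)
    fix x y :: real assume "x \<le> y"
    then have "prim p y - prim p x = (LBINT t:{x..y}. p t)" using ac_onD(2)[OF ac_on_prim[OF that(1)], of x UNIV y] by simp
    moreover have "0 \<le> (LBINT t:{x..y}. p t)" by (rule set_integral_nonneg_on) (rule that)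
    ultimately show "c + prim p x \<le> c + prim p y" by simp
  qed
  have ac: "ac_on UNIV (\<lambda>x. F x - (prim (\<lambda>x. (\<bar>f x\<bar> + f x) / 2) x - prim (\<lambda>x. (\<bar>f x\<bar> - f x) / 2) x)) (\<lambda>x. f x - ((\<bar>f x\<bar> + f x) / 2 - (\<bar>f x\<bar> - f x) / 2))"
    by (intro ac_on_diff F ac_on_prim l1)
  have "F x - (prim (\<lambda>x. (\<bar>f x\<bar> + f x) / 2) x - prim (\<lambda>x. (\<bar>f x\<bar> - f x) / 2) x) = F 0 - (prim (\<lambda>x. (\<bar>f x\<bar> + f x) / 2) 0 - prim (\<lambda>x. (\<bar>f x\<bar> - f x) / 2) 0)" for x
  proof -
    have z: "(\<lambda>x. f x - ((\<bar>f x\<bar> + f x) / 2 - (\<bar>f x\<bar> - f x) / 2)) = (\<lambda>x. 0)" by (simp add: fun_eq_iff field_simps)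
    show ?thesis
      using ac_onD(2)[OF ac[unfolded z], of 0 x] ac_onD(2)[OF ac[unfolded z], of x 0]
      by (cases "0 \<le> x") auto
  qed
  then have "F x = (F 0 - (prim (\<lambda>x. (\<bar>f x\<bar> + f x) / 2) 0 - prim (\<lambda>x. (\<bar>f x\<bar> - f x) / 2) 0) + prim (\<lambda>x. (\<bar>f x\<bar> + f x) / 2) x) - (0 + prim (\<lambda>x. (\<bar>f x\<bar> - f x) / 2) x)" for x
    by (simp add: algebra_simps)
  moreover have "0 \<le> (\<bar>f x\<bar> + f x) / 2" "0 \<le> (\<bar>f x\<bar> - f x) / 2" for x by auto
  ultimately show ?thesis using lbvI[OF mono[OF l1(1)] mono[OF l1(2)]] by blast
qed

lemma locally_BV_iff_lbv: "locally_BV f \<longleftrightarrow> lbv (\<lambda>x. Re (f x)) \<and> lbv (\<lambda>x. Im (f x))"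
  unfolding locally_BV_def lbv_def by simp

section \<open>Representatives of Sobolev functions\<close>

lemma continuous_AE_eq:
  fixes f g :: "real \<Rightarrow> complex"
  assumes "continuous_on UNIV f" "continuous_on UNIV g" "AE x in lborel. f x = g x"
  shows "f = g"
proof (rule ccontr)
  assume "f \<noteq> g"
  then obtain x where x: "f x \<noteq> g x" by auto
  have o: "open {x. f x \<noteq> g x}" by (rule open_Collect_neq[OF assms(1,2)])
  then obtain e where e: "0 < e" "ball x e \<subseteq> {x. f x \<noteq> g x}" using x open_contains_ball by blast
  have "{x. f x \<noteq> g x} \<in> null_sets lborel"
    using assms(3) borel_open[OF o] by (subst AE_iff_null_sets) auto
  then have "ball x e \<in> null_sets lborel" using null_sets_subset[of _ lborel "ball x e"] e(2) by auto
  moreover have "emeasure lborel (ball x e) = ennreal (2 * e)" using e(1) by (simp add: ball_eq_greaterThanLessThan)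
  ultimately show False using e(1) by (simp add: null_sets_def)
qed

lemma wderiv:
  assumes "u \<in> H1" shows "wderiv u \<in> L2" "weak_derivative u (wderiv u)"
  using someI_ex[of "\<lambda>v. v \<in> L2 \<and> weak_derivative u v"] assms unfolding wderiv_def H1_def by auto

lemma weak_derivative_AE_unique:
  assumes "weak_derivative u v" "weak_derivative u w" "v \<in> L2" "w \<in> L2"
  shows "AE x in lborel. v x = w x"
proof (rule locint_AE_eqI)
  fix \<phi> assume "test_function \<phi>"
  then show "(LBINT x. complex_of_real (\<phi> x) * v x) = (LBINT x. complex_of_real (\<phi> x) * w x)"
    using assms(1,2) unfolding weak_derivative_def by (simp add: mult.commute)
qed (use L2_locintb[OF assms(3)] L2_locintb[OF assms(4)] in \<open>auto simp: locintb_def\<close>)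

lemma weak_derivative_ac:
  assumes "ac_on UNIV U v" shows "weak_derivative U v"
  unfolding weak_derivative_def using ac_test_by_parts[OF assms] by (simp add: mult.commute)

text \<open>Continuous functions that agree almost everywhere coincide, so the \<open>THE\<close> in
  \<open>cont_rep\<close> finds this representative.\<close>

lemma cont_rep_eq:
  assumes "continuous_on UNIV U" "AE x in lborel. U x = u x"
  shows "cont_rep u = U"
  unfolding cont_rep_def
proof (rule the_equality)
  fix v assume v: "continuous_on UNIV v \<and> (AE x in lborel. v x = u x)"
  then have "AE x in lborel. v x = U x" using assms(2) by (auto elim: AE_mp)
  then show "v = U" using continuous_AE_eq assms(1) v by blast
qed (use assms in auto)

lemma L2_cong_AE: assumes "u \<in> L2" "AE x in lborel. u x = v x" "v \<in> borel_measurable borel" shows "v \<in> L2"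
proof -
  have "integrable lborel (\<lambda>x. (norm (u x))\<^sup>2)" using assms(1) by (simp add: L2_def)
  moreover have "AE x in lborel. (norm (u x))\<^sup>2 = (norm (v x))\<^sup>2" using assms(2) by eventually_elim simp
  moreover have "(\<lambda>x. (norm (u x))\<^sup>2) \<in> borel_measurable lborel" "(\<lambda>x. (norm (v x))\<^sup>2) \<in> borel_measurable lborel"
    using assms by (auto simp: L2_def)
  ultimately have "integrable lborel (\<lambda>x. (norm (v x))\<^sup>2)" using integrable_cong_AE by blast
  then show ?thesis using assms(3) by (simp add: L2_def)
qed

lemma H1_representative:
  assumes u: "u \<in> H1"
  obtains U where "ac_on UNIV U (wderiv u)" "AE x in lborel. u x = U x" "U \<in> L2" "cont_rep u = U"
proof -
  note w = wderiv[OF u]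
  have uL: "u \<in> L2" using u by (simp add: H1_def)
  have "\<exists>c. AE x in lborel. u x = c + prim (wderiv u) x"
  proof (rule du_Bois_Reymond)
    show "locint u" "u \<in> borel_measurable borel" "locint (wderiv u)"
      using L2_locintb[OF uL] L2_locintb[OF w(1)] by (auto simp: locintb_def)
    fix \<phi> assume "test_function \<phi>"
    then show "(LBINT x. complex_of_real (\<phi> x) * wderiv u x) = - (LBINT x. complex_of_real (deriv \<phi> x) * u x)"
      using w(2) unfolding weak_derivative_def by (simp add: mult.commute)
  qed
  then obtain c where c: "AE x in lborel. u x = c + prim (wderiv u) x" by blast
  define U where "U x = c + prim (wderiv u) x" for x
  have l: "locint (wderiv u)" using L2_locintb[OF w(1)] by (simp add: locintb_def)
  have "ac_on UNIV U (\<lambda>x. 0 + wderiv u x)" unfolding U_def[abs_def] by (intro ac_on_add ac_on_const ac_on_prim l)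
  then have ac: "ac_on UNIV U (wderiv u)" by simp
  have Uc: "continuous_on UNIV U" by (rule ac_on_UNIV_continuous[OF ac])
  have AE: "AE x in lborel. u x = U x" using c by (simp add: U_def)
  have "U \<in> L2" by (rule L2_cong_AE[OF uL AE borel_measurable_continuous_onI[OF Uc]])
  moreover have "cont_rep u = U" by (rule cont_rep_eq[OF Uc]) (use AE in eventually_elim, simp)
  ultimately show thesis using that ac AE by blast
qed

text \<open>|U|^2 has the derivative 2 Re (cnj U * v), which is integrable over the line, so its
  total change is bounded. Boundedness of U is what makes b0 U square integrable.\<close>

lemma H1_bounded:
  assumes ac: "ac_on UNIV U v" and U: "U \<in> L2" and v: "v \<in> L2"
  shows "\<exists>C. \<forall>x. cmod (U x) \<le> C"
proof -
  have "ac_on UNIV (\<lambda>x. Re (cnj (U x) * U x)) (\<lambda>x. Re (cnj (v x) * U x + cnj (U x) * v x))"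
    by (intro ac_on_bounded_linear[OF bounded_linear_Re] ac_on_mult ac_on_bounded_linear[OF bounded_linear_cnj] ac is_interval_univ)
  then have sq: "ac_on UNIV (\<lambda>x. (cmod (U x))\<^sup>2) (\<lambda>x. 2 * Re (cnj (U x) * v x))"
    by (rule ac_on_cong[OF _ _ _ is_interval_univ]) (simp_all add: cmod_power2 power2_eq_square[of "Re _"] power2_eq_square[of "Im _"])
  have i: "integrable lborel (\<lambda>x. 2 * (cmod (U x) * cmod (v x)))" using L2_mult_integrable[OF U v] by auto
  define I where "I = (LBINT x. 2 * (cmod (U x) * cmod (v x)))"
  have le: "\<bar>(cmod (U d))\<^sup>2 - (cmod (U c))\<^sup>2\<bar> \<le> I" if "c \<le> d" for c d
  proof -
    have "\<bar>(cmod (U d))\<^sup>2 - (cmod (U c))\<^sup>2\<bar> = norm (LBINT x:{c..d}. 2 * Re (cnj (U x) * v x))"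
      using ac_onD(2)[OF sq, of c d] that by simp
    also have "\<dots> \<le> (LBINT x:{c..d}. norm (2 * Re (cnj (U x) * v x)))" by (rule set_integral_norm_bound)
    also have "\<dots> \<le> I" unfolding I_def set_lebesgue_integral_def
    proof (rule integral_mono[OF _ i])
      show "integrable lborel (\<lambda>x. indicat_real {c..d} x *\<^sub>R norm (2 * Re (cnj (U x) * v x)))"
        using set_integrable_norm[OF ac_onD(1)[OF sq, of c d]] that by (simp add: set_integrable_def)
      fix x show "indicat_real {c..d} x *\<^sub>R norm (2 * Re (cnj (U x) * v x)) \<le> 2 * (cmod (U x) * cmod (v x))"
        using Re_mult_bound[of "cnj (U x)" "v x"] by (auto simp: indicator_def abs_mult simp del: times_complex.simps)
    qed
    finally show ?thesis .
  qed
  have "(cmod (U x))\<^sup>2 \<le> (cmod (U 0))\<^sup>2 + I" for x using le[of 0 x] le[of x 0] by (cases "0 \<le> x") auto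
  then have "cmod (U x) \<le> (cmod (U 0))\<^sup>2 + I + 1" for x
    using self_le_power2_add_1[of "cmod (U x)"] order_trans[of "cmod (U x)" "(cmod (U x))\<^sup>2 + 1"] by (metis add_right_mono)
  then show ?thesis by blast
qed

section \<open>The operator in terms of the reduced system\<close>

lemma L2_add:
  assumes "f \<in> L2" "g \<in> L2" shows "(\<lambda>x. f x + g x :: complex) \<in> L2"
proof -
  have "integrable lborel (\<lambda>x. (norm (f x + g x))\<^sup>2)"
  proof (rule Bochner_Integration.integrable_bound)
    show "integrable lborel (\<lambda>x. 2 * (norm (f x))\<^sup>2 + 2 * (norm (g x))\<^sup>2)" using assms by (auto simp: L2_def)
    have "(norm (f x + g x))\<^sup>2 \<le> 2 * (norm (f x))\<^sup>2 + 2 * (norm (g x))\<^sup>2" for x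
    proof -
      have "(norm (f x + g x))\<^sup>2 \<le> (norm (f x) + norm (g x))\<^sup>2" by (intro power_mono norm_triangle_ineq) simp
      also have "\<dots> \<le> 2 * (norm (f x))\<^sup>2 + 2 * (norm (g x))\<^sup>2"
        using sum_squares_bound[of "norm (f x)" "norm (g x)"] unfolding power2_sum by linarith
      finally show ?thesis .
    qed
    then show "AE x in lborel. norm ((norm (f x + g x))\<^sup>2) \<le> norm (2 * (norm (f x))\<^sup>2 + 2 * (norm (g x))\<^sup>2)"
      by (intro AE_I2) (simp add: abs_of_nonneg)
  qed (use assms in \<open>auto simp: L2_def\<close>)
  then show ?thesis using assms by (auto simp: L2_def)
qed

lemma L2_bounded_mult:
  fixes f :: "real \<Rightarrow> complex"
  assumes f: "f \<in> L2" and k: "k \<in> borel_measurable borel" "\<And>x. norm (k x) \<le> C"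
  shows "(\<lambda>x. k x * f x) \<in> L2"
proof -
  have "integrable lborel (\<lambda>x. (norm (k x * f x))\<^sup>2)"
  proof (rule Bochner_Integration.integrable_bound)
    show "integrable lborel (\<lambda>x. C\<^sup>2 * (norm (f x))\<^sup>2)" using f by (auto simp: L2_def)
    have "(norm (k x * f x))\<^sup>2 \<le> C\<^sup>2 * (norm (f x))\<^sup>2" for x
      unfolding norm_mult power_mult_distrib using k(2)[of x] by (intro mult_right_mono power_mono) auto
    then show "AE x in lborel. norm ((norm (k x * f x))\<^sup>2) \<le> norm (C\<^sup>2 * (norm (f x))\<^sup>2)"
      by (intro AE_I2) simp
  qed (use f k(1) in \<open>auto simp: L2_def\<close>)
  then show ?thesis using f k(1) by (auto simp: L2_def)
qed

lemma integrable_locintb: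
  fixes f :: "real \<Rightarrow> 'a::{banach, second_countable_topology}"
  assumes "integrable lborel f" shows "locintb f"
  unfolding locintb_def locint_def set_integrable_def
  using assms integrable_mult_indicator[OF _ assms] by auto

lemma locintb_L2_mult: 
  fixes f g :: "real \<Rightarrow> complex"
  assumes "f \<in> L2" "g \<in> L2" shows "locintb (\<lambda>x. f x * g x)"
proof (rule integrable_locintb, rule Bochner_Integration.integrable_bound[OF L2_mult_integrable[OF assms]])
  show "(\<lambda>x. f x * g x) \<in> borel_measurable lborel" using assms by (auto simp: L2_def)
qed (simp add: norm_mult)

text \<open>The formula for Q is asked only almost everywhere, so that Q may be built from
  truncations of b1 and V1 that are bounded at every point.\<close>

locale schroedinger = reduced_system h \<epsilon> K M a w Q n B
  for h \<epsilon> K M and a w Q n B :: "real \<Rightarrow> real" +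
  fixes \<alpha> \<beta> b0 b1 V1 :: "real \<Rightarrow> real" and V0 :: "real set \<Rightarrow> real" and E C X Y :: real
  assumes \<alpha>: "\<And>x. \<alpha> x * a x = 1" "\<alpha> \<in> borel_measurable borel"
    and \<beta>: "\<And>x. \<beta> x * w x = 1" "\<beta> \<in> borel_measurable borel"
    and b0: "b0 \<in> L1" "b0 \<in> L2"
    and b1: "b1 \<in> borel_measurable borel" "\<And>x. \<bar>b1 x\<bar> \<le> C"
    and V1: "V1 \<in> borel_measurable borel" "\<And>x. \<bar>V1 x\<bar> \<le> C"
    and V0: "finite_signed_measure V0" "measure_norm V0 \<le> ennreal X" "0 \<le> X"
    and c_integrable: "integrable lborel (\<lambda>x. a x * ((b0 x)\<^sup>2 + 2 * b0 x * b1 x))"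
    and Y: "(LBINT x. \<bar>a x * ((b0 x)\<^sup>2 + 2 * b0 x * b1 x)\<bar>) \<le> Y"
    and Q_eq: "AE x in lborel. Q x = w x * (V1 x - E) - a x * (b1 x)\<^sup>2"
    and B_eq: "\<And>x. B x = a x * (b0 x + b1 x)"
    and n_eq: "\<And>x. n x = cumulative V0 w (\<lambda>x. a x * ((b0 x)\<^sup>2 + 2 * b0 x * b1 x)) x / h"
begin

abbreviation "b \<equiv> (\<lambda>x. b0 x + b1 x)"
abbreviation "c \<equiv> (\<lambda>x. a x * ((b0 x)\<^sup>2 + 2 * b0 x * b1 x))"
abbreviation "Dom \<equiv> schroedinger_domain h \<alpha> \<beta> b V0 V1"
abbreviation "Op \<equiv> schroedinger_op h \<alpha> \<beta> b V0 V1"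
abbreviation "Meas \<equiv> schroedinger_measure h \<alpha> \<beta> b V0 V1"

lemma borels [measurable]: "a \<in> borel_measurable borel" "w \<in> borel_measurable borel" "n \<in> borel_measurable borel"
  "b0 \<in> borel_measurable borel" "b1 \<in> borel_measurable borel" "V1 \<in> borel_measurable borel" "\<alpha> \<in> borel_measurable borel" "\<beta> \<in> borel_measurable borel"
  using borel b0 b1 V1 \<alpha> \<beta> by (auto simp: L2_def)

lemma M_pos: "0 < M" using M_ge by simp

lemma \<alpha>_pos: "0 < \<alpha> x" "\<alpha> x \<le> M" and \<beta>_pos: "0 < \<beta> x" "\<beta> x \<le> M"
proof -
  have inv: "0 < y \<and> y \<le> M" if "y * v = 1" "1 / M \<le> v" "0 < v" for y v :: real
  proof -
    have y: "y = 1 / v" using that(1,3) by (simp add: field_simps)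
    have "1 / v \<le> M" using that(2,3) M_pos by (simp add: field_simps)
    then show ?thesis unfolding y using that(3) by simp
  qed
  show "0 < \<alpha> x" "\<alpha> x \<le> M" using inv[OF \<alpha>(1) a_bd(1) a_pos] by auto
  show "0 < \<beta> x" "\<beta> x \<le> M" using inv[OF \<beta>(1) w_bd(1) w_pos] by auto
qed

lemma cumulative_data: "cumulative_data V0 w c M X Y"
  by unfold_locales (use V0 w_pos w_bd c_integrable Y in \<open>auto simp: less_imp_le\<close>)

lemma hn: "cumulative V0 w c x = h * n x"
  unfolding n_eq using h_pos by simp

lemma b0_L2: "(\<lambda>x. complex_of_real (b0 x)) \<in> L2"
  using b0(2) by (simp add: L2_def)

lemma b_mult:
  assumes "v \<in> L2" shows "locintb (\<lambda>x. complex_of_real (b x) * v x)"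
proof -
  have "locbdd b1" using b1 by (intro locbdd_bounded[of b1 C]) auto
  then have "locintb (\<lambda>x. complex_of_real (b1 x) * v x)"
    by (intro locintb_mult locbdd_of_real L2_locintb assms)
  from locintb_add[OF locintb_L2_mult[OF b0_L2 assms] this] show ?thesis by (simp add: distrib_right)
qed

lemma b_mult_L2:
  assumes "v \<in> L2" "\<And>x. cmod (v x) \<le> D" shows "(\<lambda>x. complex_of_real (b x) * v x) \<in> L2"
proof -
  have "v \<in> borel_measurable borel" using assms(1) by (simp add: L2_def)
  from L2_bounded_mult[OF b0_L2 this assms(2)] have "(\<lambda>x. v x * complex_of_real (b0 x)) \<in> L2" .
  moreover have "(\<lambda>x. complex_of_real (b1 x) * v x) \<in> L2"
    by (rule L2_bounded_mult[OF assms(1), where C = C]) (use b1 in auto)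
  ultimately show ?thesis using L2_add by (fastforce simp: algebra_simps)
qed

text \<open>The derivative of r = p - n U as dictated by the measure equation with density g, before
  the weak derivative v of U is expressed through the flux.\<close>

definition RR :: "(real \<Rightarrow> complex) \<Rightarrow> (real \<Rightarrow> complex) \<Rightarrow> (real \<Rightarrow> complex) \<Rightarrow> real \<Rightarrow> complex" where
  "RR v U g x = (- (of_real (w x) * g x) + (- \<i> * of_real h) * (of_real (b x) * v x) + of_real (w x * V1 x) * U x
      + U x * of_real (c x) - of_real (h * n x) * v x) / of_real h"

text \<open>Agreement with the density on indicators is agreement on all of \<open>bbs\<close>
  (\<open>A\<close>). It may be tested on \<psi> w instead, since \<beta> w = 1 removes \<beta> from
  the derivative measure (\<open>Bq\<close>). Integrating the V0 term by parts gives the weak form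
  of r' = \<open>RR\<close> for r = p - n U (\<open>Cq\<close>), and \<open>du_Bois_Reymond\<close>
  produces r (\<open>Dq\<close>).\<close>

lemma density_iff:
  assumes u: "u \<in> H1" and U: "ac_on UNIV U (wderiv u)" "AE x in lborel. u x = U x" "U \<in> L2" "cont_rep u = U"
    and fl: "locally_BV_class (flux h \<alpha> b u)" and g: "g \<in> L2"
  shows "has_density (Meas u) g \<longleftrightarrow>
    (\<exists>r. ac_on UNIV r (RR (wderiv u) U g) \<and> (AE x in lborel. flux h \<alpha> b u x = r x + of_real (n x) * U x))"
proof -
  define v where "v = wderiv u"
  define p where "p = flux h \<alpha> b u"
  note v = wderiv[OF u, folded v_def]
  have uL: "u \<in> L2" using u by (simp add: H1_def)
  have Uc: "continuous_on UNIV U" by (rule ac_on_UNIV_continuous[OF U(1)])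
  note [locbdd_intros] = locbdd_continuous[OF Uc]
  have lb: "locbdd \<alpha>" "locbdd \<beta>" "locbdd V1"
    by (rule locbdd_bounded[of _ M] locbdd_bounded[of _ C], use \<alpha>_pos \<beta>_pos V1(2) borels in \<open>simp_all add: abs_of_pos\<close>)+
  note [locbdd_intros] = lb
  have vl: "locintb v" by (rule L2_locintb[OF v(1)])
  have p_eq: "p x = of_real (h * \<alpha> x) * v x + \<i> * (of_real (b x) * u x)" for x
    by (simp add: p_def flux_def v_def mult.assoc)
  have pl: "locintb p" unfolding p_eq[abs_def]
    by (intro locintb_add locintb_mult vl b_mult uL locbdd_intros)
  have bv: "locintb (\<lambda>x. of_real (b x) * v x)" by (rule b_mult[OF v(1)])
  have cl: "locintb (\<lambda>x. complex_of_real (c x))" by (intro locintb_of_real_Re_Im integrable_locintb c_integrable)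
  define F1 where "F1 x = - of_real (h\<^sup>2 * \<alpha> x) * wderiv u x - \<i> * of_real (h * b x) * u x" for x
  have F1: "F1 x = - of_real h * p x" for x
    by (simp add: F1_def p_eq v_def algebra_simps power2_eq_square)
  have F1b: "F1 \<in> borel_measurable borel" unfolding F1[abs_def] using locintbD(1)[OF pl] by measurable
  have "locally_BV_class F1"
  proof -
    obtain q where q: "locally_BV q" "AE x in lborel. p x = q x" using fl unfolding locally_BV_class_def p_def by blast
    have "locally_BV (\<lambda>x. - of_real h * q x)"
      using q(1) h_pos lbv_minus[OF lbv_cmult[of _ h]] unfolding locally_BV_iff_lbv by simp
    moreover have "AE x in lborel. F1 x = - of_real h * q x" using q(2) by eventually_elim (simp add: F1)
    ultimately show ?thesis unfolding locally_BV_class_def by blast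
  qed
  note mu = dBV_loc_exists[OF this F1b]
  let ?\<mu> = "dBV_loc F1"
  \<comment> \<open>The measure of the operator as a functional of \<phi>, so that functions other
    than indicators can be inserted.\<close>
  define T where "T \<phi> = complex_integral ?\<mu> (\<lambda>x. \<phi> x * of_real (\<beta> x)) + (LBINT x. \<phi> x * (of_real (h * \<beta> x * b x) * Dx u x))
      + signed_integral V0 (\<lambda>x. \<phi> x * U x) + (LBINT x. \<phi> x * (U x * of_real (V1 x)))" for \<phi>
  have MT: "Meas u A = T (\<lambda>x. complex_of_real (indicator A x))" for A
    unfolding schroedinger_measure_def T_def F1_def[symmetric, abs_def] U(4) of_real_indicator ..
  have D: "locintb (\<lambda>x. of_real (h * \<beta> x * b x) * Dx u x)"
  proof -
    have "locintb (\<lambda>x. (of_real (h * \<beta> x) * (- \<i>)) * (of_real (b x) * v x))"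
      by (intro locintb_mult bv locbdd_intros)
    then show ?thesis by (simp add: Dx_def v_def mult_ac)
  qed
  have VU: "locintb (\<lambda>x. U x * of_real (V1 x))" by (intro locintb_locbdd locbdd_intros)
  have lbB: "k \<in> borel_measurable borel" "\<And>N. \<exists>C. \<forall>x\<in>{-N..N}. norm (k x) \<le> C" if "locbdd k" for k :: "real \<Rightarrow> complex"
    using that by (auto simp: locbdd_def)
  have radonT: "radon T"
    unfolding T_def[abs_def]
    by (intro radon_add radon_mult[OF radon_complex_integral[OF mu(1)]] radon_locint(1) locintbD(1)[OF D] locintbD(3)[OF D]
        locintbD(1)[OF VU] locintbD(3)[OF VU] radon_mult[OF radon_signed_integral[OF finite_signed_measure_charge[OF V0(1)]]] lbB locbdd_intros)
  define G where "G \<phi> = (LBINT x. \<phi> x * g x)" for \<phi>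
  have gl: "locintb g" by (rule L2_locintb[OF g])
  have radonG: "radon G" unfolding G_def[abs_def] by (intro radon_locint(1) locintbD[OF gl])
  have A: "has_density (Meas u) g \<longleftrightarrow> (\<forall>\<phi>. bbs \<phi> \<longrightarrow> T \<phi> = G \<phi>)"
  proof
    assume "has_density (Meas u) g"
    then have "T (\<lambda>x. complex_of_real (indicator A x)) = G (\<lambda>x. complex_of_real (indicator A x))" if "A \<in> sets borel" "bounded A" for A
      using that unfolding has_density_def MT G_def of_real_indicator by blast
    then show "\<forall>\<phi>. bbs \<phi> \<longrightarrow> T \<phi> = G \<phi>" using radon_eqI_indicator[OF radonT radonG] by blast
  next
    assume *: "\<forall>\<phi>. bbs \<phi> \<longrightarrow> T \<phi> = G \<phi>"
    show "has_density (Meas u) g"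
      unfolding has_density_def MT
    proof (intro ballI impI)
      fix A :: "real set" assume "A \<in> sets borel" "bounded A"
      from *[rule_format, OF bbs_indicator[OF this]]
      show "T (\<lambda>x. complex_of_real (indicator A x)) = (LBINT x. indicator A x * g x)"
        by (simp add: G_def of_real_indicator)
    qed
  qed
  have wB: "locbdd (\<lambda>x. complex_of_real (w x))" and \<beta>B: "locbdd (\<lambda>x. complex_of_real (\<beta> x))" by (intro locbdd_intros)+
  \<comment> \<open>w is only Borel, so \<psi> w is not a test function. The step back goes through
    \<open>radon_eqI_test\<close> for the functionals multiplied by w, applied to \<phi>
    \<beta>.\<close>
  have Bq: "(\<forall>\<phi>. bbs \<phi> \<longrightarrow> T \<phi> = G \<phi>) \<longleftrightarrow> (\<forall>\<psi>. test_function \<psi> \<longrightarrow> T (\<lambda>x. of_real (\<psi> x) * of_real (w x)) = G (\<lambda>x. of_real (\<psi> x) * of_real (w x)))"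
  proof
    assume "\<forall>\<phi>. bbs \<phi> \<longrightarrow> T \<phi> = G \<phi>"
    then show "\<forall>\<psi>. test_function \<psi> \<longrightarrow> T (\<lambda>x. of_real (\<psi> x) * of_real (w x)) = G (\<lambda>x. of_real (\<psi> x) * of_real (w x))"
      using bbs_mult[OF test_function_bbs lbB(1)[OF wB] lbB(2)[OF wB]] by blast
  next
    assume *: "\<forall>\<psi>. test_function \<psi> \<longrightarrow> T (\<lambda>x. of_real (\<psi> x) * of_real (w x)) = G (\<lambda>x. of_real (\<psi> x) * of_real (w x))"
    show "\<forall>\<phi>. bbs \<phi> \<longrightarrow> T \<phi> = G \<phi>"
    proof (intro allI impI)
      fix \<phi> assume \<phi>: "bbs \<phi>"
      have b: "bbs (\<lambda>x. \<phi> x * of_real (\<beta> x))" by (rule bbs_mult[OF \<phi> lbB(1)[OF \<beta>B] lbB(2)[OF \<beta>B]])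
      have "T (\<lambda>x. (\<phi> x * of_real (\<beta> x)) * of_real (w x)) = G (\<lambda>x. (\<phi> x * of_real (\<beta> x)) * of_real (w x))"
        by (rule radon_eqI_test[OF radon_mult[OF radonT lbB(1)[OF wB] lbB(2)[OF wB]] radon_mult[OF radonG lbB(1)[OF wB] lbB(2)[OF wB]] _ b])
          (use * in blast)
      moreover have "(\<phi> x * of_real (\<beta> x)) * of_real (w x) = \<phi> x" for x
        using \<beta>(1)[of x] by (simp add: mult.assoc flip: of_real_mult)
      ultimately show "T \<phi> = G \<phi>" by simp
    qed
  qed
  let ?R = "RR v U g"
  let ?q = "\<lambda>x. p x - of_real (n x) * U x"
  have nU: "locintb (\<lambda>x. of_real (n x) * U x)" by (intro locintb_locbdd locbdd_intros)
  have ql: "locintb ?q" by (intro locintb_diff pl nU)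
  have wg: "locintb (\<lambda>x. of_real (w x) * g x)" by (intro locintb_mult gl locbdd_intros)
  have t1: "locintb (\<lambda>x. (- \<i> * of_real h) * (of_real (b x) * v x))" by (intro locintb_mult bv locbdd_intros)
  have t2: "locintb (\<lambda>x. of_real (w x * V1 x) * U x)" by (intro locintb_locbdd locbdd_intros)
  have t3: "locintb (\<lambda>x. U x * of_real (c x))" by (intro locintb_mult cl locbdd_intros)
  have t4: "locintb (\<lambda>x. of_real (h * n x) * v x)" by (intro locintb_mult vl locbdd_intros)
  have Rl: "locintb ?R"
  proof -
    have "locintb (\<lambda>x. (1 / of_real h) * ((((- \<i> * of_real h) * (of_real (b x) * v x) - of_real (w x) * g x) + of_real (w x * V1 x) * U x
      + U x * of_real (c x)) - of_real (h * n x) * v x))"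
      by (intro locintb_mult[OF locbdd_const] locintb_diff[OF _ t4] locintb_add[OF _ t3] locintb_add[OF _ t2] locintb_diff[OF t1 wg])
    moreover have "(1 / of_real h) * ((((- \<i> * of_real h) * (of_real (b x) * v x) - of_real (w x) * g x) + of_real (w x * V1 x) * U x
      + U x * of_real (c x)) - of_real (h * n x) * v x) = ?R x" for x
      unfolding RR_def by (simp only: times_divide_eq_left mult_1) (simp only: minus_add diff_conv_add_uminus add_ac)
    ultimately show ?thesis by simp
  qed
  have Cq: "(T (\<lambda>x. of_real (\<psi> x) * of_real (w x)) = G (\<lambda>x. of_real (\<psi> x) * of_real (w x)))
     \<longleftrightarrow> ((LBINT x. complex_of_real (\<psi> x) * ?R x) = - (LBINT x. complex_of_real (deriv \<psi> x) * ?q x))"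
    if \<psi>: "test_function \<psi>" for \<psi>
  proof -
    let ?\<psi> = "\<lambda>x. complex_of_real (\<psi> x)" and ?\<psi>' = "\<lambda>x. complex_of_real (deriv \<psi> x)"
    obtain N where N: "\<And>x. \<bar>x\<bar> > N \<Longrightarrow> \<psi> x = 0" using test_function_support[OF \<psi>] by blast
    have N': "deriv \<psi> x = 0" if "\<bar>x\<bar> > N" for x using test_function_deriv_outside[of N \<psi>, OF N that] .
    note b\<psi> = test_function_bbs[OF \<psi>] and b\<psi>' = test_function_bbs[OF test_function_deriv[OF \<psi>]]
    have I: "integrable lborel (\<lambda>x. ?\<psi> x * k x)" "integrable lborel (\<lambda>x. ?\<psi>' x * k x)" if "locintb k" for k
      using radon_locint(2)[OF locintbD(3,1)[OF that] b\<psi>] radon_locint(2)[OF locintbD(3,1)[OF that] b\<psi>'] by auto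
    have \<beta>w: "complex_of_real (\<beta> x) * of_real (w x) = 1" for x using \<beta>(1)[of x] by (simp flip: of_real_mult)
    have e1: "complex_integral ?\<mu> (\<lambda>x. ?\<psi> x * of_real (w x) * of_real (\<beta> x)) = of_real h * (LBINT x. ?\<psi>' x * p x)"
    proof -
      have "complex_integral ?\<mu> (\<lambda>x. ?\<psi> x * of_real (w x) * of_real (\<beta> x)) = complex_integral ?\<mu> ?\<psi>"
      proof -
        have "?\<psi> x * of_real (w x) * of_real (\<beta> x) = ?\<psi> x * (of_real (\<beta> x) * of_real (w x))" for x by (simp only: mult_ac)
        then show ?thesis by (simp only: \<beta>w mult_1_right)
      qed
      also have "\<dots> = - (LBINT x. F1 x * ?\<psi>' x)" using mu(2) \<psi> by (simp add: has_derivative_measure_def)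
      also have "\<dots> = - (LBINT x. (- of_real h) * (?\<psi>' x * p x))" by (simp add: F1 mult_ac)
      finally show ?thesis by simp
    qed
    have e2: "(LBINT x. ?\<psi> x * of_real (w x) * (of_real (h * \<beta> x * b x) * Dx u x)) = (LBINT x. ?\<psi> x * ((- \<i> * of_real h) * (of_real (b x) * v x)))"
    proof (rule Bochner_Integration.integral_cong[OF refl])
      fix x
      have "?\<psi> x * of_real (w x) * (of_real (h * \<beta> x * b x) * Dx u x) = (of_real (\<beta> x) * of_real (w x)) * (?\<psi> x * ((- \<i> * of_real h) * (of_real (b x) * v x)))"
        by (simp add: Dx_def v_def mult_ac)
      then show "?\<psi> x * of_real (w x) * (of_real (h * \<beta> x * b x) * Dx u x) = ?\<psi> x * ((- \<i> * of_real h) * (of_real (b x) * v x))"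
        unfolding \<beta>w by simp
    qed
    \<comment> \<open>The term with V0 is integrated by parts against \<psi> U. Of the two parts of
      its derivative, \<psi>' U supplies n U in r = p - n U, and \<psi> v supplies the term -h n v
      of \<open>RR\<close>.\<close>
    have ac: "ac_on UNIV (\<lambda>x. ?\<psi> x * U x) (\<lambda>x. ?\<psi>' x * U x + ?\<psi> x * v x)"
      using U(1) unfolding v_def by (intro ac_on_mult test_function_ac(2) \<psi> is_interval_univ)
    have "(\<lambda>x. ?\<psi>' x * U x + ?\<psi> x * v x) \<in> borel_measurable borel"
      using borel_measurable_integrable[OF I(2)[OF locintb_locbdd[OF locbdd_continuous[OF Uc]]]] borel_measurable_integrable[OF I(1)[OF vl]] by simp
    from cumulative_data.cumulative_by_parts[OF cumulative_data ac this, of N] N N'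
    have bp: "signed_integral V0 (\<lambda>x. ?\<psi> x * U x * of_real (w x)) - (LBINT x. ?\<psi> x * U x * of_real (c x))
      = - (LBINT x. (?\<psi>' x * U x + ?\<psi> x * v x) * of_real (h * n x))"
      unfolding hn by simp
    have "(LBINT x. (?\<psi>' x * U x + ?\<psi> x * v x) * of_real (h * n x))
       = (LBINT x. of_real h * (?\<psi>' x * (of_real (n x) * U x)) + ?\<psi> x * (of_real (h * n x) * v x))"
      by (simp add: algebra_simps)
    also have "\<dots> = of_real h * (LBINT x. ?\<psi>' x * (of_real (n x) * U x)) + (LBINT x. ?\<psi> x * (of_real (h * n x) * v x))"
      using I(2)[OF nU] I(1)[OF t4] by (subst Bochner_Integration.integral_add) (simp_all del: of_real_mult)
    finally have e3: "signed_integral V0 (\<lambda>x. ?\<psi> x * of_real (w x) * U x) = (LBINT x. ?\<psi> x * (U x * of_real (c x)))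
      - (of_real h * (LBINT x. ?\<psi>' x * (of_real (n x) * U x)) + (LBINT x. ?\<psi> x * (of_real (h * n x) * v x)))"
      using bp by (simp add: mult_ac algebra_simps)
    have e4: "(LBINT x. ?\<psi> x * of_real (w x) * (U x * of_real (V1 x))) = (LBINT x. ?\<psi> x * (of_real (w x * V1 x) * U x))"
      by (simp add: mult_ac)
    have eG: "G (\<lambda>x. ?\<psi> x * of_real (w x)) = (LBINT x. ?\<psi> x * (of_real (w x) * g x))"
      by (simp add: G_def mult.assoc)
    have eR: "of_real h * (LBINT x. ?\<psi> x * ?R x) = - (LBINT x. ?\<psi> x * (of_real (w x) * g x)) + (LBINT x. ?\<psi> x * ((- \<i> * of_real h) * (of_real (b x) * v x)))
       + (LBINT x. ?\<psi> x * (of_real (w x * V1 x) * U x)) + (LBINT x. ?\<psi> x * (U x * of_real (c x))) - (LBINT x. ?\<psi> x * (of_real (h * n x) * v x))"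
    proof -
      have "of_real h * (LBINT x. ?\<psi> x * ?R x) = (LBINT x. of_real h * (?\<psi> x * ?R x))" by simp
      also have "\<dots> = (LBINT x. ((((?\<psi> x * ((- \<i> * of_real h) * (of_real (b x) * v x)) - ?\<psi> x * (of_real (w x) * g x)) + ?\<psi> x * (of_real (w x * V1 x) * U x))
         + ?\<psi> x * (U x * of_real (c x))) - ?\<psi> x * (of_real (h * n x) * v x)))"
      proof -
        have *: "k * (p * ((- g + t1 + t2 + t3 - t4) / k)) = (((p * t1 - p * g) + p * t2) + p * t3) - p * t4"
          if "k \<noteq> 0" for k p g t1 t2 t3 t4 :: complex
          using that by (simp add: field_simps)
        show ?thesis
          unfolding RR_def by (intro Bochner_Integration.integral_cong refl *) (use h_pos in simp)
      qed
      also have "\<dots> = ((((LBINT x. ?\<psi> x * ((- \<i> * of_real h) * (of_real (b x) * v x))) - (LBINT x. ?\<psi> x * (of_real (w x) * g x)))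
         + (LBINT x. ?\<psi> x * (of_real (w x * V1 x) * U x))) + (LBINT x. ?\<psi> x * (U x * of_real (c x)))) - (LBINT x. ?\<psi> x * (of_real (h * n x) * v x))"
        using I(1)[OF t1] I(1)[OF t2] I(1)[OF t3] I(1)[OF t4] I(1)[OF wg]
        by (simp only: Bochner_Integration.integral_add Bochner_Integration.integral_diff Bochner_Integration.integrable_add Bochner_Integration.integrable_diff)
      finally show ?thesis by simp
    qed
    have eq: "(LBINT x. ?\<psi>' x * ?q x) = (LBINT x. ?\<psi>' x * p x) - (LBINT x. ?\<psi>' x * (of_real (n x) * U x))"
      unfolding right_diff_distrib by (rule Bochner_Integration.integral_diff[OF I(2)[OF pl] I(2)[OF nU]])
    have "T (\<lambda>x. ?\<psi> x * of_real (w x)) - G (\<lambda>x. ?\<psi> x * of_real (w x)) = of_real h * ((LBINT x. ?\<psi> x * ?R x) + (LBINT x. ?\<psi>' x * ?q x))"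
    proof -
      have *: "of_real h * (y + z) = of_real h * y + of_real h * z" for y z :: complex by (rule distrib_left)
      have **: "of_real h * (y - z) = of_real h * y - of_real h * z" for y z :: complex by (rule right_diff_distrib)
      show ?thesis unfolding * eR eq ** T_def e1 e2 e3 e4 eG by simp
    qed
    moreover have "complex_of_real h \<noteq> 0" using h_pos by simp
    moreover have "t = g \<longleftrightarrow> y = - z" if "t - g = k * (y + z)" "k \<noteq> 0" for t g k y z :: complex
    proof -
      have "t = g \<longleftrightarrow> k * (y + z) = 0" using that(1) by (metis right_minus_eq)
      then show ?thesis using that(2) by (simp add: eq_neg_iff_add_eq_0)
    qed
    ultimately show ?thesis by blast
  qed
  have Dq: "(\<forall>\<psi>. test_function \<psi> \<longrightarrow> (LBINT x. complex_of_real (\<psi> x) * ?R x) = - (LBINT x. complex_of_real (deriv \<psi> x) * ?q x))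
    \<longleftrightarrow> (\<exists>r. ac_on UNIV r ?R \<and> (AE x in lborel. p x = r x + of_real (n x) * U x))"
  proof
    assume "\<forall>\<psi>. test_function \<psi> \<longrightarrow> (LBINT x. complex_of_real (\<psi> x) * ?R x) = - (LBINT x. complex_of_real (deriv \<psi> x) * ?q x)"
    then obtain d where d: "AE x in lborel. ?q x = d + prim ?R x"
      using du_Bois_Reymond[OF locintbD(3,1)[OF ql] locintbD(3)[OF Rl]] by blast
    have "ac_on UNIV (\<lambda>x. d + prim ?R x) (\<lambda>x. 0 + ?R x)" by (intro ac_on_add ac_on_const ac_on_prim locintbD(3)[OF Rl])
    moreover have "AE x in lborel. p x = (d + prim ?R x) + of_real (n x) * U x" using d by eventually_elim (simp add: algebra_simps)
    ultimately show "\<exists>r. ac_on UNIV r ?R \<and> (AE x in lborel. p x = r x + of_real (n x) * U x)" by auto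
  next
    assume "\<exists>r. ac_on UNIV r ?R \<and> (AE x in lborel. p x = r x + of_real (n x) * U x)"
    then obtain r where r: "ac_on UNIV r ?R" "AE x in lborel. p x = r x + of_real (n x) * U x" by blast
    show "\<forall>\<psi>. test_function \<psi> \<longrightarrow> (LBINT x. complex_of_real (\<psi> x) * ?R x) = - (LBINT x. complex_of_real (deriv \<psi> x) * ?q x)"
    proof (intro allI impI)
      fix \<psi> assume \<psi>: "test_function \<psi>"
      have m1: "(\<lambda>x. complex_of_real (deriv \<psi> x) * ?q x) \<in> borel_measurable lborel"
        using borel_measurable_integrable[OF radon_locint(2)[OF locintbD(3,1)[OF ql] test_function_bbs[OF test_function_deriv[OF \<psi>]]]] .
      have rl: "locintb r" by (intro locintb_locbdd locbdd_continuous ac_on_UNIV_continuous[OF r(1)])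
      have m2: "(\<lambda>x. complex_of_real (deriv \<psi> x) * r x) \<in> borel_measurable lborel"
        using borel_measurable_integrable[OF radon_locint(2)[OF locintbD(3,1)[OF rl] test_function_bbs[OF test_function_deriv[OF \<psi>]]]] .
      have "AE x in lborel. complex_of_real (deriv \<psi> x) * ?q x = complex_of_real (deriv \<psi> x) * r x"
        using r(2) by eventually_elim simp
      from integral_cong_AE[OF m1 m2 this] ac_test_by_parts[OF r(1) \<psi>]
      show "(LBINT x. complex_of_real (\<psi> x) * ?R x) = - (LBINT x. complex_of_real (deriv \<psi> x) * ?q x)" by simp
    qed
  qed
  show ?thesis unfolding A Bq using Cq Dq unfolding v_def p_def by blast
qed

section \<open>Equivalence of the operator equation and the first order system\<close>

lemma density_unique:
  assumes "has_density \<mu> g" "has_density \<mu> g'" "g \<in> L2" "g' \<in> L2"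
  shows "AE x in lborel. g x = g' x"
proof -
  note l = L2_locintb[OF assms(3)] L2_locintb[OF assms(4)]
  have r: "radon (\<lambda>\<phi>. LBINT x. \<phi> x * g x)" "radon (\<lambda>\<phi>. LBINT x. \<phi> x * g' x)"
    by (intro radon_locint(1) locintbD[OF l(1)] locintbD[OF l(2)])+
  have "(LBINT x. complex_of_real (indicator A x) * g x) = (LBINT x. complex_of_real (indicator A x) * g' x)"
    if "A \<in> sets borel" "bounded A" for A
    using assms(1,2) that unfolding has_density_def of_real_indicator by metis
  from radon_eqI_indicator[OF r this] show ?thesis
    by (intro locint_AE_eqI locintbD[OF l(1)] locintbD[OF l(2)]) (simp add: test_function_bbs)
qed

lemma Op_density:
  assumes "u \<in> Dom" shows "Op u \<in> L2" "has_density (Meas u) (Op u)"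
  using someI_ex[of "\<lambda>g. g \<in> L2 \<and> has_density (Meas u) g"] assms
  unfolding schroedinger_op_def schroedinger_domain_def by auto

text \<open>Insert h v = a p - i B U. The magnetic term -i b (h v) produces -a b^2 U, of which c
  restores the part with b0; the remaining -a b1^2 belongs to Q.\<close>

lemma RR_eq_dr:
  assumes v: "v x = dU U r x" and g: "g x = f x + Complex E \<epsilon> * U x" and q: "Q x = w x * (V1 x - E) - a x * (b1 x)\<^sup>2"
  shows "RR v U g x = dr f U r x"
proof -
  have hv: "of_real h * v x = of_real (a x) * P U r x - \<i> * of_real (B x) * U x"
    unfolding v dU_def using h_pos by simp
  have z: "Complex E \<epsilon> = of_real E + \<i> * of_real \<epsilon>" by (simp add: complex_eq_iff)
  have "RR v U g x = (- (of_real (w x) * g x) - \<i> * of_real (b x) * (of_real h * v x) + of_real (w x * V1 x) * U x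
      + U x * of_real (c x) - of_real (n x) * (of_real h * v x)) / of_real h"
    unfolding RR_def by (simp add: mult_ac)
  also have "\<dots> = dr f U r x"
    unfolding hv g z dr_def q B_eq by (rule arg_cong[where f = "\<lambda>y. y / of_real h"]) (simp add: algebra_simps power2_eq_square)
  finally show ?thesis .
qed

text \<open>\<open>density_iff\<close> supplies r, and the definition of the flux, solved for u',
  gives the equation for U. That the flux is square integrable uses that U is bounded, since b0 is
  only in L2.\<close>

lemma solves_imp_sol:
  assumes s: "solves Dom Op (Complex E \<epsilon>) f u" and f: "f \<in> L2"
  shows "\<exists>U r. sol UNIV f U r \<and> (AE x in lborel. u x = U x) \<and> U \<in> L2 \<and> P U r \<in> L2"
proof -
  have uD: "u \<in> Dom" and eq: "AE x in lborel. Op u x - Complex E \<epsilon> * u x = f x" using s by (auto simp: solves_def)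
  have u: "u \<in> H1" and fl: "locally_BV_class (flux h \<alpha> b u)" using uD by (auto simp: schroedinger_domain_def)
  have uL: "u \<in> L2" using u by (simp add: H1_def)
  obtain U where U: "ac_on UNIV U (wderiv u)" "AE x in lborel. u x = U x" "U \<in> L2" "cont_rep u = U"
    using H1_representative[OF u] .
  note v = wderiv[OF u]
  obtain r where r: "ac_on UNIV r (RR (wderiv u) U (Op u))" "AE x in lborel. flux h \<alpha> b u x = r x + of_real (n x) * U x"
    using density_iff[OF u U fl Op_density(1)[OF uD]] Op_density(2)[OF uD] by blast
  have Uc: "continuous_on UNIV U" "continuous_on UNIV r" using ac_on_UNIV_continuous U(1) r(1) by auto
  note lb = locbdd_continuous[OF Uc(1)] locbdd_continuous[OF Uc(2)]
  note [measurable] = locbddD(1)[OF lb(1)] locbddD(1)[OF lb(2)]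
  have [measurable]: "f \<in> borel_measurable borel" using f by (simp add: L2_def)
  have BB[measurable]: "B \<in> borel_measurable borel" using B by (simp add: locintb_def)
  have [measurable]: "Q \<in> borel_measurable borel" by (rule borel)
  have AEv: "AE x in lborel. wderiv u x = dU U r x"
    using r(2) U(2)
  proof eventually_elim
    case (elim x)
    have "complex_of_real (\<alpha> x) * of_real (a x) = 1" using \<alpha>(1)[of x] by (simp flip: of_real_mult)
    then have "of_real h * wderiv u x = of_real (a x) * (of_real (h * \<alpha> x) * wderiv u x)" by (simp add: mult_ac)
    also have "of_real (h * \<alpha> x) * wderiv u x = P U r x - \<i> * of_real (b x) * U x"
      using elim by (simp add: flux_def P_def algebra_simps)
    also have "of_real (a x) * \<dots> = of_real h * dU U r x"
    proof -
      have "of_real h * dU U r x = of_real (a x) * P U r x - \<i> * of_real (B x) * U x" unfolding dU_def using h_pos by simp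
      then show ?thesis unfolding B_eq by (simp add: algebra_simps)
    qed
    finally show ?case by (rule mult_left_cancel[THEN iffD1, rotated]) (use h_pos in simp)
  qed
  have AER: "AE x in lborel. RR (wderiv u) U (Op u) x = dr f U r x"
    using AEv eq U(2) Q_eq
  proof eventually_elim
    case (elim x)
    show ?case by (rule RR_eq_dr) (use elim in \<open>auto simp: algebra_simps\<close>)
  qed
  have dUm: "dU U r \<in> borel_measurable borel" "dr f U r \<in> borel_measurable borel"
    unfolding dU_def[abs_def] dr_def[abs_def] P_def by measurable
  have "sol UNIV f U r"
    unfolding sol_def using Uc ac_on_cong_AE[OF U(1) AEv dUm(1)] ac_on_cong_AE[OF r(1) AER dUm(2)] by blast
  moreover have "P U r \<in> L2"
  proof -
    obtain D where D: "\<And>x. cmod (U x) \<le> D" using H1_bounded[OF U(1,3) v(1)] by blast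
    have "(\<lambda>x. complex_of_real (h * \<alpha> x) * wderiv u x) \<in> L2"
      by (rule L2_bounded_mult[OF v(1), where C = "h * M"])
        (use \<alpha>_pos h_pos in \<open>auto simp: norm_mult abs_of_pos intro: mult_left_mono\<close>)
    moreover have "(\<lambda>x. \<i> * (complex_of_real (b x) * U x)) \<in> L2"
      by (rule L2_bounded_mult[OF b_mult_L2[OF U(3) D], where C = 1]) auto
    ultimately have L: "(\<lambda>x. complex_of_real (h * \<alpha> x) * wderiv u x + \<i> * (complex_of_real (b x) * U x)) \<in> L2"
      by (rule L2_add)
    show ?thesis
    proof (rule L2_cong_AE[OF L])
      show "AE x in lborel. complex_of_real (h * \<alpha> x) * wderiv u x + \<i> * (complex_of_real (b x) * U x) = P U r x"
        using r(2) U(2) by eventually_elim (simp add: flux_def P_def mult.assoc)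
      show "P U r \<in> borel_measurable borel" unfolding P_def[abs_def] by measurable
    qed
  qed
  ultimately show ?thesis using U by blast
qed

text \<open>The bounds D put the flux into the domain: they make it bounded and make b U square
  integrable. Local bounded variation holds because n is a combination of bounded monotone functions
  and U, r are absolutely continuous.\<close>

lemma sol_imp_solves:
  assumes s: "sol UNIV f U r" and UP: "U \<in> L2" "P U r \<in> L2" and f: "f \<in> L2"
    and bd: "\<And>x. cmod (U x) \<le> D" "\<And>x. cmod (P U r x) \<le> D"
  shows "solves Dom Op (Complex E \<epsilon>) f U"
proof -
  have ac: "ac_on UNIV U (dU U r)" "ac_on UNIV r (dr f U r)" and Uc: "continuous_on UNIV U" "continuous_on UNIV r"
    using s by (auto simp: sol_def)
  note lb = locbdd_continuous[OF Uc(1)] locbdd_continuous[OF Uc(2)]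
  note [measurable] = locbddD(1)[OF lb(1)] locbddD(1)[OF lb(2)]
  have BB[measurable]: "B \<in> borel_measurable borel" using B by (simp add: locintb_def)
  have dUL: "dU U r \<in> L2"
  proof -
    have "(\<lambda>x. complex_of_real (a x / h) * P U r x) \<in> L2"
      by (rule L2_bounded_mult[OF UP(2), where C = "M / h"])
        (use a_pos a_bd(2) h_pos in \<open>auto simp: norm_divide abs_of_pos intro: divide_right_mono\<close>)
    moreover have "(\<lambda>x. (- \<i> * complex_of_real (a x / h)) * (complex_of_real (b x) * U x)) \<in> L2"
      by (rule L2_bounded_mult[OF b_mult_L2[OF UP(1) bd(1)], where C = "M / h"])
        (use a_pos a_bd(2) h_pos in \<open>auto simp: norm_divide norm_mult abs_of_pos intro: divide_right_mono\<close>)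
    ultimately have "(\<lambda>x. complex_of_real (a x / h) * P U r x + (- \<i> * complex_of_real (a x / h)) * (complex_of_real (b x) * U x)) \<in> L2"
      by (rule L2_add)
    moreover have "complex_of_real (a x / h) * P U r x + (- \<i> * complex_of_real (a x / h)) * (complex_of_real (b x) * U x) = dU U r x" for x
      unfolding dU_def B_eq by (simp add: diff_divide_distrib)
    ultimately show ?thesis by simp
  qed
  have wd: "weak_derivative U (dU U r)" by (rule weak_derivative_ac[OF ac(1)])
  have H: "U \<in> H1" unfolding H1_def using UP(1) dUL wd by blast
  note v = wderiv[OF H]
  have AEv: "AE x in lborel. dU U r x = wderiv U x" by (rule weak_derivative_AE_unique[OF wd v(2) dUL v(1)])
  have [measurable]: "wderiv U \<in> borel_measurable borel" using v(1) by (simp add: L2_def)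
  have acU: "ac_on UNIV U (wderiv U)" by (rule ac_on_cong_AE[OF ac(1) AEv]) measurable
  have cr: "cont_rep U = U" by (rule cont_rep_eq[OF Uc(1)]) simp
  have AEfl: "AE x in lborel. flux h \<alpha> b U x = P U r x"
    using AEv
  proof eventually_elim
    case (elim x)
    have \<alpha>a: "complex_of_real (\<alpha> x) * of_real (a x) = 1" using \<alpha>(1)[of x] by (simp flip: of_real_mult)
    have "of_real (h * \<alpha> x) * dU U r x = of_real (\<alpha> x) * (of_real (a x) * P U r x - \<i> * of_real (B x) * U x)"
      unfolding dU_def using h_pos by simp
    also have "\<dots> = (of_real (\<alpha> x) * of_real (a x)) * P U r x - (of_real (\<alpha> x) * of_real (a x)) * (\<i> * of_real (b x) * U x)"
      unfolding B_eq by (simp add: algebra_simps)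
    also have "\<dots> = P U r x - \<i> * of_real (b x) * U x" unfolding \<alpha>a by simp
    finally show ?case using elim by (simp add: flux_def)
  qed
  have flm: "flux h \<alpha> b U \<in> borel_measurable borel" unfolding flux_def[abs_def] by measurable
  have Linf: "flux h \<alpha> b U \<in> Linf"
  proof -
    have "AE x in lborel. ereal (norm (flux h \<alpha> b U x)) \<le> ereal D" using AEfl by eventually_elim (simp add: bd(2))
    then have "Linf_norm (flux h \<alpha> b U) \<le> ereal D"
      unfolding Linf_norm_def using flm by (intro esssup_I) auto
    then have "Linf_norm (flux h \<alpha> b U) < \<infinity>" by (rule le_less_trans) simp
    then show ?thesis unfolding Linf_def using flm by simp
  qed
  have lBV: "locally_BV_class (flux h \<alpha> b U)"
  proof -
    obtain f1 f2 f3 f4 where bm: "bmono f1" "bmono f2" "bmono f3" "bmono f4" "cumulative V0 w c = (\<lambda>x. (f1 x - f2 x) - (f3 x - f4 x))"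
      using cumulative_data.cumulative_bmono[OF cumulative_data] by blast
    have "lbv (\<lambda>x. n x * k x)" if k: "lbv k" for k
    proof -
      have "lbv (\<lambda>x. (1 / h) * ((f1 x * k x - f2 x * k x) - (f3 x * k x - f4 x * k x)))"
        using h_pos by (intro lbv_cmult lbv_diff lbv_bmono_mult bm k) auto
      moreover have "(1 / h) * ((f1 x * k x - f2 x * k x) - (f3 x * k x - f4 x * k x)) = n x * k x" for x
        unfolding n_eq bm(5) by (simp only: divide_inverse mult_1 algebra_simps)
      ultimately show ?thesis by simp
    qed
    moreover have "lbv (\<lambda>x. Re (U x))" "lbv (\<lambda>x. Im (U x))" "lbv (\<lambda>x. Re (r x))" "lbv (\<lambda>x. Im (r x))"
      by (rule lbv_ac[OF ac_on_bounded_linear[OF bounded_linear_Re ac(1)]] lbv_ac[OF ac_on_bounded_linear[OF bounded_linear_Im ac(1)]]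
          lbv_ac[OF ac_on_bounded_linear[OF bounded_linear_Re ac(2)]] lbv_ac[OF ac_on_bounded_linear[OF bounded_linear_Im ac(2)]])+
    ultimately have "locally_BV (P U r)"
      unfolding locally_BV_iff_lbv P_def by (auto intro!: lbv_add)
    then show ?thesis unfolding locally_BV_class_def using AEfl by blast
  qed
  define g where "g x = f x + Complex E \<epsilon> * U x" for x
  have gL: "g \<in> L2" unfolding g_def[abs_def]
    by (intro L2_add f L2_bounded_mult[OF UP(1), where C = "cmod (Complex E \<epsilon>)"]) auto
  have [measurable]: "g \<in> borel_measurable borel" using gL by (simp add: L2_def)
  have AER: "AE x in lborel. dr f U r x = RR (wderiv U) U g x"
    using AEv Q_eq by eventually_elim (rule RR_eq_dr[symmetric], auto simp: g_def)
  have RRm: "RR (wderiv U) U g \<in> borel_measurable borel" unfolding RR_def[abs_def] by measurable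
  have "\<exists>r. ac_on UNIV r (RR (wderiv U) U g) \<and> (AE x in lborel. flux h \<alpha> b U x = r x + of_real (n x) * U x)"
    using ac_on_cong_AE[OF ac(2) AER RRm] AEfl unfolding P_def by blast
  then have dens: "has_density (Meas U) g"
    using density_iff[OF H acU _ UP(1) cr lBV gL] by simp
  then have Dom: "U \<in> Dom" unfolding schroedinger_domain_def using H Linf lBV gL by blast
  from density_unique[OF Op_density(2)[OF Dom] dens Op_density(1)[OF Dom] gL]
  have "AE x in lborel. Op U x - Complex E \<epsilon> * U x = f x" by eventually_elim (simp add: g_def)
  then show ?thesis using Dom by (simp add: solves_def)
qed

lemma sol_L2_bound:
  assumes s: "sol UNIV f U r" and UP: "U \<in> L2" "P U r \<in> L2" and f: "f \<in> L2"
  shows "(LBINT x. (cmod (U x))\<^sup>2) \<le> (M\<^sup>2 / \<bar>\<epsilon>\<bar>)\<^sup>2 * (LBINT x. (cmod (f x))\<^sup>2)"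
proof -
  define A where "A = (LBINT x. (cmod (U x))\<^sup>2)"
  define F where "F = (LBINT x. (cmod (f x))\<^sup>2)"
  define D where "D = (LBINT x. cmod (U x) * cmod (f x))"
  define \<eta> where "\<eta> = \<bar>\<epsilon>\<bar> / M\<^sup>2"
  have \<eta>: "0 < \<eta>" using eps M_pos by (simp add: \<eta>_def)
  have i: "integrable lborel (\<lambda>x. (cmod (U x))\<^sup>2)" "integrable lborel (\<lambda>x. (cmod (f x))\<^sup>2)"
    using UP f by (auto simp: L2_def)
  have "\<bar>\<epsilon>\<bar> * A \<le> M\<^sup>2 * D" using line_estimate(1)[OF s UP f] by (simp add: A_def D_def)
  then have AD: "\<eta> * A \<le> D" using M_pos by (simp add: \<eta>_def field_simps)
  have "D \<le> (LBINT x. \<eta> / 2 * (cmod (U x))\<^sup>2 + 1 / (2 * \<eta>) * (cmod (f x))\<^sup>2)"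
    unfolding D_def
  proof (rule integral_mono[OF L2_mult_integrable[OF UP(1) f]])
    fix x
    have "0 \<le> (\<eta> * cmod (U x) - cmod (f x))\<^sup>2" by simp
    then have "2 * \<eta> * (cmod (U x) * cmod (f x)) \<le> \<eta>\<^sup>2 * (cmod (U x))\<^sup>2 + (cmod (f x))\<^sup>2"
      by (simp add: power2_diff power_mult_distrib algebra_simps)
    then show "cmod (U x) * cmod (f x) \<le> \<eta> / 2 * (cmod (U x))\<^sup>2 + 1 / (2 * \<eta>) * (cmod (f x))\<^sup>2"
      using \<eta> by (simp add: field_simps power2_eq_square)
  qed (use i in auto)
  also have "\<dots> = \<eta> / 2 * A + 1 / (2 * \<eta>) * F" using i by (simp add: A_def F_def)
  finally have "\<eta> / 2 * A \<le> 1 / (2 * \<eta>) * F" using AD by linarith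
  then have "A \<le> (1 / \<eta>)\<^sup>2 * F" using \<eta> by (simp add: field_simps power2_eq_square)
  then show ?thesis by (simp add: A_def F_def \<eta>_def)
qed

text \<open>Through the equivalence with the system, existence is \<open>sol_L2_exists\<close>,
  while uniqueness and the norm bound are both \<open>sol_L2_bound\<close>, once for a difference of
  solutions.\<close>

lemma resolvent_set:
  assumes bd: "\<And>f U r. sol UNIV f U r \<Longrightarrow> U \<in> L2 \<Longrightarrow> P U r \<in> L2 \<Longrightarrow> f \<in> L2 \<Longrightarrow> \<exists>D. \<forall>x. cmod (U x) \<le> D \<and> cmod (P U r x) \<le> D"
  shows "in_resolvent_set Dom Op (Complex E \<epsilon>)"
  unfolding in_resolvent_set_def
proof (intro conjI ballI allI impI)
  fix f :: "real \<Rightarrow> complex" assume f: "f \<in> L2"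
  obtain U r where s: "sol UNIV f U r" "U \<in> L2" "P U r \<in> L2" using sol_L2_exists[OF f] by blast
  obtain D where "\<And>x. cmod (U x) \<le> D" "\<And>x. cmod (P U r x) \<le> D" using bd[OF s f] by blast
  then show "\<exists>u. solves Dom Op (Complex E \<epsilon>) f u" using sol_imp_solves[OF s f] by blast
next
  fix f u v :: "real \<Rightarrow> complex" assume f: "f \<in> L2" and uv: "solves Dom Op (Complex E \<epsilon>) f u \<and> solves Dom Op (Complex E \<epsilon>) f v"
  obtain U r where s: "sol UNIV f U r" "AE x in lborel. u x = U x" "U \<in> L2" "P U r \<in> L2" using solves_imp_sol f uv by blast
  obtain V q where t: "sol UNIV f V q" "AE x in lborel. v x = V x" "V \<in> L2" "P V q \<in> L2" using solves_imp_sol f uv by blast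
  let ?W = "\<lambda>x. U x + (-1) * V x" and ?z = "\<lambda>x. r x + (-1) * q x"
  have W: "sol UNIV (\<lambda>x. f x + (-1) * f x) ?W ?z" by (rule sol_lincomb[OF s(1) t(1)])
  have m: "(\<lambda>x. (-1) * k x) \<in> L2" if "k \<in> L2" for k :: "real \<Rightarrow> complex" by (rule L2_bounded_mult[OF that, where C = 1]) auto
  have WL: "?W \<in> L2" by (rule L2_add[OF s(3) m[OF t(3)]])
  have "(\<lambda>x. P U r x + (-1) * P V q x) \<in> L2" by (rule L2_add[OF s(4) m[OF t(4)]])
  then have PL: "P ?W ?z \<in> L2" using P_lincomb[of U "-1" V r q] by presburger
  have "(\<lambda>x. f x + (-1) * f x) \<in> L2" by (rule L2_add[OF f m[OF f]])
  from sol_L2_bound[OF W WL PL this] have le: "(LBINT x. (cmod (?W x))\<^sup>2) \<le> 0" by simp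
  have i: "integrable lborel (\<lambda>x. (cmod (?W x))\<^sup>2)" using WL by (simp add: L2_def)
  have "(LBINT x. (cmod (?W x))\<^sup>2) = 0" by (rule antisym[OF le]) (rule Bochner_Integration.integral_nonneg, simp)
  then have "AE x in lborel. (cmod (?W x))\<^sup>2 = 0"
    using integral_nonneg_eq_0_iff_AE[OF i] by simp
  then show "AE x in lborel. u x = v x" using s(2) t(2) by eventually_elim simp
next
  show "\<exists>K. \<forall>f\<in>L2. \<forall>u. solves Dom Op (Complex E \<epsilon>) f u \<longrightarrow> L2_norm u \<le> K * L2_norm f"
  proof (intro exI ballI allI impI)
    fix f u :: "real \<Rightarrow> complex" assume f: "f \<in> L2" and su: "solves Dom Op (Complex E \<epsilon>) f u"
    obtain U r where s: "sol UNIV f U r" "AE x in lborel. u x = U x" "U \<in> L2" "P U r \<in> L2" using solves_imp_sol f su by blast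
    have um: "u \<in> borel_measurable borel" "U \<in> borel_measurable borel"
      using su s(3) by (auto simp: solves_def schroedinger_domain_def H1_def L2_def)
    have "(LBINT x. (cmod (u x))\<^sup>2) = (LBINT x. (cmod (U x))\<^sup>2)"
      by (rule integral_cong_AE) (use um s(2) in \<open>auto elim: AE_mp\<close>)
    also have "\<dots> \<le> (M\<^sup>2 / \<bar>\<epsilon>\<bar>)\<^sup>2 * (LBINT x. (cmod (f x))\<^sup>2)" by (rule sol_L2_bound[OF s(1,3,4) f])
    finally have "sqrt (LBINT x. (cmod (u x))\<^sup>2) \<le> sqrt ((M\<^sup>2 / \<bar>\<epsilon>\<bar>)\<^sup>2 * (LBINT x. (cmod (f x))\<^sup>2))" by simp
    also have "\<dots> = (M\<^sup>2 / \<bar>\<epsilon>\<bar>) * sqrt (LBINT x. (cmod (f x))\<^sup>2)" by (simp add: real_sqrt_mult abs_of_nonneg del: abs_divide)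
    finally show "L2_norm u \<le> (M\<^sup>2 / \<bar>\<epsilon>\<bar>) * L2_norm f" by (simp add: L2_norm_def)
  qed
qed

end

section \<open>Uniform bounds at fixed \<open>h\<close>\<close>

definition clamp :: "real \<Rightarrow> real \<Rightarrow> real" where
  "clamp N y = max (- N) (min N y)"

lemma clamp_lipschitz: "\<bar>clamp N x - clamp N y\<bar> \<le> \<bar>x - y\<bar>"
  unfolding clamp_def by linarith

lemma clamp_bound: "0 \<le> N \<Longrightarrow> \<bar>clamp N y\<bar> \<le> N"
  unfolding clamp_def by linarith

lemma clamp_eq: "\<bar>y\<bar> \<le> N \<Longrightarrow> clamp N y = y"
  unfolding clamp_def by linarith

lemma clamp_borel [measurable]: "clamp N \<in> borel_measurable borel"
  unfolding clamp_def[abs_def] by measurable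

lemma tbv_clamp:
  assumes "tbv C f" shows "tbv C (\<lambda>x. clamp N (f x))"
  using tbv_lipschitz[OF assms clamp_borel, of 1 N] clamp_lipschitz by simp

text \<open>Truncation is 1-Lipschitz, so it keeps the integral modulus of continuity, and the
  essential bound makes it a change on a null set.\<close>

lemma BV_clamp:
  assumes f: "BV f" and N: "0 \<le> N" "Linf_norm f \<le> ereal N" "measure_norm (dBV f) \<le> ennreal N"
  shows "tbv (2 * N) (\<lambda>x. clamp N (f x))" "AE x in lborel. clamp N (f x) = f x" "f \<in> borel_measurable borel"
proof -
  show b: "f \<in> borel_measurable borel" by (rule BV_borel[OF f])
  show "tbv (2 * N) (\<lambda>x. clamp N (f x))" by (rule tbv_clamp[OF BV_tbv[OF f N(3,1)]])
  have "AE x in lborel. ereal (norm (f x)) \<le> Linf_norm f"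
    unfolding Linf_norm_def by (rule esssup_AE)
  then show "AE x in lborel. clamp N (f x) = f x"
  proof eventually_elim
    case (elim x)
    have "ereal (norm (f x)) \<le> ereal N" using elim N(2) by (rule order_trans)
    then show ?case by (intro clamp_eq) simp
  qed
qed

locale bounded_coefficients =
  fixes h \<epsilon> E N R :: real and \<alpha> \<beta> b0 b1 V1 :: "real \<Rightarrow> real" and V0 :: "real set \<Rightarrow> real"
  assumes h: "0 < h" "h \<le> N" and eps: "\<epsilon> \<noteq> 0" "\<bar>\<epsilon>\<bar> \<le> N" and E: "\<bar>E\<bar> \<le> N" and R: "0 \<le> R" "R \<le> N" and N: "1 \<le> N"
    and BVs: "BV \<alpha>" "BV \<beta>" "BV b1" "BV V1"
    and dnorm: "measure_norm (dBV \<alpha>) \<le> ennreal N" "measure_norm (dBV \<beta>) \<le> ennreal N"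
      "measure_norm (dBV b1) \<le> ennreal N" "measure_norm (dBV V1) \<le> ennreal N"
    and \<alpha>: "\<And>x. 1 / N \<le> \<alpha> x" "\<And>x. \<alpha> x \<le> N"
    and \<beta>: "\<And>x. 1 / N \<le> \<beta> x" "\<And>x. \<beta> x \<le> N"
    and b1: "Linf_norm b1 \<le> ereal N" and V1: "Linf_norm V1 \<le> ereal N"
    and V0: "finite_signed_measure V0" "measure_norm V0 \<le> ennreal N"
    and b0: "b0 \<in> L1" "b0 \<in> L2" "L1_norm b0 \<le> N" "L2_norm b0 \<le> N"
    and far: "\<And>x. R \<le> \<bar>x\<bar> \<Longrightarrow> 1 / N \<le> inverse (\<beta> x) * \<alpha> x * (E - V1 x) + (b1 x)\<^sup>2"
begin

text \<open>One constant for all bounds of \<open>uniform_system\<close>. The largest demand is that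
  of \<open>k_tbv\<close>, 4 N^2 + 6 N^3 + 4 N^5, which is at most 14 N^5 for N \<ge> 1.\<close>

definition M :: real where "M = 16 * N ^ 5"

text \<open>The norm bounds on \<open>b1\<close> and \<open>V1\<close> hold only almost everywhere; truncation gives
  representatives that satisfy them at every point.\<close>

definition b1' :: "real \<Rightarrow> real" where "b1' x = clamp N (b1 x)"
definition V1' :: "real \<Rightarrow> real" where "V1' x = clamp N (V1 x)"
definition a :: "real \<Rightarrow> real" where "a x = 1 / \<alpha> x"
definition w :: "real \<Rightarrow> real" where "w x = 1 / \<beta> x"
definition Q :: "real \<Rightarrow> real" where "Q x = w x * (V1' x - E) - a x * (b1' x)\<^sup>2"
text \<open>This is -Q/a, which makes the leading coefficient of the energy derivative vanish. It
  may be negative for bounded x, hence the lower truncation in \<open>k\<close>.\<close>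

definition k0 :: "real \<Rightarrow> real" where "k0 x = b1' x * b1' x - \<alpha> x * w x * (V1' x - E)"
definition k :: "real \<Rightarrow> real" where "k x = max (k0 x) (1 / N)"
definition c :: "real \<Rightarrow> real" where "c x = a x * ((b0 x)\<^sup>2 + 2 * b0 x * b1 x)"
definition n :: "real \<Rightarrow> real" where "n x = cumulative V0 w c x / h"
definition B :: "real \<Rightarrow> real" where "B x = a x * (b0 x + b1 x)"

lemma N_pos: "0 < N" "0 \<le> N" using N by auto

lemma N_pow: "N ^ i \<le> N ^ j" if "i \<le> j"
  using that N by (rule power_increasing)

lemma M_bounds: "1 \<le> M" "N \<le> M" "16 * N ^ 5 \<le> M" "16 * N ^ 3 \<le> M"
  using N_pow[of 0 5] N_pow[of 1 5] N_pow[of 3 5] by (auto simp: M_def)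

lemma inverse_bounds:
  assumes "1 / N \<le> y" "y \<le> N"
  shows "0 < y" "1 / N \<le> 1 / y" "1 / y \<le> N"
proof -
  have "0 < 1 / N" using N by simp
  then show y: "0 < y" using assms(1) by linarith
  show "1 / N \<le> 1 / y" using assms(2) y by (simp add: frac_le)
  show "1 / y \<le> N" using assms(1) y N_pos by (simp add: field_simps)
qed

lemma a_bd: "0 < a x" "1 / N \<le> a x" "a x \<le> N" and w_bd: "0 < w x" "1 / N \<le> w x" "w x \<le> N"
  and \<alpha>_pos: "0 < \<alpha> x" and \<beta>_pos: "0 < \<beta> x"
  using inverse_bounds[OF \<alpha>] inverse_bounds[OF \<beta>] by (auto simp: a_def w_def)

lemma one_div: "1 / M \<le> 1 / N" using M_bounds N by (simp add: frac_le)

lemma b1'_bd: "\<bar>b1' x\<bar> \<le> N" and V1'_bd: "\<bar>V1' x\<bar> \<le> N"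
  using clamp_bound N_pos by (auto simp: b1'_def V1'_def)

lemma AE_eq: "AE x in lborel. b1' x = b1 x" "AE x in lborel. V1' x = V1 x"
  unfolding b1'_def V1'_def by (intro BV_clamp(2) BVs N_pos b1 V1 dnorm)+

lemma tbvs: "tbv (2 * N) \<alpha>" "tbv (2 * N) \<beta>" "tbv (2 * N) b1'" "tbv (2 * N) V1'"
  unfolding b1'_def[abs_def] V1'_def[abs_def] by (intro BV_clamp(1) BV_tbv BVs N_pos b1 V1 dnorm)+

lemma borels [measurable]: "\<alpha> \<in> borel_measurable borel" "\<beta> \<in> borel_measurable borel" "b1 \<in> borel_measurable borel"
  "V1 \<in> borel_measurable borel" "b0 \<in> borel_measurable borel"
  using BV_borel BVs b0(2) by (auto simp: L2_def)

lemma borels' [measurable]: "a \<in> borel_measurable borel" "w \<in> borel_measurable borel" "b1' \<in> borel_measurable borel"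
  "V1' \<in> borel_measurable borel" "Q \<in> borel_measurable borel" "c \<in> borel_measurable borel"
proof -
  show [measurable]: "a \<in> borel_measurable borel" "w \<in> borel_measurable borel" "b1' \<in> borel_measurable borel" "V1' \<in> borel_measurable borel"
    unfolding a_def[abs_def] w_def[abs_def] b1'_def[abs_def] V1'_def[abs_def] by measurable
  show "Q \<in> borel_measurable borel" "c \<in> borel_measurable borel"
    unfolding Q_def[abs_def] c_def[abs_def] by measurable
qed

lemma tbv_w: "tbv (2 * N ^ 3) w"
proof -
  have "tbv (N\<^sup>2 * (2 * N) + 0 * 0) w"
  proof (rule tbv_dominated[OF tbvs(2) tbv_const])
    fix e :: real
    have "\<bar>w (x + e) - w x\<bar> \<le> N\<^sup>2 * \<bar>\<beta> (x + e) - \<beta> x\<bar>" for x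
    proof -
      have "w (x + e) - w x = (w (x + e) * w x) * (\<beta> x - \<beta> (x + e))"
        using \<beta>_pos[of x] \<beta>_pos[of "x + e"] by (simp add: w_def field_simps)
      then have "\<bar>w (x + e) - w x\<bar> = (w (x + e) * w x) * \<bar>\<beta> (x + e) - \<beta> x\<bar>"
        using w_bd(1)[of x] w_bd(1)[of "x + e"] by (simp add: abs_mult abs_minus_commute)
      also have "\<dots> \<le> (N * N) * \<bar>\<beta> (x + e) - \<beta> x\<bar>"
        using w_bd[of x] w_bd[of "x + e"] by (intro mult_right_mono mult_mono) auto
      finally show ?thesis by (simp add: power2_eq_square)
    qed
    then show "AE x in lborel. \<bar>w (x + e) - w x\<bar> \<le> N\<^sup>2 * \<bar>\<beta> (x + e) - \<beta> x\<bar> + 0 * \<bar>0 - 0 :: real\<bar>" by simp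
  qed (use N in auto)
  then show ?thesis by (simp add: power2_eq_square power3_eq_cube mult_ac)
qed

lemma VE_bd: "\<bar>V1' x - E\<bar> \<le> 2 * N" using V1'_bd[of x] E by linarith

lemma b2_bd: "\<bar>b1' x * b1' x\<bar> \<le> N\<^sup>2"
  using b1'_bd[of x] unfolding abs_mult power2_eq_square by (intro mult_mono) auto

lemma Q_bd: "\<bar>Q x\<bar> \<le> M"
proof -
  have "\<bar>w x * (V1' x - E)\<bar> \<le> N * (2 * N)" "\<bar>a x * (b1' x * b1' x)\<bar> \<le> N * N\<^sup>2"
    using VE_bd[of x] b2_bd[of x] a_bd[of x] w_bd[of x] N_pos unfolding abs_mult[of "w x"] abs_mult[of "a x"]
    by (auto intro!: mult_mono)
  then have "\<bar>Q x\<bar> \<le> 2 * N\<^sup>2 + N ^ 3" unfolding Q_def by (simp add: power2_eq_square power3_eq_cube)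
  then show ?thesis using N_pow[of 2 3] M_bounds(4) N_pos(2) zero_le_power[of N 3] by linarith
qed

lemma \<alpha>w_bd: "\<bar>\<alpha> x * w x\<bar> \<le> N\<^sup>2"
  using \<alpha>(2)[of x] \<alpha>_pos[of x] w_bd[of x] unfolding abs_mult power2_eq_square by (intro mult_mono) auto

lemma k_bd: "1 / M \<le> k x" "k x \<le> M"
proof -
  show "1 / M \<le> k x" using one_div unfolding k_def by linarith
  have "\<bar>\<alpha> x * w x * (V1' x - E)\<bar> \<le> N\<^sup>2 * (2 * N)"
    unfolding abs_mult[of "\<alpha> x * w x"] using \<alpha>w_bd[of x] VE_bd[of x] by (intro mult_mono) auto
  then have "k0 x \<le> N\<^sup>2 + 2 * N ^ 3"
    using b2_bd[of x] unfolding k0_def by (simp add: power2_eq_square power3_eq_cube)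
  moreover have "1 / N \<le> 1" using N by simp
  ultimately show "k x \<le> M" using N_pow[of 2 3] M_bounds(1,4) N_pos(2) zero_le_power[of N 3] unfolding k_def by linarith
qed

lemma k_tbv: "tbv M k"
proof -
  have p: "tbv (N * (2 * N) + N * (2 * N ^ 3)) (\<lambda>x. \<alpha> x * w x)"
    by (rule tbv_mult[OF tbvs(1) tbv_w]) (use \<alpha>(2) \<alpha>_pos w_bd N_pos in \<open>auto simp: abs_of_pos\<close>)
  have v: "tbv (2 * N + 0) (\<lambda>x. V1' x - E)" by (rule tbv_diff[OF tbvs(4) tbv_const])
  have "tbv ((2 * N) * (N * (2 * N) + N * (2 * N ^ 3)) + N\<^sup>2 * (2 * N + 0)) (\<lambda>x. (\<alpha> x * w x) * (V1' x - E))"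
    by (rule tbv_mult[OF p v]) (use \<alpha>w_bd VE_bd N_pos in auto)
  moreover have "tbv (N * (2 * N) + N * (2 * N)) (\<lambda>x. b1' x * b1' x)"
    by (rule tbv_mult[OF tbvs(3) tbvs(3)]) (use b1'_bd N_pos in auto)
  ultimately have "tbv ((N * (2 * N) + N * (2 * N)) + ((2 * N) * (N * (2 * N) + N * (2 * N ^ 3)) + N\<^sup>2 * (2 * N + 0))) k0"
    unfolding k0_def[abs_def] by (intro tbv_diff)
  then have "tbv (4 * N\<^sup>2 + 6 * N ^ 3 + 4 * N ^ 5) k0"
    by (simp add: algebra_simps power2_eq_square power3_eq_cube numeral_eq_Suc)
  then have t: "tbv M k0"
    by (rule tbv_mono) (use N_pow[of 2 5] N_pow[of 3 5] zero_le_power[OF N_pos(2), of 5] in \<open>unfold M_def, linarith\<close>)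
  have "tbv (1 * M) (\<lambda>x. max (k0 x) (1 / N))"
  proof (rule tbv_lipschitz[OF t, where L = "\<lambda>y. max y (1 / N)"])
    show "(\<lambda>y. max y (1 / N)) \<in> borel_measurable borel" by measurable
    show "\<bar>max (k0 x) (1 / N) - max (k0 y) (1 / N)\<bar> \<le> 1 * \<bar>k0 x - k0 y\<bar>" for x y by (auto simp: max_def)
  qed simp
  then show ?thesis by (simp add: k_def[abs_def])
qed

lemma k_far: "AE x in lborel. R \<le> \<bar>x\<bar> \<longrightarrow> Q x + a x * k x = 0"
  using AE_eq
proof eventually_elim
  case (elim x)
  show ?case
  proof
    assume x: "R \<le> \<bar>x\<bar>"
    have "k0 x = inverse (\<beta> x) * \<alpha> x * (E - V1 x) + (b1 x)\<^sup>2"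
      unfolding k0_def elim w_def by (simp only: power2_eq_square divide_inverse mult_1 algebra_simps)
    \<comment> \<open>Beyond R the nontrapping condition makes the lower truncation in
      \<open>k\<close> inactive.\<close>
    then have k: "k x = k0 x" using far[OF x] by (simp add: k_def)
    have "\<alpha> x * a x = 1" using \<alpha>_pos[of x] by (simp add: a_def)
    moreover have "a x * (b1' x * b1' x - \<alpha> x * w x * (V1' x - E)) = a x * (b1' x)\<^sup>2 - (\<alpha> x * a x) * (w x * (V1' x - E))"
      by (simp add: algebra_simps power2_eq_square)
    ultimately show "Q x + a x * k x = 0" unfolding k k0_def Q_def by simp
  qed
qed

lemma c_bound: "AE x in lborel. \<bar>c x\<bar> \<le> N * ((b0 x)\<^sup>2 + 2 * N * \<bar>b0 x\<bar>)"
  using AE_eq(1)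
proof eventually_elim
  case (elim x)
  have "\<bar>(b0 x)\<^sup>2 + 2 * b0 x * b1 x\<bar> \<le> (b0 x)\<^sup>2 + 2 * \<bar>b0 x\<bar> * \<bar>b1 x\<bar>"
    by (rule order_trans[OF abs_triangle_ineq]) (simp add: abs_mult)
  also have "\<dots> \<le> (b0 x)\<^sup>2 + 2 * \<bar>b0 x\<bar> * N" using b1'_bd[of x] elim by (intro add_left_mono mult_left_mono) auto
  finally have "\<bar>(b0 x)\<^sup>2 + 2 * b0 x * b1 x\<bar> \<le> (b0 x)\<^sup>2 + 2 * N * \<bar>b0 x\<bar>" by (simp add: mult_ac)
  then show ?case unfolding c_def abs_mult[of "a x"] using a_bd[of x] by (intro mult_mono) auto
qed

lemma c_integrable: "integrable lborel c" and c_norm: "(LBINT x. \<bar>c x\<bar>) \<le> 3 * N ^ 3"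
proof -
  have i: "integrable lborel (\<lambda>x. (b0 x)\<^sup>2)" "integrable lborel (\<lambda>x. \<bar>b0 x\<bar>)"
    using b0(1,2) by (auto simp: L1_def L2_def)
  then have i': "integrable lborel (\<lambda>x. N * ((b0 x)\<^sup>2 + 2 * N * \<bar>b0 x\<bar>))" by simp
  show ci: "integrable lborel c"
    by (rule Bochner_Integration.integrable_bound[OF i']) (use c_bound in \<open>auto elim!: eventually_mono\<close>)
  have "(LBINT x. \<bar>c x\<bar>) \<le> (LBINT x. N * ((b0 x)\<^sup>2 + 2 * N * \<bar>b0 x\<bar>))"
    by (rule integral_mono_AE[OF integrable_abs[OF ci] i' c_bound])
  also have "\<dots> = N * ((LBINT x. (b0 x)\<^sup>2) + 2 * N * (LBINT x. \<bar>b0 x\<bar>))" using i by simp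
  also have "\<dots> \<le> N * (N\<^sup>2 + 2 * N * N)"
  proof -
    have "sqrt (LBINT x. (b0 x)\<^sup>2) \<le> N" using b0(4) by (simp add: L2_norm_def)
    then have "(LBINT x. (b0 x)\<^sup>2) \<le> N\<^sup>2" using N_pos by (simp add: real_sqrt_le_iff sqrt_le_D)
    moreover have "(LBINT x. \<bar>b0 x\<bar>) \<le> N" using b0(3) by (simp add: L1_norm_def)
    ultimately show ?thesis using N_pos by (intro mult_left_mono add_mono) auto
  qed
  finally show "(LBINT x. \<bar>c x\<bar>) \<le> 3 * N ^ 3" by (simp add: power2_eq_square power3_eq_cube algebra_simps)
qed

lemma cumulative_c: "cumulative_data V0 w c N N (3 * N ^ 3)"
  by unfold_locales (use V0 N_pos w_bd c_integrable c_norm in \<open>auto simp: less_imp_le\<close>)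

lemma cumulative_M: "2 * (N * N + 3 * N ^ 3) \<le> M"
proof -
  have "N * N \<le> N ^ 3" using N_pow[of 2 3] by (simp add: power2_eq_square)
  then show ?thesis unfolding distrib_left using M_bounds(4) zero_le_power[OF N_pos(2), of 3] by linarith
qed

lemma n_bd: "\<bar>n x\<bar> \<le> M / h"
proof -
  have "\<bar>cumulative V0 w c x\<bar> \<le> M"
    by (rule order_trans[OF cumulative_data.cumulative_bound[OF cumulative_c] cumulative_M])
  then show ?thesis using h unfolding n_def by (simp add: abs_div divide_right_mono)
qed

lemma n_tbv: "tbv (M / h) n"
proof -
  have t: "tbv M (cumulative V0 w c)"
    by (rule tbv_mono[OF cumulative_data.cumulative_tbv[OF cumulative_c] cumulative_M])
  have "tbv (1 / h * M) (\<lambda>x. cumulative V0 w c x / h)"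
    by (rule tbv_lipschitz[OF t]) (use h in \<open>auto simp: abs_div simp flip: diff_divide_distrib\<close>)
  then show ?thesis by (simp add: n_def[abs_def])
qed

lemma b1_bounded: "\<exists>C. (\<forall>x. \<bar>b1 x\<bar> \<le> C) \<and> (\<forall>x. \<bar>V1 x\<bar> \<le> C)"
proof -
  obtain C D where "\<forall>x. \<bar>b1 x\<bar> \<le> C" "\<forall>x. \<bar>V1 x\<bar> \<le> D" using BV_bounded BVs(3,4) by meson
  then have "(\<forall>x. \<bar>b1 x\<bar> \<le> max C D) \<and> (\<forall>x. \<bar>V1 x\<bar> \<le> max C D)" by (auto simp: le_max_iff_disj)
  then show ?thesis by blast
qed

lemma B_locintb: "locintb B"
proof -
  obtain C where "\<forall>x. \<bar>b1 x\<bar> \<le> C" using b1_bounded by blast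
  then have "locbdd b1" by (intro locbdd_bounded[of b1 C]) auto
  moreover have "locintb b0" using b0(1) by (intro integrable_locintb) (simp add: L1_def)
  moreover have "locbdd a" by (rule locbdd_bounded[of a N]) (use a_bd in \<open>auto simp: abs_of_pos\<close>)
  ultimately show ?thesis
    unfolding B_def[abs_def] by (intro locintb_mult locintb_add[OF _ locintb_locbdd])
qed

lemma uniform: "uniform_system h \<epsilon> M a w Q n B k R"
proof
  show "a \<in> borel_measurable borel" "w \<in> borel_measurable borel" "Q \<in> borel_measurable borel" by measurable
  show "n \<in> borel_measurable borel" using n_tbv by (simp add: tbv_def)
  show "1 / M \<le> a x" "a x \<le> M" "1 / M \<le> w x" "w x \<le> M" for x
    using a_bd[of x] w_bd[of x] one_div M_bounds(2) by linarith+
  show "AE x in lborel. R \<le> \<bar>x\<bar> \<longrightarrow> Q x + a x * k x = 0" by (rule k_far)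
qed (use h eps R M_bounds Q_bd n_bd B_locintb n_tbv k_tbv k_bd in auto)

lemma schroedinger_ex: "\<exists>C. schroedinger h \<epsilon> (M / h) M a w Q n B \<alpha> \<beta> b0 b1 V1 V0 E C N (3 * N ^ 3)"
proof -
  interpret uniform_system h \<epsilon> M a w Q n B k R by (rule uniform)
  obtain C where C: "\<forall>x. \<bar>b1 x\<bar> \<le> C" "\<forall>x. \<bar>V1 x\<bar> \<le> C" using b1_bounded by blast
  have "AE x in lborel. Q x = w x * (V1 x - E) - a x * (b1 x)\<^sup>2"
    using AE_eq by eventually_elim (simp add: Q_def)
  then have "schroedinger h \<epsilon> (M / h) M a w Q n B \<alpha> \<beta> b0 b1 V1 V0 E C N (3 * N ^ 3)"
    using C c_integrable c_norm V0 b0 N_pos \<alpha>_pos \<beta>_pos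
    by unfold_locales (auto simp: c_def n_def B_def c_def[abs_def] a_def w_def less_imp_neq[symmetric])
  then show ?thesis by blast
qed

lemma resolvent_estimate:
  defines "Dm \<equiv> schroedinger_domain h \<alpha> \<beta> (\<lambda>x. b0 x + b1 x) V0 V1" and "Op \<equiv> schroedinger_op h \<alpha> \<beta> (\<lambda>x. b0 x + b1 x) V0 V1"
  shows "in_resolvent_set Dm Op (Complex E \<epsilon>)"
    and "\<And>f u. f \<in> L2 \<Longrightarrow> integrable lborel f \<Longrightarrow> solves Dm Op (Complex E \<epsilon>) f u \<Longrightarrow>
      AE x in lborel. cmod (u x) \<le> M * (uniform_system.Csup h M * (LBINT x. cmod (f x)))"
proof -
  interpret U: uniform_system h \<epsilon> M a w Q n B k R by (rule uniform)
  obtain C where "schroedinger h \<epsilon> (M / h) M a w Q n B \<alpha> \<beta> b0 b1 V1 V0 E C N (3 * N ^ 3)" using schroedinger_ex by blast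
  then interpret S: schroedinger h \<epsilon> "M / h" M a w Q n B \<alpha> \<beta> b0 b1 V1 V0 E C N "3 * N ^ 3" .
  show "in_resolvent_set Dm Op (Complex E \<epsilon>)"
    unfolding Dm_def Op_def by (rule S.resolvent_set) (rule U.sol_bounded)
  fix f u :: "real \<Rightarrow> complex" assume f: "f \<in> L2" "integrable lborel f" and s: "solves Dm Op (Complex E \<epsilon>) f u"
  obtain U r where U: "U.sol UNIV f U r" "AE x in lborel. u x = U x" "U \<in> L2" "U.P U r \<in> L2"
    using S.solves_imp_sol[OF s[unfolded Dm_def Op_def] f(1)] by blast
  show "AE x in lborel. cmod (u x) \<le> M * (U.Csup * (LBINT x. cmod (f x)))"
    using U(2) by eventually_elim (simp only: U.sup_estimate[OF U(1,3,4) f])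
qed

end

section \<open>The weighted resolvent\<close>

lemma bracket_weight: "(bracket x powr (- s))\<^sup>2 = (1 + x\<^sup>2) powr (- s)"
proof -
  have "(bracket x powr (- s))\<^sup>2 = bracket x powr (- s) * bracket x powr (- s)" by (rule power2_eq_square)
  also have "\<dots> = bracket x powr (- s + - s)" by (simp only: powr_add)
  also have "\<dots> = (1 + x\<^sup>2) powr (1 / 2 * (- s + - s))" unfolding bracket_def by (simp only: powr_powr power2_abs)
  finally show ?thesis by simp
qed

lemma bracket_weight_bounds: "0 \<le> bracket x powr (- s)" "0 \<le> s \<Longrightarrow> bracket x powr (- s) \<le> 1"
proof -
  show "0 \<le> bracket x powr (- s)" by simp
  assume s: "0 \<le> s"
  have "1 \<le> bracket x" unfolding bracket_def by (rule ge_one_powr_ge_zero) auto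
  then have "bracket x powr (- s) \<le> bracket x powr 0" using s by (intro powr_mono) auto
  then show "bracket x powr (- s) \<le> 1" using \<open>1 \<le> bracket x\<close> by simp
qed

lemma bracket_borel [measurable]: "bracket \<in> borel_measurable borel"
  unfolding bracket_def[abs_def] by measurable

lemma integrable_powr_tail:
  fixes q :: real assumes "q < -1"
  shows "integrable lborel (\<lambda>x. indicator {0..} x * (1 + x) powr q)"
proof (rule integrableI_nonneg)
  define F :: "real \<Rightarrow> real" where "F x = (1 + x) powr (q + 1) / (q + 1)" for x
  have F: "DERIV F x :> (1 + x) powr q" if "0 \<le> x" for x
  proof -
    have "DERIV (\<lambda>x. (1 + x) powr (q + 1)) x :> (q + 1) * (1 + x) powr (q + 1 - 1)"
      using that by (auto intro!: derivative_eq_intros)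
    from DERIV_cdivide[OF this, of "q + 1"] show ?thesis unfolding F_def[abs_def] using assms by simp
  qed
  have lim: "(F \<longlongrightarrow> 0) at_top"
    unfolding F_def using assms by real_asymp
  have "(\<integral>\<^sup>+x. ennreal ((1 + x) powr q) * indicator {0..} x \<partial>lborel) = 0 - F 0"
    by (rule nn_integral_FTC_atLeast[OF _ F _ lim]) auto
  moreover have "ennreal (indicator {0..} x * (1 + x) powr q) = ennreal ((1 + x) powr q) * indicator {0..} x" for x :: real
    by (simp split: split_indicator)
  ultimately show "(\<integral>\<^sup>+x. ennreal (indicator {0..} x * (1 + x) powr q) \<partial>lborel) < \<infinity>" by simp
qed auto

text \<open>Comparison with the power -2s of 1 + |x|, which is integrable because 2s > 1; the factor
  2 powr s comes from (1 + |x|)^2 \<le> 2 (1 + x^2).\<close>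

lemma integrable_bracket_weight:
  assumes s: "s > 1 / 2" shows "integrable lborel (\<lambda>x. (bracket x powr (- s))\<^sup>2)"
proof -
  define g :: "real \<Rightarrow> real" where "g x = indicator {0..} x * (1 + x) powr (- 2 * s)" for x
  have g: "integrable lborel g" unfolding g_def[abs_def] by (rule integrable_powr_tail) (use s in simp)
  have g': "integrable lborel (\<lambda>x. g (- x))" using lborel_integrable_real_affine[OF g, of "-1" 0] by simp
  have i: "integrable lborel (\<lambda>x. 2 powr s * (g x + g (- x)))" using g g' by simp
  have le: "(1 + x\<^sup>2) powr (- s) \<le> 2 powr s * (g x + g (- x))" for x
  proof -
    have "(1 + \<bar>x\<bar>)\<^sup>2 \<le> 2 * (1 + x\<^sup>2)"
      using sum_squares_bound[of 1 "\<bar>x\<bar>"] by (simp add: power2_sum)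
    then have "(2 * (1 + x\<^sup>2)) powr (- s) \<le> ((1 + \<bar>x\<bar>)\<^sup>2) powr (- s)"
      using s by (intro powr_mono2') auto
    also have "\<dots> = (1 + \<bar>x\<bar>) powr (- 2 * s)" by (simp add: powr_powr flip: powr_numeral)
    also have "\<dots> \<le> g x + g (- x)" by (cases "0 \<le> x") (auto simp: g_def)
    finally have "2 powr s * (2 * (1 + x\<^sup>2)) powr (- s) \<le> 2 powr s * (g x + g (- x))" by (intro mult_left_mono) auto
    moreover have "2 powr s * (2 * (1 + x\<^sup>2)) powr (- s) = (1 + x\<^sup>2) powr (- s)"
    proof -
      have "2 powr s * 2 powr (- s) = (1 :: real)" by (simp flip: powr_add)
      moreover have "(2 * (1 + x\<^sup>2)) powr (- s) = 2 powr (- s) * (1 + x\<^sup>2) powr (- s)" by (rule powr_mult)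
      ultimately show ?thesis by (simp add: mult.assoc[symmetric])
    qed
    ultimately show ?thesis by (simp only:)
  qed
  show ?thesis
    unfolding bracket_weight
    by (rule Bochner_Integration.integrable_bound[OF i]) (use le in \<open>auto intro: order_trans[OF _ abs_ge_self]\<close>)
qed

text \<open>The right weight maps L2 into L1, the resolvent maps L1 data into bounded functions by
  hypothesis, and the left weight maps bounded functions into L2. Both weights use that the squared
  weight is integrable.\<close>

lemma weighted_resolvent_bound:
  assumes s: "s > 1 / 2" and res: "in_resolvent_set D P z" and D: "D \<subseteq> L2" and A: "0 \<le> A"
    and sup: "\<And>f u. f \<in> L2 \<Longrightarrow> integrable lborel f \<Longrightarrow> solves D P z f u \<Longrightarrow>
      AE x in lborel. cmod (u x) \<le> A * (LBINT x. cmod (f x))"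
  shows "L2_opnorm (\<lambda>f. weight s (resolvent D P z (weight s f))) \<le> ereal (A * ((LBINT x. (bracket x powr (- s))\<^sup>2) + 1)\<^sup>2)"
  unfolding L2_opnorm_def
proof (rule SUP_least)
  let ?\<omega> = "\<lambda>x. bracket x powr (- s)"
  define \<Omega> where "\<Omega> = (LBINT x. (?\<omega> x)\<^sup>2)"
  have \<omega>i: "integrable lborel (\<lambda>x. (?\<omega> x)\<^sup>2)" by (rule integrable_bracket_weight[OF s])
  have \<Omega>: "0 \<le> \<Omega>" unfolding \<Omega>_def by (rule Bochner_Integration.integral_nonneg) simp
  fix f :: "real \<Rightarrow> complex" assume f: "f \<in> {f \<in> L2. L2_norm f \<le> 1}"
  then have fL: "f \<in> L2" and fn: "sqrt (LBINT x. (cmod (f x))\<^sup>2) \<le> 1" by (auto simp: L2_norm_def)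
  have fi: "integrable lborel (\<lambda>x. (cmod (f x))\<^sup>2)" and [measurable]: "f \<in> borel_measurable borel"
    using fL by (auto simp: L2_def)
  have f1: "(LBINT x. (cmod (f x))\<^sup>2) \<le> 1" using fn by simp
  let ?\<phi> = "weight s f"
  have \<phi>L: "?\<phi> \<in> L2" unfolding weight_def
    by (rule L2_bounded_mult[OF fL, where C = 1]) (use bracket_weight_bounds(2) s in auto)
  \<comment> \<open>Pointwise Young's inequality; with the L2 norm of f at most 1 it does the work
    of the Cauchy-Schwarz inequality.\<close>
  have le: "cmod (?\<phi> x) \<le> ((?\<omega> x)\<^sup>2 + (cmod (f x))\<^sup>2) / 2" for x
    using sum_squares_bound[of "?\<omega> x" "cmod (f x)"] by (simp add: weight_def norm_mult)
  have i: "integrable lborel (\<lambda>x. ((?\<omega> x)\<^sup>2 + (cmod (f x))\<^sup>2) / 2)" using \<omega>i fi by simp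
  have \<phi>m: "?\<phi> \<in> borel_measurable borel" unfolding weight_def by measurable
  have \<phi>i: "integrable lborel ?\<phi>"
    by (rule Bochner_Integration.integrable_bound[OF i]) (use \<phi>m le in \<open>auto intro: order_trans[OF _ abs_ge_self]\<close>)
  have "(LBINT x. cmod (?\<phi> x)) \<le> (LBINT x. ((?\<omega> x)\<^sup>2 + (cmod (f x))\<^sup>2) / 2)"
    by (rule integral_mono[OF integrable_norm[OF \<phi>i] i le])
  also have "\<dots> = (\<Omega> + (LBINT x. (cmod (f x))\<^sup>2)) / 2" using \<omega>i fi by (simp add: \<Omega>_def)
  finally have \<phi>1: "(LBINT x. cmod (?\<phi> x)) \<le> \<Omega> + 1" unfolding add_divide_distrib using f1 \<Omega> by linarith
  define u where "u = resolvent D P z ?\<phi>"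
  have "\<exists>u. solves D P z ?\<phi> u" using res \<phi>L unfolding in_resolvent_set_def by blast
  then have u: "solves D P z ?\<phi> u" unfolding u_def resolvent_def by (rule someI_ex)
  have [measurable]: "u \<in> borel_measurable borel" using u D by (auto simp: solves_def L2_def)
  let ?K = "A * (\<Omega> + 1)"
  have K: "0 \<le> ?K" using A \<Omega> by simp
  have uK: "AE x in lborel. cmod (u x) \<le> ?K"
    using sup[OF \<phi>L \<phi>i u] by eventually_elim (rule order_trans, assumption, rule mult_left_mono[OF \<phi>1 A])
  have le2: "AE x in lborel. (cmod (weight s u x))\<^sup>2 \<le> ?K\<^sup>2 * (?\<omega> x)\<^sup>2"
    using uK
  proof eventually_elim
    case (elim x)
    then have "(cmod (u x))\<^sup>2 \<le> ?K\<^sup>2" by (intro power_mono) auto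
    then have "(cmod (u x))\<^sup>2 * (?\<omega> x)\<^sup>2 \<le> ?K\<^sup>2 * (?\<omega> x)\<^sup>2" by (intro mult_right_mono) auto
    moreover have "(cmod (weight s u x))\<^sup>2 = (cmod (u x))\<^sup>2 * (?\<omega> x)\<^sup>2"
      unfolding weight_def norm_mult power_mult_distrib by simp
    ultimately show ?case by simp
  qed
  have i2: "integrable lborel (\<lambda>x. ?K\<^sup>2 * (?\<omega> x)\<^sup>2)" using \<omega>i by simp
  have wm: "weight s u \<in> borel_measurable borel" unfolding weight_def by measurable
  have i3: "integrable lborel (\<lambda>x. (cmod (weight s u x))\<^sup>2)"
    by (rule Bochner_Integration.integrable_bound[OF i2]) (use wm le2 in \<open>auto elim!: eventually_mono\<close>)
  have "(LBINT x. (cmod (weight s u x))\<^sup>2) \<le> (LBINT x. ?K\<^sup>2 * (?\<omega> x)\<^sup>2)"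
    by (rule integral_mono_AE[OF i3 i2 le2])
  also have "\<dots> = ?K\<^sup>2 * \<Omega>" by (simp add: \<Omega>_def)
  also have "\<dots> \<le> ?K\<^sup>2 * (\<Omega> + 1)\<^sup>2"
    using \<Omega> by (intro mult_left_mono) (auto simp: power2_sum)
  finally have "sqrt (LBINT x. (cmod (weight s u x))\<^sup>2) \<le> sqrt ((?K * (\<Omega> + 1))\<^sup>2)" by (simp add: power_mult_distrib)
  also have "\<dots> = A * (\<Omega> + 1)\<^sup>2" using K \<Omega> by (simp add: power2_eq_square)
  finally show "ereal (L2_norm (weight s (resolvent D P z (weight s f)))) \<le> ereal (A * ((LBINT x. (?\<omega> x)\<^sup>2) + 1)\<^sup>2)"
    by (simp add: L2_norm_def u_def \<Omega>_def)
qed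

text \<open>\<open>Cg\<close> is free of h, so the main factor is exp (Cg / h). What remains is a
  polynomial in 1/h, and since h \<le> N it can be absorbed into the exponential as well.\<close>

lemma Csup_le_exp:
  fixes M N \<Omega> :: real
  assumes M: "1 \<le> M" and N: "1 \<le> N" and \<Omega>: "0 \<le> \<Omega>"
  shows "\<exists>C>0. \<forall>h\<in>{0<..N}. \<forall>\<epsilon> a w Q n B k R. uniform_system h \<epsilon> M a w Q n B k R \<longrightarrow>
    0 \<le> uniform_system.Csup h M \<and> M * uniform_system.Csup h M * \<Omega> \<le> exp (C / h)"
proof -
  define G where "G = (1 + M) * ((M + M\<^sup>2) * (2 * M) + M * M^3 + M + M * (2 * M * M)) + 2 * M * M\<^sup>2 + M * (M * M)"
  define T1 where "T1 = 2 * M * ((M + 2 * M\<^sup>2 * M) * M\<^sup>2 + M * M) + (1 + 2 * M) * M\<^sup>2"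
  define K where "K = M * (2 * M * (T1 * M + 1)) * \<Omega>"
  have G0: "0 \<le> G" using M unfolding G_def by (intro add_nonneg_nonneg mult_nonneg_nonneg zero_le_power) auto
  have T0: "0 \<le> T1" using M unfolding T1_def by (intro add_nonneg_nonneg mult_nonneg_nonneg zero_le_power) auto
  have K0: "0 \<le> K" using M T0 \<Omega> unfolding K_def by (intro mult_nonneg_nonneg add_nonneg_nonneg) auto
  have main: "0 \<le> uniform_system.Csup h M \<and> M * uniform_system.Csup h M * \<Omega> \<le> exp ((G + 3 + K * N) / h)"
    if h: "0 < h" "h \<le> N" and u: "uniform_system h \<epsilon> M a w Q n B k R" for h \<epsilon> a w Q n B k R
  proof -
    interpret uniform_system h \<epsilon> M a w Q n B k R by (rule u)
    \<comment> \<open>Each power of t is replaced by the same or a higher power of e = exp t \<ge>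
      1. \<open>T\<close> costs e^2 and the prefactor costs e, which explains the 3 in the final
      constant.\<close>
    define t where "t = 1 / h"
    define e where "e = exp t"
    have t: "0 < t" using h by (simp add: t_def)
    have e: "1 \<le> e" "t \<le> e" unfolding e_def using t exp_ge_add_one_self[of t] by (simp, linarith)
    have Nt: "1 \<le> N * t" using h by (simp add: t_def field_simps)
    have T_eq: "T = 2 * M * ((M + 2 * (M * t)\<^sup>2 * M) * M\<^sup>2 + M * M) + (1 + 2 * (M * t)) * M\<^sup>2"
      by (simp add: T_def t_def)
    have Cg_eq: "Cg = G" by (simp add: Cg_def G_def)
    have e2: "1 \<le> e\<^sup>2" "e \<le> e\<^sup>2" "t\<^sup>2 \<le> e\<^sup>2"
      using e t by (auto intro: power_mono self_le_power)
    have T0': "0 \<le> T" unfolding T_eq using M t by (intro add_nonneg_nonneg mult_nonneg_nonneg zero_le_power) auto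
    have Te: "T \<le> e\<^sup>2 * T1"
    proof -
      have 1: "M + 2 * (M * t)\<^sup>2 * M \<le> e\<^sup>2 * (M + 2 * M\<^sup>2 * M)"
      proof -
        have "1 * M \<le> e\<^sup>2 * M" "t\<^sup>2 * (2 * M\<^sup>2 * M) \<le> e\<^sup>2 * (2 * M\<^sup>2 * M)"
          using e2 M by (intro mult_right_mono; simp)+
        then show ?thesis by (simp add: power_mult_distrib algebra_simps)
      qed
      have 2: "1 + 2 * (M * t) \<le> e\<^sup>2 * (1 + 2 * M)"
      proof -
        have "t * (2 * M) \<le> e\<^sup>2 * (2 * M)" using e e2 M by (intro mult_right_mono) auto
        then show ?thesis using e2(1) by (simp add: algebra_simps)
      qed
      have 3: "1 * (M * M) \<le> e\<^sup>2 * (M * M)" using e2 by (intro mult_right_mono) auto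
      have "(M + 2 * (M * t)\<^sup>2 * M) * M\<^sup>2 + M * M \<le> (e\<^sup>2 * (M + 2 * M\<^sup>2 * M)) * M\<^sup>2 + e\<^sup>2 * (M * M)"
        using 3 by (intro add_mono mult_right_mono[OF 1]) auto
      then have "2 * M * ((M + 2 * (M * t)\<^sup>2 * M) * M\<^sup>2 + M * M) \<le> 2 * M * ((e\<^sup>2 * (M + 2 * M\<^sup>2 * M)) * M\<^sup>2 + e\<^sup>2 * (M * M))"
        using M by (intro mult_left_mono) auto
      moreover have "(1 + 2 * (M * t)) * M\<^sup>2 \<le> (e\<^sup>2 * (1 + 2 * M)) * M\<^sup>2" by (rule mult_right_mono[OF 2]) simp
      ultimately have "T \<le> 2 * M * ((e\<^sup>2 * (M + 2 * M\<^sup>2 * M)) * M\<^sup>2 + e\<^sup>2 * (M * M)) + (e\<^sup>2 * (1 + 2 * M)) * M\<^sup>2"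
        unfolding T_eq by (rule add_mono)
      also have "\<dots> = e\<^sup>2 * T1" unfolding T1_def by (simp add: algebra_simps)
      finally show ?thesis .
    qed
    have TM: "T * M + 1 \<le> e\<^sup>2 * (T1 * M + 1)"
      unfolding distrib_left mult.assoc[symmetric] mult_1_right by (rule add_mono[OF mult_right_mono[OF Te]]) (use M e2(1) in auto)
    have TM0: "0 \<le> T * M + 1" using T0' M by (intro add_nonneg_nonneg mult_nonneg_nonneg) auto
    have Cs: "Csup = exp (G * t) * (2 * M * t * (T * M + 1))" unfolding Csup_def Cg_eq by (simp add: t_def)
    have C0: "0 \<le> Csup" unfolding Cs using M t TM0 by (intro mult_nonneg_nonneg) auto
    have "2 * M * t * (T * M + 1) \<le> (2 * M * e) * (e\<^sup>2 * (T1 * M + 1))"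
      using M e t TM TM0 by (intro mult_mono mult_nonneg_nonneg mult_left_mono) auto
    then have "Csup \<le> exp (G * t) * ((2 * M * e) * (e\<^sup>2 * (T1 * M + 1)))"
      unfolding Cs by (intro mult_left_mono) auto
    then have "M * Csup * \<Omega> \<le> M * (exp (G * t) * ((2 * M * e) * (e\<^sup>2 * (T1 * M + 1)))) * \<Omega>"
      using M \<Omega> by (intro mult_right_mono mult_left_mono) auto
    also have "\<dots> = exp (G * t) * e ^ 3 * K" by (simp add: K_def power2_eq_square power3_eq_cube mult_ac)
    \<comment> \<open>The fixed constant K also has to go into an exponent proportional to t; this
      is possible because N t \<ge> 1.\<close>
    also have "\<dots> \<le> exp (G * t) * e ^ 3 * exp (K * (N * t))"
    proof (rule mult_left_mono)
      have "K * 1 \<le> K * (N * t)" using Nt K0 by (rule mult_left_mono)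
      also have "\<dots> \<le> exp (K * (N * t))" using exp_ge_add_one_self[of "K * (N * t)"] by linarith
      finally show "K \<le> exp (K * (N * t))" by simp
    qed (use e in auto)
    also have "\<dots> = exp ((G + 3 + K * N) / h)"
      by (simp add: e_def t_def exp_of_nat_mult[symmetric] add_divide_distrib exp_add[symmetric])
    finally show ?thesis using C0 by simp
  qed
  moreover have "0 < G + 3 + K * N" using G0 K0 N by (intro add_nonneg_pos add_pos_nonneg mult_nonneg_nonneg) auto
  ultimately show ?thesis by (intro exI[of _ "G + 3 + K * N"]) auto
qed

theorem corollary1p6:
  fixes s Emax h0 \<epsilon>0 :: real
    and E :: "real \<Rightarrow> real"
    and \<alpha> \<beta> b0 b1 V1 :: "real \<Rightarrow> real \<Rightarrow> real"
    and V0 :: "real \<Rightarrow> real set \<Rightarrow> real"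
  assumes "s > 1/2" and "Emax > 0" and "h0 > 0" and "\<epsilon>0 > 0"
    and energy: "\<And>h. h \<in> {0<..h0} \<Longrightarrow> E h \<in> {-Emax..Emax}"
    and V0_measure: "\<And>h. h > 0 \<Longrightarrow> finite_signed_measure (V0 h)"
    and b0_L1_L2: "\<And>h. h > 0 \<Longrightarrow> b0 h \<in> L1 \<inter> L2"
    and V1_b1_BV: "\<And>h. h > 0 \<Longrightarrow> BV (V1 h) \<and> BV (b1 h)"
    and \<alpha>_\<beta>_BV: "\<And>h. h > 0 \<Longrightarrow> BV (\<alpha> h) \<and> BV (\<beta> h)"
    and \<alpha>_\<beta>_pos: "\<And>h x. h > 0 \<Longrightarrow> \<alpha> h x > 0 \<and> \<beta> h x > 0"
    and \<alpha>_\<beta>_inf: "\<And>h. h > 0 \<Longrightarrow> (INF x. \<alpha> h x) > 0 \<and> (INF x. \<beta> h x) > 0"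
    and uniform_BV: "\<exists>M. \<forall>h\<in>{0<..h0}.
          Linf_norm (V1 h) \<le> ereal M \<and> measure_norm (dBV (V1 h)) \<le> ennreal M \<and>
          Linf_norm (b1 h) \<le> ereal M \<and> measure_norm (dBV (b1 h)) \<le> ennreal M \<and>
          measure_norm (dBV (\<alpha> h)) \<le> ennreal M \<and> measure_norm (dBV (\<beta> h)) \<le> ennreal M \<and>
          (SUP x. \<alpha> h x) \<le> M \<and> (SUP x. \<beta> h x) \<le> M"
    and uniform_inf: "\<exists>c>0. \<forall>h\<in>{0<..h0}. (INF x. \<alpha> h x) > c \<and> (INF x. \<beta> h x) > c"
    and nontrapping_at_infinity: "\<exists>R1>0.
          (INF (h, x)\<in>{0<..h0} \<times> {x. \<bar>x\<bar> \<ge> R1}.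
             ereal (inverse (\<beta> h x) * \<alpha> h x * (E h - V1 h x) + (b1 h x)\<^sup>2)) > 0"
    and uniform_singular: "\<exists>M. \<forall>h\<in>{0<..h0}.
          measure_norm (V0 h) \<le> ennreal M \<and> L1_norm (b0 h) \<le> M \<and> L2_norm (b0 h) \<le> M"
  shows "\<exists>C1>0. \<forall>h\<in>{0<..h0}. \<forall>\<epsilon>\<in>{-\<epsilon>0..\<epsilon>0} - {0}.
    let b = (\<lambda>x. b0 h x + b1 h x);
        D = schroedinger_domain h (\<alpha> h) (\<beta> h) b (V0 h) (V1 h);
        P = schroedinger_op h (\<alpha> h) (\<beta> h) b (V0 h) (V1 h);
        z = Complex (E h) \<epsilon>
    in in_resolvent_set D P z \<and>
       L2_opnorm (\<lambda>f. weight s (resolvent D P z (weight s f))) \<le> ereal (exp (C1 / h))"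
proof -
  from uniform_BV obtain M1 where M1: "\<And>h. h \<in> {0<..h0} \<Longrightarrow>
      Linf_norm (V1 h) \<le> ereal M1 \<and> measure_norm (dBV (V1 h)) \<le> ennreal M1 \<and>
      Linf_norm (b1 h) \<le> ereal M1 \<and> measure_norm (dBV (b1 h)) \<le> ennreal M1 \<and>
      measure_norm (dBV (\<alpha> h)) \<le> ennreal M1 \<and> measure_norm (dBV (\<beta> h)) \<le> ennreal M1 \<and>
      (SUP x. \<alpha> h x) \<le> M1 \<and> (SUP x. \<beta> h x) \<le> M1" by blast
  from uniform_inf obtain c where c: "0 < c" "\<And>h. h \<in> {0<..h0} \<Longrightarrow> (INF x. \<alpha> h x) > c \<and> (INF x. \<beta> h x) > c" by blast
  from nontrapping_at_infinity obtain R1 where R1: "0 < R1" "0 < (INF (h, x)\<in>{0<..h0} \<times> {x. \<bar>x\<bar> \<ge> R1}.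
      ereal (inverse (\<beta> h x) * \<alpha> h x * (E h - V1 h x) + (b1 h x)\<^sup>2))" by blast
  from uniform_singular obtain M2 where M2: "\<And>h. h \<in> {0<..h0} \<Longrightarrow>
      measure_norm (V0 h) \<le> ennreal M2 \<and> L1_norm (b0 h) \<le> M2 \<and> L2_norm (b0 h) \<le> M2" by blast
  \<comment> \<open>The infimum is an extended real; \<delta> is a positive real number below
    it.\<close>
  obtain \<delta> where \<delta>: "0 < \<delta>" "ereal \<delta> < (INF (h, x)\<in>{0<..h0} \<times> {x. \<bar>x\<bar> \<ge> R1}.
      ereal (inverse (\<beta> h x) * \<alpha> h x * (E h - V1 h x) + (b1 h x)\<^sup>2))"
    using ereal_dense2[OF R1(2)] by auto
  have far: "\<delta> \<le> inverse (\<beta> h x) * \<alpha> h x * (E h - V1 h x) + (b1 h x)\<^sup>2" if "h \<in> {0<..h0}" "R1 \<le> \<bar>x\<bar>" for h x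
  proof -
    have "(INF (h, x)\<in>{0<..h0} \<times> {x. \<bar>x\<bar> \<ge> R1}. ereal (inverse (\<beta> h x) * \<alpha> h x * (E h - V1 h x) + (b1 h x)\<^sup>2))
        \<le> ereal (inverse (\<beta> h x) * \<alpha> h x * (E h - V1 h x) + (b1 h x)\<^sup>2)"
      using INF_lower[of "(h, x)" "{0<..h0} \<times> {x. \<bar>x\<bar> \<ge> R1}"
          "\<lambda>(h, x). ereal (inverse (\<beta> h x) * \<alpha> h x * (E h - V1 h x) + (b1 h x)\<^sup>2)"] that by simp
    with \<delta>(2) have "ereal \<delta> < ereal (inverse (\<beta> h x) * \<alpha> h x * (E h - V1 h x) + (b1 h x)\<^sup>2)" by (rule less_le_trans)
    then show ?thesis by simp
  qed
  \<comment> \<open>One number for all uniform bounds: 1/c and 1/\<delta> provide the lower bounds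
    1/N, the other summands the upper bounds.\<close>
  define N where "N = 1 + h0 + \<epsilon>0 + Emax + R1 + \<bar>M1\<bar> + \<bar>M2\<bar> + 1 / c + 1 / \<delta>"
  have pos: "0 < 1 / c" "0 < 1 / \<delta>" using c(1) \<delta>(1) by auto
  have N: "1 \<le> N" "h0 \<le> N" "\<epsilon>0 \<le> N" "Emax \<le> N" "R1 \<le> N" "M1 \<le> N" "M2 \<le> N" "1 / c \<le> N" "1 / \<delta> \<le> N"
    unfolding N_def using pos assms(2-4) R1(1) abs_ge_self[of M1] abs_ge_self[of M2] abs_ge_zero[of M1] abs_ge_zero[of M2] by linarith+
  have cN: "1 / N \<le> c" "1 / N \<le> \<delta>" using N(1,8,9) c(1) \<delta>(1) by (simp_all add: field_simps)
  \<comment> \<open>A real supremum or infimum bounds the values only of a bounded family: bounded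
    variation supplies the upper bound, positivity the lower one.\<close>
  have coef: "1 / N \<le> f x \<and> f x \<le> N" if f: "BV f" "\<And>x. 0 < f x" "(INF x. f x) > c" "(SUP x. f x) \<le> M1" for f :: "real \<Rightarrow> real" and x
  proof -
    obtain C where C: "\<forall>x. \<bar>f x\<bar> \<le> C" using BV_bounded[OF f(1)] by blast
    have "bdd_above (range f)" using C by (auto intro!: bdd_aboveI2[of _ _ C] elim: allE dest: abs_le_D1)
    then have "f x \<le> (SUP x. f x)" by (intro cSUP_upper) auto
    moreover have "bdd_below (range f)" using f(2) by (auto intro!: bdd_belowI2[of _ 0] less_imp_le)
    then have "(INF x. f x) \<le> f x" by (intro cINF_lower) auto
    ultimately show ?thesis using f(3,4) cN N by linarith
  qed
  have coeffs: "bounded_coefficients h \<epsilon> (E h) N R1 (\<alpha> h) (\<beta> h) (b0 h) (b1 h) (V1 h) (V0 h)"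
    if h: "h \<in> {0<..h0}" and \<epsilon>: "\<epsilon> \<in> {-\<epsilon>0..\<epsilon>0} - {0}" for h \<epsilon>
  proof
    have h': "0 < h" "h \<le> h0" using h by auto
    show "0 < h" "h \<le> N" "\<epsilon> \<noteq> 0" "\<bar>\<epsilon>\<bar> \<le> N" "\<bar>E h\<bar> \<le> N" using h' \<epsilon> N energy[OF h] by auto
    show "0 \<le> R1" "R1 \<le> N" "1 \<le> N" using R1 N by auto
    show bv: "BV (\<alpha> h)" "BV (\<beta> h)" "BV (b1 h)" "BV (V1 h)" using V1_b1_BV \<alpha>_\<beta>_BV h'(1) by auto
    note le = ennreal_leI[OF N(6)] ennreal_leI[OF N(7)]
    show "measure_norm (dBV (\<alpha> h)) \<le> ennreal N" "measure_norm (dBV (\<beta> h)) \<le> ennreal N"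
      "measure_norm (dBV (b1 h)) \<le> ennreal N" "measure_norm (dBV (V1 h)) \<le> ennreal N"
      using M1[OF h] le(1) by (auto intro: order_trans)
    show "measure_norm (V0 h) \<le> ennreal N" using M2[OF h] le(2) by (auto intro: order_trans)
    have le': "ereal M1 \<le> ereal N" using N(6) by simp
    show "Linf_norm (b1 h) \<le> ereal N" "Linf_norm (V1 h) \<le> ereal N" using M1[OF h] le' by (auto intro: order_trans)
    show "1 / N \<le> \<alpha> h x" "\<alpha> h x \<le> N" "1 / N \<le> \<beta> h x" "\<beta> h x \<le> N" for x
      using coef[OF bv(1)] coef[OF bv(2)] \<alpha>_\<beta>_pos[OF h'(1)] c(2)[OF h] M1[OF h] by auto
    show "finite_signed_measure (V0 h)" using V0_measure h'(1) by auto
    show "b0 h \<in> L1" "b0 h \<in> L2" using b0_L1_L2 h'(1) by auto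
    show "L1_norm (b0 h) \<le> N" "L2_norm (b0 h) \<le> N" using M2[OF h] N(7) by auto
    show "1 / N \<le> inverse (\<beta> h x) * \<alpha> h x * (E h - V1 h x) + (b1 h x)\<^sup>2" if "R1 \<le> \<bar>x\<bar>" for x
      using far[OF h that] cN(2) by linarith
  qed
  define M where "M = 16 * N ^ 5"
  have M: "1 \<le> M" using one_le_power[OF N(1), of 5] by (simp add: M_def)
  define \<Omega> where "\<Omega> = ((LBINT x. (bracket x powr (- s))\<^sup>2) + 1)\<^sup>2"
  have \<Omega>: "0 \<le> \<Omega>" by (simp add: \<Omega>_def)
  obtain C where C: "0 < C" "\<forall>h\<in>{0<..N}. \<forall>\<epsilon> a w Q n B k R. uniform_system h \<epsilon> M a w Q n B k R \<longrightarrow>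
      0 \<le> uniform_system.Csup h M \<and> M * uniform_system.Csup h M * \<Omega> \<le> exp (C / h)"
    using Csup_le_exp[OF M N(1) \<Omega>] by blast
  have "in_resolvent_set (schroedinger_domain h (\<alpha> h) (\<beta> h) (\<lambda>x. b0 h x + b1 h x) (V0 h) (V1 h))
      (schroedinger_op h (\<alpha> h) (\<beta> h) (\<lambda>x. b0 h x + b1 h x) (V0 h) (V1 h)) (Complex (E h) \<epsilon>) \<and>
    L2_opnorm (\<lambda>f. weight s (resolvent (schroedinger_domain h (\<alpha> h) (\<beta> h) (\<lambda>x. b0 h x + b1 h x) (V0 h) (V1 h))
      (schroedinger_op h (\<alpha> h) (\<beta> h) (\<lambda>x. b0 h x + b1 h x) (V0 h) (V1 h)) (Complex (E h) \<epsilon>) (weight s f))) \<le> ereal (exp (C / h))"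
    (is "in_resolvent_set ?D ?P ?z \<and> ?norm \<le> _")
    if h: "h \<in> {0<..h0}" and \<epsilon>: "\<epsilon> \<in> {-\<epsilon>0..\<epsilon>0} - {0}" for h \<epsilon>
  proof -
    interpret bc: bounded_coefficients h \<epsilon> "E h" N R1 "\<alpha> h" "\<beta> h" "b0 h" "b1 h" "V1 h" "V0 h" by (rule coeffs[OF h \<epsilon>])
    have Meq: "bc.M = M" by (simp add: bc.M_def M_def)
    note est = bc.resolvent_estimate[unfolded Meq]
    have hN: "h \<in> {0<..N}" using h N(2) by auto
    have Cs: "0 \<le> uniform_system.Csup h M" "M * uniform_system.Csup h M * \<Omega> \<le> exp (C / h)"
      using C(2)[rule_format, OF hN bc.uniform[unfolded Meq]] by auto
    have A: "0 \<le> M * uniform_system.Csup h M" using Cs(1) M by simp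
    have D: "?D \<subseteq> L2" by (auto simp: schroedinger_domain_def H1_def)
    have "?norm \<le> ereal (M * uniform_system.Csup h M * \<Omega>)"
      unfolding \<Omega>_def
      by (rule weighted_resolvent_bound[OF assms(1) est(1) D A]) (use est(2) in \<open>simp only: mult.assoc\<close>)
    also have "\<dots> \<le> ereal (exp (C / h))" using Cs(2) by simp
    finally show ?thesis using est(1) by blast
  qed
  then show ?thesis unfolding Let_def using C(1) by blast
qed

end
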